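(* Let $\mathrm I=[a,b]$ be an interval and let $\sigma_1,\sigma_2,\gamma:\mathrm I\to\mathbb C^{p\times p}$ be fixed continuous functions such that $\sigma_1,\sigma_2$ take self-adjoint values, $\sigma_1$ is differentiable with invertible values, and $\gamma+\gamma^*=-\frac{d}{dt_2}\sigma_1$ on $\mathrm I$. Then for every $t_2^0\in\mathrm I$ there is a one-to-one correspondence, given by $(\gamma_*,S)\mapsto Y(\lambda)=S(\lambda,t_2^0)$, between pairs $(\gamma_*,S)$ such that $\gamma_*$ is continuous in a neighborhood of $t_2^0$ and $S\in\mathcal{SI}$ (with respect to $\sigma_1,\sigma_2,\gamma,\gamma_*$ on that neighborhood), and functions $Y(\lambda)\in\mathcal S(t_2^0)$.
   Context: $\mathbb C_+$ is the open right half plane. Vessel parameters: $\sigma_1,\sigma_2,\gamma,\gamma_*$ together with an interval $\mathrm I$ are called vessel parameters if these are continuous $\mathbb C^{p\times p}$-valued functions on $\mathrm I$, $\sigma_1$ and $\sigma_2$ take self-adjoint values, $\sigma_1$ is differentiable and invertible on $\mathrm I$, and $\gamma+\gamma^*=\gamma_*+\gamma_*^*=-\frac{d}{dt_2}\sigma_1$ on $\mathrm I$. The class $\mathcal{SI}$ corresponding to vessel parameters $\sigma_1,\sigma_2,\gamma,\gamma_*$ on an interval consists of the $\mathbb C^{p\times p}$-valued functions $S(\lambda,t_2)$, meromorphic in $\lambda\in\mathbb C_+$ for each $t_2$, such that: (1) for each $t_2$, $S(\cdot,t_2)$ is analytic in a neighborhood of $\lambda=\infty$ and $S(\infty,t_2)=I_p$;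 (2) for each $\lambda$, $S(\lambda,\cdot)$ is continuous in $t_2$; (3) in the domain of analyticity, $S(\lambda,t_2)^*\sigma_1(t_2)S(\lambda,t_2)\le\sigma_1(t_2)$ for $\Re\lambda>0$, and equality holds for $\Re\lambda=0$; (4) $S(\lambda,t_2)$ maps solutions $u(\lambda,t_2)$ of the input equation $\lambda\sigma_2u-\sigma_1\frac{\partial}{\partial t_2}u+\gamma u=0$ to solutions $y=Su$ of the output equation $\lambda\sigma_2y-\sigma_1\frac{\partial}{\partial t_2}y+\gamma_*y=0$ with the same spectral parameter $\lambda$. The class $\mathcal S(t_2^0)$ consists of the $\mathbb C^{p\times p}$-valued functions $Y(\lambda)$, meromorphic in $\mathbb C_+$ and analytic at infinity, such that: (1) $Y(\infty)=I_p$; (2) $Y(\lambda)^*\sigma_1(t_2^0)Y(\lambda)\le\sigma_1(t_2^0)$ for all $\lambda\in\mathbb C_+$ where $Y$ is analytic; (3) $Y(\lambda)^*\sigma_1(t_2^0)Y(\lambda)=\sigma_1(t_2^0)$ for almost all $\lambda$ with $\Re\lambda=0$, where $Y(\lambda)$ denotes the non-tangential limit.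
   Formalization: In condition (3) of the class SI, equality for Re λ = 0 is required of the non-tangential limits at almost all points of the imaginary axis, not only at points of analyticity; otherwise S(λ,t_2^0) need not lie in S(t_2^0). *)

theory Defs
  imports "HOL-Complex_Analysis.Complex_Analysis"
begin

type_synonym 'p cmat = "complex ^ 'p ^ 'p"

abbreviation right_half_plane :: "complex set" where
  "right_half_plane \<equiv> {z. 0 < Re z}"

definition cadjoint :: "'p::finite cmat \<Rightarrow> 'p cmat" where
  "cadjoint A = transpose (map_matrix cnj A)"

definition self_adjoint :: "'p::finite cmat \<Rightarrow> bool" where
  "self_adjoint A \<longleftrightarrow> cadjoint A = A"

text \<open>The Loewner order. Membership in the nonnegative reals forces the quadratic form to be
  real-valued, so that \<open>B - A\<close> is self-adjoint.\<close>

definition loewner_le :: "'p::finite cmat \<Rightarrow> 'p cmat \<Rightarrow> bool" where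
  "loewner_le A B \<longleftrightarrow>
     (\<forall>v. (\<Sum>i\<in>UNIV. cnj (v $ i) * (((B - A) *v v) $ i)) \<in> \<real>\<^sub>\<ge>\<^sub>0)"

section \<open>Matrix-valued meromorphic functions on the right half plane\<close>

text \<open>A meromorphic function is represented by its normalised version (removable singularities
  removed, value 0 at the poles, entrywise). Hence two representatives describe the
  same meromorphic function on the right half plane iff they agree pointwise there, and
  \<open>mat_analytic_at\<close> describes the complement of the poles. Values outside the half plane only
  matter near infinity, where they are determined by those in the half plane, and at points
  of the imaginary axis across which the function is analytic.\<close>

definition mat_meromorphic_on :: "(complex \<Rightarrow> 'p::finite cmat) \<Rightarrow> complex set \<Rightarrow> bool" where
  "mat_meromorphic_on F A \<longleftrightarrow> (\<forall>i j. (\<lambda>z. F z $ i $ j) nicely_meromorphic_on A)"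

definition mat_analytic_at :: "(complex \<Rightarrow> 'p::finite cmat) \<Rightarrow> complex \<Rightarrow> bool" where
  "mat_analytic_at F z \<longleftrightarrow> (\<forall>i j. (\<lambda>w. F w $ i $ j) analytic_on {z})"

text \<open>\<open>F\<close> is analytic in a full neighbourhood of infinity on the Riemann sphere, with
  value \<open>V\<close> at infinity.\<close>

definition mat_analytic_at_infinity :: "(complex \<Rightarrow> 'p::finite cmat) \<Rightarrow> 'p cmat \<Rightarrow> bool" where
  "mat_analytic_at_infinity F V \<longleftrightarrow>
     (\<forall>i j. (\<lambda>w. if w = 0 then V $ i $ j else F (inverse w) $ i $ j) analytic_on {0})"

text \<open>Non-tangential limit at the boundary point \<open>\<i> y\<close>, from the right half plane:
  convergence inside every Stolz angle.\<close>

definition nontangential_limit :: "(complex \<Rightarrow> 'p::finite cmat) \<Rightarrow> real \<Rightarrow> 'p cmat \<Rightarrow> bool" where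
  "nontangential_limit F y L \<longleftrightarrow>
     (\<forall>M>0. (F \<longlongrightarrow> L) (at (Complex 0 y) within {z. 0 < Re z \<and> \<bar>Im z - y\<bar> \<le> M * Re z}))"

definition contractive_in_rhp :: "'p::finite cmat \<Rightarrow> (complex \<Rightarrow> 'p cmat) \<Rightarrow> bool" where
  "contractive_in_rhp J F \<longleftrightarrow>
     (\<forall>z\<in>right_half_plane. mat_analytic_at F z \<longrightarrow> loewner_le (cadjoint (F z) ** J ** F z) J)"

definition boundary_unitary :: "'p::finite cmat \<Rightarrow> (complex \<Rightarrow> 'p cmat) \<Rightarrow> bool" where
  "boundary_unitary J F \<longleftrightarrow>
     (AE y in lebesgue. \<exists>L. nontangential_limit F y L \<and> cadjoint L ** J ** L = J)"

section \<open>Vessel parameters and the two classes\<close>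

definition vessel_parameters ::
  "real set \<Rightarrow> (real \<Rightarrow> 'p::finite cmat) \<Rightarrow> (real \<Rightarrow> 'p cmat) \<Rightarrow> (real \<Rightarrow> 'p cmat) \<Rightarrow>
   (real \<Rightarrow> 'p cmat) \<Rightarrow> bool" where
  "vessel_parameters T \<sigma>1 \<sigma>2 \<gamma> \<gamma>s \<longleftrightarrow>
     is_interval T \<and>
     continuous_on T \<sigma>1 \<and> continuous_on T \<sigma>2 \<and> continuous_on T \<gamma> \<and> continuous_on T \<gamma>s \<and>
     (\<forall>t\<in>T. self_adjoint (\<sigma>1 t) \<and> self_adjoint (\<sigma>2 t) \<and> invertible (\<sigma>1 t)) \<and>
     (\<forall>t\<in>T. \<exists>D. (\<sigma>1 has_vector_derivative D) (at t within T) \<and>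
                \<gamma> t + cadjoint (\<gamma> t) = - D \<and> \<gamma>s t + cadjoint (\<gamma>s t) = - D)"

text \<open>\<open>z \<sigma>2 u - \<sigma>1 u' + g u = 0\<close> at the point \<open>t\<close>; one-sided derivative at the end points of \<open>T\<close>.\<close>

definition solves_at ::
  "real set \<Rightarrow> (real \<Rightarrow> 'p::finite cmat) \<Rightarrow> (real \<Rightarrow> 'p cmat) \<Rightarrow> (real \<Rightarrow> 'p cmat) \<Rightarrow>
   complex \<Rightarrow> (real \<Rightarrow> complex ^ 'p) \<Rightarrow> real \<Rightarrow> bool" where
  "solves_at T \<sigma>1 \<sigma>2 g z u t \<longleftrightarrow>
     (\<exists>u'. (u has_vector_derivative u') (at t within T) \<and>
           z *s (\<sigma>2 t *v u t) - \<sigma>1 t *v u' + g t *v u t = 0)"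

text \<open>The class \<open>SI\<close>. Statements about \<open>S z t\<close> for fixed \<open>z\<close> are imposed at those \<open>t\<close> for which
  \<open>z\<close> is not a pole of \<open>S(\<cdot>,t)\<close> (the poles are not assumed beforehand to be independent of \<open>t\<close>).
  Since \<open>S(\<cdot>,t)\<close> is a function on the right half plane, equality on the imaginary axis is meant for
  the non-tangential boundary values, almost everywhere, as in \<open>class_S\<close>. Equality
  at every point of analyticity on the axis is stated as well; alone it would be
  too weak, being vacuous on an arc of the axis consisting of singularities.\<close>

definition class_SI ::
  "real set \<Rightarrow> (real \<Rightarrow> 'p::finite cmat) \<Rightarrow> (real \<Rightarrow> 'p cmat) \<Rightarrow> (real \<Rightarrow> 'p cmat) \<Rightarrow>
   (real \<Rightarrow> 'p cmat) \<Rightarrow> (complex \<Rightarrow> real \<Rightarrow> 'p cmat) set" where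
  "class_SI T \<sigma>1 \<sigma>2 \<gamma> \<gamma>s = {S.
     (\<forall>t\<in>T. mat_meromorphic_on (\<lambda>z. S z t) right_half_plane) \<and>
     (\<forall>t\<in>T. mat_analytic_at_infinity (\<lambda>z. S z t) (mat 1)) \<and>
     (\<forall>z\<in>right_half_plane. \<forall>t\<in>T. mat_analytic_at (\<lambda>w. S w t) z \<longrightarrow>
        continuous (at t within T) (S z)) \<and>
     (\<forall>t\<in>T. contractive_in_rhp (\<sigma>1 t) (\<lambda>z. S z t) \<and>
        boundary_unitary (\<sigma>1 t) (\<lambda>z. S z t) \<and>
        (\<forall>z. Re z = 0 \<and> mat_analytic_at (\<lambda>w. S w t) z \<longrightarrow>
           cadjoint (S z t) ** \<sigma>1 t ** S z t = \<sigma>1 t)) \<and>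
     (\<forall>z\<in>right_half_plane. \<forall>u. (\<forall>t\<in>T. solves_at T \<sigma>1 \<sigma>2 \<gamma> z u t) \<longrightarrow>
        (\<forall>t\<in>T. mat_analytic_at (\<lambda>w. S w t) z \<longrightarrow>
           solves_at T \<sigma>1 \<sigma>2 \<gamma>s z (\<lambda>s. S z s *v u s) t))}"

text \<open>The class \<open>S(t\<^sub>0)\<close>; it depends on \<open>t\<^sub>0\<close> only through \<open>J = \<sigma>1 t\<^sub>0\<close>.\<close>

definition class_S :: "'p::finite cmat \<Rightarrow> (complex \<Rightarrow> 'p cmat) set" where
  "class_S J = {Y.
     mat_meromorphic_on Y right_half_plane \<and>
     mat_analytic_at_infinity Y (mat 1) \<and>
     contractive_in_rhp J Y \<and>
     boundary_unitary J Y}"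

text \<open>The pairs \<open>(\<gamma>s, S)\<close>, each together with the neighbourhood \<open>T\<close> of \<open>t0\<close> in \<open>I\<close> (an interval,
  relatively open in \<open>I\<close>) on which it lives.\<close>

definition SI_pairs ::
  "real set \<Rightarrow> (real \<Rightarrow> 'p::finite cmat) \<Rightarrow> (real \<Rightarrow> 'p cmat) \<Rightarrow> (real \<Rightarrow> 'p cmat) \<Rightarrow> real \<Rightarrow>
   (real set \<times> (real \<Rightarrow> 'p cmat) \<times> (complex \<Rightarrow> real \<Rightarrow> 'p cmat)) set" where
  "SI_pairs I \<sigma>1 \<sigma>2 \<gamma> t0 = {(T, \<gamma>s, S).
     openin (top_of_set I) T \<and> is_interval T \<and> t0 \<in> T \<and>
     vessel_parameters T \<sigma>1 \<sigma>2 \<gamma> \<gamma>s \<and>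
     S \<in> class_SI T \<sigma>1 \<sigma>2 \<gamma> \<gamma>s}"

end

theory Submission
  imports Defs "HOL-Complex_Analysis.Complex_Analysis"
begin

text \<open>With the fundamental matrices \<open>\<Phi>\<close>, \<open>\<Phi>s\<close> of the input and output equations normalised at
  \<open>t0\<close>, condition (4) forces \<open>S(\<cdot>,t) = \<Phi>s(\<cdot>,t) Y \<Phi>(\<cdot>,t)\<^sup>-\<^sup>1\<close>. Here \<open>\<Phi>s\<close> is entire in the
  spectral parameter and \<open>S\<close> is \<open>I\<close> at infinity, so \<open>S \<Phi> = \<Phi>s Y\<close> is a Birkhoff
  factorization near infinity. Its uniqueness (Liouville) determines \<open>\<Phi>s\<close>, hence \<open>\<gamma>s\<close> and \<open>S\<close>, from \<open>Y\<close>.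
  Conversely, for \<open>t\<close> near \<open>t0\<close> the loop \<open>Y \<Phi> Y\<^sup>-\<^sup>1\<close> is close to \<open>I\<close> and can be factored by a fixed point
  iteration; differentiating the factorization in \<open>t\<close> shows that \<open>\<Phi>s\<close> solves an equation whose
  coefficient is linear in the spectral parameter, which yields \<open>\<gamma>s\<close>. The
  delicate point is that \<open>S(\<cdot>,t)\<close> stays contractive with respect to the indefinite form \<open>\<sigma>1 t\<close>: a
  Julia--Caratheodory estimate at infinity gives the defect of \<open>Y\<close> a lower bound proportional to
  \<open>Re z\<close>, while the perturbation caused by \<open>\<Phi>\<close> and \<open>\<Phi>s\<close>, being unitary on the imaginary axis,
  is also at most proportional to \<open>Re z\<close>; the maximum principle then removes the remaining loss.\<close>

text \<open>\<open>\<Phi>\<close> is entire but in general has an essential singularity at infinity,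
  so no norm over a neighbourhood of infinity is available. Every splitting is therefore estimated
  from the annulus between the radii \<open>R\<close> and \<open>2 * R\<close> alone, and uniqueness
  makes these bounds valid for whichever splitting occurs. A second obstacle is that
  \<open>\<sigma>1\<close> is indefinite: \<open>Y\<close> may have poles in the half plane, and
  contractivity gives no bound on \<open>Y\<close> itself. The Cayley transform replaces
  \<open>Y\<close> by bounded functions without poles. In the contractivity argument the Julia
  constant \<open>C\<close> of \<open>Y\<close> fixes how close \<open>\<Phi>\<close> and
  \<open>\<Phi>s\<close> must be to the identity on the disc of radius \<open>2 * R\<close>, and
  thereby the size of the neighbourhood: half of the Julia gain pays for the part of the
  perturbation along \<open>u - Y u\<close>, and what is left is proportional to \<open>Re z\<close>
  and to the squared norm of the very vector on which the Cayley transform of \<open>S\<close> acts.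
  For uniqueness, the conditions on \<open>S\<close> only speak about points that are not poles at
  the given time, so poles have to be kept out of a whole disc before anything can be differentiated
  in \<open>t\<close>.\<close>

no_notation fps_nth (infixl "$" 75)

section \<open>Complex matrices\<close>

lemma norm_vec_sq: "(norm (x :: complex ^ 'n))\<^sup>2 = (\<Sum>i\<in>UNIV. (norm (x $ i))\<^sup>2)"
  by (simp add: norm_vec_def L2_set_def sum_nonneg)

lemma norm_mat_sq: "(norm (A :: complex ^ 'n ^ 'm))\<^sup>2 = (\<Sum>i\<in>UNIV. \<Sum>j\<in>UNIV. (norm (A $ i $ j))\<^sup>2)"
  by (simp add: norm_vec_def L2_set_def sum_nonneg)

lemma norm_entry_le: "norm (A $ i $ j) \<le> norm (A :: complex ^ 'n ^ 'm)"
  by (meson Finite_Cartesian_Product.norm_nth_le order_trans)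

lemma norm_matrix_le_entries:
  assumes "\<And>i j. norm ((A :: complex ^ 'n ^ 'm) $ i $ j) \<le> B"
  shows "norm A \<le> real (CARD('m) * CARD('n)) * B"
proof -
  have "norm A \<le> (\<Sum>i\<in>UNIV. norm (A $ i))"
    by (metis L2_set_le_sum norm_vec_def norm_ge_zero)
  also have "\<dots> \<le> (\<Sum>i\<in>UNIV. \<Sum>j\<in>UNIV. norm (A $ i $ j))"
    by (intro sum_mono) (metis L2_set_le_sum norm_vec_def norm_ge_zero)
  also have "\<dots> \<le> (\<Sum>i\<in>(UNIV::'m set). \<Sum>j\<in>(UNIV::'n set). B)"
    by (intro sum_mono assms)
  finally show ?thesis by simp
qed

lemma norm_sum_mult_le:
  "norm (\<Sum>i\<in>UNIV. f i * g i :: complex) \<le>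
     L2_set (\<lambda>i. norm (f i)) UNIV * L2_set (\<lambda>i. norm (g i)) (UNIV :: 'n::finite set)"
proof -
  have "norm (\<Sum>i\<in>UNIV. f i * g i) \<le> (\<Sum>i\<in>UNIV. \<bar>norm (f i)\<bar> * \<bar>norm (g i)\<bar>)"
    by (rule order_trans[OF norm_sum]) (simp add: norm_mult)
  also have "\<dots> \<le> L2_set (\<lambda>i. norm (f i)) UNIV * L2_set (\<lambda>i. norm (g i)) UNIV"
    by (rule L2_set_mult_ineq)
  finally show ?thesis .
qed

lemma norm_matrix_vector_mult:
  "norm ((A :: complex ^ 'n ^ 'm) *v x) \<le> norm A * norm x"
proof -
  have 1: "norm ((A *v x) $ i) \<le> norm (A $ i) * norm x" for i
    using norm_sum_mult_le[of "\<lambda>j. A $ i $ j" "\<lambda>j. x $ j"]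
    by (simp add: matrix_vector_mult_def norm_vec_def)
  have "(norm (A *v x))\<^sup>2 \<le> (\<Sum>i\<in>UNIV. (norm (A $ i) * norm x)\<^sup>2)"
    unfolding norm_vec_sq[of "A *v x"] by (intro sum_mono power_mono 1) auto
  also have "\<dots> = (\<Sum>i\<in>UNIV. (norm (A $ i))\<^sup>2) * (norm x)\<^sup>2"
    by (simp add: power_mult_distrib sum_distrib_right)
  also have "(\<Sum>i\<in>UNIV. (norm (A $ i))\<^sup>2) = (norm A)\<^sup>2"
    by (simp add: norm_vec_def L2_set_def sum_nonneg)
  finally show ?thesis
    by (simp add: power_mult_distrib[symmetric] power2_le_iff_abs_le)
qed

text \<open>The norm of this type is the Frobenius norm. Cauchy-Schwarz in each entry of the product
  makes it submultiplicative with constant 1.\<close>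

lemma norm_matrix_mult:
  "norm ((A :: complex ^ 'n ^ 'm) ** (B :: complex ^ 'k ^ 'n)) \<le> norm A * norm B"
proof -
  let ?b = "\<lambda>j. L2_set (\<lambda>k. norm (B $ k $ j)) UNIV"
  have 1: "norm ((A ** B) $ i $ j) \<le> norm (A $ i) * ?b j" for i j
    using norm_sum_mult_le[of "\<lambda>k. A $ i $ k" "\<lambda>k. B $ k $ j"]
    by (simp add: matrix_matrix_mult_def norm_vec_def)
  have b2: "(\<Sum>j\<in>UNIV. (?b j)\<^sup>2) = (norm B)\<^sup>2"
    unfolding norm_mat_sq by (subst sum.swap) (simp add: L2_set_def sum_nonneg)
  have a2: "(\<Sum>i\<in>UNIV. (norm (A $ i))\<^sup>2) = (norm A)\<^sup>2"
    by (simp add: norm_vec_def L2_set_def sum_nonneg)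
  have "(norm (A ** B))\<^sup>2 \<le> (\<Sum>i\<in>UNIV. \<Sum>j\<in>UNIV. (norm (A $ i) * ?b j)\<^sup>2)"
    unfolding norm_mat_sq[of "A ** B"] by (intro sum_mono power_mono 1) auto
  also have "\<dots> = (\<Sum>i\<in>UNIV. (norm (A $ i))\<^sup>2) * (\<Sum>j\<in>UNIV. (?b j)\<^sup>2)"
    by (simp add: power_mult_distrib sum_product)
  also have "\<dots> = (norm A * norm B)\<^sup>2"
    by (simp only: a2 b2 power_mult_distrib)
  finally show ?thesis
    by (simp add: power2_le_iff_abs_le)
qed

lemma norm_matrix_mult_le:
  "norm (A :: complex ^ 'n ^ 'm) \<le> a \<Longrightarrow> norm (B :: complex ^ 'k ^ 'n) \<le> b \<Longrightarrow> norm (A ** B) \<le> a * b"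
  by (rule order_trans[OF norm_matrix_mult]) (auto intro!: mult_mono order_trans[OF norm_ge_zero])

lemma bounded_bilinear_matrix_mult:
  "bounded_bilinear ((**) :: complex ^ 'n ^ 'm \<Rightarrow> complex ^ 'k ^ 'n \<Rightarrow> complex ^ 'k ^ 'm)"
proof
  show "\<exists>K. \<forall>(A :: complex ^ 'n ^ 'm) (B :: complex ^ 'k ^ 'n). norm (A ** B) \<le> norm A * norm B * K"
    by (auto intro!: exI[of _ 1] norm_matrix_mult)
qed (auto simp: vec_eq_iff matrix_matrix_mult_def algebra_simps scaleR_sum_right sum.distrib)

lemma bounded_bilinear_matrix_vector_mult:
  "bounded_bilinear ((*v) :: complex ^ 'n ^ 'm \<Rightarrow> complex ^ 'n \<Rightarrow> complex ^ 'm)"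
proof
  show "\<exists>K. \<forall>(A :: complex ^ 'n ^ 'm) x. norm (A *v x) \<le> norm A * norm x * K"
    by (auto intro!: exI[of _ 1] norm_matrix_vector_mult)
qed (auto simp: vec_eq_iff matrix_vector_mult_def algebra_simps scaleR_sum_right sum.distrib)

lemmas tendsto_mm = bounded_bilinear.tendsto[OF bounded_bilinear_matrix_mult]
lemmas tendsto_mv = bounded_bilinear.tendsto[OF bounded_bilinear_matrix_vector_mult]
lemmas continuous_on_mm = bounded_bilinear.continuous_on[OF bounded_bilinear_matrix_mult]
lemmas has_vector_derivative_mm =
  bounded_bilinear.has_vector_derivative[OF bounded_bilinear_matrix_mult]
lemmas has_vector_derivative_mv =
  bounded_bilinear.has_vector_derivative[OF bounded_bilinear_matrix_vector_mult]
lemmas mm_diff_left = bounded_bilinear.diff_left[OF bounded_bilinear_matrix_mult]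
lemmas mm_diff_right = bounded_bilinear.diff_right[OF bounded_bilinear_matrix_mult]
lemmas mm_add_left = bounded_bilinear.add_left[OF bounded_bilinear_matrix_mult]
lemmas mm_add_right = bounded_bilinear.add_right[OF bounded_bilinear_matrix_mult]
lemmas mm_minus_left = bounded_bilinear.minus_left[OF bounded_bilinear_matrix_mult]
lemmas mm_minus_right = bounded_bilinear.minus_right[OF bounded_bilinear_matrix_mult]
lemmas mm_scaleR_left = bounded_bilinear.scaleR_left[OF bounded_bilinear_matrix_mult]
lemmas mm_scaleR_right = bounded_bilinear.scaleR_right[OF bounded_bilinear_matrix_mult]
lemmas mm_zero_left = bounded_bilinear.zero_left[OF bounded_bilinear_matrix_mult]
lemmas mm_zero_right = bounded_bilinear.zero_right[OF bounded_bilinear_matrix_mult]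
lemmas mm_algebra = mm_diff_left mm_diff_right mm_add_left mm_add_right mm_minus_left
  mm_minus_right mm_zero_left mm_zero_right matrix_mul_lid matrix_mul_rid
lemmas mv_diff_left = bounded_bilinear.diff_left[OF bounded_bilinear_matrix_vector_mult]
lemmas mv_diff_right = bounded_bilinear.diff_right[OF bounded_bilinear_matrix_vector_mult]
lemmas mv_add_left = bounded_bilinear.add_left[OF bounded_bilinear_matrix_vector_mult]
lemmas mv_add_right = bounded_bilinear.add_right[OF bounded_bilinear_matrix_vector_mult]
lemmas mv_minus_left = bounded_bilinear.minus_left[OF bounded_bilinear_matrix_vector_mult]
lemmas mv_minus_right = bounded_bilinear.minus_right[OF bounded_bilinear_matrix_vector_mult]
lemmas mv_zero_left = bounded_bilinear.zero_left[OF bounded_bilinear_matrix_vector_mult]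
lemmas mv_zero_right = bounded_bilinear.zero_right[OF bounded_bilinear_matrix_vector_mult]
lemmas mv_algebra = mv_diff_left mv_diff_right mv_add_left mv_add_right mv_minus_left
  mv_minus_right mv_zero_left mv_zero_right matrix_vector_mul_lid

lemma mat_mult_nth: "(mat (z::complex) ** (A :: complex ^ 'n ^ 'n)) $ i $ j = z * A $ i $ j"
  by (simp add: matrix_matrix_mult_def mat_def if_distrib[of "\<lambda>x. x * _"] cong: if_cong)

lemma mult_mat_nth: "((A :: complex ^ 'n ^ 'n) ** mat (z::complex)) $ i $ j = z * A $ i $ j"
  by (simp add: matrix_matrix_mult_def mat_def if_distrib[of "\<lambda>x. _ * x"] mult.commute cong: if_cong)

lemma mat_commute: "(A :: complex ^ 'n ^ 'n) ** mat z = mat z ** A"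
  by (simp add: vec_eq_iff mat_mult_nth mult_mat_nth)

lemma mat_left_commute:
  "(A :: complex ^ 'n ^ 'n) ** (mat z ** B) = mat z ** (A ** B)"
  by (metis mat_commute matrix_mul_assoc)

lemma mat_mult_mat: "mat z ** mat w = (mat (z * w) :: complex ^ 'n ^ 'n)"
  by (simp add: vec_eq_iff mat_mult_nth) (simp add: mat_def)

lemma mat_mult_vec: "mat z *v v = z *s (v :: complex ^ 'n)"
  by (simp add: vec_eq_iff matrix_vector_mult_def mat_def if_distrib[of "\<lambda>x. x * _"] cong: if_cong)

lemma norm_mat_mult: "norm (mat z ** (A :: complex ^ 'n ^ 'n)) = norm z * norm A"
proof -
  have "(norm (mat z ** A))\<^sup>2 = (norm z * norm A)\<^sup>2"
    by (simp add: norm_mat_sq mat_mult_nth norm_mult power_mult_distrib sum_distrib_left)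
  then show ?thesis
    by (metis norm_ge_zero power2_eq_imp_eq zero_le_mult_iff)
qed

lemma mat_of_real_mult: "mat (complex_of_real r) ** A = r *\<^sub>R (A :: complex ^ 'n ^ 'n)"
  by (simp add: vec_eq_iff mat_mult_nth scaleR_conv_of_real[where 'a = complex])

text \<open>In the Frobenius norm the identity has the square root of the dimension as its norm, not
  1. Hence the factors \<open>norm (mat 1)\<close> in the later constants.\<close>

lemma norm_mat_1_pos: "norm (mat 1 :: complex ^ 'n ^ 'n) \<ge> 1"
  using norm_entry_le[of "mat 1 :: complex ^ 'n ^ 'n" undefined undefined] by (simp add: mat_def)

subsection \<open>Inverses\<close>

lemma
  assumes "invertible (A :: complex ^ 'n ^ 'n)"
  shows minv_right: "A ** matrix_inv A = mat 1" and minv_left: "matrix_inv A ** A = mat 1"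
  using someI_ex[OF assms[unfolded invertible_def]] by (auto simp: matrix_inv_def)

lemma minv_left': "invertible (A :: complex ^ 'n ^ 'n) \<Longrightarrow> matrix_inv A ** (A ** B) = B"
  by (simp add: matrix_mul_assoc minv_left)

lemma minv_right': "invertible (A :: complex ^ 'n ^ 'n) \<Longrightarrow> A ** (matrix_inv A ** B) = B"
  by (simp add: matrix_mul_assoc minv_right)

lemma mult_eq_1_commute: "(A :: complex ^ 'n ^ 'n) ** B = mat 1 \<Longrightarrow> B ** A = mat 1"
  using matrix_left_right_inverse by blast

lemma invertibleI: "(A :: complex ^ 'n ^ 'n) ** B = mat 1 \<Longrightarrow> invertible A"
  using mult_eq_1_commute invertible_def by blast

lemma matrix_inv_eqI: "(A :: complex ^ 'n ^ 'n) ** B = mat 1 \<Longrightarrow> matrix_inv A = B"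
  by (metis invertibleI matrix_mul_assoc matrix_mul_lid matrix_mul_rid minv_left)

lemma invertible_minv: "invertible (A :: complex ^ 'n ^ 'n) \<Longrightarrow> invertible (matrix_inv A)"
  using minv_left invertibleI by blast

lemma invertible_mm: "invertible (A :: complex ^ 'n ^ 'n) \<Longrightarrow> invertible (B :: complex ^ 'n ^ 'n) \<Longrightarrow> invertible (A ** B)"
  using invertible_mult by blast

lemma minv_mm:
  "invertible (A :: complex ^ 'n ^ 'n) \<Longrightarrow> invertible (B :: complex ^ 'n ^ 'n) \<Longrightarrow>
     matrix_inv (A ** B) = matrix_inv B ** matrix_inv A"
  by (rule matrix_inv_eqI) (simp add: matrix_mul_assoc[symmetric] minv_right minv_right')

lemma invertible_injI:
  assumes "\<And>v. (A :: complex ^ 'n ^ 'n) *v v = 0 \<Longrightarrow> v = 0"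
  shows "invertible A"
proof -
  have "inj ((*v) A)"
    by (rule injI) (metis assms eq_iff_diff_eq_0 mv_diff_right)
  then obtain B where "B ** A = mat 1"
    using matrix_left_invertible_injective[of A] by blast
  then show ?thesis
    using mult_eq_1_commute invertibleI by blast
qed

text \<open>A kernel vector would satisfy \<open>(A - mat 1) *v v = - v\<close>, which a norm below
  1 forbids for \<open>v\<close> other than 0.\<close>

lemma invertible_near_1:
  assumes "norm (A - mat 1 :: complex ^ 'n ^ 'n) \<le> c" "c < 1"
  shows "invertible A"
proof (rule invertible_injI)
  fix v assume v: "A *v v = 0"
  have "(A - mat 1) *v v = - v" by (simp add: mv_algebra v)
  then have "norm v \<le> norm (A - mat 1) * norm v"
    using norm_matrix_vector_mult[of "A - mat 1" v] by simp
  also have "\<dots> \<le> c * norm v" using assms by (intro mult_right_mono) auto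
  finally have "(1 - c) * norm v \<le> 0" by (simp add: algebra_simps)
  with assms show "v = 0"
    by (metis diff_gt_0_iff_gt mult_le_0_iff norm_le_zero_iff not_less)
qed

text \<open>In \<open>A^-1 = I - (A - I) A^-1\<close> the norm of the last term is absorbed on the
  left, at the price of the factor 2.\<close>

lemma norm_minv_near_1:
  assumes "norm (A - mat 1 :: complex ^ 'n ^ 'n) \<le> 1/2"
  shows "norm (matrix_inv A) \<le> 2 * norm (mat 1 :: complex ^ 'n ^ 'n)"
proof -
  have inv: "invertible A" using invertible_near_1[OF assms] by simp
  have "matrix_inv A = mat 1 - (A - mat 1) ** matrix_inv A"
    by (simp add: mm_algebra minv_right[OF inv])
  then have "norm (matrix_inv A) \<le> norm (mat 1 :: complex ^ 'n ^ 'n) + norm ((A - mat 1) ** matrix_inv A)"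
    by (metis norm_triangle_ineq4)
  also have "norm ((A - mat 1) ** matrix_inv A) \<le> 1/2 * norm (matrix_inv A)"
    by (rule norm_matrix_mult_le[OF assms order_refl])
  finally show ?thesis by simp
qed

text \<open>Cramer's rule for column \<open>j\<close> of the inverse. As a quotient of determinants
  the entry inherits continuity and holomorphy from the entries of \<open>A\<close>; this is how
  both are proved for inverses.\<close>

lemma minv_entry:
  assumes "invertible (A :: complex ^ 'n ^ 'n)"
  shows "matrix_inv A $ i $ j =
    det (\<chi> k l. if l = i then (if k = j then 1 else 0) else A $ k $ l) / det A"
proof -
  let ?x = "column j (matrix_inv A)"
  have nz: "det A \<noteq> 0" using assms invertible_det_nz by blast
  have "A *v ?x = column j (A ** matrix_inv A)"
    by (simp add: vec_eq_iff column_def matrix_vector_mult_def matrix_matrix_mult_def)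
  also have "\<dots> = (\<chi> k. if k = j then 1 else 0)"
    by (simp add: minv_right[OF assms] vec_eq_iff column_def mat_def)
  finally have "?x = (\<chi> k. det (\<chi> i l. if l = k then (\<chi> k. if k = j then 1 else 0) $ i else A $ i $ l) / det A)"
    using cramer[OF nz] by blast
  then have "?x $ i = det (\<chi> k l. if l = i then (if k = j then 1 else 0) else A $ k $ l) / det A"
    by (simp cong: if_cong)
  then show ?thesis by (simp add: column_def)
qed

lemma continuous_on_det:
  fixes F :: "'a::topological_space \<Rightarrow> complex ^ 'n ^ 'n"
  assumes "\<And>i j. continuous_on S (\<lambda>x. F x $ i $ j)"
  shows "continuous_on S (\<lambda>x. det (F x))"
  unfolding det_def by (intro continuous_intros assms)

lemma continuous_on_matrix_entries:
  fixes F :: "'a::topological_space \<Rightarrow> complex ^ 'n ^ 'm"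
  assumes "\<And>i j. continuous_on S (\<lambda>x. F x $ i $ j)"
  shows "continuous_on S F"
  using assms unfolding continuous_on_def by (auto intro!: vec_tendstoI)

lemma continuous_on_minv:
  assumes F: "continuous_on S F" and inv: "\<And>x. x \<in> S \<Longrightarrow> invertible (F x :: complex ^ 'n ^ 'n)"
  shows "continuous_on S (\<lambda>x. matrix_inv (F x))"
proof (rule continuous_on_matrix_entries)
  fix i j
  have F': "continuous_on S (\<lambda>x. F x $ k $ l)" for k l
    by (intro continuous_intros F)
  have "continuous_on S (\<lambda>x. det (\<chi> k l. if l = i then (if k = j then 1 else 0) else F x $ k $ l) / det (F x))"
  proof (intro continuous_on_divide continuous_on_det)
    show "continuous_on S (\<lambda>x. (\<chi> k l. if l = i then (if k = j then 1 else 0) else F x $ k $ l) $ k $ l)" for k l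
      using F' by (cases "l = i"; cases "k = j") simp_all
  qed (use inv invertible_det_nz F' in auto)
  then show "continuous_on S (\<lambda>x. matrix_inv (F x) $ i $ j)"
    by (simp add: inv minv_entry cong: continuous_on_cong)
qed

subsection \<open>Adjoints and the Hermitian form\<close>

lemma cadjoint_nth [simp]: "cadjoint A $ i $ j = cnj (A $ j $ i)"
  by (simp add: cadjoint_def transpose_def map_matrix_def)

lemma cadjoint_mult: "cadjoint (A ** B) = cadjoint B ** cadjoint A"
  by (simp add: vec_eq_iff matrix_matrix_mult_def mult.commute)

lemma cadjoint_add: "cadjoint (A + B) = cadjoint A + cadjoint B"
  by (simp add: vec_eq_iff)

lemma cadjoint_diff: "cadjoint (A - B) = cadjoint A - cadjoint B"
  by (simp add: vec_eq_iff)

lemma cadjoint_mat: "cadjoint (mat z) = mat (cnj z)"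
  by (simp add: vec_eq_iff mat_def)

lemma norm_cadjoint [simp]: "norm (cadjoint A) = norm A"
proof -
  have "(norm (cadjoint A))\<^sup>2 = (norm A)\<^sup>2"
    unfolding norm_mat_sq by (subst sum.swap) simp
  then show ?thesis by (simp add: power2_eq_iff_nonneg)
qed

lemma cadjoint_scaleR: "cadjoint (r *\<^sub>R A) = r *\<^sub>R cadjoint A"
  by (simp add: vec_eq_iff)

lemma bounded_linear_cadjoint: "bounded_linear cadjoint"
  by (rule bounded_linear_intro[where K = 1]) (auto simp: cadjoint_add cadjoint_scaleR)

lemma invertible_cadjoint: "invertible A \<Longrightarrow> invertible (cadjoint A)"
  by (metis cadjoint_mat cadjoint_mult complex_cnj_one invertibleI minv_left)

lemma minv_cadjoint: "invertible A \<Longrightarrow> matrix_inv (cadjoint A) = cadjoint (matrix_inv A)"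
  by (metis cadjoint_mat cadjoint_mult complex_cnj_one matrix_inv_eqI minv_left)

text \<open>The standard Hermitian form, conjugate linear in the first argument. The indefinite
  forms of the proof are \<open>hip v (J *v v)\<close> with self-adjoint \<open>J\<close>.\<close>

definition hip :: "complex ^ 'n \<Rightarrow> complex ^ 'n \<Rightarrow> complex" where
  "hip u v = (\<Sum>i\<in>UNIV. cnj (u $ i) * v $ i)"

lemma loewner_le_hip: "loewner_le A B \<longleftrightarrow> (\<forall>v. hip v ((B - A) *v v) \<in> \<real>\<^sub>\<ge>\<^sub>0)"
  by (simp add: loewner_le_def hip_def)

lemma hip_add_left: "hip (u + v) w = hip u w + hip v w"
  by (simp add: hip_def sum.distrib algebra_simps)

lemma hip_add_right: "hip w (u + v) = hip w u + hip w v"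
  by (simp add: hip_def sum.distrib algebra_simps)

lemma hip_diff_left: "hip (u - v) w = hip u w - hip v w"
  by (simp add: hip_def sum_subtractf algebra_simps)

lemma hip_diff_right: "hip w (u - v) = hip w u - hip w v"
  by (simp add: hip_def sum_subtractf algebra_simps)

lemma hip_cscale_left: "hip (c *s u) w = cnj c * hip u w"
  by (simp add: hip_def sum_distrib_left algebra_simps)

lemma hip_cscale_right: "hip w (c *s u) = c * hip w u"
  by (simp add: hip_def sum_distrib_left algebra_simps)

lemma hip_zero_left [simp]: "hip 0 u = 0" and hip_zero_right [simp]: "hip u 0 = 0"
  by (simp_all add: hip_def)

lemmas hip_algebra = hip_add_left hip_add_right hip_diff_left hip_diff_right
  hip_cscale_left hip_cscale_right

lemma cnj_hip: "cnj (hip u v) = hip v u"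
  by (simp add: hip_def mult.commute)

lemma Re_hip_commute: "Re (hip u v) = Re (hip v u)"
  by (metis cnj_hip complex_cnj(1) complex_cnj_cancel_iff cnj.simps(1))

lemma hip_self: "hip u u = of_real ((norm u)\<^sup>2)"
  by (simp add: hip_def norm_vec_sq mult.commute[of "cnj _"] complex_norm_square[symmetric] del: of_real_power)

lemma norm_hip_le: "norm (hip u v) \<le> norm u * norm v"
  using norm_sum_mult_le[of "\<lambda>i. cnj (u $ i)" "\<lambda>i. v $ i"] by (simp add: hip_def norm_vec_def)

lemma hip_adjoint: "hip (A *v u) v = hip u (cadjoint A *v v)"
proof -
  have "hip (A *v u) v = (\<Sum>i\<in>UNIV. \<Sum>j\<in>UNIV. cnj (u $ j) * cnj (A $ i $ j) * v $ i)"
    by (simp add: hip_def matrix_vector_mult_def sum_distrib_right sum_distrib_left mult_ac)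
  also have "\<dots> = (\<Sum>j\<in>UNIV. \<Sum>i\<in>UNIV. cnj (u $ j) * cnj (A $ i $ j) * v $ i)"
    by (rule sum.swap)
  also have "\<dots> = hip u (cadjoint A *v v)"
    by (simp add: hip_def matrix_vector_mult_def sum_distrib_left mult_ac)
  finally show ?thesis .
qed

lemma hip_self_adjoint: "cadjoint J = J \<Longrightarrow> hip (J *v u) v = hip u (J *v v)"
  by (simp add: hip_adjoint)

lemma Im_hip_self_adjoint: "cadjoint J = J \<Longrightarrow> Im (hip u (J *v u)) = 0"
proof -
  assume "cadjoint J = J"
  then have "cnj (hip u (J *v u)) = hip u (J *v u)"
    by (simp add: cnj_hip hip_self_adjoint)
  then show ?thesis by (metis Reals_cnj_iff complex_is_Real_iff)
qed

lemma hip_congruence: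
  "hip v ((cadjoint S ** J ** S) *v v) = hip (S *v v) (J *v (S *v v))"
  by (simp add: hip_adjoint matrix_vector_mul_assoc matrix_mul_assoc)

text \<open>For self-adjoint \<open>J\<close> the reality requirement in \<open>loewner_le\<close> is automatic.\<close>

lemma loewner_le_congruence_iff:
  assumes "cadjoint J = J"
  shows "loewner_le (cadjoint S ** J ** S) J \<longleftrightarrow>
    (\<forall>v. Re (hip (S *v v) (J *v (S *v v))) \<le> Re (hip v (J *v v)))"
proof -
  have "hip v ((J - cadjoint S ** J ** S) *v v) =
      hip v (J *v v) - hip (S *v v) (J *v (S *v v))" for v
    by (simp add: mv_diff_left hip_diff_right hip_congruence)
  then show ?thesis
    unfolding loewner_le_hip
    by (simp add: complex_nonneg_Reals_iff Im_hip_self_adjoint[OF assms])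
qed

lemma matrix_eqI_vec: "(\<And>v. A *v v = B *v v) \<Longrightarrow> (A :: complex ^ 'n ^ 'm) = B"
  by (simp add: matrix_eq)

subsection \<open>Matrix-valued holomorphic functions\<close>

definition mhol :: "(complex \<Rightarrow> complex ^ 'n ^ 'm) \<Rightarrow> complex set \<Rightarrow> bool" where
  "mhol F U \<longleftrightarrow> (\<forall>i j. (\<lambda>z. F z $ i $ j) holomorphic_on U)"

lemma mholI: "(\<And>i j. (\<lambda>z. F z $ i $ j) holomorphic_on U) \<Longrightarrow> mhol F U"
  by (simp add: mhol_def)

lemma mholD: "mhol F U \<Longrightarrow> (\<lambda>z. F z $ i $ j) holomorphic_on U"
  by (simp add: mhol_def)

lemma mhol_const [intro]: "mhol (\<lambda>z. A) U"
  by (simp add: mhol_def)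

lemma mhol_mat: "f holomorphic_on U \<Longrightarrow> mhol (\<lambda>z. mat (f z) :: complex ^ 'n ^ 'n) U"
proof (rule mholI)
  show "(\<lambda>z. (mat (f z) :: complex ^ 'n ^ 'n) $ i $ j) holomorphic_on U" if "f holomorphic_on U" for i j
    using that by (cases "i = j") (simp_all add: mat_def)
qed

lemma mhol_add: "mhol F U \<Longrightarrow> mhol G U \<Longrightarrow> mhol (\<lambda>z. F z + G z) U"
  by (auto simp: mhol_def intro!: holomorphic_intros)

lemma mhol_diff: "mhol F U \<Longrightarrow> mhol G U \<Longrightarrow> mhol (\<lambda>z. F z - G z) U"
  by (auto simp: mhol_def intro!: holomorphic_intros)

lemma mhol_mult: "mhol F U \<Longrightarrow> mhol G U \<Longrightarrow> mhol (\<lambda>z. F z ** G z) U"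
  by (auto simp: mhol_def matrix_matrix_mult_def intro!: holomorphic_intros)

lemma mhol_subset: "mhol F U \<Longrightarrow> V \<subseteq> U \<Longrightarrow> mhol F V"
  unfolding mhol_def by (blast intro: holomorphic_on_subset)

lemma mhol_cong: "(\<And>z. z \<in> U \<Longrightarrow> F z = G z) \<Longrightarrow> mhol F U \<longleftrightarrow> mhol G U"
  by (simp add: mhol_def cong: holomorphic_cong)

lemma holomorphic_det:
  fixes F :: "complex \<Rightarrow> complex ^ 'n ^ 'n"
  assumes "\<And>i j. (\<lambda>z. F z $ i $ j) holomorphic_on U"
  shows "(\<lambda>z. det (F z)) holomorphic_on U"
  unfolding det_def by (intro holomorphic_intros assms)

lemma mhol_minv:
  fixes F :: "complex \<Rightarrow> complex ^ 'n ^ 'n"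
  assumes F: "mhol F U" and inv: "\<And>z. z \<in> U \<Longrightarrow> invertible (F z)"
  shows "mhol (\<lambda>z. matrix_inv (F z)) U"
proof (rule mholI)
  fix i j
  have "(\<lambda>z. det (\<chi> k l. if l = i then (if k = j then 1 else 0) else F z $ k $ l) / det (F z)) holomorphic_on U"
  proof (intro holomorphic_on_divide holomorphic_det)
    show "(\<lambda>x. (\<chi> k l. if l = i then (if k = j then 1 else 0) else F x $ k $ l) $ k $ l) holomorphic_on U" for k l
      using mholD[OF F] by (cases "l = i"; cases "k = j") simp_all
  qed (use inv invertible_det_nz mholD[OF F] in auto)
  then show "(\<lambda>z. matrix_inv (F z) $ i $ j) holomorphic_on U"
    by (simp add: inv minv_entry cong: holomorphic_cong)
qed

lemma mhol_compose:
  "mhol F U \<Longrightarrow> f holomorphic_on V \<Longrightarrow> f ` V \<subseteq> U \<Longrightarrow> mhol (\<lambda>z. F (f z)) V"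
  using holomorphic_on_compose_gen[of f V "\<lambda>z. F z $ _ $ _" U] by (auto simp: mhol_def o_def)

text \<open>The map \<open>z \<mapsto> - cnj z\<close> is the reflection in the imaginary axis;
  conjugating before and after restores holomorphy, as in the Schwarz reflection principle.\<close>

lemma holomorphic_reflect:
  "open U \<Longrightarrow> f holomorphic_on ((\<lambda>z. - cnj z) ` U) \<Longrightarrow> (\<lambda>z. cnj (f (- cnj z))) holomorphic_on U"
proof -
  assume U: "open U" and "f holomorphic_on ((\<lambda>z. - cnj z) ` U)"
  then have "(\<lambda>z. f (- z)) holomorphic_on (cnj ` U)"
    by (intro holomorphic_on_compose_gen[of uminus _ f, unfolded o_def] holomorphic_intros) auto
  then have "(cnj \<circ> (\<lambda>z. f (- z)) \<circ> cnj) holomorphic_on U"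
    using U by (rule holomorphic_on_compose_cnj_cnj)
  then show ?thesis by (simp add: o_def)
qed

text \<open>For \<open>Re z = 0\<close> the reflected adjoint is the plain adjoint of
  \<open>F z\<close>. It turns unitarity on the axis into an identity between holomorphic functions,
  to which the identity theorem and Liouville's theorem apply.\<close>

lemma mhol_reflect:
  "open U \<Longrightarrow> mhol F ((\<lambda>z. - cnj z) ` U) \<Longrightarrow> mhol (\<lambda>z. cadjoint (F (- cnj z))) U"
  using holomorphic_reflect by (fastforce simp: mhol_def)

lemma mhol_continuous_on: "mhol F U \<Longrightarrow> continuous_on U F"
  by (intro continuous_on_matrix_entries holomorphic_on_imp_continuous_on mholD)

lemma holomorphic_hip:
  assumes "mhol F U"
  shows "(\<lambda>z. hip x (F z *v y)) holomorphic_on U"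
  unfolding hip_def matrix_vector_mult_def
  by (auto intro!: holomorphic_intros mholD assms)

lemma tendsto_matrix_entries:
  fixes F :: "'a \<Rightarrow> complex ^ 'n ^ 'm"
  assumes "\<And>i j. ((\<lambda>x. F x $ i $ j) \<longlongrightarrow> L $ i $ j) G"
  shows "(F \<longlongrightarrow> L) G"
  by (intro vec_tendstoI assms)

lemma tendsto_entry:
  fixes F :: "'a \<Rightarrow> complex ^ 'n ^ 'm"
  shows "(F \<longlongrightarrow> L) G \<Longrightarrow> ((\<lambda>x. F x $ i $ j) \<longlongrightarrow> L $ i $ j) G"
  by (intro tendsto_vec_nth)

lemma tendsto_minv:
  assumes F: "(F \<longlongrightarrow> L) G" and inv: "invertible (L :: complex ^ 'n ^ 'n)"
  shows "((\<lambda>x. matrix_inv (F x)) \<longlongrightarrow> matrix_inv L) G"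
proof -
  let ?U = "{A. det A \<noteq> (0 :: complex)} :: (complex ^ 'n ^ 'n) set"
  have op: "open ?U"
    by (intro open_Collect_neq continuous_on_det continuous_intros)
  have "continuous_on ?U matrix_inv"
    using continuous_on_minv[of ?U "\<lambda>x. x"] invertible_det_nz by (auto intro: continuous_on_id)
  then have "isCont matrix_inv L"
    using op inv invertible_det_nz continuous_on_eq_continuous_at by blast
  then show ?thesis using F isCont_tendsto_compose by blast
qed

section \<open>Linear differential equations depending on a spectral parameter\<close>

text \<open>The powers of \<open>z\<close> are kept apart in the Picard iterates: each term is then visibly a polynomial
  in \<open>z\<close>, and the solution is entire in \<open>z\<close>.\<close>

primrec picard_coeff ::
  "real \<Rightarrow> (real \<Rightarrow> 'p::finite cmat) \<Rightarrow> (real \<Rightarrow> 'p cmat) \<Rightarrow> nat \<Rightarrow> nat \<Rightarrow> real \<Rightarrow> 'p cmat"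
  where
    "picard_coeff c \<alpha> \<beta> 0 = (\<lambda>k t. if k = 0 then mat 1 else 0)"
  | "picard_coeff c \<alpha> \<beta> (Suc n) = (\<lambda>k t. integral {c..t}
       (\<lambda>s. (if k = 0 then 0 else \<alpha> s ** picard_coeff c \<alpha> \<beta> n (k - 1) s) + \<beta> s ** picard_coeff c \<alpha> \<beta> n k s))"

definition picard_term ::
  "real \<Rightarrow> (real \<Rightarrow> 'p::finite cmat) \<Rightarrow> (real \<Rightarrow> 'p cmat) \<Rightarrow> nat \<Rightarrow> complex \<Rightarrow> real \<Rightarrow> 'p cmat" where
  "picard_term c \<alpha> \<beta> n z t = (\<Sum>k\<le>n. mat (z ^ k) ** picard_coeff c \<alpha> \<beta> n k t)"

definition picard ::
  "real \<Rightarrow> (real \<Rightarrow> 'p::finite cmat) \<Rightarrow> (real \<Rightarrow> 'p cmat) \<Rightarrow> complex \<Rightarrow> real \<Rightarrow> 'p cmat" where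
  "picard c \<alpha> \<beta> z t = (\<Sum>n. picard_term c \<alpha> \<beta> n z t)"

context
  fixes c d :: real and \<alpha> \<beta> :: "real \<Rightarrow> 'p::finite cmat"
  assumes cd: "c \<le> d" and \<alpha>: "continuous_on {c..d} \<alpha>" and \<beta>: "continuous_on {c..d} \<beta>"
begin

lemma picard_coeff_continuous: "continuous_on {c..d} (picard_coeff c \<alpha> \<beta> n k)"
proof (induction n arbitrary: k)
  case (Suc n)
  have "continuous_on {c..d}
      (\<lambda>s. (if k = 0 then 0 else \<alpha> s ** picard_coeff c \<alpha> \<beta> n (k - 1) s) + \<beta> s ** picard_coeff c \<alpha> \<beta> n k s)"
    by (cases k) (auto intro!: continuous_on_add continuous_on_mm \<alpha> \<beta> Suc)
  then show ?case
    by (simp add: indefinite_integral_continuous_1 integrable_continuous_real)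
qed simp

lemma picard_coeff_derivative:
  assumes "t \<in> {c..d}"
  shows "(picard_coeff c \<alpha> \<beta> (Suc n) k has_vector_derivative
     (if k = 0 then 0 else \<alpha> t ** picard_coeff c \<alpha> \<beta> n (k - 1) t) + \<beta> t ** picard_coeff c \<alpha> \<beta> n k t)
     (at t within {c..d})"
proof -
  have "continuous_on {c..d}
      (\<lambda>s. (if k = 0 then 0 else \<alpha> s ** picard_coeff c \<alpha> \<beta> n (k - 1) s) + \<beta> s ** picard_coeff c \<alpha> \<beta> n k s)"
    by (cases k) (auto intro!: continuous_on_add continuous_on_mm \<alpha> \<beta> picard_coeff_continuous)
  from integral_has_vector_derivative[OF this assms] show ?thesis by simp
qed

lemma picard_coeff_eq_0: "k > n \<Longrightarrow> picard_coeff c \<alpha> \<beta> n k t = 0"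
  by (induction n arbitrary: k t) (auto simp: mm_zero_right)

lemma picard_coeff_start: "n > 0 \<Longrightarrow> picard_coeff c \<alpha> \<beta> n k c = 0"
  by (cases n) auto

text \<open>Multiplication by \<open>mat z\<close> raises the power of \<open>z\<close> by one,
  which is the index shift built into the recursion. So the polynomials obey the usual Picard
  recursion with coefficient \<open>mat z ** \<alpha> t + \<beta> t\<close>.\<close>

lemma picard_term_derivative:
  assumes "t \<in> {c..d}"
  shows "(picard_term c \<alpha> \<beta> (Suc n) z has_vector_derivative
     (mat z ** \<alpha> t + \<beta> t) ** picard_term c \<alpha> \<beta> n z t) (at t within {c..d})"
proof -
  let ?q = "picard_coeff c \<alpha> \<beta>"
  have "(picard_term c \<alpha> \<beta> (Suc n) z has_vector_derivative
     (\<Sum>k\<le>Suc n. mat (z ^ k) ** ((if k = 0 then 0 else \<alpha> t ** ?q n (k - 1) t) + \<beta> t ** ?q n k t)))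
     (at t within {c..d})"
    unfolding picard_term_def
    by (intro has_vector_derivative_sum bounded_linear.has_vector_derivative
        [OF bounded_bilinear.bounded_linear_right[OF bounded_bilinear_matrix_mult]]
        picard_coeff_derivative assms)
  moreover have "(\<Sum>k\<le>Suc n. mat (z ^ k) ** ((if k = 0 then 0 else \<alpha> t ** ?q n (k - 1) t) + \<beta> t ** ?q n k t))
      = (\<Sum>k\<le>Suc n. if k = 0 then 0 else mat (z ^ k) ** (\<alpha> t ** ?q n (k - 1) t))
        + (\<Sum>k\<le>Suc n. mat (z ^ k) ** (\<beta> t ** ?q n k t))"
    by (simp only: mm_add_right sum.distrib) (auto intro!: sum.cong simp: mm_zero_right)
  moreover have "(\<Sum>k\<le>Suc n. if k = 0 then 0 else mat (z ^ k) ** (\<alpha> t ** ?q n (k - 1) t))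
      = (mat z ** \<alpha> t) ** picard_term c \<alpha> \<beta> n z t"
    unfolding picard_term_def sum.atMost_Suc_shift
      bounded_bilinear.sum_right[OF bounded_bilinear_matrix_mult]
    by (auto intro!: sum.cong simp: mat_left_commute matrix_mul_assoc mat_mult_mat mult.commute
        mat_commute[of "mat z ** \<alpha> t"])
  \<comment> \<open>The term \<open>k = Suc n\<close> drops out, since the iterate of index
    \<open>n\<close> has degree at most \<open>n\<close> in \<open>z\<close>.\<close>
  moreover have "(\<Sum>k\<le>Suc n. mat (z ^ k) ** (\<beta> t ** ?q n k t)) = \<beta> t ** picard_term c \<alpha> \<beta> n z t"
    unfolding picard_term_def bounded_bilinear.sum_right[OF bounded_bilinear_matrix_mult]
    by (simp add: picard_coeff_eq_0 mm_zero_right mat_left_commute)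
  ultimately show ?thesis by (simp add: mm_add_left)
qed

lemma picard_term_0: "picard_term c \<alpha> \<beta> 0 z t = mat 1"
  by (simp add: picard_term_def)

lemma picard_term_start: "n > 0 \<Longrightarrow> picard_term c \<alpha> \<beta> n z c = 0"
  by (simp add: picard_term_def picard_coeff_start mm_zero_right)

lemma picard_term_continuous: "continuous_on {c..d} (picard_term c \<alpha> \<beta> n z)"
  unfolding picard_term_def
  by (intro continuous_on_sum continuous_on_mm picard_coeff_continuous continuous_intros)

text \<open>Induction by comparing derivatives: the derivative of the majorant of index
  \<open>n + 1\<close> is \<open>K\<close> times the majorant of index \<open>n\<close>, as for the
  exponential series.\<close>

lemma picard_term_bound:
  assumes K: "\<And>t. t \<in> {c..d} \<Longrightarrow> norm (mat z ** \<alpha> t + \<beta> t) \<le> K" and t: "t \<in> {c..d}"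
  shows "norm (picard_term c \<alpha> \<beta> n z t) \<le> norm (mat 1 :: 'p cmat) * ((K * (t - c)) ^ n / fact n)"
  using t
proof (induction n arbitrary: t)
  case 0
  then show ?case by (simp add: picard_term_0)
next
  case (Suc n)
  let ?N = "norm (mat 1 :: 'p cmat)"
  have K0: "K \<ge> 0" using order_trans[OF norm_ge_zero K[of c]] cd by simp
  show ?case
  proof (cases "t = c")
    case True
    then show ?thesis by (simp add: picard_term_start)
  next
    case False
    with Suc.prems have ct: "c < t" by simp
    have "norm (picard_term c \<alpha> \<beta> (Suc n) z t - picard_term c \<alpha> \<beta> (Suc n) z c)
      \<le> ?N * ((K * (t - c)) ^ Suc n / fact (Suc n)) - ?N * ((K * (c - c)) ^ Suc n / fact (Suc n))"
    proof (rule differentiable_bound_general[OF ct,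
          where \<phi> = "\<lambda>s. ?N * ((K * (s - c)) ^ Suc n / fact (Suc n))"
            and \<phi>' = "\<lambda>s. K * (?N * ((K * (s - c)) ^ n / fact n))"
            and f' = "\<lambda>s. (mat z ** \<alpha> s + \<beta> s) ** picard_term c \<alpha> \<beta> n z s"])
      show "continuous_on {c..t} (picard_term c \<alpha> \<beta> (Suc n) z)"
        using Suc.prems by (auto intro: continuous_on_subset[OF picard_term_continuous])
      show "continuous_on {c..t} (\<lambda>s. ?N * ((K * (s - c)) ^ Suc n / fact (Suc n)))"
        by (intro continuous_intros) auto
      fix s assume s: "c < s" "s < t"
      then have s': "s \<in> {c..d}" "s \<in> interior {c..d}" using Suc.prems by auto
      show "(picard_term c \<alpha> \<beta> (Suc n) z has_vector_derivative
          (mat z ** \<alpha> s + \<beta> s) ** picard_term c \<alpha> \<beta> n z s) (at s)"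
        using picard_term_derivative[OF s'(1)] at_within_interior[OF s'(2)] by simp
      have "((\<lambda>s. ?N * ((K * (s - c)) ^ Suc n / fact (Suc n))) has_real_derivative
          ?N * (real (Suc n) * (K * (s - c)) ^ n * K / fact (Suc n))) (at s)"
        by (auto intro!: derivative_eq_intros simp del: fact_Suc power_Suc)
      also have "?N * (real (Suc n) * (K * (s - c)) ^ n * K / fact (Suc n)) = K * (?N * ((K * (s - c)) ^ n / fact n))"
        by (simp add: field_simps del: of_nat_Suc)
      finally show "((\<lambda>s. ?N * ((K * (s - c)) ^ Suc n / fact (Suc n))) has_vector_derivative
          K * (?N * ((K * (s - c)) ^ n / fact n))) (at s)"
        by (simp add: has_real_derivative_iff_has_vector_derivative)
      show "norm ((mat z ** \<alpha> s + \<beta> s) ** picard_term c \<alpha> \<beta> n z s) \<le> K * (?N * ((K * (s - c)) ^ n / fact n))"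
        by (intro norm_matrix_mult_le K Suc.IH s')
    qed
    then show ?thesis by (simp add: picard_term_start)
  qed
qed

lemma picard_coefficient_bound:
  "\<exists>K\<ge>0. \<forall>z t. norm z \<le> \<rho> \<longrightarrow> t \<in> {c..d} \<longrightarrow> norm (mat z ** \<alpha> t + \<beta> t) \<le> K"
proof -
  obtain a where a: "\<And>t. t \<in> {c..d} \<Longrightarrow> norm (\<alpha> t) \<le> a"
    using compact_imp_bounded[OF compact_continuous_image[OF \<alpha>]] by (force simp: bounded_iff)
  obtain b where b: "\<And>t. t \<in> {c..d} \<Longrightarrow> norm (\<beta> t) \<le> b"
    using compact_imp_bounded[OF compact_continuous_image[OF \<beta>]] by (force simp: bounded_iff)
  have ab: "a \<ge> 0" "b \<ge> 0"
    using order_trans[OF norm_ge_zero a[of c]] order_trans[OF norm_ge_zero b[of c]] cd by simp_all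
  show ?thesis
  proof (intro exI[of _ "\<bar>\<rho>\<bar> * a + b"] conjI allI impI)
    fix z :: complex and t assume zt: "norm z \<le> \<rho>" "t \<in> {c..d}"
    have "norm (mat z ** \<alpha> t + \<beta> t) \<le> norm z * norm (\<alpha> t) + norm (\<beta> t)"
      by (metis norm_mat_mult norm_triangle_ineq)
    also have "\<dots> \<le> \<bar>\<rho>\<bar> * a + b"
      using zt a b ab by (intro add_mono mult_mono) auto
    finally show "norm (mat z ** \<alpha> t + \<beta> t) \<le> \<bar>\<rho>\<bar> * a + b" .
  qed (use ab in auto)
qed

text \<open>Taken at \<open>t = d\<close>, the majorants depend neither on \<open>z\<close> in the
  disc nor on \<open>t\<close> and sum to an exponential, so the M-test is uniform in both
  variables.\<close>

lemma picard_uniform: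
  "\<exists>B. uniform_limit (cball 0 \<rho> \<times> {c..d}) (\<lambda>n (z, t). \<Sum>i<n. picard_term c \<alpha> \<beta> i z t)
        (\<lambda>(z, t). picard c \<alpha> \<beta> z t) sequentially \<and>
     (\<forall>z t. norm z \<le> \<rho> \<longrightarrow> t \<in> {c..d} \<longrightarrow> norm (picard c \<alpha> \<beta> z t) \<le> B)"
proof -
  obtain K where K: "K \<ge> 0" "\<And>z t. norm z \<le> \<rho> \<Longrightarrow> t \<in> {c..d} \<Longrightarrow> norm (mat z ** \<alpha> t + \<beta> t) \<le> K"
    using picard_coefficient_bound by blast
  define M where "M n = norm (mat 1 :: 'p cmat) * ((K * (d - c)) ^ n / fact n)" for n
  have M: "norm (picard_term c \<alpha> \<beta> n z t) \<le> M n" if "norm z \<le> \<rho>" "t \<in> {c..d}" for n z t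
  proof -
    have "norm (picard_term c \<alpha> \<beta> n z t) \<le> norm (mat 1 :: 'p cmat) * ((K * (t - c)) ^ n / fact n)"
      using picard_term_bound K that by blast
    also have "\<dots> \<le> M n"
      unfolding M_def using that K
      by (intro mult_left_mono divide_right_mono power_mono) auto
    finally show ?thesis .
  qed
  have sM: "summable M"
    using summable_exp_generic[of "K * (d - c)"] unfolding M_def
    by (intro summable_mult) (simp add: field_simps)
  have "uniform_limit (cball 0 \<rho> \<times> {c..d}) (\<lambda>n x. \<Sum>i<n. picard_term c \<alpha> \<beta> i (fst x) (snd x))
        (\<lambda>x. picard c \<alpha> \<beta> (fst x) (snd x)) sequentially"
    unfolding picard_def by (rule Weierstrass_m_test[OF _ sM]) (auto intro: M)
  moreover have "norm (picard c \<alpha> \<beta> z t) \<le> suminf M" if "norm z \<le> \<rho>" "t \<in> {c..d}" for z t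
    unfolding picard_def using M[OF that] sM by (rule norm_suminf_le)
  ultimately show ?thesis
    by (auto simp: case_prod_unfold)
qed

lemma picard_holomorphic:
  assumes "t \<in> {c..d}" shows "mhol (\<lambda>z. picard c \<alpha> \<beta> z t) U"
proof (rule mholI)
  fix i j
  have "(\<lambda>z. picard c \<alpha> \<beta> z t $ i $ j) holomorphic_on UNIV"
  proof (rule holomorphic_uniform_sequence)
    fix n
    have "mhol (\<lambda>z. \<Sum>i<n. picard_term c \<alpha> \<beta> i z t) UNIV"
      by (auto simp: mhol_def picard_term_def mat_mult_nth intro!: holomorphic_intros)
    then show "(\<lambda>z. (\<Sum>i<n. picard_term c \<alpha> \<beta> i z t) $ i $ j) holomorphic_on UNIV"
      by (rule mholD)
  next
    fix z :: complex
    obtain B where "uniform_limit (cball 0 (norm z + 1) \<times> {c..d}) (\<lambda>n (z, t). \<Sum>i<n. picard_term c \<alpha> \<beta> i z t)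
        (\<lambda>(z, t). picard c \<alpha> \<beta> z t) sequentially"
      using picard_uniform by blast
    then have u: "uniform_limit (cball z 1) (\<lambda>n z. \<Sum>i<n. picard_term c \<alpha> \<beta> i z t)
        (\<lambda>z. picard c \<alpha> \<beta> z t) sequentially"
      unfolding uniform_limit_iff
    proof (rule all_forward, intro impI)
      fix e :: real
      assume "0 < e \<longrightarrow> (\<forall>\<^sub>F n in sequentially. \<forall>x\<in>cball 0 (cmod z + 1) \<times> {c..d}.
                  dist (case x of (z, t) \<Rightarrow> \<Sum>i<n. picard_term c \<alpha> \<beta> i z t) (case x of (z, t) \<Rightarrow> picard c \<alpha> \<beta> z t) < e)"
        and "0 < e"
      then have *: "\<forall>\<^sub>F n in sequentially. \<forall>x\<in>cball 0 (cmod z + 1) \<times> {c..d}.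
                  dist (case x of (z, t) \<Rightarrow> \<Sum>i<n. picard_term c \<alpha> \<beta> i z t) (case x of (z, t) \<Rightarrow> picard c \<alpha> \<beta> z t) < e"
        by blast
      have "w \<in> cball 0 (cmod z + 1)" if "w \<in> cball z 1" for w
        using that norm_triangle_ineq2[of w z] by (simp add: dist_norm norm_minus_commute)
      with assms show "\<forall>\<^sub>F n in sequentially. \<forall>x\<in>cball z 1.
            dist (\<Sum>i<n. picard_term c \<alpha> \<beta> i x t) (picard c \<alpha> \<beta> x t) < e"
        by (intro eventually_mono[OF *]) auto
    qed
    have "uniform_limit (cball z 1) (\<lambda>n z. (\<Sum>i<n. picard_term c \<alpha> \<beta> i z t) $ i $ j)
        (\<lambda>z. picard c \<alpha> \<beta> z t $ i $ j) sequentially"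
      unfolding uniform_limit_iff
    proof (rule allI, rule impI)
      fix e :: real assume "0 < e"
      with u have "\<forall>\<^sub>F n in sequentially. \<forall>x\<in>cball z 1.
            dist (\<Sum>i<n. picard_term c \<alpha> \<beta> i x t) (picard c \<alpha> \<beta> x t) < e"
        by (auto simp: uniform_limit_iff)
      then show "\<forall>\<^sub>F n in sequentially. \<forall>x\<in>cball z 1.
            dist ((\<Sum>i<n. picard_term c \<alpha> \<beta> i x t) $ i $ j) (picard c \<alpha> \<beta> x t $ i $ j) < e"
        by (rule eventually_mono) (meson dist_vec_nth_le order_le_less_trans)
    qed
    then show "\<exists>d>0. cball z d \<subseteq> UNIV \<and> uniform_limit (cball z d) (\<lambda>n z. (\<Sum>i<n. picard_term c \<alpha> \<beta> i z t) $ i $ j)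
        (\<lambda>z. picard c \<alpha> \<beta> z t $ i $ j) sequentially"
      by (intro exI[of _ 1]) auto
  qed auto
  then show "(\<lambda>z. picard c \<alpha> \<beta> z t $ i $ j) holomorphic_on U"
    by (rule holomorphic_on_subset) auto
qed

lemma picard_start: "picard c \<alpha> \<beta> z c = mat 1"
proof -
  have "(\<lambda>n. picard_term c \<alpha> \<beta> n z c) = (\<lambda>n. if n = 0 then mat 1 else 0)"
    by (auto simp: picard_term_0 picard_term_start)
  then show ?thesis
    unfolding picard_def using suminf_finite[of "{0}" "\<lambda>n. picard_term c \<alpha> \<beta> n z c"]
    by (simp add: picard_term_0 picard_term_start)
qed

lemma picard_derivative:
  assumes t: "t \<in> {c..d}"
  shows "(picard c \<alpha> \<beta> z has_vector_derivative (mat z ** \<alpha> t + \<beta> t) ** picard c \<alpha> \<beta> z t) (at t within {c..d})"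
proof -
  let ?P = "\<lambda>n. picard_term c \<alpha> \<beta> n z" and ?A = "\<lambda>t. mat z ** \<alpha> t + \<beta> t"
  obtain K where K: "K \<ge> 0" "\<And>t. t \<in> {c..d} \<Longrightarrow> norm (?A t) \<le> K"
    using picard_coefficient_bound[of "norm z"] by blast
  obtain B where B: "uniform_limit (cball 0 (norm z) \<times> {c..d}) (\<lambda>n (z, t). \<Sum>i<n. picard_term c \<alpha> \<beta> i z t)
        (\<lambda>(z, t). picard c \<alpha> \<beta> z t) sequentially"
    using picard_uniform by blast
  \<comment> \<open>The term of index 0 is constant, so the differentiated series is the coefficient
    times the original series, shifted by one index: \<open>n\<close> differentiated terms
    correspond to \<open>n - 1\<close> original ones.\<close>
  define f' where "f' n s h = h *\<^sub>R (case n of 0 \<Rightarrow> 0 | Suc m \<Rightarrow> ?A s ** ?P m s)" for n s h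
  have "\<exists>g. \<forall>x\<in>{c..d}. (\<lambda>n. ?P n x) sums g x \<and>
      (g has_derivative (\<lambda>h. h *\<^sub>R (?A x ** picard c \<alpha> \<beta> z x))) (at x within {c..d})"
  proof (rule has_derivative_series[where f' = f' and x = c and l = "mat 1"])
    show "(?P n has_derivative f' n x) (at x within {c..d})" if "x \<in> {c..d}" for n x
    proof (cases n)
      case 0
      have "picard_term c \<alpha> \<beta> 0 z = (\<lambda>t. mat 1)" by (simp add: fun_eq_iff picard_term_0)
      then show ?thesis by (simp add: 0 f'_def[abs_def])
    next
      case (Suc m)
      then show ?thesis using picard_term_derivative[OF that, of m z]
        by (simp add: Suc f'_def[abs_def] has_vector_derivative_def)
    qed
    fix e :: real assume e: "e > 0"
    have "\<forall>\<^sub>F n in sequentially. \<forall>t\<in>{c..d}. dist (\<Sum>i<n. ?P i t) (picard c \<alpha> \<beta> z t) < e / (K + 1)"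
      using uniform_limitD[OF B, of "e / (K + 1)"] e K by (auto elim!: eventually_mono)
    then have "\<forall>\<^sub>F n in sequentially. \<forall>t\<in>{c..d}. dist (\<Sum>i<n - 1. ?P i t) (picard c \<alpha> \<beta> z t) < e / (K + 1)"
      by (simp add: eventually_sequentially) (metis le_diff_conv2 nat_le_linear add_leD2 add_le_imp_le_diff)
    then show "\<forall>\<^sub>F n in sequentially. \<forall>x\<in>{c..d}. \<forall>h.
       norm ((\<Sum>i<n. f' i x h) - h *\<^sub>R (?A x ** picard c \<alpha> \<beta> z x)) \<le> e * norm h"
      using eventually_gt_at_top[of 0]
    proof eventually_elim
      case (elim n)
      then obtain m where n: "n = Suc m" by (cases n) auto
      show ?case
      proof (intro ballI allI)
        fix x h :: real assume x: "x \<in> {c..d}"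
        have "(\<Sum>i<n. f' i x h) = h *\<^sub>R (?A x ** (\<Sum>i<m. ?P i x))"
          unfolding n sum.lessThan_Suc_shift
          by (simp add: f'_def bounded_bilinear.sum_right[OF bounded_bilinear_matrix_mult] scaleR_sum_right)
        then have "norm ((\<Sum>i<n. f' i x h) - h *\<^sub>R (?A x ** picard c \<alpha> \<beta> z x)) =
           norm (h *\<^sub>R (?A x ** ((\<Sum>i<m. ?P i x) - picard c \<alpha> \<beta> z x)))"
          by (simp add: mm_diff_right scaleR_diff_right)
        also have "\<dots> \<le> norm h * (K * (e / (K + 1)))"
          unfolding norm_scaleR real_norm_def
          using elim(1) x n K(2)[OF x]
          by (intro mult_left_mono norm_matrix_mult_le) (auto simp: dist_norm less_imp_le)
        also have "\<dots> \<le> norm h * e"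
          using K e by (intro mult_left_mono) (auto simp: field_simps)
        finally show "norm ((\<Sum>i<n. f' i x h) - h *\<^sub>R (?A x ** picard c \<alpha> \<beta> z x)) \<le> e * norm h"
          by (simp add: mult.commute)
      qed
    qed
  next
    show "c \<in> {c..d}" using cd by simp
    show "(\<lambda>n. ?P n c) sums mat 1"
      using sums_finite[of "{0}" "\<lambda>n. ?P n c"] by (simp add: picard_term_0 picard_term_start)
  qed auto
  then obtain g where g: "\<And>x. x \<in> {c..d} \<Longrightarrow> (\<lambda>n. ?P n x) sums g x"
    "\<And>x. x \<in> {c..d} \<Longrightarrow> (g has_derivative (\<lambda>h. h *\<^sub>R (?A x ** picard c \<alpha> \<beta> z x))) (at x within {c..d})"
    by blast
  have "g x = picard c \<alpha> \<beta> z x" if "x \<in> {c..d}" for x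
    using g(1)[OF that] by (simp add: picard_def sums_unique)
  then have "(picard c \<alpha> \<beta> z has_derivative (\<lambda>h. h *\<^sub>R (?A t ** picard c \<alpha> \<beta> z t))) (at t within {c..d})"
    using has_derivative_transform[OF t _ g(2)[OF t], of "picard c \<alpha> \<beta> z"] by simp
  then show ?thesis by (simp add: has_vector_derivative_def)
qed

end

section \<open>Fundamental matrices normalised at an interior or end point, and their dependence on
  time\<close>

lemma transpose_mm: "transpose (A ** B) = transpose B ** transpose (A :: complex ^ 'n ^ 'm)"
  by (simp add: matrix_transpose_mul)

lemma bounded_linear_transpose: "bounded_linear (transpose :: complex ^ 'n ^ 'm \<Rightarrow> _)"
proof (rule bounded_linear_intro[where K = 1])
  fix A :: "complex ^ 'n ^ 'm"
  have "(norm (transpose A))\<^sup>2 = (norm A)\<^sup>2"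
    unfolding norm_mat_sq transpose_def by (subst sum.swap) simp
  then show "norm (transpose A) \<le> norm A * 1" by (simp add: power2_eq_iff_nonneg)
qed (auto simp: transpose_def vec_eq_iff)

text \<open>\<open>\<Psi>\<close> is the inverse of the fundamental matrix \<open>\<Phi>\<close>; it arises from the transposed equation.\<close>

definition fundamental_pair ::
  "real set \<Rightarrow> real \<Rightarrow> (real \<Rightarrow> 'p::finite cmat) \<Rightarrow> (real \<Rightarrow> 'p cmat) \<Rightarrow>
   (complex \<Rightarrow> real \<Rightarrow> 'p cmat) \<Rightarrow> (complex \<Rightarrow> real \<Rightarrow> 'p cmat) \<Rightarrow> bool" where
  "fundamental_pair T t0 \<alpha> \<beta> \<Phi> \<Psi> \<longleftrightarrow>
     (\<forall>z. \<Phi> z t0 = mat 1 \<and> \<Psi> z t0 = mat 1) \<and>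
     (\<forall>z. \<forall>t\<in>T. \<Phi> z t ** \<Psi> z t = mat 1 \<and> \<Psi> z t ** \<Phi> z t = mat 1 \<and>
        (\<Phi> z has_vector_derivative (mat z ** \<alpha> t + \<beta> t) ** \<Phi> z t) (at t within T) \<and>
        (\<Psi> z has_vector_derivative - (\<Psi> z t ** (mat z ** \<alpha> t + \<beta> t))) (at t within T)) \<and>
     (\<forall>t\<in>T. mhol (\<lambda>z. \<Phi> z t) UNIV \<and> mhol (\<lambda>z. \<Psi> z t) UNIV) \<and>
     (\<forall>\<rho>. \<exists>B. \<forall>z. \<forall>t\<in>T. norm z \<le> \<rho> \<longrightarrow> norm (\<Phi> z t) \<le> B \<and> norm (\<Psi> z t) \<le> B)"

text \<open>The Picard series starts at the left end \<open>c\<close>, whereas the pair is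
  normalised at \<open>t0\<close>. The transposed series for the negated transposed coefficients is
  a left inverse, because the derivative of the product cancels; multiplying by the values at
  \<open>t0\<close> then moves the normalisation.\<close>

lemma fundamental_pair_exists:
  fixes \<alpha> \<beta> :: "real \<Rightarrow> 'p::finite cmat"
  assumes t0: "t0 \<in> {c..d}" and \<alpha>: "continuous_on {c..d} \<alpha>" and \<beta>: "continuous_on {c..d} \<beta>"
  shows "\<exists>\<Phi> \<Psi>. fundamental_pair {c..d} t0 \<alpha> \<beta> \<Phi> \<Psi>"
proof -
  have cd: "c \<le> d" using t0 by simp
  have \<alpha>': "continuous_on {c..d} (\<lambda>t. - transpose (\<alpha> t))" "continuous_on {c..d} (\<lambda>t. - transpose (\<beta> t))"
    by (intro continuous_intros bounded_linear.continuous_on[OF bounded_linear_transpose] \<alpha> \<beta>)+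
  define F where "F = picard c \<alpha> \<beta>"
  define G where "G z t = transpose (picard c (\<lambda>t. - transpose (\<alpha> t)) (\<lambda>t. - transpose (\<beta> t)) z t)" for z t
  note F = picard_derivative[OF cd \<alpha> \<beta>, folded F_def]
  have G: "(G z has_vector_derivative - (G z t ** (mat z ** \<alpha> t + \<beta> t))) (at t within {c..d})"
    if "t \<in> {c..d}" for z t
  proof -
    let ?X = "picard c (\<lambda>t. - transpose (\<alpha> t)) (\<lambda>t. - transpose (\<beta> t))"
    have "(G z has_vector_derivative
        transpose ((mat z ** - transpose (\<alpha> t) + - transpose (\<beta> t)) ** ?X z t)) (at t within {c..d})"
      unfolding G_def
      by (rule bounded_linear.has_vector_derivative[OF bounded_linear_transpose
            picard_derivative[OF cd \<alpha>' that]])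
    also have "mat z ** - transpose (\<alpha> t) + - transpose (\<beta> t) = transpose (- (mat z ** \<alpha> t + \<beta> t))"
      by (simp add: vec_eq_iff mat_mult_nth) (simp add: transpose_def mat_mult_nth)
    finally show ?thesis
      by (simp only: transpose_mm transpose_transpose G_def[symmetric] mm_minus_right)
  qed
  have GF: "G z t ** F z t = mat 1" if t: "t \<in> {c..d}" for z t
  proof -
    have "((\<lambda>t. G z t ** F z t) has_vector_derivative 0) (at t within {c..d})" if "t \<in> {c..d}" for t
      using has_vector_derivative_mm[OF G[OF that, of z] F[OF that, of z]]
      by (simp add: mm_minus_left matrix_mul_assoc)
    then obtain K where K: "\<And>t. t \<in> {c..d} \<Longrightarrow> G z t ** F z t = K"
      using has_vector_derivative_zero_constant[OF convex_real_interval(5), of c d "\<lambda>t. G z t ** F z t"]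
      by blast
    have "G z c ** F z c = mat 1"
      unfolding G_def F_def
      by (simp add: picard_start[OF cd] \<alpha> \<beta> \<alpha>' transpose_mat)
    with K[of c] K[OF t] cd show ?thesis by simp
  qed
  note FG = mult_eq_1_commute[OF GF]
  define \<Phi> where "\<Phi> z t = F z t ** G z t0" for z t
  define \<Psi> where "\<Psi> z t = F z t0 ** G z t" for z t
  have "\<Phi> z t ** \<Psi> z t = mat 1" if "t \<in> {c..d}" for z t
    unfolding \<Phi>_def \<Psi>_def
    by (metis FG GF matrix_mul_assoc matrix_mul_rid t0 that)
  moreover have "\<Phi> z t0 = mat 1" "\<Psi> z t0 = mat 1" for z
    by (simp_all add: \<Phi>_def \<Psi>_def FG[OF t0])
  moreover have "(\<Phi> z has_vector_derivative (mat z ** \<alpha> t + \<beta> t) ** \<Phi> z t) (at t within {c..d})"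
    if "t \<in> {c..d}" for z t
    unfolding \<Phi>_def matrix_mul_assoc
    by (rule bounded_linear.has_vector_derivative[OF bounded_bilinear.bounded_linear_left
          [OF bounded_bilinear_matrix_mult] F[OF that]])
  moreover have "(\<Psi> z has_vector_derivative - (\<Psi> z t ** (mat z ** \<alpha> t + \<beta> t))) (at t within {c..d})"
    if "t \<in> {c..d}" for z t
    using bounded_linear.has_vector_derivative[OF bounded_bilinear.bounded_linear_right
          [OF bounded_bilinear_matrix_mult] G[OF that], of "F z t0"]
    unfolding \<Psi>_def by (simp add: mm_minus_right matrix_mul_assoc)
  moreover have holF: "mhol (\<lambda>z. F z t) UNIV" and holG: "mhol (\<lambda>z. G z t) UNIV"
    if "t \<in> {c..d}" for t
  proof -
    show "mhol (\<lambda>z. F z t) UNIV"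
      unfolding F_def by (rule picard_holomorphic[OF cd \<alpha> \<beta> that])
    show "mhol (\<lambda>z. G z t) UNIV"
      using picard_holomorphic[OF cd \<alpha>' that] by (simp add: G_def mhol_def transpose_def)
  qed
  moreover have "\<exists>B. \<forall>z. \<forall>t\<in>{c..d}. norm z \<le> \<rho> \<longrightarrow> norm (\<Phi> z t) \<le> B \<and> norm (\<Psi> z t) \<le> B" for \<rho>
  proof -
    obtain B1 where B1: "\<And>z t. norm z \<le> \<rho> \<Longrightarrow> t \<in> {c..d} \<Longrightarrow> norm (F z t) \<le> B1"
      using picard_uniform[OF cd \<alpha> \<beta>, of \<rho>] unfolding F_def by blast
    have tr: "norm (transpose A) = norm (A :: 'p cmat)" for A
    proof -
      have "(norm (transpose A))\<^sup>2 = (norm A)\<^sup>2"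
        unfolding norm_mat_sq transpose_def by (subst sum.swap) simp
      then show ?thesis by (simp add: power2_eq_iff_nonneg)
    qed
    obtain B2 where B2: "\<And>z t. norm z \<le> \<rho> \<Longrightarrow> t \<in> {c..d} \<Longrightarrow> norm (G z t) \<le> B2"
      using picard_uniform[OF cd \<alpha>', of \<rho>] unfolding G_def tr by blast
    show ?thesis
      using B1 B2 t0 by (intro exI[of _ "B1 * B2"]) (auto simp: \<Phi>_def \<Psi>_def intro!: norm_matrix_mult_le)
  qed
  moreover have "mhol (\<lambda>z. \<Phi> z t) UNIV \<and> mhol (\<lambda>z. \<Psi> z t) UNIV" if "t \<in> {c..d}" for t
    unfolding \<Phi>_def \<Psi>_def using that t0 by (auto intro!: mhol_mult holF holG)
  ultimately have "fundamental_pair {c..d} t0 \<alpha> \<beta> \<Phi> \<Psi>"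
    unfolding fundamental_pair_def by (auto intro: mult_eq_1_commute)
  then show ?thesis by blast
qed

lemma fundamental_pair_lipschitz:
  fixes \<alpha> \<beta> :: "real \<Rightarrow> 'p::finite cmat" and \<Phi> \<Psi> :: "complex \<Rightarrow> real \<Rightarrow> 'p cmat"
  assumes fp: "fundamental_pair {c..d} t0 \<alpha> \<beta> \<Phi> \<Psi>" and t0: "t0 \<in> {c..d}"
    and \<alpha>: "continuous_on {c..d} \<alpha>" and \<beta>: "continuous_on {c..d} \<beta>"
  shows "\<exists>L\<ge>0. \<forall>z s t. norm z \<le> \<rho> \<longrightarrow> s \<in> {c..d} \<longrightarrow> t \<in> {c..d} \<longrightarrow>
    norm (\<Phi> z t - \<Phi> z s) \<le> L * \<bar>t - s\<bar>"
proof -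
  have cd: "c \<le> d" using t0 by simp
  obtain K where K: "K \<ge> 0" "\<And>z t. norm z \<le> \<rho> \<Longrightarrow> t \<in> {c..d} \<Longrightarrow> norm (mat z ** \<alpha> t + \<beta> t) \<le> K"
    using picard_coefficient_bound[OF cd \<alpha> \<beta>, of \<rho>] by blast
  obtain B where B: "\<And>z t. norm z \<le> \<rho> \<Longrightarrow> t \<in> {c..d} \<Longrightarrow> norm (\<Phi> z t) \<le> B"
    using fp unfolding fundamental_pair_def by meson
  show ?thesis
  \<comment> \<open>The mean value estimate bounds the remainder after the linear term with
    \<open>2 * (K * \<bar>B\<bar>)\<close>; the linear term itself adds one more
    \<open>K * \<bar>B\<bar>\<close>.\<close>
  proof (intro exI[of _ "3 * (K * \<bar>B\<bar>)"] conjI allI impI)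
    fix z :: complex and s t assume z: "norm z \<le> \<rho>" and st: "s \<in> {c..d}" "t \<in> {c..d}"
    let ?f' = "\<lambda>t. (mat z ** \<alpha> t + \<beta> t) ** \<Phi> z t"
    have f': "norm (?f' x) \<le> K * \<bar>B\<bar>" if "x \<in> {c..d}" for x
      by (rule norm_matrix_mult_le) (use K z that B[OF z that] in auto)
    have "norm (\<Phi> z t - \<Phi> z s - (t - s) *\<^sub>R ?f' s) \<le> norm (t - s) * (2 * (K * \<bar>B\<bar>))"
    proof (rule vector_differentiable_bound_linearization[where S = "{c..d}"])
      show "(\<Phi> z has_vector_derivative ?f' x) (at x within {c..d})" if "x \<in> {c..d}" for x
        using fp that unfolding fundamental_pair_def by blast
      show "closed_segment s t \<subseteq> {c..d}"
        using st closed_segment_subset by blast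
      show "norm (?f' x - ?f' s) \<le> 2 * (K * \<bar>B\<bar>)" if "x \<in> {c..d}" for x
        using norm_triangle_ineq4[of "?f' x" "?f' s"] f'[OF that] f'[OF st(1)] by linarith
    qed (use st in auto)
    moreover have "norm ((t - s) *\<^sub>R ?f' s) \<le> \<bar>t - s\<bar> * (K * \<bar>B\<bar>)"
      unfolding norm_scaleR by (intro mult_left_mono f' st) auto
    moreover have "norm (\<Phi> z t - \<Phi> z s) \<le>
        norm (\<Phi> z t - \<Phi> z s - (t - s) *\<^sub>R ?f' s) + norm ((t - s) *\<^sub>R ?f' s)"
      using norm_triangle_ineq[of "\<Phi> z t - \<Phi> z s - (t - s) *\<^sub>R ?f' s" "(t - s) *\<^sub>R ?f' s"]
      by (simp add: algebra_simps)
    ultimately show "norm (\<Phi> z t - \<Phi> z s) \<le> 3 * (K * \<bar>B\<bar>) * \<bar>t - s\<bar>"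
      by (simp add: algebra_simps)
  qed (use K in auto)
qed

text \<open>\<open>\<Phi> z t ** \<Psi> z \<tau>\<close> is the transition matrix from
  \<open>\<tau>\<close> to \<open>t\<close>. The point is that the remainder is uniform for
  \<open>z\<close> in a disc, since the splitting estimates need a bound on a whole annulus.\<close>

lemma fundamental_pair_linearization:
  fixes \<alpha> \<beta> :: "real \<Rightarrow> 'p::finite cmat" and \<Phi> \<Psi> :: "complex \<Rightarrow> real \<Rightarrow> 'p cmat"
  assumes fp: "fundamental_pair {c..d} t0 \<alpha> \<beta> \<Phi> \<Psi>" and t0: "t0 \<in> {c..d}"
    and \<alpha>: "continuous_on {c..d} \<alpha>" and \<beta>: "continuous_on {c..d} \<beta>"
    and \<tau>: "\<tau> \<in> {c..d}" and e: "e > 0"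
  shows "\<exists>\<delta>>0. \<forall>z t. norm z \<le> \<rho> \<longrightarrow> t \<in> {c..d} \<longrightarrow> \<bar>t - \<tau>\<bar> < \<delta> \<longrightarrow>
    norm (\<Phi> z t ** \<Psi> z \<tau> - mat 1 - (t - \<tau>) *\<^sub>R (mat z ** \<alpha> \<tau> + \<beta> \<tau>)) \<le> e * \<bar>t - \<tau>\<bar>"
proof -
  have cd: "c \<le> d" using t0 by simp
  obtain K where K: "K \<ge> 0" "\<And>z t. norm z \<le> \<rho> \<Longrightarrow> t \<in> {c..d} \<Longrightarrow> norm (mat z ** \<alpha> t + \<beta> t) \<le> K"
    using picard_coefficient_bound[OF cd \<alpha> \<beta>, of \<rho>] by blast
  obtain B' where B': "\<And>z t. norm z \<le> \<rho> \<Longrightarrow> t \<in> {c..d} \<Longrightarrow> norm (\<Phi> z t) \<le> B' \<and> norm (\<Psi> z t) \<le> B'"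
    using fp unfolding fundamental_pair_def by meson
  define B where "B = \<bar>B'\<bar> + 1"
  have B: "B > 0" "norm (\<Phi> z t) \<le> B" "norm (\<Psi> z t) \<le> B" if "norm z \<le> \<rho>" "t \<in> {c..d}" for z t
    using B'[OF that] by (auto simp: B_def)
  have Bpos: "B > 0" by (simp add: B_def add_nonneg_pos)
  obtain L where L: "L \<ge> 0" "\<And>z s t. norm z \<le> \<rho> \<Longrightarrow> s \<in> {c..d} \<Longrightarrow> t \<in> {c..d} \<Longrightarrow>
      norm (\<Phi> z t - \<Phi> z s) \<le> L * \<bar>t - s\<bar>"
    using fundamental_pair_lipschitz[OF fp t0 \<alpha> \<beta>, of \<rho>] by blast
  \<comment> \<open>The error \<open>e\<close> is shared equally: one half goes to the variation of
    the coefficients through \<open>e1\<close>, the other to the variation of \<open>\<Phi>\<close>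
    through \<open>d3\<close>.\<close>
  define e1 where "e1 = e / (2 * (\<bar>\<rho>\<bar> + 1) * B * B)"
  have e1: "e1 > 0" using e Bpos by (simp add: e1_def)
  obtain d1 where d1: "d1 > 0" "\<And>t. t \<in> {c..d} \<Longrightarrow> \<bar>t - \<tau>\<bar> < d1 \<Longrightarrow> norm (\<alpha> t - \<alpha> \<tau>) < e1"
    using \<alpha> \<tau> e1 unfolding continuous_on_iff dist_norm real_norm_def by meson
  obtain d2 where d2: "d2 > 0" "\<And>t. t \<in> {c..d} \<Longrightarrow> \<bar>t - \<tau>\<bar> < d2 \<Longrightarrow> norm (\<beta> t - \<beta> \<tau>) < e1"
    using \<beta> \<tau> e1 unfolding continuous_on_iff dist_norm real_norm_def by meson
  define d3 where "d3 = e / (2 * (K * L * B + 1))"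
  have KLB: "K * L * B \<ge> 0" using K L Bpos by simp
  have d3: "d3 > 0" using e KLB by (simp add: d3_def)
  define \<delta> where "\<delta> = min d1 (min d2 d3)"
  show ?thesis
  proof (intro exI[of _ \<delta>] conjI allI impI)
    show "\<delta> > 0" using d1 d2 d3 by (simp add: \<delta>_def)
    fix z :: complex and t assume z: "norm z \<le> \<rho>" and t: "t \<in> {c..d}" and td: "\<bar>t - \<tau>\<bar> < \<delta>"
    define A where "A t = mat z ** \<alpha> t + \<beta> t" for t
    let ?S = "{c..d} \<inter> ball \<tau> \<delta>"
    let ?f' = "\<lambda>x. (A x ** \<Phi> z x) ** \<Psi> z \<tau>"
    have inv: "\<Phi> z \<tau> ** \<Psi> z \<tau> = mat 1"
      using fp \<tau> unfolding fundamental_pair_def by blast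
    then have f'\<tau>: "?f' \<tau> = A \<tau>" by (simp add: matrix_mul_assoc[symmetric])
    have "norm (\<Phi> z t ** \<Psi> z \<tau> - \<Phi> z \<tau> ** \<Psi> z \<tau> - (t - \<tau>) *\<^sub>R ?f' \<tau>) \<le> norm (t - \<tau>) * e"
    proof (rule vector_differentiable_bound_linearization[where S = ?S and f = "\<lambda>x. \<Phi> z x ** \<Psi> z \<tau>" and f' = ?f'])
      show "((\<lambda>x. \<Phi> z x ** \<Psi> z \<tau>) has_vector_derivative ?f' x) (at x within ?S)" if x: "x \<in> ?S" for x
      proof (rule bounded_linear.has_vector_derivative[OF bounded_bilinear.bounded_linear_left
          [OF bounded_bilinear_matrix_mult]])
        have "(\<Phi> z has_vector_derivative A x ** \<Phi> z x) (at x within {c..d})"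
          using fp x unfolding fundamental_pair_def A_def by blast
        then show "(\<Phi> z has_vector_derivative A x ** \<Phi> z x) (at x within ?S)"
          by (rule has_vector_derivative_within_subset) auto
      qed
      have "convex ?S" by (intro convex_Int) auto
      moreover have "t \<in> ?S" "\<tau> \<in> ?S"
        using t td \<tau> \<open>\<delta> > 0\<close> by (auto simp: dist_real_def)
      ultimately show "closed_segment \<tau> t \<subseteq> ?S" "\<tau> \<in> ?S"
        using closed_segment_subset by blast+
      fix x assume "x \<in> ?S"
      then have x: "x \<in> {c..d}" and xd: "\<bar>x - \<tau>\<bar> < \<delta>" by (auto simp: dist_real_def)
      have "?f' x - ?f' \<tau> = ((A x - A \<tau>) ** \<Phi> z x) ** \<Psi> z \<tau> + (A \<tau> ** (\<Phi> z x - \<Phi> z \<tau>)) ** \<Psi> z \<tau>"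
        by (simp add: mm_algebra)
      also have "norm \<dots> \<le> norm (((A x - A \<tau>) ** \<Phi> z x) ** \<Psi> z \<tau>) + norm ((A \<tau> ** (\<Phi> z x - \<Phi> z \<tau>)) ** \<Psi> z \<tau>)"
        by (rule norm_triangle_ineq)
      also have "norm (((A x - A \<tau>) ** \<Phi> z x) ** \<Psi> z \<tau>) \<le> (((\<bar>\<rho>\<bar> + 1) * e1) * B) * B"
      proof (intro norm_matrix_mult_le B z x \<tau>)
        have "A x - A \<tau> = mat z ** (\<alpha> x - \<alpha> \<tau>) + (\<beta> x - \<beta> \<tau>)" by (simp add: A_def mm_algebra)
        then have "norm (A x - A \<tau>) \<le> norm z * norm (\<alpha> x - \<alpha> \<tau>) + norm (\<beta> x - \<beta> \<tau>)"
          by (metis norm_mat_mult norm_triangle_ineq)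
        also have "\<dots> \<le> \<bar>\<rho>\<bar> * e1 + e1"
          using z d1(2)[OF x] d2(2)[OF x] xd e1
          by (intro add_mono mult_mono) (auto simp: \<delta>_def)
        finally show "norm (A x - A \<tau>) \<le> (\<bar>\<rho>\<bar> + 1) * e1" by (simp add: algebra_simps)
      qed
      also have "(((\<bar>\<rho>\<bar> + 1) * e1) * B) * B = e / 2"
      proof -
        have "r * (e / (2 * r * B * B)) * B * B = e / 2" if "r > 0" for r
          using that Bpos by (simp add: field_simps)
        from this[of "\<bar>\<rho>\<bar> + 1"] show ?thesis unfolding e1_def by simp
      qed
      also have "norm ((A \<tau> ** (\<Phi> z x - \<Phi> z \<tau>)) ** \<Psi> z \<tau>) \<le> (K * (L * d3)) * B"
      proof (intro norm_matrix_mult_le B z \<tau>)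
        show "norm (A \<tau>) \<le> K" using K z \<tau> by (simp add: A_def)
        have "norm (\<Phi> z x - \<Phi> z \<tau>) \<le> L * \<bar>x - \<tau>\<bar>" using L z x \<tau> by blast
        also have "\<dots> \<le> L * d3" using L xd by (intro mult_left_mono) (auto simp: \<delta>_def)
        finally show "norm (\<Phi> z x - \<Phi> z \<tau>) \<le> L * d3" .
      qed
      also have "(K * (L * d3)) * B = (K * L * B) * d3" by (simp add: algebra_simps)
      also have "\<dots> \<le> e / 2"
        unfolding d3_def using KLB e by (simp add: field_simps)
      finally show "norm (?f' x - ?f' \<tau>) \<le> e" by simp
    qed
    then show "norm (\<Phi> z t ** \<Psi> z \<tau> - mat 1 - (t - \<tau>) *\<^sub>R (mat z ** \<alpha> \<tau> + \<beta> \<tau>)) \<le> e * \<bar>t - \<tau>\<bar>"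
      unfolding f'\<tau> inv by (simp add: A_def mult.commute)
  qed
qed

section \<open>Function theory in the right half plane\<close>

text \<open>Infinity approached from inside the half plane. \<open>Y\<close> is analytic on a full
  neighbourhood of infinity, but its Cayley transforms are only constructed in the half
  plane.\<close>

definition rhp_infinity :: "complex filter" where
  "rhp_infinity = inf at_infinity (principal {z. 0 < Re z})"

lemma eventually_rhp_infinity:
  "eventually P rhp_infinity \<longleftrightarrow> (\<exists>\<rho>. \<forall>z. 0 < Re z \<longrightarrow> norm z > \<rho> \<longrightarrow> P z)"
  unfolding rhp_infinity_def eventually_inf_principal eventually_at_infinity
  by (metis (mono_tags, lifting) gt_ex less_imp_le less_le_trans mem_Collect_eq)

lemma filterlim_of_real_rhp_infinity: "filterlim of_real rhp_infinity at_top"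
  unfolding rhp_infinity_def filterlim_inf filterlim_principal
  using eventually_gt_at_top[of 0] by (auto simp: filterlim_of_real_at_infinity)

lemma tendsto_rhp_infinity: "(f \<longlongrightarrow> l) at_infinity \<Longrightarrow> (f \<longlongrightarrow> l) rhp_infinity"
  unfolding rhp_infinity_def by (rule tendsto_mono[OF inf_le1])

lemma rhp_infinity_neq_bot: "rhp_infinity \<noteq> bot"
proof
  assume "rhp_infinity = bot"
  then obtain \<rho> where \<rho>: "\<And>z. 0 < Re z \<Longrightarrow> \<rho> < norm z \<Longrightarrow> False"
    using eventually_rhp_infinity[of "\<lambda>_. False"] by auto
  have "0 < \<bar>\<rho>\<bar> + 1" "\<rho> < \<bar>\<rho>\<bar> + 1" by linarith+
  then show False using \<rho>[of "of_real (\<bar>\<rho>\<bar> + 1)"] by (simp add: norm_of_real del: of_real_add)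
qed

lemma open_rhp: "open {z::complex. 0 < Re z}" and convex_rhp: "convex {z::complex. 0 < Re z}"
  by (simp_all add: open_halfspace_Re_gt convex_halfspace_Re_gt)

lemma connected_rhp: "connected {z::complex. 0 < Re z}"
  by (rule convex_connected[OF convex_rhp])

lemma tendsto_mat:
  assumes "(f \<longlongrightarrow> c) F"
  shows "((\<lambda>x. mat (f x) :: complex ^ 'n ^ 'n) \<longlongrightarrow> mat c) F"
proof (rule tendsto_matrix_entries)
  show "((\<lambda>x. (mat (f x) :: complex ^ 'n ^ 'n) $ i $ j) \<longlongrightarrow> mat c $ i $ j) F" for i j
    using assms by (cases "i = j") (simp_all add: mat_def)
qed

text \<open>If \<open>G\<close> exceeded 1 at \<open>z0\<close>, the points with modulus at least
  that of \<open>G z0\<close> would form a compact subset of the half plane, because the two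
  boundary hypotheses keep them away from the axis and from infinity. So the maximum is attained,
  \<open>G\<close> is constant, and its value near infinity gives the contradiction.\<close>

lemma maximum_principle_rhp:
  assumes hol: "G holomorphic_on {z. 0 < Re z}"
    and bd: "\<And>y e. e > 0 \<Longrightarrow> \<exists>d>0. \<forall>z. 0 < Re z \<longrightarrow> dist z (Complex 0 y) < d \<longrightarrow> norm (G z) \<le> 1 + e"
    and inf: "\<And>e. e > 0 \<Longrightarrow> eventually (\<lambda>z. norm (G z) \<le> 1 + e) rhp_infinity"
    and z0: "0 < Re z0"
  shows "norm (G z0) \<le> 1"
proof (rule ccontr)
  assume "\<not> norm (G z0) \<le> 1"
  define e where "e = (norm (G z0) - 1) / 2"
  have e: "e > 0" "norm (G z0) > 1 + e" using \<open>\<not> norm (G z0) \<le> 1\<close> by (auto simp: e_def field_simps)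
  define K where "K = {z. 0 < Re z \<and> norm (G z0) \<le> norm (G z)}"
  obtain \<rho> where \<rho>: "\<And>z. 0 < Re z \<Longrightarrow> norm z > \<rho> \<Longrightarrow> norm (G z) \<le> 1 + e"
    using inf[OF e(1)] unfolding eventually_rhp_infinity by blast
  have cont: "continuous_on {z. 0 < Re z} G" using hol by (rule holomorphic_on_imp_continuous_on)
  have "closed K"
  proof (subst closed_sequential_limits, intro allI impI, elim conjE)
    fix x l assume x: "\<forall>n. x n \<in> K" and l: "x \<longlonglongrightarrow> l"
    have "0 \<le> Re l"
      using x by (intro tendsto_lowerbound[OF tendsto_Re[OF l]]) (auto simp: K_def less_imp_le)
    have "Re l \<noteq> 0"
    proof
      assume "Re l = 0"
      then have l_eq: "l = Complex 0 (Im l)" by (simp add: complex_eq_iff)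
      obtain d where d: "d > 0" "\<And>z. 0 < Re z \<Longrightarrow> dist z (Complex 0 (Im l)) < d \<Longrightarrow> norm (G z) \<le> 1 + e"
        using bd[OF e(1)] by blast
      obtain n where "dist (x n) l < d" using l d(1) by (meson lim_sequentially order_refl)
      then have "norm (G (x n)) \<le> 1 + e" using d(2)[of "x n"] x l_eq by (auto simp: K_def)
      moreover have "norm (G z0) \<le> norm (G (x n))" using x by (simp add: K_def)
      ultimately show False using e by linarith
    qed
    with \<open>0 \<le> Re l\<close> have "0 < Re l" by simp
    then have "isCont G l"
      using cont continuous_on_eq_continuous_at[OF open_rhp, of G] \<open>0 < Re l\<close> by simp
    then have "(\<lambda>n. norm (G (x n))) \<longlonglongrightarrow> norm (G l)"
      by (intro tendsto_norm isCont_tendsto_compose[OF _ l])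
    then have "norm (G z0) \<le> norm (G l)"
      by (rule tendsto_lowerbound) (use x in \<open>auto simp: K_def\<close>)
    with \<open>0 < Re l\<close> show "l \<in> K" by (simp add: K_def)
  qed
  moreover have "K \<subseteq> cball 0 \<rho>"
    using \<rho> e by (fastforce simp: K_def)
  ultimately have "compact K"
    using bounded_subset[OF bounded_cball] compact_eq_bounded_closed by blast
  moreover have "z0 \<in> K" using z0 by (simp add: K_def)
  moreover have "continuous_on K (\<lambda>z. norm (G z))"
    by (intro continuous_on_norm continuous_on_subset[OF cont]) (auto simp: K_def)
  ultimately obtain w where w: "w \<in> K" "\<And>z. z \<in> K \<Longrightarrow> norm (G z) \<le> norm (G w)"
    using continuous_attains_sup[of K "\<lambda>z. norm (G z)"] by blast
  have max: "norm (G z) \<le> norm (G w)" if "0 < Re z" for z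
  proof (cases "z \<in> K")
    case False
    then have "norm (G z) < norm (G z0)" using that by (simp add: K_def)
    also have "\<dots> \<le> norm (G w)" using w(2) \<open>z0 \<in> K\<close> .
    finally show ?thesis by simp
  qed (rule w(2))
  have "G constant_on {z. 0 < Re z}"
    by (rule maximum_modulus_principle[OF hol open_rhp connected_rhp open_rhp order_refl, of w])
      (use w(1) max in \<open>auto simp: K_def\<close>)
  then obtain k where k: "\<And>z. 0 < Re z \<Longrightarrow> G z = k" unfolding constant_on_def by blast
  have "norm (G (of_real (\<bar>\<rho>\<bar> + 1))) \<le> 1 + e"
    by (rule \<rho>) (auto simp: norm_of_real simp del: of_real_add)
  moreover have "G (of_real (\<bar>\<rho>\<bar> + 1)) = G z0" using k z0 by simp
  ultimately show False using e by simp
qed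

lemma analytic_remove_sings_bounded:
  assumes iso: "isolated_singularity_at f z" and bd: "eventually (\<lambda>w. norm (f w) \<le> B) (at z)"
  shows "remove_sings f analytic_on {z}"
proof -
  obtain r where r: "r > 0" "f analytic_on ball z r - {z}"
    using iso unfolding isolated_singularity_at_def by blast
  have hol: "f holomorphic_on ball z r - {z}"
    using r(2) by (rule analytic_imp_holomorphic)
  have "z \<in> interior (ball z r)" using r by simp
  then obtain g where g: "g holomorphic_on ball z r" "\<And>w. w \<in> ball z r - {z} \<Longrightarrow> g w = f w"
    using holomorphic_on_extend_bounded[OF hol] bd by blast
  have "isCont g z"
    using g(1) r(1) by (meson centre_in_ball continuous_on_eq_continuous_at holomorphic_on_imp_continuous_on open_ball)
  then have "g \<midarrow>z\<rightarrow> g z" by (simp add: isCont_def)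
  then have "f \<midarrow>z\<rightarrow> g z"
    using g(2) r(1) Lim_transform_within_open[of g "g z" z UNIV "ball z r" f] by auto
  with iso show ?thesis by (rule remove_sings_analytic_at)
qed

lemma tendsto_const_div_at_infinity: "((\<lambda>z. c / (z + d :: complex)) \<longlongrightarrow> 0) at_infinity"
proof -
  have "filterlim (\<lambda>z. z + d) at_infinity at_infinity"
    using filterlim_ident tendsto_add_filterlim_at_infinity'[OF filterlim_ident tendsto_const[of d]] by blast
  then show ?thesis
    by (rule tendsto_divide_0[OF tendsto_const])
qed

lemma tendsto_self_div_at_infinity: "((\<lambda>z. z / (z + d :: complex)) \<longlongrightarrow> 1) at_infinity"
proof -
  have "((\<lambda>z. 1 - d / (z + d)) \<longlongrightarrow> 1 - 0) at_infinity"
    by (intro tendsto_intros tendsto_const_div_at_infinity)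
  moreover have "eventually (\<lambda>z. 1 - d / (z + d) = z / (z + d)) at_infinity"
    using eventually_not_equal_at_infinity[of "- d"]
  proof eventually_elim
    case (elim z)
    then have "z + d \<noteq> 0" by (simp add: add_eq_0_iff2)
    then show ?case by (simp add: field_simps)
  qed
  ultimately show ?thesis by (simp add: tendsto_cong)
qed

text \<open>The form \<open>Re \<langle>x/(\<lambda> - z) + y, H z (x/(\<lambda> - z) + y)\<rangle>\<close> is nonnegative on the imaginary axis.
  Removing its pole at \<open>\<lambda>\<close> without changing real parts on the axis gives a function \<open>T\<close> holomorphic
  in the half plane with \<open>Re T \<ge> 0\<close> there; the inequality is read off from \<open>z * T z\<close> at infinity.\<close>

lemma positive_real_quadratic:
  fixes H :: "complex \<Rightarrow> 'p::finite cmat"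
  assumes eps: "\<epsilon> > 0" and H: "mhol H {z. - \<epsilon> < Re z}"
    and pos: "\<And>z x. 0 \<le> Re z \<Longrightarrow> 0 \<le> Re (hip x (H z *v x))"
    and lim: "((\<lambda>z. mat z ** H z) \<longlongrightarrow> M) rhp_infinity"
    and l: "0 < Re l"
  shows "0 \<le> Re (hip x (H l *v x)) / Re l + 2 * Re (hip y (H l *v x)) + Re (hip y (M *v y))"
proof -
  define a where "a z = hip x (H z *v x)" for z
  define b where "b z = hip x (H z *v y)" for z
  define d where "d z = hip y (H z *v x)" for z
  define e where "e z = hip y (H z *v y)" for z
  define \<delta> where "\<delta> = min \<epsilon> (Re l)"
  have \<delta>: "\<delta> > 0" "\<delta> \<le> \<epsilon>" "\<delta> \<le> Re l" using eps l by (auto simp: \<delta>_def)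
  define D where "D = {z. - \<delta> < Re z}"
  have oD: "open D" unfolding D_def by (rule open_halfspace_Re_gt)
  have HD: "mhol H D" using H \<delta> by (auto intro: mhol_subset simp: D_def)
  have hol: "a holomorphic_on D" "b holomorphic_on D" "d holomorphic_on D" "e holomorphic_on D"
    unfolding a_def b_def d_def e_def by (intro holomorphic_hip HD)+
  have nz: "cnj l + z \<noteq> 0" if "z \<in> D" for z
    using that \<delta> by (auto simp: D_def complex_eq_iff)
  \<comment> \<open>For \<open>Re z = 0\<close> the number \<open>cnj l + z\<close> is the conjugate
    of \<open>l - z\<close>, and as a function of \<open>z\<close> it has no zero in
    \<open>D\<close>. So \<open>f z / (l - z)\<close> collects the terms of the form that have a
    pole at \<open>l\<close>, with residue governed by \<open>w = f l\<close>.\<close>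
  define f where "f z = a z / (cnj l + z) + d z" for z
  define w where "w = f l"
  have holf: "f holomorphic_on D" unfolding f_def by (intro holomorphic_intros hol nz)
  define q where "q = (\<lambda>z. if z = l then deriv f l else (f z - f l) / (z - l))"
  have holq: "q holomorphic_on D" unfolding q_def by (rule pole_lemma_open[OF holf oD])
  \<comment> \<open>Removing the pole subtracts \<open>w / (l - z)\<close>. Adding
    \<open>cnj w / (cnj l + z)\<close> in return makes the total change on the axis a difference of
    conjugate numbers, hence purely imaginary.\<close>
  define T where "T z = - q z + (b z + cnj w) / (cnj l + z) + e z" for z
  have holT: "T holomorphic_on D" unfolding T_def by (intro holomorphic_intros hol holq nz)
  have axis: "0 \<le> Re (T z)" if z: "Re z = 0" for z
  proof -
    have zl: "z \<noteq> l" using z l by auto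
    define k where "k = l - z"
    have k: "k \<noteq> 0" "cnj k \<noteq> 0" using zl by (auto simp: k_def)
    have ck: "cnj l + z = cnj k" using z by (simp add: k_def complex_eq_iff)
    have "T z = (f z - w) / k + (b z + cnj w) / cnj k + e z"
      using zl by (simp add: T_def q_def ck w_def k_def divide_simps) (simp add: algebra_simps)
    also have "\<dots> = (a z / (k * cnj k) + b z / cnj k + d z / k + e z) - (w / k - cnj (w / k))"
      unfolding f_def ck using k by (simp add: field_simps)
    also have "a z / (k * cnj k) + b z / cnj k + d z / k + e z =
        hip ((1 / k) *s x + y) (H z *v ((1 / k) *s x + y))"
      using k by (simp add: a_def b_def d_def e_def mv_algebra hip_algebra vector_scalar_commute) (simp add: field_simps)
    finally show ?thesis using pos[of z "(1 / k) *s x + y"] z by (simp del: complex_cnj_divide)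
  qed
  have H0: "((\<lambda>z. H z) \<longlongrightarrow> 0) rhp_infinity"
  proof -
    have "((\<lambda>z. mat (1 / z) ** (mat z ** H z)) \<longlongrightarrow> mat 0 ** M) rhp_infinity"
      by (intro tendsto_mm lim tendsto_mat tendsto_rhp_infinity
          tendsto_const_div_at_infinity[of 1 0, simplified])
    moreover have "eventually (\<lambda>z. mat (1 / z) ** (mat z ** H z) = H z) rhp_infinity"
      unfolding eventually_rhp_infinity
      by (intro exI[of _ 0]) (auto simp: matrix_mul_assoc mat_mult_mat)
    moreover have "mat 0 ** M = 0" by (simp add: vec_eq_iff mat_mult_nth)
    ultimately show ?thesis by (simp add: tendsto_cong)
  qed
  have hip_lim: "((\<lambda>z. hip u (F z *v v)) \<longlongrightarrow> hip u (L *v v)) rhp_infinity"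
    if "(F \<longlongrightarrow> L) rhp_infinity" for F :: "complex \<Rightarrow> 'p cmat" and L u v
    unfolding hip_def by (intro tendsto_intros tendsto_mv that)
  have "(a \<longlongrightarrow> 0) rhp_infinity" "(b \<longlongrightarrow> 0) rhp_infinity" "(d \<longlongrightarrow> 0) rhp_infinity"
    using hip_lim[OF H0] by (auto simp: a_def[abs_def] b_def[abs_def] d_def[abs_def] mv_algebra)
  note abd = this
  have ze: "((\<lambda>z. z * e z) \<longlongrightarrow> hip y (M *v y)) rhp_infinity"
    using hip_lim[OF lim, of y y]
    by (simp add: e_def matrix_vector_mul_assoc[symmetric] mat_mult_vec hip_cscale_right)
  have f0: "(f \<longlongrightarrow> 0) rhp_infinity"
  proof -
    have "((\<lambda>z. a z * (1 / (z + cnj l)) + d z) \<longlongrightarrow> 0 * 0 + 0) rhp_infinity"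
      by (intro tendsto_intros abd tendsto_rhp_infinity[OF tendsto_const_div_at_infinity])
    then show ?thesis by (simp add: f_def[abs_def] add.commute)
  qed
  have zT: "((\<lambda>z. z * T z) \<longlongrightarrow> w + cnj w + hip y (M *v y)) rhp_infinity"
  proof -
    have "((\<lambda>z. - (z / (z + - l)) * (f z - w) + (z / (z + cnj l)) * (b z + cnj w) + z * e z) \<longlongrightarrow>
        - 1 * (0 - w) + 1 * (0 + cnj w) + hip y (M *v y)) rhp_infinity"
      by (intro tendsto_intros tendsto_rhp_infinity[OF tendsto_self_div_at_infinity] f0 abd ze)
    moreover have "eventually (\<lambda>z. - (z / (z + - l)) * (f z - w) + (z / (z + cnj l)) * (b z + cnj w) + z * e z
        = z * T z) rhp_infinity"
      unfolding eventually_rhp_infinity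
    proof (intro exI[of _ "norm l"] allI impI)
      fix z assume "0 < Re z" "norm l < norm z"
      then have "z \<noteq> l" by auto
      then have "q z = (f z - w) / (z - l)" by (simp add: q_def w_def)
      then show "- (z / (z + - l)) * (f z - w) + (z / (z + cnj l)) * (b z + cnj w) + z * e z = z * T z"
        by (simp add: T_def algebra_simps)
    qed
    ultimately show ?thesis by (simp add: tendsto_cong)
  qed
  have T0: "(T \<longlongrightarrow> 0) rhp_infinity"
  proof -
    have "((\<lambda>z. (1 / (z + 0)) * (z * T z)) \<longlongrightarrow> 0 * (w + cnj w + hip y (M *v y))) rhp_infinity"
      by (intro tendsto_mult zT tendsto_rhp_infinity[OF tendsto_const_div_at_infinity])
    moreover have "eventually (\<lambda>z. (1 / (z + 0)) * (z * T z) = T z) rhp_infinity"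
      unfolding eventually_rhp_infinity by (intro exI[of _ 0]) auto
    ultimately show ?thesis by (simp add: tendsto_cong)
  qed
  have posT: "0 \<le> Re (T z)" if "0 < Re z" for z
  proof -
    \<comment> \<open>The exponential turns the lower bound for the real part into a bound for the
      modulus.\<close>
    have "norm (exp (- T z)) \<le> 1"
    proof (rule maximum_principle_rhp[where G = "\<lambda>z. exp (- T z)"])
      show "(\<lambda>z. exp (- T z)) holomorphic_on {z. 0 < Re z}"
        using \<delta> by (intro holomorphic_intros holomorphic_on_subset[OF holT]) (auto simp: D_def)
      show "\<exists>d>0. \<forall>z. 0 < Re z \<longrightarrow> dist z (Complex 0 y) < d \<longrightarrow> norm (exp (- T z)) \<le> 1 + e"
        if "e > 0" for y e
      proof -
        have "Complex 0 y \<in> D" using \<delta> by (simp add: D_def)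
        then have "isCont (\<lambda>z. norm (exp (- T z))) (Complex 0 y)"
          using holT oD by (intro continuous_intros)
            (metis continuous_on_eq_continuous_at holomorphic_on_imp_continuous_on)
        moreover have "norm (exp (- T (Complex 0 y))) \<le> 1" using axis[of "Complex 0 y"] by simp
        ultimately obtain d where d: "d > 0" "\<And>z. dist z (Complex 0 y) < d \<Longrightarrow>
            dist (norm (exp (- T z))) (norm (exp (- T (Complex 0 y)))) < e"
          using \<open>e > 0\<close> unfolding continuous_at_eps_delta by meson
        have "norm (exp (- T z)) \<le> 1 + e" if "dist z (Complex 0 y) < d" for z
          using d(2)[OF that] \<open>norm (exp (- T (Complex 0 y))) \<le> 1\<close> unfolding dist_real_def by linarith
        with d(1) show ?thesis by blast
      qed
      show "eventually (\<lambda>z. norm (exp (- T z)) \<le> 1 + e) rhp_infinity" if "e > 0" for e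
      proof -
        have "((\<lambda>z. norm (exp (- T z))) \<longlongrightarrow> norm (exp (- 0 :: complex))) rhp_infinity"
          by (intro tendsto_intros T0)
        then have "eventually (\<lambda>z. norm (exp (- T z)) < 1 + e) rhp_infinity"
          by (rule order_tendstoD(2)) (use that in auto)
        then show ?thesis by (rule eventually_mono) simp
      qed
    qed (fact that)
    then show ?thesis by simp
  qed
  \<comment> \<open>Along the positive reals multiplication by \<open>z\<close> keeps the sign of
    the real part, so the limit of \<open>z * T z\<close> has nonnegative real part.\<close>
  have "((\<lambda>r. Re (of_real r * T (of_real r))) \<longlongrightarrow> Re (w + cnj w + hip y (M *v y))) at_top"
    by (intro tendsto_Re filterlim_compose[OF zT filterlim_of_real_rhp_infinity])
  moreover have "eventually (\<lambda>r. 0 \<le> Re (of_real r * T (of_real r))) at_top"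
    using eventually_gt_at_top[of 0]
    by eventually_elim (simp add: posT)
  ultimately have "0 \<le> Re (w + cnj w + hip y (M *v y))"
    by (intro tendsto_lowerbound[where F = at_top]) auto
  moreover have "cnj l + l = of_real (2 * Re l)" by (simp add: complex_eq_iff)
  then have "Re w = Re (a l) / (2 * Re l) + Re (d l)" by (simp add: w_def f_def del: of_real_mult)
  ultimately show ?thesis by (simp add: a_def d_def field_simps)
qed

text \<open>The quadratic inequality holds for every \<open>y\<close>, and \<open>y\<close> is
  chosen to exploit it best. As it asks for holomorphy across the axis, it is applied to
  \<open>H\<close> shifted by \<open>\<epsilon>\<close>, at the point \<open>z - \<epsilon>\<close>,
  and \<open>\<epsilon>\<close> tends to 0.\<close>

lemma positive_real_julia:
  fixes H :: "complex \<Rightarrow> 'p::finite cmat"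
  assumes H: "mhol H {z. 0 < Re z}"
    and pos: "\<And>z x. 0 < Re z \<Longrightarrow> 0 \<le> Re (hip x (H z *v x))"
    and lim: "((\<lambda>z. mat z ** H z) \<longlongrightarrow> M) rhp_infinity"
    and C: "C > 0" "norm M \<le> C" and z: "0 < Re z"
  shows "Re z * (norm (H z *v x))\<^sup>2 \<le> C * Re (hip x (H z *v x))"
proof -
  \<comment> \<open>For \<open>y = - c H x\<close> with \<open>c > 0\<close> the last two terms of
    the quadratic inequality are at most \<open>(C c^2 - 2 c) |H x|^2\<close>, which is smallest at
    \<open>c = 1 / C\<close>.\<close>
  define y where "y = - (1 / C) *\<^sub>R (H z *v x)"
  define A where "A = Re (hip x (H z *v x))"
  define h where "h = (norm (H z *v x))\<^sup>2"
  define k where "k = 2 * Re (hip y (H z *v x)) + Re (hip y (M *v y))"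
  have y_eq: "y = complex_of_real (- (1 / C)) *s (H z *v x)"
    by (simp add: y_def vec_eq_iff scaleR_conv_of_real[where 'a = complex])
  have hy: "Re (hip y (H z *v x)) = - h / C"
    unfolding y_eq hip_cscale_left hip_self by (simp add: h_def)
  have "Re (hip y (M *v y)) \<le> norm (hip y (M *v y))" by (rule complex_Re_le_cmod)
  also have "\<dots> \<le> norm y * (norm M * norm y)"
    by (rule order_trans[OF norm_hip_le]) (intro mult_left_mono norm_matrix_vector_mult norm_ge_zero)
  also have "\<dots> \<le> norm y * (C * norm y)" using C by (intro mult_left_mono mult_right_mono) auto
  also have "\<dots> = h / C"
    using C by (simp add: y_def h_def power2_eq_square)
  finally have k: "k \<le> - h / C" unfolding k_def hy by simp
  have *: "0 \<le> A + (Re z - \<epsilon>) * k" if eps: "0 < \<epsilon>" "\<epsilon> < Re z" for \<epsilon>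
  proof -
    have "0 \<le> Re (hip x (H (z - of_real \<epsilon> + of_real \<epsilon>) *v x)) / Re (z - of_real \<epsilon>) +
        2 * Re (hip y (H (z - of_real \<epsilon> + of_real \<epsilon>) *v x)) + Re (hip y (M *v y))"
    proof (rule positive_real_quadratic[where H = "\<lambda>z. H (z + of_real \<epsilon>)", OF eps(1)])
      show "mhol (\<lambda>z. H (z + of_real \<epsilon>)) {z. - \<epsilon> < Re z}"
        by (rule mhol_compose[OF H]) (auto intro!: holomorphic_intros)
      show "0 \<le> Re (hip x (H (z + of_real \<epsilon>) *v x))" if "0 \<le> Re z" for z x
        using pos eps that by simp
      have "filterlim (\<lambda>z. z + of_real \<epsilon>) at_infinity rhp_infinity"
        unfolding rhp_infinity_def
        by (intro filterlim_mono[OF tendsto_add_filterlim_at_infinity'[OF filterlim_ident tendsto_const] order_refl inf_le1])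
      then have "filterlim (\<lambda>z. z + of_real \<epsilon>) rhp_infinity rhp_infinity"
        unfolding rhp_infinity_def filterlim_inf filterlim_principal
        using eps by (auto simp: eventually_inf_principal rhp_infinity_def)
      from filterlim_compose[OF lim this]
      have "((\<lambda>z. mat (z / (z + of_real \<epsilon>)) ** (mat (z + of_real \<epsilon>) ** H (z + of_real \<epsilon>))) \<longlongrightarrow> mat 1 ** M) rhp_infinity"
        by (rule tendsto_mm[OF tendsto_mat[OF tendsto_rhp_infinity[OF tendsto_self_div_at_infinity]]])
      moreover have "eventually (\<lambda>z. mat (z / (z + of_real \<epsilon>)) ** (mat (z + of_real \<epsilon>) ** H (z + of_real \<epsilon>)) =
          mat z ** H (z + of_real \<epsilon>)) rhp_infinity"
        unfolding eventually_rhp_infinity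
      proof (intro exI[of _ 0] allI impI)
        fix z :: complex assume "0 < Re z"
        then have "z + of_real \<epsilon> \<noteq> 0" using eps by (auto simp: complex_eq_iff)
        then show "mat (z / (z + of_real \<epsilon>)) ** (mat (z + of_real \<epsilon>) ** H (z + of_real \<epsilon>)) = mat z ** H (z + of_real \<epsilon>)"
          by (simp add: matrix_mul_assoc mat_mult_mat)
      qed
      ultimately show "((\<lambda>z. mat z ** H (z + of_real \<epsilon>)) \<longlongrightarrow> M) rhp_infinity"
        by (simp add: tendsto_cong)
    qed (use eps in auto)
    then have "0 \<le> A / (Re z - \<epsilon>) + k" by (simp add: A_def k_def)
    then show ?thesis using eps by (simp add: field_simps)
  qed
  have "((\<lambda>\<epsilon>. A + (Re z - \<epsilon>) * k) \<longlongrightarrow> A + (Re z - 0) * k) (at_right 0)"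
    by (intro tendsto_intros)
  moreover have "eventually (\<lambda>\<epsilon>. 0 \<le> A + (Re z - \<epsilon>) * k) (at_right 0)"
    using z * by (auto simp: eventually_at_right_field intro!: exI[of _ "Re z"])
  ultimately have "0 \<le> A + Re z * k"
    by (intro tendsto_lowerbound[where F = "at_right (0::real)"]) auto
  moreover have "Re z * k \<le> Re z * (- h / C)" using k z by (intro mult_left_mono) auto
  ultimately have "Re z * h / C \<le> A" by simp
  then show ?thesis using C by (simp add: A_def h_def pos_divide_le_eq mult.commute)
qed

section \<open>Splitting a function holomorphic near infinity\<close>

text \<open>The difference quotient of \<open>f\<close> at \<open>z\<close> is holomorphic in the
  exterior, so its integrals over the two homotopic circles agree. What remains is
  \<open>f z\<close> times the integral of \<open>1 / (w - z)\<close>, which is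
  \<open>2 * pi * \<i>\<close> for the outer circle and 0 for the inner one.\<close>

lemma annulus_cauchy:
  assumes R: "R > 0" and f: "f holomorphic_on {z. R < norm z}"
    and r: "R < r1" "r1 < norm z" "norm z < r2"
  shows "contour_integral (circlepath 0 r2) (\<lambda>w. f w / (w - z)) -
      contour_integral (circlepath 0 r1) (\<lambda>w. f w / (w - z)) = 2 * of_real pi * \<i> * f z"
proof -
  let ?O = "{z. R < norm z}"
  have oO: "open ?O" by (intro open_Collect_less continuous_intros)
  define h where "h w = (if w = z then deriv f z else (f w - f z) / (w - z))" for w
  have holh: "h holomorphic_on ?O" unfolding h_def by (rule pole_lemma_open[OF f oO])
  have hom: "homotopic_loops ?O (circlepath 0 r1) (circlepath 0 r2)"
  proof (rule homotopic_loops_linear)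
    fix t :: real assume "t \<in> {0..1}"
    show "closed_segment (circlepath 0 r1 t) (circlepath 0 r2 t) \<subseteq> ?O"
    proof
      fix w assume "w \<in> closed_segment (circlepath 0 r1 t) (circlepath 0 r2 t)"
      then obtain u where u: "0 \<le> u" "u \<le> 1"
        "w = (1 - u) *\<^sub>R circlepath 0 r1 t + u *\<^sub>R circlepath 0 r2 t"
        by (auto simp: closed_segment_def)
      then have "w = of_real ((1 - u) * r1 + u * r2) * exp (2 * of_real pi * \<i> * t)"
        by (simp add: circlepath scaleR_conv_of_real algebra_simps)
      then have "norm w = \<bar>(1 - u) * r1 + u * r2\<bar>"
        by (simp add: norm_mult norm_exp_eq_Re del: of_real_add of_real_mult)
      moreover have "(1 - u) * r1 + u * r2 \<ge> (1 - u) * r1 + u * r1"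
        using u r by (intro add_left_mono mult_left_mono) auto
      ultimately show "w \<in> ?O" using r R by (simp add: algebra_simps)
    qed
  qed auto
  have eq: "contour_integral (circlepath 0 r1) h = contour_integral (circlepath 0 r2) h"
    by (rule Cauchy_theorem_homotopic_loops[OF hom oO holh]) auto
  have sub: "path_image (circlepath 0 r) \<subseteq> ?O - {z}" if "R < r" "r \<noteq> norm z" for r
    using that R by auto
  have ci: "contour_integral (circlepath 0 r) h =
      contour_integral (circlepath 0 r) (\<lambda>w. f w / (w - z)) - f z * contour_integral (circlepath 0 r) (\<lambda>w. 1 / (w - z))"
    if r: "R < r" "r \<noteq> norm z" for r
  proof -
    have int1: "(\<lambda>w. f w / (w - z)) contour_integrable_on circlepath 0 r"
      by (rule contour_integrable_holomorphic_simple[of _ "?O - {z}"])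
        (use sub[OF r] oO in \<open>auto intro!: holomorphic_intros holomorphic_on_subset[OF f]\<close>)
    have int2: "(\<lambda>w. 1 / (w - z)) contour_integrable_on circlepath 0 r"
      by (rule contour_integrable_holomorphic_simple[of _ "?O - {z}"])
        (use sub[OF r] oO in \<open>auto intro!: holomorphic_intros\<close>)
    have "contour_integral (circlepath 0 r) h =
        contour_integral (circlepath 0 r) (\<lambda>w. f w / (w - z) - f z * (1 / (w - z)))"
      by (rule contour_integral_eq) (use sub[OF r] in \<open>auto simp: h_def diff_divide_distrib\<close>)
    also have "\<dots> = contour_integral (circlepath 0 r) (\<lambda>w. f w / (w - z)) -
        contour_integral (circlepath 0 r) (\<lambda>w. f z * (1 / (w - z)))"
      by (intro contour_integral_diff int1 contour_integrable_lmul int2)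
    also have "contour_integral (circlepath 0 r) (\<lambda>w. f z * (1 / (w - z))) =
        f z * contour_integral (circlepath 0 r) (\<lambda>w. 1 / (w - z))"
      by (rule contour_integral_lmul[OF int2])
    finally show ?thesis .
  qed
  have out: "contour_integral (circlepath 0 r2) (\<lambda>w. 1 / (w - z)) = 2 * of_real pi * \<i>"
    using Cauchy_integral_circlepath_simple[of "\<lambda>_. 1" 0 r2 z] r by (simp add: contour_integral_unique)
  have inn: "contour_integral (circlepath 0 r1) (\<lambda>w. 1 / (w - z)) = 0"
  proof (rule contour_integral_unique, rule Cauchy_theorem_disc_simple)
    show "(\<lambda>w. 1 / (w - z)) holomorphic_on ball 0 (norm z)" by (auto intro!: holomorphic_intros)
    show "path_image (circlepath 0 r1) \<subseteq> ball 0 (norm z)" using r R by auto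
  qed auto
  show ?thesis
    using eq ci[of r1] ci[of r2] r out inn R by (simp add: algebra_simps)
qed

lemma holomorphic_cauchy_transform:
  assumes r: "r > 0" and f: "continuous_on (sphere 0 r) f"
  shows "(\<lambda>z. contour_integral (circlepath 0 r) (\<lambda>w. f w / (w - z))) holomorphic_on - sphere 0 r"
proof -
  have img: "path_image (circlepath 0 r) = sphere 0 r" using r by simp
  have "(\<lambda>z. contour_integral (circlepath 0 r) (\<lambda>w. f w / (w - z))) field_differentiable at z within - sphere 0 r"
    if z: "z \<in> - sphere 0 r" for z
  proof -
    have "((\<lambda>z. contour_integral (circlepath 0 r) (\<lambda>w. f w / (w - z))) has_field_derivative
        (of_nat 1 * contour_integral (circlepath 0 r) (\<lambda>u. f u / (u - z) ^ Suc 1))) (at z)"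
    proof (rule Cauchy_next_derivative(2)[where S = UNIV and B = "2 * pi * \<bar>r\<bar>"])
      show "continuous_on (path_image (circlepath 0 r)) f" using f img by simp
      show "norm (vector_derivative (circlepath 0 r) (at t)) \<le> 2 * pi * \<bar>r\<bar>" for t
        by (simp add: vector_derivative_circlepath norm_mult norm_exp_eq_Re)
      show "((\<lambda>u. f u / (u - w) ^ 1) has_contour_integral
          contour_integral (circlepath 0 r) (\<lambda>u. f u / (u - w))) (circlepath 0 r)"
        if "w \<in> UNIV - path_image (circlepath 0 r)" for w
        unfolding power_one_right
        by (rule has_contour_integral_integral, rule contour_integrable_continuous_circlepath)
          (use that img f in \<open>auto intro!: continuous_intros\<close>)
    qed (use z img in auto)
    then show ?thesis
      using field_differentiable_at_within field_differentiable_def by blast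
  qed
  then show ?thesis by (simp add: holomorphic_on_def)
qed

lemma norm_cauchy_transform_le:
  fixes f :: "complex \<Rightarrow> complex"
  assumes r: "r > 0" and f: "continuous_on (sphere 0 r) f" and M: "\<And>w. norm w = r \<Longrightarrow> norm (f w) \<le> M"
    and d: "d > 0" "\<And>w. norm w = r \<Longrightarrow> d \<le> norm (w - z)"
  shows "norm (contour_integral (circlepath 0 r) (\<lambda>w. f w / (w - z)) / (2 * of_real pi * \<i>)) \<le> r * M / d"
proof -
  have M0: "M \<ge> 0" using order_trans[OF norm_ge_zero M[of "of_real r"]] r by simp
  have nz: "w - z \<noteq> 0" if "norm w = r" for w using d(2)[OF that] d(1) by auto
  have "((\<lambda>w. f w / (w - z)) has_contour_integral
      contour_integral (circlepath 0 r) (\<lambda>w. f w / (w - z))) (circlepath 0 r)"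
    by (rule has_contour_integral_integral, rule contour_integrable_continuous_circlepath)
      (use r f nz in \<open>auto intro!: continuous_intros\<close>)
  then have "norm (contour_integral (circlepath 0 r) (\<lambda>w. f w / (w - z))) \<le> M / d * (2 * pi * r)"
  proof (rule has_contour_integral_bound_circlepath)
    fix w :: complex assume "norm (w - 0) = r"
    then show "norm (f w / (w - z)) \<le> M / d"
      using M[of w] d(2)[of w] d(1) M0 by (auto simp: norm_divide intro!: frac_le)
  qed (use M0 d r in auto)
  then show ?thesis by (simp add: norm_divide norm_mult field_simps)
qed

text \<open>Laurent splitting into an entire part and a part vanishing at infinity, each a Cauchy
  integral over one circle, continued by the relation \<open>m z - s z = f z\<close>. The bounds
  involve \<open>f\<close> only up to radius \<open>2 * R\<close>, so \<open>f\<close> may grow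
  arbitrarily at infinity.\<close>

lemma annulus_split:
  assumes R: "R > 0" and f: "f holomorphic_on {z. R < norm z}"
    and M: "\<And>z. R < norm z \<Longrightarrow> norm z \<le> 2 * R \<Longrightarrow> norm (f z) \<le> M"
  shows "\<exists>m s. m holomorphic_on UNIV \<and> s holomorphic_on {z. R < norm z} \<and>
    (\<forall>z. R < norm z \<longrightarrow> m z - s z = f z) \<and> (s \<longlongrightarrow> 0) at_infinity \<and>
    (\<forall>z. norm z \<le> 2 * R \<longrightarrow> norm (m z) \<le> 6 * M) \<and>
    (\<forall>z. R < norm z \<longrightarrow> norm (s z) \<le> 6 * M) \<and>
    (\<forall>z. 2 * R \<le> norm z \<longrightarrow> norm z * norm (s z) \<le> 4 * R * M)"
proof -
  let ?O = "{z. R < norm z}"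
  have oO: "open ?O" by (intro open_Collect_less continuous_intros)
  define c where "c r z = contour_integral (circlepath 0 r) (\<lambda>w. f w / (w - z)) / (2 * of_real pi * \<i>)" for r z
  have contf: "continuous_on (sphere 0 r) f" if "R < r" for r
    by (rule continuous_on_subset[OF holomorphic_on_imp_continuous_on[OF f]]) (use that in auto)
  have holc: "c r holomorphic_on - sphere 0 r" if "R < r" for r
    unfolding c_def using that R
    by (intro holomorphic_intros holomorphic_cauchy_transform contf) auto
  \<comment> \<open>Between the circles of radius \<open>5 / 4 * R\<close> and \<open>2 * R\<close>
    both descriptions hold; this overlap is where the pieces are glued.\<close>
  have ann: "c (2 * R) z - c (5 / 4 * R) z = f z" if "5 / 4 * R < norm z" "norm z < 2 * R" for z
    using annulus_cauchy[OF R f, of "5 / 4 * R" z "2 * R"] that R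
    by (simp add: c_def diff_divide_distrib[symmetric])
  have M0: "M \<ge> 0" using order_trans[OF norm_ge_zero M[of "of_real (2 * R)"]] R by simp
  define s where "s z = (if norm z < 2 * R then c (2 * R) z - f z else c (5 / 4 * R) z)" for z
  define m where "m z = (if norm z < 2 * R then c (2 * R) z else f z + s z)" for z
  have s_eq: "s z = c (5 / 4 * R) z" if "5 / 4 * R < norm z" for z
    using ann[of z] that by (auto simp: s_def algebra_simps)
  have m_eq: "m z = f z + s z" for z by (simp add: m_def s_def)
  have hols: "s holomorphic_on ?O"
  proof -
    have "s holomorphic_on (?O \<inter> ball 0 (2 * R)) \<union> {z. 5 / 4 * R < norm z}"
    proof (rule holomorphic_on_Un)
      have "(\<lambda>z. c (2 * R) z - f z) holomorphic_on ?O \<inter> ball 0 (2 * R)"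
        using R by (intro holomorphic_intros holomorphic_on_subset[OF f] holomorphic_on_subset[OF holc]) auto
      then show "s holomorphic_on ?O \<inter> ball 0 (2 * R)"
        by (rule holomorphic_transform) (auto simp: s_def)
      have "c (5 / 4 * R) holomorphic_on {z. 5 / 4 * R < norm z}"
        using R by (intro holomorphic_on_subset[OF holc]) auto
      then show "s holomorphic_on {z. 5 / 4 * R < norm z}"
        by (rule holomorphic_transform) (auto simp: s_eq)
      show "open (?O \<inter> ball 0 (2 * R))" "open {z::complex. 5 / 4 * R < norm z}"
        using oO by (auto intro!: open_Collect_less continuous_intros)
    qed
    then show ?thesis by (rule holomorphic_on_subset) (use R in auto)
  qed
  have holm: "m holomorphic_on UNIV"
  proof -
    have "m holomorphic_on ball 0 (2 * R) \<union> ?O"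
    proof (rule holomorphic_on_Un)
      have "c (2 * R) holomorphic_on ball 0 (2 * R)"
        using R by (intro holomorphic_on_subset[OF holc]) auto
      then show "m holomorphic_on ball 0 (2 * R)"
        by (rule holomorphic_transform) (auto simp: m_def)
      show "m holomorphic_on ?O"
        unfolding m_eq by (intro holomorphic_intros f hols)
    qed (use oO in auto)
    then show ?thesis by (rule holomorphic_on_subset) (use R in auto)
  qed
  \<comment> \<open>The circle of radius \<open>3 / 2 * R\<close> has distance \<open>R / 2\<close>
    from the outer contour and \<open>R / 4\<close> from the inner one. This gives the factors 4 and
    5, and 6 after \<open>f\<close> itself is added.\<close>
  have bm: "norm (c (2 * R) z) \<le> 4 * M" if "norm z \<le> 3 / 2 * R" for z
  proof -
    have "norm (c (2 * R) z) \<le> 2 * R * M / (R / 2)"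
      unfolding c_def
    proof (rule norm_cauchy_transform_le)
      show "R / 2 \<le> norm (w - z)" if "norm w = 2 * R" for w
        using norm_triangle_ineq2[of w z] that \<open>norm z \<le> 3 / 2 * R\<close> by simp
    qed (use R M contf in auto)
    then show ?thesis using R by simp
  qed
  have bs: "norm (c (5 / 4 * R) z) \<le> 5 / 4 * R * M / (norm z - 5 / 4 * R)" if "norm z \<ge> 3 / 2 * R" for z
    unfolding c_def
  proof (rule norm_cauchy_transform_le)
    show "norm z - 5 / 4 * R \<le> norm (w - z)" if "norm w = 5 / 4 * R" for w
      using norm_triangle_ineq2[of z w] that by (simp add: norm_minus_commute)
  qed (use R M contf that in auto)
  have s6: "norm (s z) \<le> 5 * M" if "R < norm z" for z
  proof (cases "norm z < 3 / 2 * R")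
    case True
    then have "s z = c (2 * R) z - f z" using R by (simp add: s_def)
    then have "norm (s z) \<le> norm (c (2 * R) z) + norm (f z)" by (simp add: norm_triangle_ineq4)
    also have "\<dots> \<le> 4 * M + M" using True that R by (intro add_mono bm M) auto
    finally show ?thesis by simp
  next
    case False
    then have "norm (s z) \<le> 5 / 4 * R * M / (norm z - 5 / 4 * R)" using bs s_eq R by simp
    also have "\<dots> \<le> 5 / 4 * R * M / (R / 4)"
      using False R M0 by (intro divide_left_mono) auto
    finally show ?thesis using R by simp
  qed
  have zs: "norm z * norm (s z) \<le> 4 * R * M" if z: "2 * R \<le> norm z" for z
  proof -
    have z0: "norm z > 0" using z R by linarith
    have "norm (s z) \<le> 5 / 4 * R * M / (norm z - 5 / 4 * R)" using bs[of z] s_eq[of z] z R by simp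
    also have "\<dots> \<le> 5 / 4 * R * M / (norm z * (3 / 8))"
      using z R M0 by (intro divide_left_mono mult_pos_pos) auto
    finally have "norm z * norm (s z) \<le> norm z * (5 / 4 * R * M / (norm z * (3 / 8)))"
      by (intro mult_left_mono) auto
    also have "\<dots> = 10 / 3 * R * M" using z0 R by (simp add: field_simps)
    also have "\<dots> \<le> 4 * R * M" using R M0 by (simp add: mult_right_mono)
    finally show ?thesis .
  qed
  have s0: "(s \<longlongrightarrow> 0) at_infinity"
  proof (rule Lim_null_comparison)
    show "eventually (\<lambda>z. norm (s z) \<le> 4 * R * M / norm z) at_infinity"
      unfolding eventually_at_infinity
    proof (intro exI[of _ "2 * R"] allI impI)
      fix z :: complex assume z: "2 * R \<le> norm z"
      with R have "0 < norm z" by linarith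
      with z show "norm (s z) \<le> 4 * R * M / norm z" using zs[of z]
        by (simp add: pos_le_divide_eq mult.commute)
    qed
    show "((\<lambda>z::complex. 4 * R * M / norm z) \<longlongrightarrow> 0) at_infinity"
      by (intro real_tendsto_divide_at_top[OF tendsto_const] filterlim_norm_at_top)
  qed
  have "norm (m z) \<le> 6 * M" if "norm z \<le> 2 * R" for z
  proof (cases "norm z \<le> 3 / 2 * R")
    case True
    then have "m z = c (2 * R) z" using R by (simp add: m_def)
    with bm[OF True] M0 show ?thesis by simp
  next
    case False
    then have "norm (m z) \<le> norm (f z) + norm (s z)" unfolding m_eq by (rule_tac norm_triangle_ineq)
    also have "\<dots> \<le> M + 5 * M" using False that R by (intro add_mono M s6) auto
    finally show ?thesis by simp
  qed
  moreover have "norm (s z) \<le> 6 * M" if "R < norm z" for z using s6[OF that] M0 by simp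
  ultimately show ?thesis
    using holm hols s0 zs m_eq by (intro exI[of _ m] exI[of _ s]) auto
qed

section \<open>Birkhoff factorization near the identity\<close>

abbreviation outside :: "real \<Rightarrow> complex set" where
  "outside R \<equiv> {z. R < norm z}"

lemma open_outside: "open (outside R)"
  by (intro open_Collect_less continuous_intros)

lemma connected_outside: "R > 0 \<Longrightarrow> connected (outside R)"
proof -
  have "outside R = - cball 0 R" by auto
  then show ?thesis using connected_complement_bounded_convex[of "cball (0::complex) R"] by simp
qed

text \<open>The scalar constant 6 times the number of entries, the price of estimating a matrix by
  its entries.\<close>

definition split_const :: "'p::finite itself \<Rightarrow> real" where
  "split_const _ = 6 * real (CARD('p) * CARD('p))"

lemma split_const_ge: "split_const TYPE('p::finite) \<ge> 6"
proof -
  have "1 \<le> CARD('p) * CARD('p)" by (simp add: Suc_le_eq)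
  then have "real (CARD('p) * CARD('p)) \<ge> 1" by linarith
  then show ?thesis unfolding split_const_def by linarith
qed

text \<open>An additive Riemann-Hilbert problem on the exterior, \<open>m\<close> being the entire
  part. With this sign, a splitting of \<open>g + s ** g\<close> whose outer part is
  \<open>s\<close> itself says that \<open>(I + s) (I + g) = I + m\<close>.\<close>

definition splits :: "real \<Rightarrow> (complex \<Rightarrow> 'p::finite cmat) \<Rightarrow> (complex \<Rightarrow> 'p cmat) \<Rightarrow> (complex \<Rightarrow> 'p cmat) \<Rightarrow> bool" where
  "splits R F m s \<longleftrightarrow> mhol m UNIV \<and> mhol s (outside R) \<and> (s \<longlongrightarrow> 0) at_infinity \<and>
     (\<forall>z\<in>outside R. m z - s z = F z)"

lemma matrix_split_exists:
  fixes F :: "complex \<Rightarrow> 'p::finite cmat"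
  assumes R: "R > 0" and F: "mhol F (outside R)"
    and M: "\<And>z. R < norm z \<Longrightarrow> norm z \<le> 2 * R \<Longrightarrow> norm (F z) \<le> M"
  shows "\<exists>m s. splits R F m s \<and>
    (\<forall>z. norm z \<le> 2 * R \<longrightarrow> norm (m z) \<le> split_const TYPE('p) * M) \<and>
    (\<forall>z. R < norm z \<longrightarrow> norm (s z) \<le> split_const TYPE('p) * M) \<and>
    (\<forall>z. 2 * R \<le> norm z \<longrightarrow> norm z * norm (s z) \<le> split_const TYPE('p) * R * M)"
proof -
  have "\<exists>m s. m holomorphic_on UNIV \<and> s holomorphic_on {z. R < norm z} \<and>
    (\<forall>z. R < norm z \<longrightarrow> m z - s z = F z $ i $ j) \<and> (s \<longlongrightarrow> 0) at_infinity \<and>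
    (\<forall>z. norm z \<le> 2 * R \<longrightarrow> norm (m z) \<le> 6 * M) \<and>
    (\<forall>z. R < norm z \<longrightarrow> norm (s z) \<le> 6 * M) \<and>
    (\<forall>z. 2 * R \<le> norm z \<longrightarrow> norm z * norm (s z) \<le> 4 * R * M)" for i j
    by (rule annulus_split[OF R mholD[OF F]]) (meson M norm_entry_le order_trans)
  then obtain m s where ms: "\<And>i j. m i j holomorphic_on UNIV" "\<And>i j. s i j holomorphic_on {z. R < norm z}"
    "\<And>i j z. R < norm z \<Longrightarrow> m i j z - s i j z = F z $ i $ j" "\<And>i j. (s i j \<longlongrightarrow> 0) at_infinity"
    "\<And>i j z. norm z \<le> 2 * R \<Longrightarrow> norm (m i j z) \<le> 6 * M"
    "\<And>i j z. R < norm z \<Longrightarrow> norm (s i j z) \<le> 6 * M"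
    "\<And>i j z. 2 * R \<le> norm z \<Longrightarrow> norm z * norm (s i j z) \<le> 4 * R * M"
    by metis
  define m' :: "complex \<Rightarrow> 'p cmat" where "m' z = (\<chi> i j. m i j z)" for z
  define s' :: "complex \<Rightarrow> 'p cmat" where "s' z = (\<chi> i j. s i j z)" for z
  have M0: "M \<ge> 0" using order_trans[OF norm_ge_zero M[of "of_real (2 * R)"]] R by simp
  have "splits R F m' s'"
    unfolding splits_def
  proof (intro conjI)
    show "(s' \<longlongrightarrow> 0) at_infinity"
      by (rule tendsto_matrix_entries) (simp add: s'_def ms)
  qed (auto simp: mhol_def m'_def s'_def ms vec_eq_iff)
  moreover have "norm (m' z) \<le> split_const TYPE('p) * M" if "norm z \<le> 2 * R" for z
    using norm_matrix_le_entries[of "m' z" "6 * M"] ms(5)[OF that]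
    by (simp add: m'_def split_const_def mult_ac)
  moreover have "norm (s' z) \<le> split_const TYPE('p) * M" if "R < norm z" for z
    using norm_matrix_le_entries[of "s' z" "6 * M"] ms(6)[OF that]
    by (simp add: s'_def split_const_def mult_ac)
  moreover have "norm z * norm (s' z) \<le> split_const TYPE('p) * R * M" if z: "2 * R \<le> norm z" for z
  proof -
    have z0: "norm z > 0" using z R by linarith
    have "norm (s i j z) \<le> 4 * R * M / norm z" for i j
      using ms(7)[OF z, of i j] z0 by (simp add: pos_le_divide_eq mult.commute)
    then have "norm (s' z) \<le> real (CARD('p) * CARD('p)) * (4 * R * M / norm z)"
      by (intro norm_matrix_le_entries) (simp add: s'_def)
    then have "norm z * norm (s' z) \<le> norm z * (real (CARD('p) * CARD('p)) * (4 * R * M / norm z))"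
      by (intro mult_left_mono) auto
    also have "\<dots> = real (CARD('p) * CARD('p)) * (4 * (R * M))" using z0 by (simp add: field_simps)
    also have "\<dots> \<le> real (CARD('p) * CARD('p)) * (6 * (R * M))"
      using R M0 by (intro mult_left_mono mult_right_mono) auto
    finally show ?thesis by (simp add: split_const_def mult_ac)
  qed
  ultimately show ?thesis by blast
qed

text \<open>Near infinity the difference of the entire parts equals the difference of the outer
  parts, so it is an entire function tending to 0.\<close>

lemma splits_unique:
  fixes F :: "complex \<Rightarrow> 'p::finite cmat"
  assumes "splits R F m s" "splits R F m' s'"
  shows "m z = m' z" "R < norm z \<Longrightarrow> s z = s' z"
proof -
  have eq: "m z - m' z = s z - s' z" if "R < norm z" for z
  proof -
    have "m z - s z = m' z - s' z" using assms that unfolding splits_def by auto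
    then show ?thesis by (simp add: algebra_simps)
  qed
  have "m z $ i $ j - m' z $ i $ j = 0" for i j z
  proof (rule Liouville_weak[of "\<lambda>z. m z $ i $ j - m' z $ i $ j"])
    show "(\<lambda>z. m z $ i $ j - m' z $ i $ j) holomorphic_on UNIV"
      using assms unfolding splits_def by (intro holomorphic_intros mholD) auto
    have "((\<lambda>z. (s z - s' z) $ i $ j) \<longlongrightarrow> (0 - 0 :: 'p cmat) $ i $ j) at_infinity"
      using assms unfolding splits_def by (intro tendsto_entry tendsto_diff) auto
    moreover have "eventually (\<lambda>z. (s z - s' z) $ i $ j = m z $ i $ j - m' z $ i $ j) at_infinity"
      unfolding eventually_at_infinity by (intro exI[of _ "R + 1"]) (simp add: eq[symmetric])
    ultimately show "((\<lambda>z. m z $ i $ j - m' z $ i $ j) \<longlongrightarrow> 0) at_infinity"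
      by (simp add: tendsto_cong)
  qed
  then show *: "m z = m' z" for z by (simp add: vec_eq_iff)
  show "R < norm z \<Longrightarrow> s z = s' z" using eq[of z] *[of z] by simp
qed

text \<open>By uniqueness every splitting is the constructed one and inherits its bounds. Splittings
  that arise later from explicit formulas are estimated in this way.\<close>

lemma splits_bounds:
  fixes F :: "complex \<Rightarrow> 'p::finite cmat"
  assumes R: "R > 0" and F: "mhol F (outside R)"
    and M: "\<And>z. R < norm z \<Longrightarrow> norm z \<le> 2 * R \<Longrightarrow> norm (F z) \<le> M"
    and sp: "splits R F m s"
  shows "norm z \<le> 2 * R \<Longrightarrow> norm (m z) \<le> split_const TYPE('p) * M"
    and "R < norm z \<Longrightarrow> norm (s z) \<le> split_const TYPE('p) * M"
    and "2 * R \<le> norm z \<Longrightarrow> norm z * norm (s z) \<le> split_const TYPE('p) * R * M"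
proof -
  obtain m' s' where *: "splits R F m' s'"
    "\<And>z. norm z \<le> 2 * R \<Longrightarrow> norm (m' z) \<le> split_const TYPE('p) * M"
    "\<And>z. R < norm z \<Longrightarrow> norm (s' z) \<le> split_const TYPE('p) * M"
    "\<And>z. 2 * R \<le> norm z \<Longrightarrow> norm z * norm (s' z) \<le> split_const TYPE('p) * R * M"
    using matrix_split_exists[OF R F M] by blast
  show "norm z \<le> 2 * R \<Longrightarrow> norm (m z) \<le> split_const TYPE('p) * M"
    "R < norm z \<Longrightarrow> norm (s z) \<le> split_const TYPE('p) * M"
    "2 * R \<le> norm z \<Longrightarrow> norm z * norm (s z) \<le> split_const TYPE('p) * R * M"
    using *(2-) splits_unique[OF sp *(1)] R by force+
qed

lemma splits_diff:
  assumes "splits R F m s" "splits R F' m' s'"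
  shows "splits R (\<lambda>z. F z - F' z) (\<lambda>z. m z - m' z) (\<lambda>z. s z - s' z)"
  using assms unfolding splits_def
  by (auto intro!: mhol_diff tendsto_eq_intros simp: algebra_simps)

lemma mhol_uniform_limit:
  fixes f :: "nat \<Rightarrow> complex \<Rightarrow> complex ^ 'n ^ 'm"
  assumes S: "open S" and hol: "\<And>n. mhol (f n) S" and lim: "uniform_limit S f g sequentially"
  shows "mhol g S"
proof (rule mholI)
  fix i j
  have lim': "uniform_limit S (\<lambda>n z. f n z $ i $ j) (\<lambda>z. g z $ i $ j) sequentially"
    unfolding uniform_limit_iff
  proof (intro allI impI)
    fix e :: real assume "0 < e"
    with lim have "\<forall>\<^sub>F n in sequentially. \<forall>x\<in>S. dist (f n x) (g x) < e"
      by (auto simp: uniform_limit_iff)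
    then show "\<forall>\<^sub>F n in sequentially. \<forall>x\<in>S. dist (f n x $ i $ j) (g x $ i $ j) < e"
      by (rule eventually_mono) (meson dist_vec_nth_le order_le_less_trans)
  qed
  show "(\<lambda>z. g z $ i $ j) holomorphic_on S"
  proof (rule holomorphic_uniform_sequence[OF S mholD[OF hol]])
    fix z assume "z \<in> S"
    then obtain d where "d > 0" "cball z d \<subseteq> S" using S open_contains_cball by blast
    then show "\<exists>d>0. cball z d \<subseteq> S \<and> uniform_limit (cball z d) (\<lambda>n z. f n z $ i $ j) (\<lambda>z. g z $ i $ j) sequentially"
      using uniform_limit_on_subset[OF lim'] by blast
  qed
qed

text \<open>Birkhoff factorization of a loop near the identity: fixed point iteration \<open>s \<mapsto> \<close> outer part of
  \<open>g + s g\<close>.\<close>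

lemma birkhoff_near_identity:
  fixes g :: "complex \<Rightarrow> 'p::finite cmat"
  assumes R: "R > 0" and g: "mhol g (outside R)"
    and eps: "\<And>z. R < norm z \<Longrightarrow> norm z \<le> 2 * R \<Longrightarrow> norm (g z) \<le> \<epsilon>"
    and small: "2 * split_const TYPE('p) * \<epsilon> \<le> 1"
  shows "\<exists>m s. mhol m UNIV \<and> mhol s (outside R) \<and> (s \<longlongrightarrow> 0) at_infinity \<and>
    (\<forall>z. R < norm z \<longrightarrow> (mat 1 + s z) ** (mat 1 + g z) = mat 1 + m z) \<and>
    (\<forall>z. norm z \<le> 2 * R \<longrightarrow> norm (m z) \<le> 2 * split_const TYPE('p) * \<epsilon>) \<and>
    (\<forall>z. R < norm z \<longrightarrow> norm (s z) \<le> 2 * split_const TYPE('p) * \<epsilon>)"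
proof -
  let ?C = "split_const TYPE('p)"
  have e0: "\<epsilon> \<ge> 0" using order_trans[OF norm_ge_zero eps[of "of_real (2 * R)"]] R by simp
  have C6: "?C \<ge> 6" by (rule split_const_ge)
  \<comment> \<open>A choice of splitting as a function of \<open>F\<close>. Its outer part is
    determined on the exterior, which is where the iteration map \<open>N\<close> is used.\<close>
  define P where "P F = (SOME p. splits R F (fst p) (snd p))" for F :: "complex \<Rightarrow> 'p cmat"
  have P: "splits R F (fst (P F)) (snd (P F))"
    if "mhol F (outside R)" "\<And>z. R < norm z \<Longrightarrow> norm z \<le> 2 * R \<Longrightarrow> norm (F z) \<le> M" for F M
  proof -
    have "\<exists>p. splits R F (fst p) (snd p)"
      using matrix_split_exists[OF R that] by fastforce
    then show ?thesis unfolding P_def by (rule someI_ex)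
  qed
  define N where "N s = snd (P (\<lambda>z. g z + s z ** g z))" for s
  define m where "m s = fst (P (\<lambda>z. g z + s z ** g z))" for s
  define \<sigma> where "\<sigma> n = (N ^^ n) (\<lambda>z. 0)" for n
  have \<sigma>0: "\<sigma> 0 z = 0" and \<sigma>S: "\<sigma> (Suc n) = N (\<sigma> n)" for n z by (simp_all add: \<sigma>_def)
  define good where "good s \<longleftrightarrow> mhol s (outside R) \<and> (\<forall>z. R < norm z \<longrightarrow> norm (s z) \<le> 2 * ?C * \<epsilon>)" for s :: "complex \<Rightarrow> 'p cmat"
  have fb: "norm (g z + s z ** g z) \<le> 2 * \<epsilon>" if "good s" "R < norm z" "norm z \<le> 2 * R" for s z
  proof -
    have "norm (s z) \<le> 1" using that small unfolding good_def by (meson order_trans)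
    then have "norm (s z ** g z) \<le> 1 * \<epsilon>" using eps that by (intro norm_matrix_mult_le) auto
    then show ?thesis using eps[OF that(2,3)] norm_triangle_ineq[of "g z" "s z ** g z"] by linarith
  qed
  have fh: "mhol (\<lambda>z. g z + s z ** g z) (outside R)" if "good s" for s
    using that g unfolding good_def by (intro mhol_add mhol_mult) auto
  have sp: "splits R (\<lambda>z. g z + s z ** g z) (m s) (N s)" if "good s" for s
    unfolding N_def m_def by (rule P[OF fh[OF that] fb[OF that]])
  have goodN: "good (N s)" if "good s" for s
    unfolding good_def
  proof (intro conjI allI impI)
    show "mhol (N s) (outside R)" using sp[OF that] by (simp add: splits_def)
    show "norm (N s z) \<le> 2 * ?C * \<epsilon>" if "R < norm z" for z
      using splits_bounds(2)[OF R fh[OF \<open>good s\<close>] fb[OF \<open>good s\<close>] sp[OF \<open>good s\<close>] that] by (simp add: mult_ac)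
  qed
  have good: "good (\<sigma> n)" for n
  proof (induction n)
    case 0
    then show ?case using e0 C6 by (auto simp: good_def \<sigma>_def)
  next
    case (Suc n)
    then show ?case by (simp add: \<sigma>S goodN)
  qed
  have contr: "norm (N s z - N s' z) \<le> D / 2" if s: "good s" "good s'"
    and D: "\<And>z. R < norm z \<Longrightarrow> norm (s z - s' z) \<le> D" and z: "R < norm z" for s s' z D
  proof -
    have D0: "D \<ge> 0" using order_trans[OF norm_ge_zero D[OF z]] .
    have "norm (N s z - N s' z) \<le> ?C * (D * \<epsilon>)"
    proof (rule splits_bounds(2)[OF R _ _ splits_diff[OF sp[OF s(1)] sp[OF s(2)]] z])
      show "mhol (\<lambda>z. g z + s z ** g z - (g z + s' z ** g z)) (outside R)"
        by (intro mhol_diff fh s)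
      fix w :: complex assume w: "R < norm w" "norm w \<le> 2 * R"
      have "g w + s w ** g w - (g w + s' w ** g w) = (s w - s' w) ** g w"
        by (simp add: mm_diff_left)
      then show "norm (g w + s w ** g w - (g w + s' w ** g w)) \<le> D * \<epsilon>"
        using D[OF w(1)] eps[OF w] by (simp add: norm_matrix_mult_le)
    qed
    \<comment> \<open>The hypothesis \<open>small\<close> is precisely what makes the contraction
      constant 1/2.\<close>
    also have "\<dots> = (2 * ?C * \<epsilon>) * (D / 2)" by simp
    also have "\<dots> \<le> 1 * (D / 2)" using small D0 by (intro mult_right_mono) auto
    finally show ?thesis by simp
  qed
  have diff: "norm (\<sigma> (Suc n) z - \<sigma> n z) \<le> (1/2) ^ n" if "R < norm z" for n z
    using that
  proof (induction n arbitrary: z)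
    case 0
    have "norm (\<sigma> 1 z) \<le> 2 * ?C * \<epsilon>" using good[of 1] 0 unfolding good_def by blast
    with small show ?case by (simp add: \<sigma>0)
  next
    case (Suc n)
    have "norm (N (\<sigma> (Suc n)) z - N (\<sigma> n) z) \<le> (1/2) ^ n / 2"
      by (rule contr[OF good good Suc.IH Suc.prems])
    then show ?case by (simp add: \<sigma>S)
  qed
  define s where "s z = (\<Sum>n. \<sigma> (Suc n) z - \<sigma> n z)" for z
  have "uniform_limit (outside R) (\<lambda>n z. \<Sum>i<n. \<sigma> (Suc i) z - \<sigma> i z) s sequentially"
    unfolding s_def by (rule Weierstrass_m_test[where M = "\<lambda>n. (1/2) ^ n"]) (auto intro: diff)
  moreover have "(\<Sum>i<n. \<sigma> (Suc i) z - \<sigma> i z) = \<sigma> n z" for n z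
    using sum_lessThan_telescope[of "\<lambda>i. \<sigma> i z" n] by (simp add: \<sigma>0)
  ultimately have lim: "uniform_limit (outside R) \<sigma> s sequentially"
    by simp
  have goods: "good s"
    unfolding good_def
  proof (intro conjI allI impI)
    show "mhol s (outside R)"
      by (rule mhol_uniform_limit[OF open_outside _ lim]) (use good good_def in blast)
    show "norm (s z) \<le> 2 * ?C * \<epsilon>" if "R < norm z" for z
    proof (rule tendsto_upperbound)
      show "(\<lambda>n. norm (\<sigma> n z)) \<longlonglongrightarrow> norm (s z)"
        using tendsto_uniform_limitI[OF lim, of z] that by (intro tendsto_norm) auto
      show "eventually (\<lambda>n. norm (\<sigma> n z) \<le> 2 * ?C * \<epsilon>) sequentially"
        using good that unfolding good_def by auto
    qed auto
  qed
  \<comment> \<open>The iterates converge uniformly and \<open>N\<close> is a contraction, so their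
    limit is a fixed point; its splitting \<open>m s - s = g + s ** g\<close> is the
    factorization.\<close>
  have Ns: "N s z = s z" if z: "R < norm z" for z
  proof (rule LIMSEQ_unique)
    show "(\<lambda>n. \<sigma> (Suc n) z) \<longlonglongrightarrow> s z"
      using tendsto_uniform_limitI[OF lim, of z] z LIMSEQ_Suc by auto
    show "(\<lambda>n. \<sigma> (Suc n) z) \<longlonglongrightarrow> N s z"
    proof (rule tendstoI)
      fix e :: real assume e: "e > 0"
      show "eventually (\<lambda>n. dist (\<sigma> (Suc n) z) (N s z) < e) sequentially"
        using uniform_limitD[OF lim e]
      proof eventually_elim
        case (elim n)
        then have "norm (N (\<sigma> n) z - N s z) \<le> e / 2"
          by (intro contr[OF good goods _ z]) (auto simp: dist_norm less_imp_le)
        then show ?case using e by (simp add: \<sigma>S dist_norm)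
      qed
    qed
  qed
  have eq: "(mat 1 + s z) ** (mat 1 + g z) = mat 1 + m s z" if "R < norm z" for z
  proof -
    have "m s z - N s z = g z + s z ** g z"
      using sp[OF goods] that unfolding splits_def by blast
    then have "m s z = s z + (g z + s z ** g z)" by (simp add: Ns[OF that] algebra_simps)
    then show ?thesis by (simp add: mm_algebra algebra_simps)
  qed
  have "(s \<longlongrightarrow> 0) at_infinity"
  proof -
    have "(N s \<longlongrightarrow> 0) at_infinity" using sp[OF goods] by (simp add: splits_def)
    moreover have "eventually (\<lambda>z. N s z = s z) at_infinity"
      unfolding eventually_at_infinity by (intro exI[of _ "R + 1"]) (simp add: Ns)
    ultimately show ?thesis by (simp add: tendsto_cong)
  qed
  moreover have "norm (m s z) \<le> 2 * ?C * \<epsilon>" if "norm z \<le> 2 * R" for z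
    using splits_bounds(1)[OF R fh[OF goods] fb[OF goods] sp[OF goods] that] by (simp add: mult_ac)
  ultimately show ?thesis
    using goods eq sp[OF goods] unfolding good_def splits_def
    by (intro exI[of _ "m s"] exI[of _ s]) auto
qed

section \<open>Meromorphic matrix functions contractive with respect to an indefinite form\<close>

lemma mat_analytic_at_ball:
  assumes "mat_analytic_at Y z"
  shows "\<exists>e>0. mhol Y (ball z e) \<and> (\<forall>w\<in>ball z e. mat_analytic_at Y w)"
proof -
  have "\<exists>e>0. (\<lambda>w. Y w $ i $ j) holomorphic_on ball z e" for i j
    using assms unfolding mat_analytic_at_def analytic_on_def by blast
  then obtain e where e: "\<And>i j. e i j > 0" "\<And>i j. (\<lambda>w. Y w $ i $ j) holomorphic_on ball z (e i j)"
    by metis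
  define d where "d = Min (range (\<lambda>(i, j). e i j))"
  have d: "d > 0" "d \<le> e i j" for i j
    unfolding d_def using e by (auto simp: Min_gr_iff intro!: Min_le)
  have hol: "mhol Y (ball z d)"
    by (rule mholI, rule holomorphic_on_subset[OF e(2)], rule subset_ball[OF d(2)])
  moreover have "mat_analytic_at Y w" if "w \<in> ball z d" for w
    unfolding mat_analytic_at_def
    using mholD[OF hol] that open_ball analytic_on_open analytic_on_subset
    by (metis empty_subsetI insert_subset)
  ultimately show ?thesis using d(1) by blast
qed

lemma mhol_imp_analytic_at: "mhol Y U \<Longrightarrow> open U \<Longrightarrow> z \<in> U \<Longrightarrow> mat_analytic_at Y z"
  unfolding mat_analytic_at_def
  by (metis analytic_on_open analytic_on_subset empty_subsetI insert_subset mholD)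

lemma mat_analytic_at_isCont: "mat_analytic_at Y z \<Longrightarrow> isCont Y z"
  unfolding isCont_def mat_analytic_at_def
  by (intro tendsto_matrix_entries) (meson analytic_at_imp_isCont isContD)

lemma mat_meromorphic_punctured:
  assumes Y: "mat_meromorphic_on Y U" and U: "open U" and z: "z \<in> U"
  shows "\<exists>e>0. ball z e \<subseteq> U \<and> (\<forall>w\<in>ball z e - {z}. mat_analytic_at Y w)"
proof -
  have "eventually (\<lambda>w. (\<lambda>w. Y w $ i $ j) analytic_on {w}) (at z)" for i j
  proof -
    have "(\<lambda>w. Y w $ i $ j) meromorphic_on U"
      using Y unfolding mat_meromorphic_on_def nicely_meromorphic_on_def by blast
    then have "isolated_singularity_at (\<lambda>w. Y w $ i $ j) z"
      using z meromorphic_on_altdef by blast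
    then obtain r where r: "r > 0" "(\<lambda>w. Y w $ i $ j) analytic_on ball z r - {z}"
      unfolding isolated_singularity_at_def by blast
    have "eventually (\<lambda>w. w \<in> ball z r - {z}) (at z)"
      using r(1) by (intro eventually_at_in_open) auto
    then show ?thesis
      by (rule eventually_mono) (use r(2) in \<open>blast intro: analytic_on_subset\<close>)
  qed
  then have "eventually (\<lambda>w. mat_analytic_at Y w) (at z)"
    unfolding mat_analytic_at_def by (intro eventually_all_finite)
  moreover have "eventually (\<lambda>w. w \<in> U) (at z)"
    using U z eventually_at_in_open' by blast
  ultimately have "eventually (\<lambda>w. mat_analytic_at Y w \<and> w \<in> U) (at z)"
    by (rule eventually_conj)
  then obtain d where "d > 0" "\<And>w. w \<noteq> z \<Longrightarrow> dist w z < d \<Longrightarrow> mat_analytic_at Y w \<and> w \<in> U"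
    unfolding eventually_at by auto
  moreover from this have "w \<in> U" if "dist w z < d" for w using that z by (cases "w = z") auto
  ultimately show ?thesis by (intro exI[of _ d]) (auto simp: dist_commute)
qed

text \<open>A finite limit excludes a pole, and a normalised meromorphic function is analytic
  wherever it has no pole.\<close>

lemma mat_meromorphic_analytic_atI:
  assumes Y: "mat_meromorphic_on Y U" and z: "z \<in> U"
    and eq: "eventually (\<lambda>w. Y w = X w) (at z)" and X: "(X \<longlongrightarrow> L) (at z)"
  shows "mat_analytic_at Y z"
  unfolding mat_analytic_at_def
proof (intro allI)
  fix i j
  have nice: "(\<lambda>w. Y w $ i $ j) nicely_meromorphic_on U"
    using Y unfolding mat_meromorphic_on_def by blast
  have "(Y \<longlongrightarrow> L) (at z)"
    using X eq by (simp add: tendsto_cong)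
  then have "((\<lambda>w. Y w $ i $ j) \<longlongrightarrow> L $ i $ j) (at z)" by (rule tendsto_entry)
  then have "\<not> is_pole (\<lambda>w. Y w $ i $ j) z"
    unfolding is_pole_def using at_neq_bot not_tendsto_and_filterlim_at_infinity by blast
  then show "(\<lambda>w. Y w $ i $ j) analytic_on {z}"
    by (rule nicely_meromorphic_on_imp_analytic_at[OF nice z])
qed

text \<open>A matrix \<open>S\<close> is contractive for the self-adjoint form \<open>J\<close> iff \<open>cayley_num J S = \<Theta> cayley_den J S\<close> for an
  ordinary contraction \<open>\<Theta>\<close>; so \<open>\<Theta>\<close> and the inverse of \<open>cayley_den J S\<close> are bounded holomorphic
  functions even where \<open>S\<close> has poles, \<open>J\<close> being invertible.\<close>

definition cayley_den :: "'p::finite cmat \<Rightarrow> 'p cmat \<Rightarrow> 'p cmat" where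
  "cayley_den J S = (mat 1 + J) + (mat 1 - J) ** S"

definition cayley_num :: "'p::finite cmat \<Rightarrow> 'p cmat \<Rightarrow> 'p cmat" where
  "cayley_num J S = (mat 1 - J) + (mat 1 + J) ** S"

lemma cayley_sum: "cayley_den J S *v v + cayley_num J S *v v = 2 *\<^sub>R (v + S *v v)"
  by (simp add: cayley_den_def cayley_num_def mv_algebra matrix_vector_mul_assoc[symmetric] mm_algebra scaleR_2)

lemma cayley_diff: "cayley_den J S *v v - cayley_num J S *v v = 2 *\<^sub>R (J *v (v - S *v v))"
  by (simp add: cayley_den_def cayley_num_def mv_algebra matrix_vector_mul_assoc[symmetric] mm_algebra scaleR_2)

lemma hip_scaleR_left: "hip (r *\<^sub>R u) v = of_real r * hip u v"
  and hip_scaleR_right: "hip u (r *\<^sub>R v) = of_real r * hip u v"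
  by (simp_all add: hip_def sum_distrib_left scaleR_conv_of_real[where 'a = complex] mult_ac)

lemma Re_hip_sum_diff: "Re (hip (a + b) (a - b)) = (norm a)\<^sup>2 - (norm b)\<^sup>2"
  using Re_hip_commute[of a b] by (simp add: hip_algebra hip_self)

lemma Re_hip_self_adjoint_sum_diff:
  assumes "cadjoint J = J"
  shows "Re (hip (v + w) (J *v (v - w))) = Re (hip v (J *v v)) - Re (hip w (J *v w))"
proof -
  have "Re (hip w (J *v v)) = Re (hip v (J *v w))"
    by (metis Re_hip_commute assms hip_self_adjoint)
  then show ?thesis by (simp add: hip_algebra mv_algebra)
qed

text \<open>With \<open>a\<close> the denominator and \<open>b\<close> the numerator applied to
  \<open>v\<close>, one has \<open>|a|^2 - |b|^2 = Re <a + b, a - b>\<close>, and the two arguments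
  are \<open>2 (v + S v)\<close> and \<open>2 J (v - S v)\<close>. So the difference is four times
  the defect of \<open>S\<close> at \<open>v\<close>.\<close>

lemma cayley_contraction:
  assumes J: "cadjoint J = J" and S: "Re (hip (S *v v) (J *v (S *v v))) \<le> Re (hip v (J *v v))"
  shows "norm (cayley_num J S *v v) \<le> norm (cayley_den J S *v v)"
proof -
  let ?a = "cayley_den J S *v v" and ?b = "cayley_num J S *v v"
  have "(norm ?a)\<^sup>2 - (norm ?b)\<^sup>2 = Re (hip (?a + ?b) (?a - ?b))" by (rule Re_hip_sum_diff[symmetric])
  also have "\<dots> = 4 * Re (hip (v + S *v v) (J *v (v - S *v v)))"
    unfolding cayley_sum cayley_diff by (simp add: hip_scaleR_left hip_scaleR_right)
  also have "\<dots> \<ge> 0" using S by (simp add: Re_hip_self_adjoint_sum_diff[OF J])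
  finally show ?thesis by (simp add: power2_le_iff_abs_le)
qed

text \<open>The vector is recovered by \<open>4 v = (a + b) + J^-1 (a - b)\<close>, and the
  numerator \<open>b\<close> is dominated by the denominator \<open>a\<close>. The constant does not
  depend on \<open>S\<close>, which is what keeps the inverse of the denominator bounded near
  poles.\<close>

lemma cayley_den_lower_bound:
  assumes J: "cadjoint J = J" "invertible J" and S: "Re (hip (S *v v) (J *v (S *v v))) \<le> Re (hip v (J *v v))"
  shows "norm v \<le> (1 + norm (matrix_inv J)) * norm (cayley_den J S *v v)"
proof -
  let ?a = "cayley_den J S *v v" and ?b = "cayley_num J S *v v"
  have ba: "norm ?b \<le> norm ?a" by (rule cayley_contraction[OF J(1) S])
  have "matrix_inv J *v (?a - ?b) = 2 *\<^sub>R (v - S *v v)"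
    unfolding cayley_diff
    by (simp add: bounded_bilinear.scaleR_right[OF bounded_bilinear_matrix_vector_mult]
        matrix_vector_mul_assoc minv_left[OF J(2)])
  moreover have "4 *\<^sub>R v = 2 *\<^sub>R (v + S *v v) + 2 *\<^sub>R (v - S *v v)"
    by (simp add: vec_eq_iff scaleR_conv_of_real[where 'a = complex] algebra_simps)
  ultimately have "4 *\<^sub>R v = (?a + ?b) + matrix_inv J *v (?a - ?b)"
    unfolding cayley_sum by simp
  then have "4 * norm v \<le> norm (?a + ?b) + norm (matrix_inv J *v (?a - ?b))"
    by (metis norm_scaleR norm_triangle_ineq abs_numeral)
  also have "\<dots> \<le> (norm ?a + norm ?a) + norm (matrix_inv J) * (norm ?a + norm ?a)"
    using ba norm_triangle_ineq[of ?a ?b] norm_triangle_ineq4[of ?a ?b]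
    by (intro add_mono order_trans[OF norm_matrix_vector_mult] mult_left_mono) auto
  also have "\<dots> = 2 * ((1 + norm (matrix_inv J)) * norm ?a)" by (simp add: algebra_simps)
  finally show ?thesis using norm_ge_zero[of v] by linarith
qed

text \<open>In the coordinate \<open>1 / z\<close> this is a first-order Taylor expansion at 0;
  \<open>Y1\<close> is the derivative there, that is, the coefficient of
  \<open>1 / z\<close>.\<close>

lemma mat_analytic_at_infinityE:
  assumes "mat_analytic_at_infinity Y V"
  obtains R Y1 where "R > 0" "mhol Y (outside R)" "(Y \<longlongrightarrow> V) at_infinity"
    "((\<lambda>z. mat z ** (Y z - V)) \<longlongrightarrow> Y1) at_infinity"
proof -
  define h where "h i j w = (if w = 0 then V $ i $ j else Y (inverse w) $ i $ j)" for i j w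
  have "\<exists>e>0. h i j holomorphic_on ball 0 e" for i j
    using assms unfolding mat_analytic_at_infinity_def analytic_on_def h_def by blast
  then obtain e where e: "\<And>i j. e i j > 0" "\<And>i j. h i j holomorphic_on ball 0 (e i j)"
    by metis
  define d where "d = Min (range (\<lambda>(i, j). e i j))"
  have d: "d > 0" "d \<le> e i j" for i j
    unfolding d_def using e by (auto simp: Min_gr_iff intro!: Min_le)
  have holh: "h i j holomorphic_on ball 0 d" for i j
    by (rule holomorphic_on_subset[OF e(2) subset_ball[OF d(2)]])
  have R: "1 / d > 0" using d(1) by simp
  have Yh: "Y z $ i $ j = h i j (inverse z)" if "z \<noteq> 0" for z i j
    using that by (simp add: h_def)
  have hol: "mhol Y (outside (1 / d))"
  proof (rule mholI)
    fix i j
    have "(\<lambda>z. h i j (inverse z)) holomorphic_on outside (1 / d)"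
    proof (rule holomorphic_on_compose_gen[OF _ holh, unfolded o_def])
      show "inverse holomorphic_on outside (1 / d)"
        using d by (intro holomorphic_intros) (auto simp: not_less)
      show "inverse ` outside (1 / d) \<subseteq> ball 0 d"
      proof safe
        fix z :: complex assume z: "1 / d < norm z"
        then have "norm z > 0" using R by linarith
        with z d show "inverse z \<in> ball 0 d" by (simp add: norm_inverse norm_divide field_simps)
      qed
    qed
    then show "(\<lambda>z. Y z $ i $ j) holomorphic_on outside (1 / d)"
    proof (rule holomorphic_transform)
      fix z assume "z \<in> outside (1 / d)"
      then have "z \<noteq> 0" using R by auto
      then show "h i j (inverse z) = Y z $ i $ j" by (rule Yh[symmetric])
    qed
  qed
  have dh: "(h i j has_field_derivative deriv (h i j) 0) (at 0)" for i j
    using holomorphic_derivI[OF holh open_ball] d(1) by simp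
  have lim: "(Y \<longlongrightarrow> V) at_infinity"
  proof (rule tendsto_matrix_entries)
    fix i j
    have "(h i j \<longlongrightarrow> h i j 0) (at 0)" using DERIV_isCont[OF dh] by (simp add: isCont_def)
    moreover have "eventually (\<lambda>w. h i j w = ((\<lambda>z. Y z $ i $ j) \<circ> inverse) w) (at 0)"
      unfolding eventually_at by (intro exI[of _ 1]) (simp add: h_def)
    ultimately show "((\<lambda>z. Y z $ i $ j) \<longlongrightarrow> V $ i $ j) at_infinity"
      unfolding lim_at_infinity_0 by (simp add: tendsto_cong h_def[of i j 0] o_def)
  qed
  define Y1 where "Y1 = (\<chi> i j. deriv (h i j) 0)"
  have "((\<lambda>z. mat z ** (Y z - V)) \<longlongrightarrow> Y1) at_infinity"
  proof (rule tendsto_matrix_entries)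
    fix i j
    have "((\<lambda>w. (h i j w - h i j 0) / (w - 0)) \<longlongrightarrow> deriv (h i j) 0) (at 0)"
      using dh has_field_derivativeD[OF dh, of i j] by (simp add: has_field_derivative_iff)
    moreover have "eventually (\<lambda>w. (h i j w - h i j 0) / (w - 0) = ((\<lambda>z. (mat z ** (Y z - V)) $ i $ j) \<circ> inverse) w) (at 0)"
      unfolding eventually_at by (intro exI[of _ 1]) (simp add: h_def mat_mult_nth divide_inverse mult.commute)
    ultimately show "((\<lambda>z. (mat z ** (Y z - V)) $ i $ j) \<longlongrightarrow> Y1 $ i $ j) at_infinity"
      unfolding lim_at_infinity_0 by (simp add: tendsto_cong Y1_def o_def)
  qed
  then show ?thesis using that[OF R hol lim] by blast
qed

text \<open>In the coordinate \<open>w = 1 / z\<close> the limit makes the function continuous at 0,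
  so the isolated singularity is removable.\<close>

lemma mat_analytic_at_infinityI:
  assumes R: "R > 0" and Y: "mhol Y (outside R)" and lim: "(Y \<longlongrightarrow> V) at_infinity"
  shows "mat_analytic_at_infinity Y V"
  unfolding mat_analytic_at_infinity_def
proof (intro allI)
  fix i j
  let ?h = "\<lambda>w. if w = 0 then V $ i $ j else Y (inverse w) $ i $ j"
  have "?h holomorphic_on ball 0 (1 / R)"
  proof (rule no_isolated_singularity)
    have "(\<lambda>w. Y (inverse w) $ i $ j) holomorphic_on ball 0 (1 / R) - {0}"
    proof (rule holomorphic_on_compose_gen[OF _ mholD[OF Y], unfolded o_def])
      show "inverse ` (ball 0 (1 / R) - {0}) \<subseteq> outside R"
        using R by (auto simp: norm_inverse norm_divide field_simps)
    qed (auto intro!: holomorphic_intros)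
    then show holh: "?h holomorphic_on ball 0 (1 / R) - {0}"
      by (rule holomorphic_transform) auto
    show "continuous_on (ball 0 (1 / R)) ?h"
      unfolding continuous_on_eq_continuous_at[OF open_ball]
    proof
      fix x :: complex assume x: "x \<in> ball 0 (1 / R)"
      show "isCont ?h x"
      proof (cases "x = 0")
        case True
        have "((\<lambda>z. Y z $ i $ j) \<longlongrightarrow> V $ i $ j) at_infinity" by (rule tendsto_entry[OF lim])
        then have "((\<lambda>w. Y (inverse w) $ i $ j) \<longlongrightarrow> V $ i $ j) (at 0)"
          unfolding lim_at_infinity_0 by (simp add: o_def)
        moreover have "eventually (\<lambda>w. Y (inverse w) $ i $ j = ?h w) (at 0)"
          unfolding eventually_at by (intro exI[of _ 1]) simp
        ultimately show ?thesis unfolding True isCont_def by (simp add: tendsto_cong)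
      next
        case False
        have "open (ball (0::complex) (1 / R) - {0})" by (intro open_Diff) auto
        then show ?thesis
          using holomorphic_on_imp_continuous_on[OF holh] x False
          by (meson DiffI continuous_on_eq_continuous_at singletonD)
      qed
    qed
  qed auto
  then show "?h analytic_on {0}"
    using R analytic_on_open[of "ball 0 (1 / R)" ?h] analytic_on_subset[of ?h "ball 0 (1 / R)" "{0}"] by auto
qed

lemma contractive_in_rhpD:
  assumes "contractive_in_rhp J Y" "cadjoint J = J" "0 < Re z" "mat_analytic_at Y z"
  shows "Re (hip (Y z *v v) (J *v (Y z *v v))) \<le> Re (hip v (J *v v))"
  using assms loewner_le_congruence_iff unfolding contractive_in_rhp_def by blast

lemma invertible_cayley_den:
  assumes J: "cadjoint J = J" "invertible J"
    and S: "\<And>v. Re (hip (S *v v) (J *v (S *v v))) \<le> Re (hip v (J *v v))"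
  shows "invertible (cayley_den J S)"
proof (rule invertible_injI)
  fix v assume "cayley_den J S *v v = 0"
  then show "v = 0" using cayley_den_lower_bound[OF J S, of v] by simp
qed

text \<open>Wherever \<open>Y\<close> is analytic the inverse of the denominator has bounded
  entries, with a constant independent of the point. The poles of \<open>Y\<close> are isolated,
  hence removable for this inverse, so \<open>F\<close> is holomorphic and bounded on the whole half
  plane.\<close>

lemma cayley_inverse_exists:
  fixes Y :: "complex \<Rightarrow> 'p::finite cmat"
  assumes Y: "mat_meromorphic_on Y right_half_plane" and c: "contractive_in_rhp J Y"
    and J: "cadjoint J = J" "invertible J"
  obtains F where "mhol F right_half_plane"
    "\<And>z. 0 < Re z \<Longrightarrow> mat_analytic_at Y z \<Longrightarrow>
       F z ** cayley_den J (Y z) = mat 1 \<and> cayley_den J (Y z) ** F z = mat 1"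
    "\<And>z i j. 0 < Re z \<Longrightarrow> norm (F z $ i $ j) \<le> 1 + norm (matrix_inv J)"
proof -
  let ?A = "\<lambda>w. cayley_den J (Y w)" and ?K = "1 + norm (matrix_inv J)"
  have inv: "invertible (?A w)" if "0 < Re w" "mat_analytic_at Y w" for w
    using invertible_cayley_den[OF J] contractive_in_rhpD[OF c J(1) that] by blast
  have bound: "norm (matrix_inv (?A w) $ i $ j) \<le> ?K" if w: "0 < Re w" "mat_analytic_at Y w" for w i j
  proof -
    have "norm (matrix_inv (?A w) *v axis j 1) \<le> ?K * norm (?A w *v (matrix_inv (?A w) *v axis j 1))"
      by (rule cayley_den_lower_bound[OF J contractive_in_rhpD[OF c J(1) w]])
    also have "\<dots> = ?K"
      by (simp add: matrix_vector_mul_assoc minv_right[OF inv[OF w]])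
    finally have "norm (matrix_inv (?A w) *v axis j 1) \<le> ?K" .
    moreover have "(matrix_inv (?A w) *v axis j 1) $ i = matrix_inv (?A w) $ i $ j"
      by (simp add: matrix_vector_mult_def axis_def if_distrib cong: if_cong)
    ultimately show ?thesis using Finite_Cartesian_Product.norm_nth_le order_trans by metis
  qed
  have holA: "mhol (\<lambda>w. matrix_inv (?A w)) U" if "U \<subseteq> right_half_plane" "mhol Y U" "\<And>w. w \<in> U \<Longrightarrow> mat_analytic_at Y w" for U
    using that inv unfolding cayley_den_def by (intro mhol_minv mhol_add mhol_mult) auto
  define F where "F z = (\<chi> i j. remove_sings (\<lambda>w. matrix_inv (?A w) $ i $ j) z)" for z
  have good: "F z = matrix_inv (?A z)" and good_an: "(\<lambda>w. matrix_inv (?A w) $ i $ j) analytic_on {z}"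
    if z: "0 < Re z" "mat_analytic_at Y z" for z i j
  proof -
    have an: "(\<lambda>w. matrix_inv (?A w) $ i $ j) analytic_on {z}" for i j
    proof -
      obtain e where e: "e > 0" "mhol Y (ball z e)" "\<And>w. w \<in> ball z e \<Longrightarrow> mat_analytic_at Y w"
        using mat_analytic_at_ball[OF z(2)] by blast
      have "mhol (\<lambda>w. matrix_inv (?A w)) (ball z e \<inter> right_half_plane)"
        using e by (intro holA) (auto intro: mhol_subset)
      moreover have "open (ball z e \<inter> right_half_plane)" using open_rhp by blast
      ultimately have "mat_analytic_at (\<lambda>w. matrix_inv (?A w)) z"
        by (rule mhol_imp_analytic_at) (use z e in auto)
      then show ?thesis unfolding mat_analytic_at_def by blast
    qed
    then show "F z = matrix_inv (?A z)" by (simp add: F_def vec_eq_iff)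
    show "(\<lambda>w. matrix_inv (?A w) $ i $ j) analytic_on {z}" by (rule an)
  qed
  have near: "\<exists>e>0. ball z e \<subseteq> right_half_plane \<and> (\<forall>w\<in>ball z e - {z}. mat_analytic_at Y w)" if "0 < Re z" for z
    by (rule mat_meromorphic_punctured[OF Y open_rhp]) (use that in simp)
  have an: "(\<lambda>z. F z $ i $ j) analytic_on {z}" if z: "0 < Re z" for z i j
  proof -
    let ?f = "\<lambda>w. matrix_inv (?A w) $ i $ j"
    obtain e where e: "e > 0" "ball z e \<subseteq> right_half_plane" "\<And>w. w \<in> ball z e - {z} \<Longrightarrow> mat_analytic_at Y w"
      using near[OF z] by blast
    have gd: "0 < Re w" "mat_analytic_at Y w" if "w \<in> ball z e - {z}" for w
      using e that by auto
    have "?f analytic_on ball z e - {z}"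
      by (subst analytic_on_analytic_at) (use good_an[OF gd] in blast)
    then have iso: "isolated_singularity_at ?f z"
      using e(1) unfolding isolated_singularity_at_def by blast
    have "eventually (\<lambda>w. w \<in> ball z e - {z}) (at z)"
      using e(1) by (intro eventually_at_in_open) auto
    then have "eventually (\<lambda>w. norm (?f w) \<le> ?K) (at z)"
      by (rule eventually_mono) (rule bound[OF gd])
    then have "remove_sings ?f analytic_on {z}"
      by (rule analytic_remove_sings_bounded[OF iso])
    then show ?thesis by (simp add: F_def)
  qed
  have hol: "mhol F right_half_plane"
  proof (rule mholI, rule analytic_imp_holomorphic)
    show "(\<lambda>z. F z $ i $ j) analytic_on right_half_plane" for i j
      by (subst analytic_on_analytic_at) (use an in auto)
  qed
  moreover have "norm (F z $ i $ j) \<le> ?K" if z: "0 < Re z" for z i j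
  proof -
    obtain e where e: "e > 0" "ball z e \<subseteq> right_half_plane" "\<And>w. w \<in> ball z e - {z} \<Longrightarrow> mat_analytic_at Y w"
      using near[OF z] by blast
    have gd: "0 < Re w" "mat_analytic_at Y w" if "w \<in> ball z e - {z}" for w
      using e that by auto
    have "((\<lambda>w. norm (F w $ i $ j)) \<longlongrightarrow> norm (F z $ i $ j)) (at z)"
      using analytic_at_imp_isCont[OF an[OF z]] by (intro tendsto_norm) (simp add: isCont_def)
    moreover have "eventually (\<lambda>w. w \<in> ball z e - {z}) (at z)"
      using e(1) by (intro eventually_at_in_open) auto
    then have "eventually (\<lambda>w. norm (F w $ i $ j) \<le> ?K) (at z)"
      by (rule eventually_mono) (use bound[OF gd] good[OF gd] in simp)
    ultimately show ?thesis by (rule tendsto_upperbound) simp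
  qed
  moreover have "F z ** ?A z = mat 1 \<and> ?A z ** F z = mat 1" if "0 < Re z" "mat_analytic_at Y z" for z
    using good[OF that] minv_left[OF inv[OF that]] minv_right[OF inv[OF that]] by simp
  ultimately show ?thesis using that by blast
qed

text \<open>If \<open>F z\<close> is invertible, solving the definition of the denominator for
  \<open>S\<close> expresses \<open>Y\<close> through the inverse of \<open>F\<close> near
  \<open>z\<close>, with a finite limit. So the poles of \<open>Y\<close> are exactly the zeros of
  \<open>det (F z)\<close>.\<close>

lemma analytic_at_iff_invertible_cayley_inverse:
  fixes Y :: "complex \<Rightarrow> 'p::finite cmat"
  assumes Y: "mat_meromorphic_on Y right_half_plane" and F: "mhol F right_half_plane"
    and FA: "\<And>z. 0 < Re z \<Longrightarrow> mat_analytic_at Y z \<Longrightarrow> F z ** cayley_den J (Y z) = mat 1"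
    and J: "invertible (mat 1 - J)" and z: "0 < Re z"
  shows "mat_analytic_at Y z \<longleftrightarrow> invertible (F z)"
proof
  assume "mat_analytic_at Y z"
  then show "invertible (F z)" using FA[OF z] invertibleI by blast
next
  assume inv: "invertible (F z)"
  have "isCont F z"
    using mhol_continuous_on[OF F] continuous_on_eq_continuous_at[OF open_rhp, of F] z by simp
  then have "((\<lambda>w. matrix_inv (mat 1 - J) ** (matrix_inv (F w) - (mat 1 + J))) \<longlongrightarrow>
      matrix_inv (mat 1 - J) ** (matrix_inv (F z) - (mat 1 + J))) (at z)"
    by (intro tendsto_mm tendsto_const tendsto_diff tendsto_minv[OF _ inv]) (simp add: isCont_def)
  moreover have "eventually (\<lambda>w. Y w = matrix_inv (mat 1 - J) ** (matrix_inv (F w) - (mat 1 + J))) (at z)"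
  proof -
    obtain e where e: "e > 0" "ball z e \<subseteq> right_half_plane" "\<And>w. w \<in> ball z e - {z} \<Longrightarrow> mat_analytic_at Y w"
      using mat_meromorphic_punctured[OF Y open_rhp, of z] z by auto
    have "eventually (\<lambda>w. w \<in> ball z e - {z}) (at z)"
      using e(1) by (intro eventually_at_in_open) auto
    then show ?thesis
    proof (rule eventually_mono)
      fix w assume w: "w \<in> ball z e - {z}"
      then have "F w ** cayley_den J (Y w) = mat 1" using FA e by blast
      then have "matrix_inv (F w) = cayley_den J (Y w)" by (rule matrix_inv_eqI)
      then show "Y w = matrix_inv (mat 1 - J) ** (matrix_inv (F w) - (mat 1 + J))"
        by (simp add: cayley_den_def minv_left'[OF J])
    qed
  qed
  ultimately show "mat_analytic_at Y z"
    using mat_meromorphic_analytic_atI[OF Y, of z] z by auto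
qed

lemma contractive_cayley_exists:
  fixes Y :: "complex \<Rightarrow> 'p::finite cmat"
  assumes Y: "mat_meromorphic_on Y right_half_plane" and c: "contractive_in_rhp J Y"
    and J: "cadjoint J = J" "invertible J" and small: "invertible (mat 1 - J)"
  obtains \<Theta> where "mhol \<Theta> right_half_plane"
    "\<And>z v. 0 < Re z \<Longrightarrow> norm (\<Theta> z *v v) \<le> norm v"
    "\<And>z. 0 < Re z \<Longrightarrow> mat_analytic_at Y z \<Longrightarrow> \<Theta> z ** cayley_den J (Y z) = cayley_num J (Y z)"
proof -
  obtain F where F: "mhol F right_half_plane"
    "\<And>z. 0 < Re z \<Longrightarrow> mat_analytic_at Y z \<Longrightarrow>
       F z ** cayley_den J (Y z) = mat 1 \<and> cayley_den J (Y z) ** F z = mat 1"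
    by (rule cayley_inverse_exists[OF Y c J]) blast
  \<comment> \<open>Solved from \<open>(I + J) den - 4 J = (I - J) num\<close>. Written through
    \<open>F\<close>, the quotient of numerator and denominator is visibly holomorphic also at the
    poles of \<open>Y\<close>.\<close>
  define \<Theta> where "\<Theta> z = matrix_inv (mat 1 - J) ** ((mat 1 + J) - mat 4 ** (J ** F z))" for z
  have hol: "mhol \<Theta> right_half_plane"
    unfolding \<Theta>_def by (intro mhol_mult mhol_diff mhol_const F)
  have eq: "\<Theta> z ** cayley_den J (Y z) = cayley_num J (Y z)" if z: "0 < Re z" "mat_analytic_at Y z" for z
  proof -
    let ?A = "cayley_den J (Y z)" and ?B = "cayley_num J (Y z)"
    have four: "mat 4 ** X = X + X + X + X" for X :: "'p cmat"
      by (simp add: vec_eq_iff mat_mult_nth)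
    have "(mat 1 + J) ** ?A - mat 4 ** J = (mat 1 - J) ** ?B"
      unfolding four by (simp add: cayley_den_def cayley_num_def mm_algebra matrix_mul_assoc algebra_simps)
    moreover have "((mat 1 + J) - mat 4 ** (J ** F z)) ** ?A = (mat 1 + J) ** ?A - mat 4 ** J"
      using F(2)[OF z] by (simp add: mm_diff_left matrix_mul_assoc[symmetric])
    ultimately have "\<Theta> z ** ?A = matrix_inv (mat 1 - J) ** ((mat 1 - J) ** ?B)"
      by (simp add: \<Theta>_def matrix_mul_assoc[symmetric])
    then show ?thesis by (simp add: minv_left'[OF small])
  qed
  have good: "norm (\<Theta> z *v v) \<le> norm v" if z: "0 < Re z" "mat_analytic_at Y z" for z v
  proof -
    have "norm (cayley_num J (Y z) *v (F z *v v)) \<le> norm (cayley_den J (Y z) *v (F z *v v))"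
      by (rule cayley_contraction[OF J(1) contractive_in_rhpD[OF c J(1) z]])
    then show ?thesis
      using F(2)[OF z] unfolding eq[OF z, symmetric]
      by (simp add: matrix_vector_mul_assoc matrix_mul_assoc[symmetric])
  qed
  have "norm (\<Theta> z *v v) \<le> norm v" if z: "0 < Re z" for z v
  proof -
    obtain e where e: "e > 0" "ball z e \<subseteq> right_half_plane" "\<And>w. w \<in> ball z e - {z} \<Longrightarrow> mat_analytic_at Y w"
      using mat_meromorphic_punctured[OF Y open_rhp, of z] z by auto
    have "isCont \<Theta> z"
      using mhol_continuous_on[OF hol] continuous_on_eq_continuous_at[OF open_rhp, of \<Theta>] z by simp
    then have "((\<lambda>w. norm (\<Theta> w *v v)) \<longlongrightarrow> norm (\<Theta> z *v v)) (at z)"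
      by (intro tendsto_norm tendsto_mv tendsto_const) (simp add: isCont_def)
    moreover have "eventually (\<lambda>w. w \<in> ball z e - {z}) (at z)"
      using e(1) by (intro eventually_at_in_open) auto
    then have "eventually (\<lambda>w. norm (\<Theta> w *v v) \<le> norm v) (at z)"
      by (rule eventually_mono) (use good e in blast)
    ultimately show ?thesis by (rule tendsto_upperbound) simp
  qed
  then show ?thesis using that hol eq by blast
qed

lemma tendsto_hip: "(f \<longlongrightarrow> a) F \<Longrightarrow> (g \<longlongrightarrow> b) F \<Longrightarrow> ((\<lambda>x. hip (f x) (g x)) \<longlongrightarrow> hip a b) F"
  unfolding hip_def by (intro tendsto_intros)

lemma invertible_mat: "c \<noteq> 0 \<Longrightarrow> invertible (mat c :: complex ^ 'n ^ 'n)"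
  by (rule invertibleI[of _ "mat (1 / c)"]) (simp add: mat_mult_mat)

text \<open>The gain \<open>Re z\<close> on the left is the Julia--Caratheodory type estimate
  at the point \<open>\<infinity>\<close>, where \<open>Y = I\<close>.\<close>

lemma contractive_julia_small:
  fixes Y :: "complex \<Rightarrow> 'p::finite cmat"
  assumes Y: "mat_meromorphic_on Y right_half_plane" and c: "contractive_in_rhp J Y"
    and inf: "mat_analytic_at_infinity Y (mat 1)"
    and J: "cadjoint J = J" "invertible J" and small: "invertible (mat 1 - J)"
  shows "\<exists>C>0. \<forall>z u. 0 < Re z \<longrightarrow> mat_analytic_at Y z \<longrightarrow>
    Re z * (norm (u - Y z *v u))\<^sup>2 \<le> C * (Re (hip u (J *v u)) - Re (hip (Y z *v u) (J *v (Y z *v u))))"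
proof -
  let ?A = "\<lambda>z. cayley_den J (Y z)" and ?B = "\<lambda>z. cayley_num J (Y z)"
  let ?two = "mat 2 :: 'p cmat"
  obtain \<Theta> where \<Theta>: "mhol \<Theta> right_half_plane"
    "\<And>z v. 0 < Re z \<Longrightarrow> norm (\<Theta> z *v v) \<le> norm v"
    "\<And>z. 0 < Re z \<Longrightarrow> mat_analytic_at Y z \<Longrightarrow> \<Theta> z ** ?A z = ?B z"
    by (rule contractive_cayley_exists[OF Y c J small]) blast
  obtain R Y1 where R: "R > 0" "mhol Y (outside R)" "(Y \<longlongrightarrow> mat 1) at_infinity"
    "((\<lambda>z. mat z ** (Y z - mat 1)) \<longlongrightarrow> Y1) at_infinity"
    by (rule mat_analytic_at_infinityE[OF inf])
  have inv2: "invertible ?two" by (simp add: invertible_mat)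
  have two: "?two = mat 1 + mat 1" by (simp add: vec_eq_iff mat_def)
  have two': "?two ** X = X + X" for X :: "'p cmat" by (simp add: vec_eq_iff mat_mult_nth)
  have Ainv: "invertible (?A z)" if "0 < Re z" "mat_analytic_at Y z" for z
    using invertible_cayley_den[OF J] contractive_in_rhpD[OF c J(1) that] by blast
  have an: "mat_analytic_at Y z" if "R < norm z" for z
    by (rule mhol_imp_analytic_at[OF R(2) open_outside]) (use that in simp)
  have Alim: "(?A \<longlongrightarrow> ?two) rhp_infinity" and Blim: "(?B \<longlongrightarrow> ?two) rhp_infinity"
  proof -
    have "((\<lambda>z. mat 1 + J + (mat 1 - J) ** Y z) \<longlongrightarrow> mat 1 + J + (mat 1 - J) ** mat 1) at_infinity"
      by (intro tendsto_intros tendsto_mm R)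
    then show "(?A \<longlongrightarrow> ?two) rhp_infinity"
      by (auto simp: cayley_den_def two mm_algebra intro!: tendsto_rhp_infinity)
    have "((\<lambda>z. mat 1 - J + (mat 1 + J) ** Y z) \<longlongrightarrow> mat 1 - J + (mat 1 + J) ** mat 1) at_infinity"
      by (intro tendsto_intros tendsto_mm R)
    then show "(?B \<longlongrightarrow> ?two) rhp_infinity"
      by (auto simp: cayley_num_def two mm_algebra intro!: tendsto_rhp_infinity)
  qed
  have Ailim: "((\<lambda>z. matrix_inv (?A z)) \<longlongrightarrow> matrix_inv ?two) rhp_infinity"
    by (rule tendsto_minv[OF Alim inv2])
  have ev: "eventually (\<lambda>z. 0 < Re z \<and> mat_analytic_at Y z) rhp_infinity"
    unfolding eventually_rhp_infinity using an by blast
  have \<Theta>_eq: "\<Theta> z = ?B z ** matrix_inv (?A z)" if "0 < Re z" "mat_analytic_at Y z" for z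
    using \<Theta>(3)[OF that, symmetric] Ainv[OF that]
    by (simp add: matrix_mul_assoc[symmetric] minv_right)
  have \<Theta>lim: "(\<Theta> \<longlongrightarrow> mat 1) rhp_infinity"
  proof -
    have "((\<lambda>z. ?B z ** matrix_inv (?A z)) \<longlongrightarrow> ?two ** matrix_inv ?two) rhp_infinity"
      by (intro tendsto_mm Blim Ailim)
    moreover have "eventually (\<lambda>z. ?B z ** matrix_inv (?A z) = \<Theta> z) rhp_infinity"
      using ev by eventually_elim (simp add: \<Theta>_eq)
    ultimately show ?thesis by (simp add: tendsto_cong minv_right[OF inv2])
  qed
  \<comment> \<open>If the contraction \<open>\<Theta> z\<close> had eigenvalue -1 with eigenvector
    \<open>x\<close>, the function \<open><x, \<Theta> x>\<close> would attain its maximal modulus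
    at \<open>z\<close> and be constant, whereas \<open>\<Theta>\<close> tends to the identity at
    infinity.\<close>
  have inv: "invertible (mat 1 + \<Theta> z)" if z: "0 < Re z" for z
  proof (rule invertible_injI)
    fix x assume "(mat 1 + \<Theta> z) *v x = 0"
    then have \<Theta>x: "\<Theta> z *v x = - x" by (simp add: mv_algebra add_eq_0_iff)
    let ?h = "\<lambda>w. hip x (\<Theta> w *v x)"
    have hz: "?h z = - of_real ((norm x)\<^sup>2)"
      unfolding \<Theta>x using hip_self[of x] hip_diff_right[of x 0 x] by simp
    have "?h constant_on right_half_plane"
    proof (rule maximum_modulus_principle[OF holomorphic_hip[OF \<Theta>(1)] open_rhp connected_rhp open_rhp order_refl, of z])
      fix w assume "w \<in> right_half_plane"
      then have "norm (?h w) \<le> norm x * norm x"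
        using \<Theta>(2)[of w x] by (intro order_trans[OF norm_hip_le] mult_left_mono) auto
      also have "\<dots> = norm (?h z)" unfolding hz by (simp add: power2_eq_square norm_mult)
      finally show "norm (?h w) \<le> norm (?h z)" .
    qed (use z in simp)
    then have const: "?h w = ?h z" if "0 < Re w" for w
      using that z unfolding constant_on_def by auto
    have "(?h \<longlongrightarrow> hip x (mat 1 *v x)) rhp_infinity"
      by (intro tendsto_hip tendsto_mv \<Theta>lim tendsto_const)
    moreover have "(?h \<longlongrightarrow> ?h z) rhp_infinity"
      by (rule tendsto_eventually) (use const in \<open>auto simp: eventually_rhp_infinity\<close>)
    ultimately have "hip x (mat 1 *v x) = ?h z"
      using tendsto_unique[OF rhp_infinity_neq_bot] by blast
    then have "complex_of_real (2 * (norm x)\<^sup>2) = 0" unfolding hz by (simp add: hip_self)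
    then show "x = 0" by (simp only: of_real_eq_0_iff) simp
  qed
  \<comment> \<open>The Cayley transform from contractions to functions with nonnegative real part.
    In terms of \<open>Y\<close> it sends \<open>u + Y u\<close> to \<open>J (u - Y u)\<close>, so
    its real part at \<open>u + Y u\<close> is the defect of \<open>Y\<close>.\<close>
  define H where "H z = (mat 1 - \<Theta> z) ** matrix_inv (mat 1 + \<Theta> z)" for z
  have H\<Theta>: "H z ** (mat 1 + \<Theta> z) = mat 1 - \<Theta> z" if "0 < Re z" for z
    by (simp add: H_def matrix_mul_assoc[symmetric] minv_left[OF inv[OF that]])
  have holH: "mhol H right_half_plane"
    unfolding H_def by (intro mhol_mult mhol_diff mhol_add mhol_const mhol_minv \<Theta>(1)) (use inv in auto)
  have posH: "0 \<le> Re (hip x (H z *v x))" if z: "0 < Re z" for z x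
  proof -
    define v where "v = matrix_inv (mat 1 + \<Theta> z) *v x"
    have x: "x = v + \<Theta> z *v v"
      using minv_right[OF inv[OF z]] unfolding v_def
      by (metis matrix_vector_mul_assoc matrix_vector_mul_lid mv_add_left)
    have "H z *v x = v - \<Theta> z *v v"
      unfolding H_def v_def by (simp add: matrix_vector_mul_assoc[symmetric] mv_algebra)
    then have "Re (hip x (H z *v x)) = (norm v)\<^sup>2 - (norm (\<Theta> z *v v))\<^sup>2"
      unfolding x by (simp add: Re_hip_sum_diff)
    also have "\<dots> \<ge> 0" using \<Theta>(2)[OF z, of v] by (simp add: power_mono)
    finally show ?thesis .
  qed
  have num: "?A z - ?B z = ?two ** (J ** (mat 1 - Y z))" for z
    unfolding two' by (simp add: cayley_den_def cayley_num_def mm_algebra algebra_simps)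
  \<comment> \<open>\<open>I - \<Theta>\<close> is the difference of denominator and numerator
    divided by the denominator, and that difference is a multiple of \<open>I - Y\<close>, of order
    \<open>1 / z\<close>. Hence \<open>z H\<close> has a limit at infinity.\<close>
  have "((\<lambda>z. - (?two ** (J ** (mat z ** (Y z - mat 1)))) ** matrix_inv (?A z) ** matrix_inv (mat 1 + \<Theta> z)) \<longlongrightarrow>
      - (?two ** (J ** Y1)) ** matrix_inv ?two ** matrix_inv (mat 1 + mat 1)) rhp_infinity"
    using inv2 by (intro tendsto_mm tendsto_minus tendsto_const tendsto_rhp_infinity[OF R(4)] Ailim
        tendsto_minv tendsto_add \<Theta>lim) (simp add: two)
  moreover have "eventually (\<lambda>z. - (?two ** (J ** (mat z ** (Y z - mat 1)))) ** matrix_inv (?A z) ** matrix_inv (mat 1 + \<Theta> z)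
      = mat z ** H z) rhp_infinity"
    using ev
  proof eventually_elim
    case (elim z)
    then have g: "0 < Re z" "mat_analytic_at Y z" by auto
    have "mat 1 - \<Theta> z = (?A z - ?B z) ** matrix_inv (?A z)"
      using \<Theta>_eq[OF g] minv_right[OF Ainv[OF g]] by (simp add: mm_diff_left)
    moreover have "- (?two ** (J ** (mat z ** (Y z - mat 1)))) = mat z ** (?A z - ?B z)"
    proof -
      have "mat z ** (?A z - ?B z) = ?two ** (J ** (mat z ** (mat 1 - Y z)))"
        by (simp only: num mat_left_commute[of ?two z] mat_left_commute[of J z])
      moreover have "mat z ** (mat 1 - Y z) = - (mat z ** (Y z - mat 1))"
        by (simp add: mm_diff_right)
      ultimately show ?thesis by (simp add: mm_minus_right)
    qed
    ultimately show ?case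
      by (simp add: H_def matrix_mul_assoc)
  qed
  ultimately obtain M where M: "((\<lambda>z. mat z ** H z) \<longlongrightarrow> M) rhp_infinity"
    by (auto simp: tendsto_cong)
  define C where "C = norm M + 1"
  have C: "C > 0" "norm M \<le> C" by (auto simp: C_def add_nonneg_pos)
  \<comment> \<open>\<open>K\<close> converts the bound for \<open>J (u - Y u)\<close>, which the
    Julia estimate provides, into one for \<open>u - Y u\<close>.\<close>
  define K where "K = norm (matrix_inv J)"
  show ?thesis
  proof (intro exI[of _ "K\<^sup>2 * C + 1"] conjI allI impI)
    show "K\<^sup>2 * C + 1 > 0" using C by (simp add: add_nonneg_pos)
    fix z u assume z: "0 < Re z" "mat_analytic_at Y z"
    let ?x = "u + Y z *v u" and ?y = "u - Y z *v u"
    have Hx: "H z *v ?x = J *v ?y"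
    proof -
      have \<Theta>A: "\<Theta> z *v (?A z *v u) = ?B z *v u"
        by (simp add: matrix_vector_mul_assoc \<Theta>(3)[OF z])
      have "H z *v ((mat 1 + \<Theta> z) *v (?A z *v u)) = (mat 1 - \<Theta> z) *v (?A z *v u)"
        by (simp only: matrix_vector_mul_assoc[of "H z"] H\<Theta>[OF z(1)])
      moreover have "(mat 1 + \<Theta> z) *v (?A z *v u) = 2 *\<^sub>R ?x"
        using cayley_sum[of J "Y z" u] by (simp add: mv_algebra \<Theta>A)
      moreover have "(mat 1 - \<Theta> z) *v (?A z *v u) = 2 *\<^sub>R (J *v ?y)"
        using cayley_diff[of J "Y z" u] by (simp add: mv_algebra \<Theta>A)
      ultimately show ?thesis
        by (simp add: bounded_bilinear.scaleR_right[OF bounded_bilinear_matrix_vector_mult])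
    qed
    define D where "D = Re (hip u (J *v u)) - Re (hip (Y z *v u) (J *v (Y z *v u)))"
    have D: "Re z * (norm (J *v ?y))\<^sup>2 \<le> C * D"
      using positive_real_julia[OF holH[unfolded] posH M C z(1), of ?x]
      unfolding Hx by (simp add: Re_hip_self_adjoint_sum_diff[OF J(1)] D_def)
    have D0: "D \<ge> 0" using contractive_in_rhpD[OF c J(1) z, of u] by (simp add: D_def)
    have "norm ?y \<le> K * norm (J *v ?y)"
      using norm_matrix_vector_mult[of "matrix_inv J" "J *v ?y"]
      by (simp add: K_def matrix_vector_mul_assoc minv_left[OF J(2)])
    then have "(norm ?y)\<^sup>2 \<le> K\<^sup>2 * (norm (J *v ?y))\<^sup>2"
      by (metis norm_ge_zero power_mono power_mult_distrib)
    then have "Re z * (norm ?y)\<^sup>2 \<le> Re z * (K\<^sup>2 * (norm (J *v ?y))\<^sup>2)"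
      using z by (intro mult_left_mono) auto
    also have "\<dots> = K\<^sup>2 * (Re z * (norm (J *v ?y))\<^sup>2)" by simp
    also have "\<dots> \<le> K\<^sup>2 * (C * D)" using D by (intro mult_left_mono) auto
    also have "\<dots> \<le> (K\<^sup>2 * C + 1) * D" using D0 by (simp add: algebra_simps)
    finally show "Re z * (norm ?y)\<^sup>2 \<le> (K\<^sup>2 * C + 1) *
        (Re (hip u (J *v u)) - Re (hip (Y z *v u) (J *v (Y z *v u))))"
      by (simp add: D_def)
  qed
qed

lemma contractive_in_rhp_scaleR:
  assumes "contractive_in_rhp J Y" "r \<ge> 0" "cadjoint J = J"
  shows "contractive_in_rhp (r *\<^sub>R J) Y"
  unfolding contractive_in_rhp_def
proof (intro ballI impI)
  fix z assume z: "z \<in> right_half_plane" "mat_analytic_at Y z"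
  have sa: "cadjoint (r *\<^sub>R J) = r *\<^sub>R J" by (simp add: cadjoint_scaleR assms)
  have sc: "hip v ((r *\<^sub>R J) *v v) = of_real r * hip v (J *v v)" for v
    by (simp add: bounded_bilinear.scaleR_left[OF bounded_bilinear_matrix_vector_mult] hip_scaleR_right)
  show "loewner_le (cadjoint (Y z) ** r *\<^sub>R J ** Y z) (r *\<^sub>R J)"
    unfolding loewner_le_congruence_iff[OF sa] sc
    using contractive_in_rhpD[OF assms(1,3) _ z(2)] z(1) assms(2) by (simp add: mult_left_mono)
qed

lemma invertible_scaleR: "r \<noteq> 0 \<Longrightarrow> invertible A \<Longrightarrow> invertible (r *\<^sub>R A :: complex ^ 'n ^ 'n)"
  by (rule invertibleI[of _ "inverse r *\<^sub>R matrix_inv A"])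
    (simp add: mm_scaleR_left mm_scaleR_right minv_right)

lemma invertible_1_minus_small: "norm J < 1 \<Longrightarrow> invertible (mat 1 - J :: complex ^ 'n ^ 'n)"
  using invertible_near_1[of "mat 1 - J" "norm J"] by simp

text \<open>Multiplying the form by a positive number changes neither contractivity nor the shape of
  the estimate, and it makes \<open>J\<close> small enough for \<open>mat 1 - J\<close> to be
  invertible.\<close>

lemma contractive_julia:
  fixes Y :: "complex \<Rightarrow> 'p::finite cmat"
  assumes Y: "mat_meromorphic_on Y right_half_plane" and c: "contractive_in_rhp J Y"
    and inf: "mat_analytic_at_infinity Y (mat 1)"
    and J: "cadjoint J = J" "invertible J"
  shows "\<exists>C>0. \<forall>z u. 0 < Re z \<longrightarrow> mat_analytic_at Y z \<longrightarrow>
    Re z * (norm (u - Y z *v u))\<^sup>2 \<le> C * (Re (hip u (J *v u)) - Re (hip (Y z *v u) (J *v (Y z *v u))))"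
proof -
  define r where "r = 1 / (norm J + 1)"
  have r: "r > 0" by (simp add: r_def add_nonneg_pos)
  have "norm (r *\<^sub>R J) < 1" by (simp add: r_def pos_divide_less_eq add_nonneg_pos)
  then have small: "invertible (mat 1 - r *\<^sub>R J)" by (rule invertible_1_minus_small)
  have "cadjoint (r *\<^sub>R J) = r *\<^sub>R J" "invertible (r *\<^sub>R J)"
    using J r by (simp_all add: cadjoint_scaleR invertible_scaleR)
  from contractive_julia_small[OF Y contractive_in_rhp_scaleR[OF c] inf this small]
  obtain C where C: "C > 0" "\<And>z u. 0 < Re z \<Longrightarrow> mat_analytic_at Y z \<Longrightarrow>
    Re z * (norm (u - Y z *v u))\<^sup>2 \<le> C * (Re (hip u ((r *\<^sub>R J) *v u)) - Re (hip (Y z *v u) ((r *\<^sub>R J) *v (Y z *v u))))"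
    using r J(1) by auto
  have "hip v ((r *\<^sub>R J) *v v) = of_real r * hip v (J *v v)" for v
    by (simp add: bounded_bilinear.scaleR_left[OF bounded_bilinear_matrix_vector_mult] hip_scaleR_right)
  then have "Re z * (norm (u - Y z *v u))\<^sup>2 \<le> (C * r) * (Re (hip u (J *v u)) - Re (hip (Y z *v u) (J *v (Y z *v u))))"
    if "0 < Re z" "mat_analytic_at Y z" for z u
    using C(2)[OF that, of u] by (simp add: algebra_simps)
  then show ?thesis using C(1) r by (intro exI[of _ "C * r"]) auto
qed

section \<open>Boundary values\<close>

lemma stolz_filter_neq_bot:
  "M \<ge> 0 \<Longrightarrow> at (Complex 0 y) within {z. 0 < Re z \<and> \<bar>Im z - y\<bar> \<le> M * Re z} \<noteq> bot"
proof -
  assume M: "M \<ge> 0"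
  have "Complex 0 y islimpt {z. 0 < Re z \<and> \<bar>Im z - y\<bar> \<le> M * Re z}"
    unfolding islimpt_approachable
  proof (intro allI impI)
    fix e :: real assume e: "e > 0"
    have "Complex (e / 2) y \<in> {z. 0 < Re z \<and> \<bar>Im z - y\<bar> \<le> M * Re z}" using e M by simp
    moreover have "dist (Complex (e / 2) y) (Complex 0 y) < e"
      using e by (simp add: dist_complex_def cmod_def)
    moreover have "Complex (e / 2) y \<noteq> Complex 0 y" using e by simp
    ultimately show "\<exists>x'\<in>{z. 0 < Re z \<and> \<bar>Im z - y\<bar> \<le> M * Re z}. x' \<noteq> Complex 0 y \<and> dist x' (Complex 0 y) < e"
      by blast
  qed
  then show ?thesis by (simp add: trivial_limit_within)
qed

lemma nontangential_limit_isCont: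
  assumes "nontangential_limit F y L" "isCont F (Complex 0 y)"
  shows "L = F (Complex 0 y)"
proof -
  let ?G = "at (Complex 0 y) within {z. 0 < Re z \<and> \<bar>Im z - y\<bar> \<le> 1 * Re z}"
  have "(F \<longlongrightarrow> L) ?G" using assms(1) unfolding nontangential_limit_def by (metis zero_less_one)
  moreover have "(F \<longlongrightarrow> F (Complex 0 y)) ?G"
    using assms(2) unfolding isCont_def by (rule tendsto_within_subset[where S = UNIV]) simp
  moreover have "?G \<noteq> bot" by (rule stolz_filter_neq_bot) simp
  ultimately show ?thesis by (rule tendsto_unique[rotated 1])
qed

text \<open>If the identity failed at \<open>z\<close>, then by continuity it would fail at all
  nearby points of the axis, where the nontangential limit is the value of \<open>F\<close>; but a
  segment is not a null set.\<close>

lemma boundary_unitary_at_analytic: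
  assumes bu: "boundary_unitary J F" and an: "mat_analytic_at F z" and z: "Re z = 0"
  shows "cadjoint (F z) ** J ** F z = J"
proof (rule ccontr)
  assume ne: "cadjoint (F z) ** J ** F z \<noteq> J"
  obtain e where e: "e > 0" "mhol F (ball z e)" "\<And>w. w \<in> ball z e \<Longrightarrow> mat_analytic_at F w"
    using mat_analytic_at_ball[OF an] by blast
  have z_eq: "Complex 0 (Im z) = z" using z by (simp add: complex_eq_iff)
  let ?G = "\<lambda>w. cadjoint (F w) ** J ** F w"
  have "isCont ?G z"
    using mat_analytic_at_isCont[OF an] unfolding isCont_def
    by (intro tendsto_mm tendsto_const bounded_linear.tendsto[OF bounded_linear_cadjoint])
  moreover have "dist J (?G z) > 0" using ne by simp
  ultimately obtain d where d: "d > 0" "\<And>w. dist w z < d \<Longrightarrow> dist (?G w) (?G z) < dist J (?G z)"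
    unfolding continuous_at_eps_delta by blast
  define r where "r = min d e"
  have r: "r > 0" using d e by (simp add: r_def)
  have bad: "\<not> (\<exists>L. nontangential_limit F y L \<and> cadjoint L ** J ** L = J)" if "y \<in> ball (Im z) r" for y
  proof
    assume "\<exists>L. nontangential_limit F y L \<and> cadjoint L ** J ** L = J"
    then obtain L where L: "nontangential_limit F y L" "cadjoint L ** J ** L = J" by blast
    have "dist (Complex 0 y) z = dist y (Im z)"
      using z by (simp add: dist_complex_def cmod_def dist_real_def)
    then have dz: "dist (Complex 0 y) z < r" using that by (simp add: dist_commute)
    then have "mat_analytic_at F (Complex 0 y)"
      by (intro e(3)) (auto simp: r_def dist_commute)
    then have "L = F (Complex 0 y)"
      using nontangential_limit_isCont[OF L(1)] mat_analytic_at_isCont by blast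
    then show False using L(2) d(2)[of "Complex 0 y"] dz by (simp add: r_def)
  qed
  obtain N where N: "N \<in> null_sets lebesgue"
    "{y \<in> space lebesgue. \<not> (\<exists>L. nontangential_limit F y L \<and> cadjoint L ** J ** L = J)} \<subseteq> N"
    using bu unfolding boundary_unitary_def eventually_ae_filter by blast
  have "ball (Im z) r \<subseteq> N" using bad N(2) by (auto simp: subset_iff)
  then have "negligible (ball (Im z) r)"
    using N(1) negligible_iff_null_sets negligible_subset by blast
  then show False using open_not_negligible[of "ball (Im z) r"] r by auto
qed

section \<open>Persistence of contractivity\<close>

text \<open>Cauchy's estimate for the derivative, on discs of radius \<open>R / 2\<close> that stay
  within radius \<open>2 * R\<close>.\<close>

lemma entire_lipschitz:
  assumes f: "f holomorphic_on UNIV" and R: "R > 0" and M: "\<And>z. norm z \<le> 2 * R \<Longrightarrow> norm (f z) \<le> M"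
    and z: "norm z \<le> 3 / 2 * R" and w: "norm w \<le> 3 / 2 * R"
  shows "norm (f z - f w) \<le> 2 * M / R * norm (z - w)"
proof (rule field_differentiable_bound)
  show "convex (cball (0::complex) (3 / 2 * R))" by simp
  fix x :: complex assume x: "x \<in> cball 0 (3 / 2 * R)"
  show "(f has_field_derivative deriv f x) (at x within cball 0 (3 / 2 * R))"
    using f by (meson UNIV_I has_field_derivative_at_within holomorphic_derivI open_UNIV)
  have "norm ((deriv ^^ 1) f x) \<le> fact 1 * M / (R / 2) ^ 1"
  proof (rule Cauchy_inequality)
    show "f holomorphic_on ball x (R / 2)" by (rule holomorphic_on_subset[OF f]) simp
    show "continuous_on (cball x (R / 2)) f"
      by (rule continuous_on_subset[OF holomorphic_on_imp_continuous_on[OF f]]) simp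
    show "norm (f y) \<le> M" if "norm (x - y) = R / 2" for y
    proof (rule M)
      show "norm y \<le> 2 * R"
        using x that norm_triangle_ineq2[of y x] by (simp add: norm_minus_commute)
    qed
  qed (use R in simp)
  then show "norm (deriv f x) \<le> 2 * M / R" by (simp add: field_simps)
qed (use z w in auto)

lemma matrix_entire_lipschitz:
  fixes P :: "complex \<Rightarrow> 'p::finite cmat"
  assumes P: "mhol P UNIV" and R: "R > 0" and M: "\<And>z. norm z \<le> 2 * R \<Longrightarrow> norm (P z - mat 1) \<le> M"
    and z: "norm z \<le> 3 / 2 * R" and w: "norm w \<le> 3 / 2 * R"
  shows "norm (P z - P w) \<le> real (CARD('p) * CARD('p)) * (2 * M / R * norm (z - w))"
proof (rule norm_matrix_le_entries)
  fix i j
  have "norm ((P z - mat 1) $ i $ j - (P w - mat 1) $ i $ j) \<le> 2 * M / R * norm (z - w)"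
  proof (rule entire_lipschitz[OF _ R _ z w])
    show "(\<lambda>z. (P z - mat 1) $ i $ j) holomorphic_on UNIV"
      by (rule mholD) (intro mhol_diff P mhol_const)
    show "norm ((P z - mat 1) $ i $ j) \<le> M" if "norm z \<le> 2 * R" for z
      using M[OF that] norm_entry_le order_trans by blast
  qed
  then show "norm ((P z - P w) $ i $ j) \<le> 2 * M / R * norm (z - w)" by simp
qed

text \<open>The factor \<open>Re z\<close> comes from exact \<open>\<sigma>\<close>-unitarity on the imaginary axis.\<close>

lemma almost_unitary:
  fixes P :: "complex \<Rightarrow> 'p::finite cmat"
  assumes P: "mhol P UNIV" and R: "R > 0" and d: "\<And>z. norm z \<le> 2 * R \<Longrightarrow> norm (P z - mat 1) \<le> \<delta>"
    and d1: "\<delta> \<le> 1" and sym: "\<And>z. cadjoint (P (- cnj z)) ** \<sigma> ** P z = J"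
    and B: "norm \<sigma> \<le> B" and z: "norm z \<le> 3 / 2 * R" "0 < Re z"
  shows "\<bar>Re (hip (P z *v u) (\<sigma> *v (P z *v u))) - Re (hip u (J *v u))\<bar> \<le>
    \<delta> * (4 * real (CARD('p) * CARD('p)) * B * (norm (mat 1 :: 'p cmat) + 1) / R) * Re z * (norm u)\<^sup>2"
proof -
  let ?n = "real (CARD('p) * CARD('p))" and ?N = "norm (mat 1 :: 'p cmat)"
  let ?w = "- cnj z"
  have d0: "\<delta> \<ge> 0" using order_trans[OF norm_ge_zero d[of 0]] R by simp
  have B0: "B \<ge> 0" using order_trans[OF norm_ge_zero B] .
  \<comment> \<open>The reflected point lies at distance \<open>2 * Re z\<close>. Replacing it by
    \<open>z\<close> in the exact identity \<open>sym\<close> costs a Lipschitz constant times this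
    distance.\<close>
  have "z - ?w = of_real (2 * Re z)" by (simp add: complex_eq_iff)
  then have zw: "norm (z - ?w) = 2 * Re z" using z by (simp only: norm_of_real)
  have "norm (P z - P ?w) \<le> ?n * (2 * \<delta> / R * norm (z - ?w))"
    by (rule matrix_entire_lipschitz[OF P R d]) (use z in auto)
  then have lip: "norm (cadjoint (P z - P ?w)) \<le> ?n * (2 * \<delta> / R * (2 * Re z))"
    by (simp only: norm_cadjoint zw)
  have "norm (P z) \<le> ?N + norm (P z - mat 1)"
    using norm_triangle_ineq[of "mat 1" "P z - mat 1"] by simp
  also have "norm (P z - mat 1) \<le> 1" using d[of z] d1 z R by simp
  finally have Pz: "norm (P z) \<le> ?N + 1" by simp
  have eq: "cadjoint (P z) ** \<sigma> ** P z - J = cadjoint (P z - P ?w) ** \<sigma> ** P z"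
    using sym[of z] by (simp add: cadjoint_diff mm_diff_left)
  have "norm (cadjoint (P z) ** \<sigma> ** P z - J) \<le> ((?n * (2 * \<delta> / R * (2 * Re z))) * B) * (?N + 1)"
    unfolding eq by (intro norm_matrix_mult_le lip B Pz)
  then have nb: "norm (cadjoint (P z) ** \<sigma> ** P z - J) \<le> \<delta> * (4 * ?n * B * (?N + 1) / R) * Re z"
    by (simp add: field_simps)
  have "hip (P z *v u) (\<sigma> *v (P z *v u)) - hip u (J *v u) = hip u ((cadjoint (P z) ** \<sigma> ** P z - J) *v u)"
    by (simp add: hip_congruence[symmetric] mv_diff_left hip_diff_right)
  then have "\<bar>Re (hip (P z *v u) (\<sigma> *v (P z *v u))) - Re (hip u (J *v u))\<bar> \<le>
      norm (hip u ((cadjoint (P z) ** \<sigma> ** P z - J) *v u))"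
    by (metis abs_Re_le_cmod minus_complex.simps(1))
  also have "\<dots> \<le> norm u * (norm (cadjoint (P z) ** \<sigma> ** P z - J) * norm u)"
    by (rule order_trans[OF norm_hip_le]) (intro mult_left_mono norm_matrix_vector_mult norm_ge_zero)
  also have "\<dots> \<le> norm u * ((\<delta> * (4 * ?n * B * (?N + 1) / R) * Re z) * norm u)"
    by (intro mult_left_mono mult_right_mono nb norm_ge_zero)
  finally show ?thesis by (simp add: power2_eq_square mult_ac)
qed

lemma parallelogram: "(norm (u + v))\<^sup>2 + (norm (u - v))\<^sup>2 = 2 * ((norm u)\<^sup>2 + (norm (v :: complex ^ 'n))\<^sup>2)"
  by (simp add: power2_norm_eq_inner inner_add_left inner_add_right inner_diff_left inner_diff_right algebra_simps)

text \<open>By the parallelogram law and \<open>\<delta> \<le> 1/2\<close> the error made in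
  replacing \<open>u + v\<close> by \<open>U + V\<close> contributes at most half of
  \<open>|u + v|^2 + |u - v|^2\<close>, and the term with \<open>u + v\<close> is absorbed on the
  left.\<close>

lemma near_identity_form_estimate:
  fixes u v U V :: "complex ^ 'n"
  assumes U: "norm (U - u) \<le> \<delta> * norm u" and V: "norm (V - v) \<le> \<delta> * norm v"
    and d: "0 \<le> \<delta>" "\<delta> \<le> 1/2"
  shows "(norm (u + v))\<^sup>2 \<le> 4 * (norm (U + V))\<^sup>2 + (norm (u - v))\<^sup>2"
proof -
  define X where "X = (norm (u + v))\<^sup>2 + (norm (u - v))\<^sup>2"
  have X: "X = 2 * ((norm u)\<^sup>2 + (norm v)\<^sup>2)" unfolding X_def by (rule parallelogram)
  have "u + v = (U + V) - ((U - u) + (V - v))" by simp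
  then have "norm (u + v) \<le> norm (U + V) + norm ((U - u) + (V - v))"
    by (metis norm_triangle_ineq4)
  also have "norm ((U - u) + (V - v)) \<le> \<delta> * norm u + \<delta> * norm v"
    using norm_triangle_ineq[of "U - u" "V - v"] U V by linarith
  finally have "norm (u + v) \<le> norm (U + V) + \<delta> * (norm u + norm v)" by (simp add: algebra_simps)
  then have "(norm (u + v))\<^sup>2 \<le> (norm (U + V) + \<delta> * (norm u + norm v))\<^sup>2"
    by (intro power_mono) auto
  also have "\<dots> \<le> 2 * (norm (U + V))\<^sup>2 + 2 * (\<delta> * (norm u + norm v))\<^sup>2"
    using sum_squares_bound[of "norm (U + V)" "\<delta> * (norm u + norm v)"] by (simp only: power2_sum)
  also have "(\<delta> * (norm u + norm v))\<^sup>2 \<le> (1/4) * X"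
  proof -
    have "(norm u + norm v)\<^sup>2 \<le> X"
      using sum_squares_bound[of "norm u" "norm v"] unfolding X by (simp add: power2_sum)
    moreover have "\<delta>\<^sup>2 \<le> (1/2)\<^sup>2" using d by (intro power_mono) auto
    ultimately have "\<delta>\<^sup>2 * (norm u + norm v)\<^sup>2 \<le> (1/2)\<^sup>2 * X" by (intro mult_mono) auto
    then show ?thesis by (simp add: power_mult_distrib power2_eq_square mult_ac)
  qed
  finally show ?thesis using X_def by linarith
qed

text \<open>The estimate \<open>key\<close> leaves a loss of the order \<open>Re z\<close>; it bounds the boundary values of
  \<open>exp (- \<langle>y, H y\<rangle>)\<close> for the Cayley transform \<open>H\<close> of \<open>S\<close>, and the loss vanishes on the imaginary axis.\<close>

lemma contractivity_persists:
  fixes Y P Pi Q :: "complex \<Rightarrow> 'p::finite cmat"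
  assumes Y: "mat_meromorphic_on Y right_half_plane" and R: "R > 0" and YR: "mhol Y (outside R)"
    and julia: "\<And>z u. 0 < Re z \<Longrightarrow> mat_analytic_at Y z \<Longrightarrow> Re z * (norm (u - Y z *v u))\<^sup>2 \<le>
        C * (Re (hip u (J *v u)) - Re (hip (Y z *v u) (J *v (Y z *v u))))" and C: "C > 0"
    and sa: "cadjoint \<sigma> = \<sigma>" and B: "norm \<sigma> \<le> B"
    and P: "mhol P UNIV" and Q: "mhol Q UNIV" and Pi: "mhol Pi UNIV" "\<And>z. P z ** Pi z = mat 1"
    and symP: "\<And>z. cadjoint (P (- cnj z)) ** \<sigma> ** P z = J"
    and symQ: "\<And>z. cadjoint (Q (- cnj z)) ** \<sigma> ** Q z = J"
    and dP: "\<And>z. norm z \<le> 2 * R \<Longrightarrow> norm (P z - mat 1) \<le> \<delta>"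
    and dQ: "\<And>z. norm z \<le> 2 * R \<Longrightarrow> norm (Q z - mat 1) \<le> \<delta>"
    and d: "\<delta> \<le> 1/2" "\<delta> * (4 * real (CARD('p) * CARD('p)) * B * (norm (mat 1 :: 'p cmat) + 1) / R) \<le> 1 / (2 * C)"
    and S: "\<And>z. S z = Q z ** Y z ** Pi z"
    and SR: "\<And>z. R < norm z \<Longrightarrow> norm (S z - mat 1) \<le> 1/2" and Slim: "(S \<longlongrightarrow> mat 1) at_infinity"
    and Ssym: "\<And>z. R < norm z \<Longrightarrow> Re z = 0 \<Longrightarrow> cadjoint (S z) ** \<sigma> ** S z = \<sigma>"
    and z: "0 < Re z" "mat_analytic_at Y z"
  shows "Re (hip (S z *v v) (\<sigma> *v (S z *v v))) \<le> Re (hip v (\<sigma> *v v))"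
proof -
  define K where "K = 4 * real (CARD('p) * CARD('p)) * B * (norm (mat 1 :: 'p cmat) + 1) / R"
  have B0: "B \<ge> 0" using order_trans[OF norm_ge_zero B] .
  have d0: "\<delta> \<ge> 0" using order_trans[OF norm_ge_zero dP[of 0]] R by simp
  have K0: "K \<ge> 0" unfolding K_def using B0 R by (intro divide_nonneg_pos mult_nonneg_nonneg) auto
  \<comment> \<open>\<open>\<delta> * K\<close> is the rate of loss in
    \<open>almost_unitary\<close>. The factor 2 remains after \<open>|u|^2 + |y|^2\<close> is
    bounded through \<open>|w + S w|^2\<close> and \<open>|u - y|^2\<close>.\<close>
  define \<kappa> where "\<kappa> = 2 * (\<delta> * K)"
  have \<kappa>0: "\<kappa> \<ge> 0" using d0 K0 by (simp add: \<kappa>_def)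
  define good where "good z \<longleftrightarrow> 0 < Re z \<and> mat_analytic_at Y z \<or> R < norm z" for z
  have PiP: "Pi z ** P z = mat 1" for z using Pi(2) mult_eq_1_commute by blast
  have anR: "mat_analytic_at Y w" if "R < norm w" for w
    by (rule mhol_imp_analytic_at[OF YR open_outside]) (use that in simp)
  \<comment> \<open>In the coordinates \<open>u = Pi w\<close> and \<open>y = Y u\<close> the defect
    of \<open>S\<close> at \<open>w\<close> is that of \<open>Y\<close> at \<open>u\<close>, up to
    the errors of \<open>P\<close> and \<open>Q\<close>. The gain is
    \<open>Re z |u - y|^2 / C\<close>; half of it absorbs the errors along \<open>u - y\<close>, and
    a loss in \<open>w + S w\<close> is left.\<close>
  have key: "Re (hip w (\<sigma> *v w)) - Re (hip (S z *v w) (\<sigma> *v (S z *v w))) \<ge>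
       Re z * ((norm (Pi z *v w - Y z *v (Pi z *v w)))\<^sup>2 / (2 * C) - \<kappa> * (norm (w + S z *v w))\<^sup>2)"
    and key0: "w + S z *v w = 0 \<Longrightarrow> w = 0"
    if z: "0 < Re z" "mat_analytic_at Y z" "norm z \<le> 3 / 2 * R" for z w
  proof -
    define u where "u = Pi z *v w"
    define y where "y = Y z *v u"
    have w: "w = P z *v u" by (simp add: u_def matrix_vector_mul_assoc Pi)
    have Sw: "S z *v w = Q z *v y" unfolding S u_def y_def by (simp add: matrix_vector_mul_assoc matrix_mul_assoc)
    have zR: "norm z \<le> 2 * R" using z R by simp
    have n1: "norm (P z *v u - u) \<le> \<delta> * norm u" and n2: "norm (Q z *v y - y) \<le> \<delta> * norm y"
      using order_trans[OF norm_matrix_vector_mult mult_right_mono[OF dP[OF zR]], of u]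
        order_trans[OF norm_matrix_vector_mult mult_right_mono[OF dQ[OF zR]], of y]
      by (simp_all add: mv_diff_left)
    have a1: "\<bar>Re (hip (P z *v u) (\<sigma> *v (P z *v u))) - Re (hip u (J *v u))\<bar> \<le> \<delta> * K * Re z * (norm u)\<^sup>2"
      unfolding K_def by (rule almost_unitary[OF P R dP _ symP B z(3,1)]) (use d in auto)
    have a2: "\<bar>Re (hip (Q z *v y) (\<sigma> *v (Q z *v y))) - Re (hip y (J *v y))\<bar> \<le> \<delta> * K * Re z * (norm y)\<^sup>2"
      unfolding K_def by (rule almost_unitary[OF Q R dQ _ symQ B z(3,1)]) (use d in auto)
    define E where "E = Re (hip w (\<sigma> *v w)) - Re (hip (S z *v w) (\<sigma> *v (S z *v w)))"
    have par: "(norm (u + y))\<^sup>2 + (norm (u - y))\<^sup>2 = 2 * ((norm u)\<^sup>2 + (norm y)\<^sup>2)"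
      by (rule parallelogram)
    have est: "(norm (u + y))\<^sup>2 \<le> 4 * (norm (w + S z *v w))\<^sup>2 + (norm (u - y))\<^sup>2"
      unfolding Sw by (subst w, rule near_identity_form_estimate[OF n1 n2 d0 d(1)])
    have "Re z * (norm (u - y))\<^sup>2 / C \<le> Re (hip u (J *v u)) - Re (hip y (J *v y))"
      using julia[OF z(1,2), of u] C by (simp add: y_def pos_divide_le_eq mult.commute)
    then have "E \<ge> Re z * (norm (u - y))\<^sup>2 / C - \<delta> * K * Re z * ((norm u)\<^sup>2 + (norm y)\<^sup>2)"
      using a1 a2 unfolding E_def Sw by (subst (1 2) w) (simp add: algebra_simps abs_le_iff)
    moreover have "\<delta> * K * Re z * ((norm u)\<^sup>2 + (norm y)\<^sup>2) \<le>
        \<delta> * K * Re z * (2 * (norm (w + S z *v w))\<^sup>2 + (norm (u - y))\<^sup>2)"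
      using par est d0 K0 z by (intro mult_left_mono) auto
    moreover have "\<delta> * K * Re z * (2 * (norm (w + S z *v w))\<^sup>2 + (norm (u - y))\<^sup>2) =
        Re z * \<kappa> * (norm (w + S z *v w))\<^sup>2 + (\<delta> * K) * (Re z * (norm (u - y))\<^sup>2)"
      by (simp add: \<kappa>_def algebra_simps)
    moreover have "(\<delta> * K) * (Re z * (norm (u - y))\<^sup>2) \<le> 1 / (2 * C) * (Re z * (norm (u - y))\<^sup>2)"
      using d(2) z by (intro mult_right_mono) (auto simp: K_def)
    ultimately have "E \<ge> Re z * (norm (u - y))\<^sup>2 / C -
        (Re z * \<kappa> * (norm (w + S z *v w))\<^sup>2 + 1 / (2 * C) * (Re z * (norm (u - y))\<^sup>2))"
      by linarith
    also have "Re z * (norm (u - y))\<^sup>2 / C -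
        (Re z * \<kappa> * (norm (w + S z *v w))\<^sup>2 + 1 / (2 * C) * (Re z * (norm (u - y))\<^sup>2)) =
        Re z * ((norm (u - y))\<^sup>2 / (2 * C) - \<kappa> * (norm (w + S z *v w))\<^sup>2)"
      using C by (simp add: field_simps)
    finally have fin: "E \<ge> Re z * ((norm (u - y))\<^sup>2 / (2 * C) - \<kappa> * (norm (w + S z *v w))\<^sup>2)" .
    then show "Re (hip w (\<sigma> *v w)) - Re (hip (S z *v w) (\<sigma> *v (S z *v w))) \<ge>
       Re z * ((norm (Pi z *v w - Y z *v (Pi z *v w)))\<^sup>2 / (2 * C) - \<kappa> * (norm (w + S z *v w))\<^sup>2)"
      by (simp add: E_def u_def y_def)
    \<comment> \<open>Here the defect of \<open>S\<close> at \<open>w\<close> is 0 and so is the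
      loss. The remaining gain then forces \<open>u = y\<close>, and the near-identity estimate
      forces \<open>u = - y\<close>.\<close>
    show "w = 0" if w0: "w + S z *v w = 0"
    proof -
      have "S z *v w = - w" using w0 by (simp add: add_eq_0_iff)
      then have "E = 0" by (simp add: E_def mv_minus_right hip_def)
      with fin have neg: "Re z * ((norm (u - y))\<^sup>2 / (2 * C)) \<le> 0" by (simp add: w0)
      have uy: "(norm (u - y))\<^sup>2 \<le> 0"
      proof (rule ccontr)
        assume "\<not> (norm (u - y))\<^sup>2 \<le> 0"
        then have "0 < Re z * ((norm (u - y))\<^sup>2 / (2 * C))"
          using C z(1) by (intro mult_pos_pos divide_pos_pos) auto
        with neg show False by linarith
      qed
      have "(norm (u + y))\<^sup>2 \<le> 0" using est uy unfolding w0 by simp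
      with uy have "u + y = 0" "u - y = 0" by simp_all
      moreover have "2 *\<^sub>R u = (u + y) + (u - y)" by (simp add: scaleR_2)
      ultimately have "2 *\<^sub>R u = 0" by (metis add.right_neutral)
      then have "u = 0" by simp
      then show ?thesis by (simp add: w mv_zero_right)
    qed
  qed
  have inv: "invertible (mat 1 + S z)" if "good z" for z
  proof (rule invertible_injI)
    fix w assume "(mat 1 + S z) *v w = 0"
    then have w: "w + S z *v w = 0" by (simp add: mv_algebra)
    show "w = 0"
    proof (cases "R < norm z")
      case True
      have "(S z - mat 1) *v w = - (2 *\<^sub>R w)"
        using w by (simp add: mv_algebra scaleR_2 add_eq_0_iff)
      then have "2 * norm w = norm ((S z - mat 1) *v w)" by simp
      also have "\<dots> \<le> 1/2 * norm w"
        by (rule order_trans[OF norm_matrix_vector_mult mult_right_mono[OF SR[OF True] norm_ge_zero]])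
      finally show ?thesis by simp
    next
      case False
      then show ?thesis using key0[OF _ _ _ w] that R by (auto simp: good_def)
    qed
  qed
  \<comment> \<open>\<open>H\<close> sends \<open>w + S w\<close> to
    \<open>\<sigma> (w - S w)\<close>, so its real part at \<open>w + S w\<close> is the defect of
    \<open>S\<close> at \<open>w\<close>: contractivity of \<open>S\<close> becomes positivity of
    \<open>H\<close>.\<close>
  define H where "H z = \<sigma> ** ((mat 1 - S z) ** matrix_inv (mat 1 + S z))" for z
  have H_form: "Re (hip y (H z *v y)) = Re (hip w (\<sigma> *v w)) - Re (hip (S z *v w) (\<sigma> *v (S z *v w)))"
    if "good z" "y = w + S z *v w" for z y w
  proof -
    have "matrix_inv (mat 1 + S z) *v y = w"
      using minv_left[OF inv[OF that(1)]] unfolding that(2)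
      by (metis matrix_vector_mul_assoc matrix_vector_mul_lid mv_add_left)
    then have "H z *v y = \<sigma> *v (w - S z *v w)"
      unfolding H_def by (simp add: matrix_vector_mul_assoc[symmetric] mv_algebra)
    then show ?thesis unfolding that(2) by (simp add: Re_hip_self_adjoint_sum_diff[OF sa])
  qed
  have surj: "\<exists>w. y = w + S z *v w" if "good z" for z y
    using minv_right[OF inv[OF that]]
    by (metis matrix_vector_mul_assoc matrix_vector_mul_lid mv_add_left)
  have lower: "Re (hip y (H z *v y)) \<ge> - (\<kappa> * (norm y)\<^sup>2 * Re z)"
    if z: "0 < Re z" "mat_analytic_at Y z" "norm z \<le> 3 / 2 * R" for z y
  proof -
    have g: "good z" using z by (simp add: good_def)
    obtain w where w: "y = w + S z *v w" using surj[OF g] by blast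
    have "Re (hip y (H z *v y)) \<ge>
       Re z * ((norm (Pi z *v w - Y z *v (Pi z *v w)))\<^sup>2 / (2 * C) - \<kappa> * (norm y)\<^sup>2)"
      using key[OF z, of w] H_form[OF g w] w by simp
    moreover have "Re z * ((norm (Pi z *v w - Y z *v (Pi z *v w)))\<^sup>2 / (2 * C) - \<kappa> * (norm y)\<^sup>2) \<ge>
        Re z * (0 - \<kappa> * (norm y)\<^sup>2)"
      using z C by (intro mult_left_mono diff_right_mono) auto
    ultimately show ?thesis by (simp add: algebra_simps)
  qed
  have goodI: "good w" if "mat_analytic_at Y w" "0 < Re w" for w using that by (simp add: good_def)
  have good_ball: "\<exists>e>0. mhol H (ball z e)" if gz: "good z" for z
  proof -
    have "mat_analytic_at Y z" using gz anR by (auto simp: good_def)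
    then obtain e where e: "e > 0" "mhol Y (ball z e)" "\<And>w. w \<in> ball z e \<Longrightarrow> mat_analytic_at Y w"
      using mat_analytic_at_ball by blast
    have "open (right_half_plane \<union> outside R)" using open_rhp open_outside by blast
    moreover have "z \<in> right_half_plane \<union> outside R" using gz by (auto simp: good_def)
    ultimately obtain e' where e': "e' > 0" "ball z e' \<subseteq> right_half_plane \<union> outside R"
      using open_contains_ball by blast
    let ?U = "ball z (min e e')"
    have gU: "good w" if "w \<in> ?U" for w
      using that e(3)[of w] e'(2) by (auto simp: good_def subset_iff)
    have "mhol S ?U" unfolding S
      by (intro mhol_mult mhol_subset[OF Q] mhol_subset[OF Pi(1)] mhol_subset[OF e(2)]) auto
    then have "mhol H ?U"
      unfolding H_def using inv gU by (intro mhol_mult mhol_diff mhol_add mhol_const mhol_minv) auto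
    then show ?thesis using e(1) e'(1) by (intro exI[of _ "min e e'"]) auto
  qed
  have posH: "0 \<le> Re (hip y (H z *v y))" if z: "0 < Re z" "mat_analytic_at Y z" for z y
  proof -
    \<comment> \<open>\<open>H\<close> may be singular at the poles of \<open>Y\<close>, but the
      lower bound for its real part bounds \<open>G\<close> nearby, so these singularities are
      removable for \<open>G\<close>.\<close>
    define G where "G w = exp (- hip y (H w *v y))" for w
    have G_an: "G analytic_on {w}" if gw: "good w" for w
    proof -
      obtain e where e: "e > 0" "mhol H (ball w e)" using good_ball[OF gw] by blast
      have "G holomorphic_on ball w e"
        unfolding G_def by (intro holomorphic_intros holomorphic_hip e)
      then show ?thesis using e(1) analytic_at_ball by blast
    qed
    have G_norm: "norm (G w) \<le> exp (\<kappa> * (norm y)\<^sup>2 * Re w)"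
      if "0 < Re w" "mat_analytic_at Y w" "norm w \<le> 3 / 2 * R" for w
      using lower[OF that, of y] by (simp add: G_def)
    have near: "\<exists>e>0. ball w e \<subseteq> right_half_plane \<inter> ball 0 (3 / 2 * R) \<and> (\<forall>x\<in>ball w e - {w}. mat_analytic_at Y x)"
      if "0 < Re w" "norm w < 3 / 2 * R" for w
    proof (rule mat_meromorphic_punctured)
      show "mat_meromorphic_on Y (right_half_plane \<inter> ball 0 (3 / 2 * R))"
        using Y unfolding mat_meromorphic_on_def by (auto intro: nicely_meromorphic_on_subset)
    qed (use that open_rhp in auto)
    define G' where "G' = remove_sings G"
    have G'_eq: "G' w = G w" if "good w" for w
      unfolding G'_def by (rule remove_sings_at_analytic[OF G_an[OF that]])
    have G'_an: "G' analytic_on {w}" and G'_bd: "norm w < 3 / 2 * R \<Longrightarrow> norm (G' w) \<le> exp (\<kappa> * (norm y)\<^sup>2 * Re w)"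
      if w: "0 < Re w" for w
    proof -
      have an_small: "G' analytic_on {w}" if w2: "norm w < 3 / 2 * R"
      proof -
        obtain e where e: "e > 0" "ball w e \<subseteq> right_half_plane \<inter> ball 0 (3 / 2 * R)"
          "\<And>x. x \<in> ball w e - {w} \<Longrightarrow> mat_analytic_at Y x"
          using near[OF w w2] by blast
        have "G analytic_on ball w e - {w}"
          by (subst analytic_on_analytic_at) (use e in \<open>auto intro!: G_an goodI\<close>)
        then have iso: "isolated_singularity_at G w"
          using e(1) unfolding isolated_singularity_at_def by blast
        have "eventually (\<lambda>x. x \<in> ball w e - {w}) (at w)"
          using e(1) by (intro eventually_at_in_open) auto
        then have "eventually (\<lambda>x. norm (G x) \<le> exp (\<kappa> * (norm y)\<^sup>2 * (3 / 2 * R))) (at w)"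
        proof (rule eventually_mono)
          fix x assume x: "x \<in> ball w e - {w}"
          then have "0 < Re x" "norm x < 3 / 2 * R" using e(2) by auto
          then have "norm (G x) \<le> exp (\<kappa> * (norm y)\<^sup>2 * Re x)"
            using e(3)[OF x] by (intro G_norm) auto
          also have "\<dots> \<le> exp (\<kappa> * (norm y)\<^sup>2 * (3 / 2 * R))"
            using \<kappa>0 \<open>norm x < 3 / 2 * R\<close> complex_Re_le_cmod[of x]
            by (intro iffD2[OF exp_le_cancel_iff] mult_left_mono) auto
          finally show "norm (G x) \<le> exp (\<kappa> * (norm y)\<^sup>2 * (3 / 2 * R))" .
        qed
        then show ?thesis unfolding G'_def by (rule analytic_remove_sings_bounded[OF iso])
      qed
      show "G' analytic_on {w}"
      proof (cases "norm w < 3 / 2 * R")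
        case False
        then have "good w" using R by (simp add: good_def)
        then have "remove_sings G analytic_on {w}" by (intro remove_sings_analytic_on G_an)
        then show ?thesis by (simp add: G'_def)
      qed (rule an_small)
      show "norm (G' w) \<le> exp (\<kappa> * (norm y)\<^sup>2 * Re w)" if w2: "norm w < 3 / 2 * R"
      proof -
        obtain e where e: "e > 0" "ball w e \<subseteq> right_half_plane \<inter> ball 0 (3 / 2 * R)"
          "\<And>x. x \<in> ball w e - {w} \<Longrightarrow> mat_analytic_at Y x"
          using near[OF w w2] by blast
        have "((\<lambda>x. exp (\<kappa> * (norm y)\<^sup>2 * Re x) - norm (G' x)) \<longlongrightarrow> exp (\<kappa> * (norm y)\<^sup>2 * Re w) - norm (G' w)) (at w)"
          using analytic_at_imp_isCont[OF an_small[OF w2]] unfolding isCont_def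
          by (intro tendsto_intros)
        moreover have "eventually (\<lambda>x. x \<in> ball w e - {w}) (at w)"
          using e(1) by (intro eventually_at_in_open) auto
        then have "eventually (\<lambda>x. 0 \<le> exp (\<kappa> * (norm y)\<^sup>2 * Re x) - norm (G' x)) (at w)"
        proof (rule eventually_mono)
          fix x assume x: "x \<in> ball w e - {w}"
          then have "0 < Re x" "norm x < 3 / 2 * R" using e(2) by auto
          then show "0 \<le> exp (\<kappa> * (norm y)\<^sup>2 * Re x) - norm (G' x)"
            using G_norm[of x] G'_eq[OF goodI] e(3)[OF x] by simp
        qed
        ultimately have "0 \<le> exp (\<kappa> * (norm y)\<^sup>2 * Re w) - norm (G' w)"
          by (rule tendsto_lowerbound) simp
        then show ?thesis by simp
      qed
    qed
    have "norm (G' z) \<le> 1"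
    proof (rule maximum_principle_rhp[where G = G'])
      show "G' holomorphic_on {z. 0 < Re z}"
        by (rule analytic_imp_holomorphic, subst analytic_on_analytic_at) (use G'_an in auto)
      show "\<exists>d>0. \<forall>z. 0 < Re z \<longrightarrow> dist z (Complex 0 y0) < d \<longrightarrow> norm (G' z) \<le> 1 + e" if e: "e > 0" for y0 e
      \<comment> \<open>Beyond \<open>R\<close> the function is continuous up to the axis and has
        modulus 1 there by \<open>Ssym\<close>. On the remaining segment only the bound
        \<open>exp (\<kappa> |y|^2 Re w)\<close> is at hand, and it tends to 1.\<close>
      proof (cases "R < norm (Complex 0 y0)")
        case True
        then have g: "good (Complex 0 y0)" by (simp add: good_def)
        have "isCont (\<lambda>w. norm (G w)) (Complex 0 y0)"
          by (intro continuous_intros analytic_at_imp_isCont G_an g)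
        then obtain d1 where d1: "d1 > 0" "\<And>w. dist w (Complex 0 y0) < d1 \<Longrightarrow>
            dist (norm (G w)) (norm (G (Complex 0 y0))) < e"
          using e unfolding continuous_at_eps_delta by meson
        obtain w where w: "y = w + S (Complex 0 y0) *v w" using surj[OF g] by blast
        have "hip w (\<sigma> *v w) = hip (S (Complex 0 y0) *v w) (\<sigma> *v (S (Complex 0 y0) *v w))"
          using Ssym[OF True] by (simp add: hip_congruence[symmetric])
        then have "Re (hip y (H (Complex 0 y0) *v y)) = 0" using H_form[OF g w] by simp
        then have "norm (G (Complex 0 y0)) = 1" by (simp add: G_def)
        moreover obtain d2 where d2: "d2 > 0" "ball (Complex 0 y0) d2 \<subseteq> outside R"
          using open_outside[of R] True open_contains_ball by (metis mem_Collect_eq)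
        ultimately have "norm (G' w) \<le> 1 + e" if "dist w (Complex 0 y0) < min d1 d2" for w
        proof -
          have "w \<in> outside R" using d2(2) that by (auto simp: dist_commute)
          then have "G' w = G w" by (intro G'_eq) (simp add: good_def)
          then show ?thesis using d1(2)[of w] that \<open>norm (G (Complex 0 y0)) = 1\<close>
            unfolding dist_real_def by auto
        qed
        then show ?thesis using d1(1) d2(1) by (intro exI[of _ "min d1 d2"]) auto
      next
        case False
        have "((\<lambda>x. exp (\<kappa> * (norm y)\<^sup>2 * x)) \<longlongrightarrow> exp (\<kappa> * (norm y)\<^sup>2 * 0)) (at (0::real))"
          by (intro tendsto_intros)
        then have "eventually (\<lambda>x. exp (\<kappa> * (norm y)\<^sup>2 * x) < 1 + e) (at (0::real))"
          by (rule order_tendstoD(2)) (use e in simp)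
        then obtain d1 where d1: "d1 > 0" "\<And>x. x \<noteq> 0 \<Longrightarrow> \<bar>x\<bar> < d1 \<Longrightarrow> exp (\<kappa> * (norm y)\<^sup>2 * x) < 1 + e"
          unfolding eventually_at by (auto simp: dist_real_def)
        have "norm (G' w) \<le> 1 + e" if w: "0 < Re w" "dist w (Complex 0 y0) < min d1 (R / 2)" for w
        proof -
          have "norm w \<le> norm (Complex 0 y0) + dist w (Complex 0 y0)"
            using norm_triangle_ineq[of "Complex 0 y0" "w - Complex 0 y0"] by (simp add: dist_norm)
          then have "norm w < 3 / 2 * R" using w False R by simp
          then have "norm (G' w) \<le> exp (\<kappa> * (norm y)\<^sup>2 * Re w)" using G'_bd[OF w(1)] by simp
          moreover have "\<bar>Re w\<bar> < d1"
            using w(2) abs_Re_le_cmod[of "w - Complex 0 y0"] by (simp add: dist_norm)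
          ultimately show ?thesis using d1(2)[of "Re w"] w(1) by simp
        qed
        then show ?thesis using d1(1) R by (intro exI[of _ "min d1 (R / 2)"]) auto
      qed
      show "eventually (\<lambda>z. norm (G' z) \<le> 1 + e) rhp_infinity" if e: "e > 0" for e
      proof -
        have "(H \<longlongrightarrow> \<sigma> ** ((mat 1 - mat 1) ** matrix_inv (mat 1 + mat 1))) at_infinity"
        proof -
          have "mat 1 + mat 1 = (mat 2 :: 'p cmat)" by (simp add: vec_eq_iff mat_def)
          then have "invertible (mat 1 + mat 1 :: 'p cmat)" by (simp add: invertible_mat)
          then show ?thesis
            unfolding H_def by (intro tendsto_mm tendsto_const tendsto_diff tendsto_minv tendsto_add Slim)
        qed
        then have H0: "(H \<longlongrightarrow> 0) at_infinity" by (simp add: mm_algebra)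
        have "((\<lambda>w. norm (exp (- hip y (H w *v y)))) \<longlongrightarrow> norm (exp (- hip y (0 *v y)))) at_infinity"
          by (intro tendsto_intros tendsto_hip tendsto_mv H0 tendsto_const)
        then have "((\<lambda>w. norm (G w)) \<longlongrightarrow> 1) at_infinity" by (simp add: G_def mv_algebra)
        then have "eventually (\<lambda>w. norm (G w) < 1 + e) at_infinity"
          by (rule order_tendstoD(2)) (use e in simp)
        then obtain b where b: "\<And>w. b \<le> norm w \<Longrightarrow> norm (G w) < 1 + e"
          unfolding eventually_at_infinity by blast
        show ?thesis unfolding eventually_rhp_infinity
        proof (intro exI[of _ "max b R"] allI impI)
          fix w :: complex assume "max b R < norm w"
          then show "norm (G' w) \<le> 1 + e" using b[of w] G'_eq[of w] by (simp add: good_def less_imp_le)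
        qed
      qed
    qed (rule z)
    then have "norm (G z) \<le> 1" using G'_eq[of z] z by (simp add: good_def)
    then show ?thesis by (simp add: G_def)
  qed
  have "good z" using z by (simp add: good_def)
  from H_form[OF this refl, of v] posH[OF z, of "v + S z *v v"] show ?thesis by simp
qed

section \<open>Vessels\<close>

lemma solves_at_iff:
  assumes "invertible (\<sigma>1 t :: 'p::finite cmat)"
  shows "solves_at T \<sigma>1 \<sigma>2 g z u t \<longleftrightarrow>
    (u has_vector_derivative (mat z ** (matrix_inv (\<sigma>1 t) ** \<sigma>2 t) + matrix_inv (\<sigma>1 t) ** g t) *v u t) (at t within T)"
proof -
  let ?A = "mat z ** (matrix_inv (\<sigma>1 t) ** \<sigma>2 t) + matrix_inv (\<sigma>1 t) ** g t"
  have A: "matrix_inv (\<sigma>1 t) *v (z *s (\<sigma>2 t *v u t) + g t *v u t) = ?A *v u t"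
    by (simp add: mat_mult_vec[symmetric] matrix_vector_mul_assoc mv_algebra mat_left_commute matrix_mul_assoc
        mat_commute)
  have "z *s (\<sigma>2 t *v u t) - \<sigma>1 t *v u' + g t *v u t = 0 \<longleftrightarrow> u' = ?A *v u t" for u'
  proof -
    have "z *s (\<sigma>2 t *v u t) - \<sigma>1 t *v u' + g t *v u t = 0 \<longleftrightarrow>
        \<sigma>1 t *v u' = z *s (\<sigma>2 t *v u t) + g t *v u t"
      by (auto simp: algebra_simps)
    also have "\<dots> \<longleftrightarrow> u' = matrix_inv (\<sigma>1 t) *v (z *s (\<sigma>2 t *v u t) + g t *v u t)"
      by (metis assms matrix_vector_mul_assoc matrix_vector_mul_lid minv_left minv_right)
    finally show ?thesis unfolding A .
  qed
  then show ?thesis unfolding solves_at_def by auto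
qed

locale vessel_data =
  fixes a b t0 :: real and \<sigma>1 \<sigma>2 \<gamma> D :: "real \<Rightarrow> 'p::finite cmat"
    and \<Phi> \<Psi> :: "complex \<Rightarrow> real \<Rightarrow> 'p cmat"
  assumes ab: "a < b" and t0: "t0 \<in> {a..b}"
    and cont: "continuous_on {a..b} \<sigma>1" "continuous_on {a..b} \<sigma>2" "continuous_on {a..b} \<gamma>"
    and sa1: "\<And>t. t \<in> {a..b} \<Longrightarrow> cadjoint (\<sigma>1 t) = \<sigma>1 t"
    and sa2: "\<And>t. t \<in> {a..b} \<Longrightarrow> cadjoint (\<sigma>2 t) = \<sigma>2 t"
    and inv1: "\<And>t. t \<in> {a..b} \<Longrightarrow> invertible (\<sigma>1 t)"
    and D\<sigma>: "\<And>t. t \<in> {a..b} \<Longrightarrow> (\<sigma>1 has_vector_derivative D t) (at t within {a..b})"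
    and D\<gamma>: "\<And>t. t \<in> {a..b} \<Longrightarrow> \<gamma> t + cadjoint (\<gamma> t) = - D t"
    and fp: "fundamental_pair {a..b} t0 (\<lambda>t. matrix_inv (\<sigma>1 t) ** \<sigma>2 t) (\<lambda>t. matrix_inv (\<sigma>1 t) ** \<gamma> t) \<Phi> \<Psi>"
begin

definition \<alpha> where "\<alpha> t = matrix_inv (\<sigma>1 t) ** \<sigma>2 t"
definition \<beta> where "\<beta> t = matrix_inv (\<sigma>1 t) ** \<gamma> t"

lemma fp': "fundamental_pair {a..b} t0 \<alpha> \<beta> \<Phi> \<Psi>"
  using fp unfolding \<alpha>_def \<beta>_def .

lemma cont_\<alpha>: "continuous_on {a..b} \<alpha>" and cont_\<beta>: "continuous_on {a..b} \<beta>"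
  unfolding \<alpha>_def \<beta>_def by (intro continuous_on_mm continuous_on_minv cont inv1; assumption)+

lemma \<Phi>_t0: "\<Phi> z t0 = mat 1" and \<Psi>_t0: "\<Psi> z t0 = mat 1"
  using fp' unfolding fundamental_pair_def by blast+

lemma \<Phi>\<Psi>: "t \<in> {a..b} \<Longrightarrow> \<Phi> z t ** \<Psi> z t = mat 1" and \<Psi>\<Phi>: "t \<in> {a..b} \<Longrightarrow> \<Psi> z t ** \<Phi> z t = mat 1"
  using fp' unfolding fundamental_pair_def by blast+

lemma D\<Phi>: "t \<in> {a..b} \<Longrightarrow> (\<Phi> z has_vector_derivative (mat z ** \<alpha> t + \<beta> t) ** \<Phi> z t) (at t within {a..b})"
  and D\<Psi>: "t \<in> {a..b} \<Longrightarrow> (\<Psi> z has_vector_derivative - (\<Psi> z t ** (mat z ** \<alpha> t + \<beta> t))) (at t within {a..b})"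
  using fp' unfolding fundamental_pair_def by blast+

lemma hol_\<Phi>: "t \<in> {a..b} \<Longrightarrow> mhol (\<lambda>z. \<Phi> z t) UNIV" and hol_\<Psi>: "t \<in> {a..b} \<Longrightarrow> mhol (\<lambda>z. \<Psi> z t) UNIV"
  using fp' unfolding fundamental_pair_def by blast+

lemma \<sigma>1_coefficient:
  assumes t: "t \<in> {a..b}"
  shows "\<sigma>1 t ** (mat z ** \<alpha> t + \<beta> t) = mat z ** \<sigma>2 t + \<gamma> t"
  by (simp add: \<alpha>_def \<beta>_def mm_add_right mat_left_commute minv_right'[OF inv1[OF t]])

text \<open>In the derivative with respect to \<open>t\<close> the two \<open>\<sigma>2\<close>
  terms cancel because \<open>- cnj z\<close> is used in the left factor, and
  \<open>\<gamma> + cadjoint \<gamma>\<close> cancels the derivative of \<open>\<sigma>1\<close>.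
  For \<open>Re z = 0\<close> the result says that \<open>\<Phi>\<close> is unitary from the form at
  \<open>t0\<close> to the form at \<open>t\<close>.\<close>

lemma \<Phi>_symmetry:
  assumes t: "t \<in> {a..b}"
  shows "cadjoint (\<Phi> (- cnj z) t) ** \<sigma>1 t ** \<Phi> z t = \<sigma>1 t0"
proof -
  let ?w = "- cnj z" and ?A = "\<lambda>z t. mat z ** \<alpha> t + \<beta> t"
  let ?f = "\<lambda>t. cadjoint (\<Phi> ?w t) ** \<sigma>1 t ** \<Phi> z t"
  have "(?f has_vector_derivative 0) (at t within {a..b})" if t: "t \<in> {a..b}" for t
  proof -
    have "(?f has_vector_derivative
        (cadjoint (\<Phi> ?w t) ** \<sigma>1 t) ** (?A z t ** \<Phi> z t) +
        (cadjoint (\<Phi> ?w t) ** D t + cadjoint (?A ?w t ** \<Phi> ?w t) ** \<sigma>1 t) ** \<Phi> z t) (at t within {a..b})"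
      by (intro has_vector_derivative_mm bounded_linear.has_vector_derivative[OF bounded_linear_cadjoint]
          D\<Phi> D\<sigma> t)
    moreover have "cadjoint (?A ?w t) ** \<sigma>1 t = cadjoint (\<gamma> t) - mat z ** \<sigma>2 t"
    proof -
      have "cadjoint (?A ?w t) ** \<sigma>1 t = cadjoint (\<sigma>1 t ** ?A ?w t)"
        by (simp only: cadjoint_mult sa1[OF t])
      also have "\<dots> = mat (- z) ** \<sigma>2 t + cadjoint (\<gamma> t)"
        by (simp add: \<sigma>1_coefficient[OF t] cadjoint_add cadjoint_mult sa2[OF t] cadjoint_mat mat_commute)
      also have "mat (- z) ** \<sigma>2 t = - (mat z ** \<sigma>2 t)"
        by (simp add: vec_eq_iff mat_mult_nth)
      finally show ?thesis by simp
    qed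
    then have "cadjoint (?A ?w t ** \<Phi> ?w t) ** \<sigma>1 t = cadjoint (\<Phi> ?w t) ** (cadjoint (\<gamma> t) - mat z ** \<sigma>2 t)"
      by (simp add: cadjoint_mult matrix_mul_assoc[symmetric])
    moreover have "(cadjoint (\<Phi> ?w t) ** \<sigma>1 t) ** (?A z t ** \<Phi> z t) =
        cadjoint (\<Phi> ?w t) ** (mat z ** \<sigma>2 t + \<gamma> t) ** \<Phi> z t"
      by (metis \<sigma>1_coefficient[OF t] matrix_mul_assoc)
    moreover have "D t = - (\<gamma> t + cadjoint (\<gamma> t))" using D\<gamma>[OF t] by simp
    ultimately show ?thesis by (simp add: mm_algebra)
  qed
  then obtain c where c: "\<And>t. t \<in> {a..b} \<Longrightarrow> ?f t = c"
    using has_vector_derivative_zero_constant[OF convex_real_interval(5), of a b ?f] by blast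
  have "cadjoint (mat 1) = (mat 1 :: 'p cmat)" by (simp add: cadjoint_mat)
  then have "?f t0 = \<sigma>1 t0" by (simp add: \<Phi>_t0)
  with c[OF t0] c[OF t] show ?thesis by simp
qed

text \<open>The derivative of \<open>\<Psi> z t *v u t\<close> vanishes on the interval; this is
  uniqueness for the linear initial value problem.\<close>

lemma solution_form:
  assumes T: "T \<subseteq> {a..b}" "convex T" "t0 \<in> T" and u: "\<And>t. t \<in> T \<Longrightarrow> solves_at T \<sigma>1 \<sigma>2 \<gamma> z u t" and t: "t \<in> T"
  shows "u t = \<Phi> z t *v u t0"
proof -
  let ?A = "\<lambda>t. mat z ** \<alpha> t + \<beta> t"
  have "((\<lambda>t. \<Psi> z t *v u t) has_vector_derivative 0) (at t within T)" if t: "t \<in> T" for t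
  proof -
    have t': "t \<in> {a..b}" using t T by blast
    have "(u has_vector_derivative ?A t *v u t) (at t within T)"
      using u[OF t] solves_at_iff[of \<sigma>1 t T \<sigma>2 \<gamma> z u, OF inv1[OF t']] by (simp add: \<alpha>_def \<beta>_def)
    from has_vector_derivative_mv[OF has_vector_derivative_within_subset[OF D\<Psi>[OF t', of z] T(1)] this]
    show ?thesis by (simp add: mv_minus_left matrix_vector_mul_assoc)
  qed
  then obtain c where c: "\<And>t. t \<in> T \<Longrightarrow> \<Psi> z t *v u t = c"
    using has_vector_derivative_zero_constant[OF T(2), of "\<lambda>t. \<Psi> z t *v u t"] by blast
  have "\<Psi> z t *v u t = u t0" using c[OF t] c[OF T(3)] by (simp add: \<Psi>_t0)
  then have "\<Phi> z t *v (\<Psi> z t *v u t) = \<Phi> z t *v u t0" by simp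
  moreover have "t \<in> {a..b}" using t T by blast
  ultimately show ?thesis by (simp only: matrix_vector_mul_assoc \<Phi>\<Psi> matrix_vector_mul_lid)
qed

end

text \<open>On the axis beyond \<open>R\<close> the boundary values give unitarity, and there the
  reflected adjoint is the adjoint. The identity theorem on the connected exterior carries the
  relation to all other points, in the left half plane too.\<close>

lemma class_S_symmetry:
  assumes Y: "Y \<in> class_S J" and R: "R > 0" "mhol Y (outside R)" and z: "R < norm z"
  shows "cadjoint (Y (- cnj z)) ** J ** Y z = J"
proof -
  have an: "mat_analytic_at Y w" if "R < norm w" for w
    by (rule mhol_imp_analytic_at[OF R(2) open_outside]) (use that in simp)
  let ?G = "\<lambda>z. cadjoint (Y (- cnj z)) ** J ** Y z - J"
  have "(\<lambda>z. - cnj z) ` outside R \<subseteq> outside R" by auto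
  then have "mhol ?G (outside R)"
    by (intro mhol_diff mhol_mult mhol_const R mhol_reflect open_outside mhol_subset[OF R(2)])
  then have hol: "(\<lambda>z. ?G z $ i $ j) holomorphic_on outside R" for i j by (rule mholD)
  have axis: "?G w = 0" if w: "Re w = 0" "R < norm w" for w
  proof -
    have "- cnj w = w" using w by (simp add: complex_eq_iff)
    moreover have "cadjoint (Y w) ** J ** Y w = J"
      using boundary_unitary_at_analytic[OF _ an[OF w(2)] w(1)] Y unfolding class_S_def by blast
    ultimately show ?thesis by simp
  qed
  have lp: "Complex 0 (R + 1) islimpt {z \<in> outside R. Re z = 0}"
    unfolding islimpt_approachable
  proof (intro allI impI)
    fix e :: real assume e: "e > 0"
    have "Complex 0 (R + 1 + e / 2) \<in> {z \<in> outside R. Re z = 0}" using e R by (simp add: cmod_def)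
    moreover have "dist (Complex 0 (R + 1 + e / 2)) (Complex 0 (R + 1)) < e"
      using e by (simp add: dist_complex_def cmod_def)
    moreover have "Complex 0 (R + 1 + e / 2) \<noteq> Complex 0 (R + 1)" using e by simp
    ultimately show "\<exists>x'\<in>{z \<in> outside R. Re z = 0}. x' \<noteq> Complex 0 (R + 1) \<and> dist x' (Complex 0 (R + 1)) < e"
      by blast
  qed
  have "?G z $ i $ j = 0" for i j
  proof (rule analytic_continuation[OF hol open_outside connected_outside[OF R(1)] _ _ lp])
    show "?G w $ i $ j = 0" if "w \<in> {z \<in> outside R. Re z = 0}" for w
      using axis[of w] that by simp
  qed (use z R in \<open>auto simp: cmod_def\<close>)
  then have "?G z = 0" by (simp add: vec_eq_iff)
  then show ?thesis by simp
qed

section \<open>Families of Birkhoff factors: symmetry and the output coefficient\<close>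

lemma matrix_liouville:
  fixes F :: "complex \<Rightarrow> 'p::finite cmat"
  assumes "mhol F UNIV" "(F \<longlongrightarrow> L) at_infinity"
  shows "F z = L"
proof -
  have "F z $ i $ j = L $ i $ j" for i j
    using Liouville_weak[OF mholD[OF assms(1)] tendsto_entry[OF assms(2)]] by blast
  then show ?thesis by (simp add: vec_eq_iff)
qed

text \<open>\<open>fact\<close> is the factorization \<open>S \<Phi> = \<Phi>s Y\<close> outside
  radius \<open>R\<close>. The bound on \<open>s\<close> keeps \<open>S\<close> within 1/2 of the
  identity there; the bound on \<open>\<Phi>s\<close> gives invertibility on the disc, about which
  \<open>fact\<close> says nothing.\<close>

locale birkhoff_family = vessel_data a b t0 \<sigma>1 \<sigma>2 \<gamma> D \<Phi> \<Psi>
  for a b t0 :: real and \<sigma>1 \<sigma>2 \<gamma> D :: "real \<Rightarrow> 'p::finite cmat"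
    and \<Phi> \<Psi> :: "complex \<Rightarrow> real \<Rightarrow> 'p cmat" +
  fixes Y :: "complex \<Rightarrow> 'p cmat" and R :: real and T :: "real set"
    and \<Phi>s s :: "complex \<Rightarrow> real \<Rightarrow> 'p cmat"
  assumes YS: "Y \<in> class_S (\<sigma>1 t0)" and R: "R > 0" and hol_Y: "mhol Y (outside R)"
    and Y1: "\<And>z. R < norm z \<Longrightarrow> norm (Y z - mat 1) \<le> 1/8" and Ylim: "(Y \<longlongrightarrow> mat 1) at_infinity"
    and T: "T \<subseteq> {a..b}" "convex T" "t0 \<in> T"
    and hol_\<Phi>s: "\<And>t. t \<in> T \<Longrightarrow> mhol (\<lambda>z. \<Phi>s z t) UNIV"
    and hol_s: "\<And>t. t \<in> T \<Longrightarrow> mhol (\<lambda>z. s z t) (outside R)"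
    and s0: "\<And>t. t \<in> T \<Longrightarrow> ((\<lambda>z. s z t) \<longlongrightarrow> 0) at_infinity"
    and s_small: "\<And>t z. t \<in> T \<Longrightarrow> R < norm z \<Longrightarrow> norm (s z t) \<le> 1 / (16 * norm (mat 1 :: 'p cmat))"
    and fact: "\<And>t z. t \<in> T \<Longrightarrow> R < norm z \<Longrightarrow> ((mat 1 + s z t) ** Y z) ** \<Phi> z t = \<Phi>s z t ** Y z"
    and \<Phi>s_small: "\<And>t z. t \<in> T \<Longrightarrow> norm z \<le> 2 * R \<Longrightarrow> norm (\<Phi>s z t - mat 1) \<le> 1/2"
begin

definition S0 where "S0 z t = (mat 1 + s z t) ** Y z"

lemma Tab: "t \<in> T \<Longrightarrow> t \<in> {a..b}" using T by blast

lemma hol_S0: "t \<in> T \<Longrightarrow> mhol (\<lambda>z. S0 z t) (outside R)"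
  unfolding S0_def by (intro mhol_mult mhol_add mhol_const hol_s hol_Y)

lemma S0_lim: "t \<in> T \<Longrightarrow> ((\<lambda>z. S0 z t) \<longlongrightarrow> mat 1) at_infinity"
proof -
  assume t: "t \<in> T"
  have "((\<lambda>z. S0 z t) \<longlongrightarrow> (mat 1 + 0) ** mat 1) at_infinity"
    unfolding S0_def by (intro tendsto_mm tendsto_add tendsto_const s0[OF t] Ylim)
  then show ?thesis by simp
qed

lemma S0_near: "t \<in> T \<Longrightarrow> R < norm z \<Longrightarrow> norm (S0 z t - mat 1) \<le> 1/2"
proof -
  assume t: "t \<in> T" and z: "R < norm z"
  have N1: "norm (mat 1 :: 'p cmat) \<ge> 1" by (rule norm_mat_1_pos)
  have "norm (Y z) \<le> norm (mat 1 :: 'p cmat) + norm (Y z - mat 1)"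
    using norm_triangle_ineq[of "mat 1" "Y z - mat 1"] by simp
  then have "norm (Y z) \<le> 2 * norm (mat 1 :: 'p cmat)" using Y1[OF z] N1 by linarith
  then have "norm (s z t ** Y z) \<le> 1 / (16 * norm (mat 1 :: 'p cmat)) * (2 * norm (mat 1 :: 'p cmat))" by (intro norm_matrix_mult_le s_small t z)
  also have "1 / (16 * n) * (2 * n) = 1/8" if "n \<ge> 1" for n :: real using that by (simp add: field_simps)
  note this[OF N1]
  finally have "norm (s z t ** Y z) \<le> 1/8" .
  moreover have eq: "S0 z t - mat 1 = (Y z - mat 1) + s z t ** Y z" by (simp add: S0_def mm_algebra)
  ultimately show "norm (S0 z t - mat 1) \<le> 1/2" unfolding eq using norm_triangle_ineq[of "Y z - mat 1" "s z t ** Y z"] Y1[OF z] by linarith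
qed

lemma S0_inv: "t \<in> T \<Longrightarrow> R < norm z \<Longrightarrow> invertible (S0 z t)"
  using invertible_near_1[OF S0_near] by simp

lemma Y_inv: "R < norm z \<Longrightarrow> invertible (Y z)"
  using invertible_near_1[OF Y1] by simp

lemma norm_S0: "t \<in> T \<Longrightarrow> R < norm z \<Longrightarrow> norm (S0 z t) \<le> norm (mat 1 :: 'p cmat) + 1/2"
  using norm_triangle_ineq[of "mat 1" "S0 z t - mat 1"] S0_near[of t z] by simp

lemma norm_S0_inv: "t \<in> T \<Longrightarrow> R < norm z \<Longrightarrow> norm (matrix_inv (S0 z t)) \<le> 2 * norm (mat 1 :: 'p cmat)"
  using norm_minv_near_1[OF S0_near] .

lemma S0_eq: "t \<in> T \<Longrightarrow> R < norm z \<Longrightarrow> S0 z t = \<Phi>s z t ** Y z ** \<Psi> z t"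
  using fact[of t z, folded S0_def] \<Phi>\<Psi>[OF Tab, of t z]
  by (metis matrix_mul_assoc matrix_mul_rid)

lemma \<Phi>s_eq: "t \<in> T \<Longrightarrow> R < norm z \<Longrightarrow> \<Phi>s z t = S0 z t ** \<Phi> z t ** matrix_inv (Y z)"
  using fact[of t z, folded S0_def] minv_right[OF Y_inv, of z]
  by (metis matrix_mul_assoc matrix_mul_rid)

lemma \<Phi>s_inv: "t \<in> T \<Longrightarrow> invertible (\<Phi>s z t)"
proof (cases "R < norm z")
  case True
  assume t: "t \<in> T"
  have "invertible (\<Phi> z t)" using \<Phi>\<Psi>[OF Tab[OF t]] invertibleI by blast
  then show ?thesis
    unfolding \<Phi>s_eq[OF t True] by (intro invertible_mm S0_inv t True invertible_minv Y_inv)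
next
  case False
  assume t: "t \<in> T"
  show ?thesis using invertible_near_1[OF \<Phi>s_small[OF t]] False R by simp
qed

text \<open>At \<open>t0\<close> the loop is trivial, so outside the disc \<open>\<Phi>s\<close> is
  \<open>mat 1 + s\<close>, and this entire function tends to the identity.\<close>

lemma \<Phi>s_t0: "\<Phi>s z t0 = mat 1"
proof (rule matrix_liouville[OF hol_\<Phi>s[OF T(3)]])
  have "((\<lambda>z. mat 1 + s z t0) \<longlongrightarrow> mat 1 + 0) at_infinity" by (intro tendsto_intros s0 T)
  moreover have "eventually (\<lambda>z. mat 1 + s z t0 = \<Phi>s z t0) at_infinity"
    unfolding eventually_at_infinity
  proof (intro exI[of _ "R + 1"] allI impI)
    fix z :: complex assume "R + 1 \<le> norm z"
    then have z: "R < norm z" by simp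
    show "mat 1 + s z t0 = \<Phi>s z t0"
      using \<Phi>s_eq[OF T(3) z] minv_right[OF Y_inv[OF z]]
      by (simp add: S0_def \<Phi>_t0 matrix_mul_assoc[symmetric])
  qed
  ultimately show "((\<lambda>z. \<Phi>s z t0) \<longlongrightarrow> mat 1) at_infinity" by (simp add: tendsto_cong)
qed

lemma Y_symmetry: "R < norm z \<Longrightarrow> cadjoint (Y (- cnj z)) ** \<sigma>1 t0 ** Y z = \<sigma>1 t0"
  by (rule class_S_symmetry[OF YS R hol_Y])

text \<open>Both sides of the symmetry factor the same loop, so they agree by Liouville's theorem.\<close>

lemma \<Phi>s_symmetry:
  assumes t: "t \<in> T"
  shows "cadjoint (\<Phi>s (- cnj z) t) ** \<sigma>1 t ** \<Phi>s z t = \<sigma>1 t0"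
proof -
  let ?J = "\<sigma>1 t0" and ?s = "\<sigma>1 t"
  note t' = Tab[OF t]
  define E where "E z = matrix_inv ?J ** (cadjoint (\<Phi>s (- cnj z) t) ** ?s ** \<Phi>s z t)" for z
  have E': "matrix_inv ?s ** matrix_inv (cadjoint (S0 (- cnj z) t)) ** ?s ** matrix_inv (S0 z t) =
      matrix_inv (\<Phi>s z t ** matrix_inv ?J ** cadjoint (\<Phi>s (- cnj z) t) ** ?s)" if z: "R < norm z" for z
  proof -
    let ?w = "- cnj z"
    have w: "R < norm ?w" using z by simp
    define P Q V W X U where "P = \<Phi> z t" and "Q = cadjoint (\<Phi> ?w t)" and "V = Y z" and "W = cadjoint (Y ?w)"
      and "X = S0 z t" and "U = cadjoint (S0 ?w t)"
    have P: "Q ** ?s ** P = ?J" using \<Phi>_symmetry[OF t'] by (simp add: P_def Q_def)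
    have V: "W ** ?J ** V = ?J" using Y_symmetry[OF z] by (simp add: V_def W_def)
    have inv: "invertible P" "invertible Q" "invertible V" "invertible W" "invertible X" "invertible U"
      "invertible ?s" "invertible ?J"
      using \<Phi>\<Psi>[OF t'] invertibleI inv1[OF t'] inv1[OF t0] Y_inv[OF z] Y_inv[OF w] S0_inv[OF t z] S0_inv[OF t w]
      unfolding P_def Q_def V_def W_def X_def U_def by (blast intro: invertible_cadjoint)+
    have 1: "\<Phi>s z t = X ** P ** matrix_inv V" unfolding X_def P_def V_def by (rule \<Phi>s_eq[OF t z])
    have 2: "cadjoint (\<Phi>s ?w t) = matrix_inv W ** Q ** U"
      unfolding \<Phi>s_eq[OF t w] W_def Q_def U_def
      by (simp add: cadjoint_mult minv_cadjoint[OF Y_inv[OF w]] matrix_mul_assoc)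
    have 3: "matrix_inv V ** matrix_inv ?J ** matrix_inv W = matrix_inv ?J"
    proof -
      have "matrix_inv (W ** ?J ** V) = matrix_inv V ** (matrix_inv ?J ** matrix_inv W)"
        using inv by (simp add: minv_mm invertible_mm)
      then show ?thesis unfolding V by (simp add: matrix_mul_assoc)
    qed
    have 4: "P ** matrix_inv ?J ** Q = matrix_inv ?s"
    proof -
      have "matrix_inv ?J = matrix_inv P ** (matrix_inv ?s ** matrix_inv Q)"
        unfolding P[symmetric] using inv by (simp add: minv_mm invertible_mm)
      then show ?thesis
        using inv by (simp add: matrix_mul_assoc[symmetric] minv_right' minv_left)
    qed
    \<comment> \<open>The factors of \<open>Y\<close> cancel by \<open>3\<close> and those of
      \<open>\<Phi>\<close> by \<open>4\<close>. What remains involves only \<open>S0\<close>, which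
      tends to the identity at infinity, while \<open>\<Phi>s\<close> alone may have no
      limit.\<close>
    have "\<Phi>s z t ** matrix_inv ?J ** cadjoint (\<Phi>s ?w t) ** ?s =
        X ** (P ** (matrix_inv V ** matrix_inv ?J ** matrix_inv W) ** Q) ** U ** ?s"
      unfolding 1 2 by (simp add: matrix_mul_assoc)
    also have "\<dots> = X ** matrix_inv ?s ** U ** ?s" by (simp only: 3 4)
    finally have "matrix_inv (\<Phi>s z t ** matrix_inv ?J ** cadjoint (\<Phi>s ?w t) ** ?s) =
        matrix_inv ?s ** (matrix_inv U ** (matrix_inv (matrix_inv ?s) ** matrix_inv X))"
      using inv by (simp add: minv_mm invertible_mm invertible_minv)
    moreover have "matrix_inv (matrix_inv ?s) = ?s"
      by (rule matrix_inv_eqI) (simp add: minv_left inv)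
    ultimately show ?thesis by (simp add: U_def X_def matrix_mul_assoc)
  qed
  define G where "G z = \<Phi>s z t ** matrix_inv ?J ** cadjoint (\<Phi>s (- cnj z) t) ** ?s" for z
  have "G z = mat 1" for z
  proof (rule matrix_liouville)
    show "mhol G UNIV"
      unfolding G_def
      by (intro mhol_mult mhol_const hol_\<Phi>s[OF t] mhol_reflect[where F = "\<lambda>z. \<Phi>s z t"] open_UNIV
          mhol_subset[OF hol_\<Phi>s[OF t]]) auto
    have refl: "filterlim (\<lambda>z. - cnj z) at_infinity at_infinity"
      unfolding filterlim_at_infinity[OF order_refl] by (auto simp: eventually_at_infinity)
    have lim: "((\<lambda>z. matrix_inv ?s ** matrix_inv (cadjoint (S0 (- cnj z) t)) ** ?s ** matrix_inv (S0 z t)) \<longlongrightarrow>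
        matrix_inv ?s ** matrix_inv (cadjoint (mat 1)) ** ?s ** matrix_inv (mat 1)) at_infinity"
      by (intro tendsto_mm tendsto_const tendsto_minv bounded_linear.tendsto[OF bounded_linear_cadjoint]
          filterlim_compose[OF S0_lim[OF t] refl] S0_lim[OF t] invertible_cadjoint invertible_mat) auto
    have one: "matrix_inv (mat 1 :: 'p cmat) = mat 1" "cadjoint (mat 1 :: 'p cmat) = mat 1"
      by (auto intro: matrix_inv_eqI simp: cadjoint_mat)
    have "((\<lambda>z. matrix_inv (G z)) \<longlongrightarrow> mat 1) at_infinity"
    proof (rule Lim_transform_eventually[OF lim[unfolded one matrix_mul_rid minv_left[OF inv1[OF t']]]])
      show "eventually (\<lambda>z. matrix_inv ?s ** matrix_inv (cadjoint (S0 (- cnj z) t)) ** ?s ** matrix_inv (S0 z t) =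
          matrix_inv (G z)) at_infinity"
        unfolding eventually_at_infinity G_def by (intro exI[of _ "R + 1"] allI impI E') simp
    qed
    then have "((\<lambda>z. matrix_inv (matrix_inv (G z))) \<longlongrightarrow> matrix_inv (mat 1)) at_infinity"
      by (rule tendsto_minv) (simp add: invertible_mat)
    moreover have "matrix_inv (matrix_inv (G z)) = G z" for z
    proof (rule matrix_inv_eqI, rule minv_left)
      show "invertible (G z)"
        unfolding G_def by (intro invertible_mm \<Phi>s_inv t invertible_minv inv1 t0 t' invertible_cadjoint)
    qed
    ultimately show "(G \<longlongrightarrow> mat 1) at_infinity" by (simp add: one)
  qed
  then have "\<Phi>s z t ** (matrix_inv ?J ** (cadjoint (\<Phi>s (- cnj z) t) ** ?s)) = mat 1"
    by (simp add: G_def matrix_mul_assoc)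
  then have "(matrix_inv ?J ** (cadjoint (\<Phi>s (- cnj z) t) ** ?s)) ** \<Phi>s z t = mat 1"
    by (rule mult_eq_1_commute)
  then have "?J ** ((matrix_inv ?J ** (cadjoint (\<Phi>s (- cnj z) t) ** ?s)) ** \<Phi>s z t) = ?J" by simp
  then show ?thesis
    by (simp add: matrix_mul_assoc[symmetric] minv_right'[OF inv1[OF t0]])
qed

text \<open>The coefficient of \<open>1 / z\<close> in the expansion of \<open>S\<close> at
  infinity; the choice is justified by the next lemma.\<close>

definition S1 where "S1 t = (SOME L. ((\<lambda>z. mat z ** (S0 z t - mat 1)) \<longlongrightarrow> L) at_infinity)"

lemma S1: "t \<in> T \<Longrightarrow> ((\<lambda>z. mat z ** (S0 z t - mat 1)) \<longlongrightarrow> S1 t) at_infinity"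
proof -
  assume t: "t \<in> T"
  have "mat_analytic_at_infinity (\<lambda>z. S0 z t) (mat 1)"
    by (rule mat_analytic_at_infinityI[OF R hol_S0[OF t] S0_lim[OF t]])
  then have "\<exists>L. ((\<lambda>z. mat z ** (S0 z t - mat 1)) \<longlongrightarrow> L) at_infinity"
    by (rule mat_analytic_at_infinityE) blast
  then show ?thesis unfolding S1_def by (rule someI_ex)
qed

text \<open>Comparing the terms of order \<open>z^0\<close> at infinity in
  \<open>S' + S A = As S\<close>, with \<open>A = z \<alpha> + \<beta>\<close> and
  \<open>As = z \<alpha> + \<beta>s\<close>, forces this value: with it, and with no other,
  \<open>S A S^-1 - As\<close> tends to 0.\<close>

definition \<beta>s where "\<beta>s t = \<beta> t + S1 t ** \<alpha> t - \<alpha> t ** S1 t"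
definition \<gamma>s where "\<gamma>s t = \<sigma>1 t ** \<beta>s t"

text \<open>\<open>S0\<close> is composed of \<open>\<Psi>\<close>, \<open>Y\<close> and
  \<open>\<Phi>s\<close>, which in turn carry the form \<open>\<sigma>1 t\<close> to
  \<open>\<sigma>1 t0\<close>, preserve it, and carry it back.\<close>

lemma S0_symmetry:
  assumes t: "t \<in> T" and z: "R < norm z"
  shows "cadjoint (S0 (- cnj z) t) ** \<sigma>1 t ** S0 z t = \<sigma>1 t"
proof -
  let ?w = "- cnj z"
  have w: "R < norm ?w" using z by simp
  note t' = Tab[OF t]
  have inv: "matrix_inv (\<Phi> z t) = \<Psi> z t" for z by (rule matrix_inv_eqI[OF \<Phi>\<Psi>[OF t']])
  have "cadjoint (\<Psi> ?w t) ** \<sigma>1 t0 ** \<Psi> z t = \<sigma>1 t"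
  proof -
    have "cadjoint (\<Psi> ?w t) ** cadjoint (\<Phi> ?w t) = mat 1"
      by (metis \<Phi>\<Psi>[OF t'] cadjoint_mat cadjoint_mult complex_cnj_one)
    then have "cadjoint (\<Psi> ?w t) ** (cadjoint (\<Phi> ?w t) ** \<sigma>1 t ** \<Phi> z t) ** \<Psi> z t = \<sigma>1 t"
      by (metis (no_types) \<Phi>\<Psi>[OF t'] matrix_mul_assoc matrix_mul_lid matrix_mul_rid)
    then show ?thesis by (simp only: \<Phi>_symmetry[OF t'])
  qed
  moreover have "cadjoint (S0 ?w t) ** \<sigma>1 t ** S0 z t =
      cadjoint (\<Psi> ?w t) ** (cadjoint (Y ?w) ** (cadjoint (\<Phi>s ?w t) ** \<sigma>1 t ** \<Phi>s z t) ** Y z) ** \<Psi> z t"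
    unfolding S0_eq[OF t z] S0_eq[OF t w] by (simp add: cadjoint_mult matrix_mul_assoc)
  ultimately show ?thesis by (simp only: \<Phi>s_symmetry[OF t] Y_symmetry[OF z])
qed

text \<open>This is the term of order \<open>1 / z\<close> in \<open>S0_symmetry\<close>. The
  reflection changes the sign of \<open>1 / z\<close>, so \<open>S1\<close> comes out self-adjoint
  rather than skew-adjoint for the form \<open>\<sigma>1 t\<close>.\<close>

lemma S1_symmetry:
  assumes t: "t \<in> T"
  shows "\<sigma>1 t ** S1 t = cadjoint (S1 t) ** \<sigma>1 t"
proof -
  let ?s = "\<sigma>1 t"
  let ?E = "\<lambda>z. mat z ** (S0 z t - mat 1)"
  have refl: "filterlim (\<lambda>z. - cnj z) at_infinity at_infinity"
    unfolding filterlim_at_infinity[OF order_refl] by (auto simp: eventually_at_infinity)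
  have "((\<lambda>z. ?s ** ?E z - cadjoint (?E (- cnj z)) ** ?s ** S0 z t) \<longlongrightarrow>
      ?s ** S1 t - cadjoint (S1 t) ** ?s ** mat 1) at_infinity"
    by (intro tendsto_diff tendsto_mm tendsto_const S1[OF t] S0_lim[OF t]
        bounded_linear.tendsto[OF bounded_linear_cadjoint] filterlim_compose[OF S1[OF t] refl])
  moreover have "eventually (\<lambda>z. ?s ** ?E z - cadjoint (?E (- cnj z)) ** ?s ** S0 z t = 0) at_infinity"
    unfolding eventually_at_infinity
  proof (intro exI[of _ "R + 1"] allI impI)
    fix z :: complex assume "R + 1 \<le> norm z"
    then have z: "R < norm z" by simp
    have mz: "mat (- z) ** X = - (mat z ** X)" for X :: "'p cmat" by (simp add: vec_eq_iff mat_mult_nth)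
    have "cadjoint (?E (- cnj z)) = - (mat z ** (cadjoint (S0 (- cnj z) t) - mat 1))"
      by (simp add: cadjoint_mult cadjoint_diff cadjoint_mat mat_commute mz)
    then have "cadjoint (?E (- cnj z)) ** ?s ** S0 z t =
        - (mat z ** (cadjoint (S0 (- cnj z) t) ** ?s ** S0 z t - ?s ** S0 z t))"
      by (simp add: mm_algebra matrix_mul_assoc)
    also have "\<dots> = mat z ** (?s ** S0 z t - ?s)"
      by (simp add: S0_symmetry[OF t z] mm_algebra)
    also have "\<dots> = mat z ** (?s ** (S0 z t - mat 1))" by (simp add: mm_diff_right)
    also have "\<dots> = ?s ** ?E z" by (rule mat_left_commute[symmetric])
    finally show "?s ** ?E z - cadjoint (?E (- cnj z)) ** ?s ** S0 z t = 0" by simp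
  qed
  ultimately have "((\<lambda>z::complex. 0) \<longlongrightarrow> ?s ** S1 t - cadjoint (S1 t) ** ?s ** mat 1) at_infinity"
    by (rule Lim_transform_eventually)
  then have "?s ** S1 t - cadjoint (S1 t) ** ?s ** mat 1 = 0"
    using tendsto_unique[OF trivial_limit_at_infinity _ tendsto_const] by blast
  then show ?thesis by simp
qed

lemma \<gamma>s_eq: "t \<in> T \<Longrightarrow> \<gamma>s t = \<gamma> t + \<sigma>1 t ** S1 t ** \<alpha> t - \<sigma>2 t ** S1 t"
  unfolding \<gamma>s_def \<beta>s_def
  by (simp add: mm_algebra \<beta>_def \<alpha>_def minv_right'[OF inv1[OF Tab]] matrix_mul_assoc minv_right[OF inv1[OF Tab]])

text \<open>By \<open>S1_symmetry\<close> the two terms by which \<open>\<gamma>s\<close> differs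
  from \<open>\<gamma>\<close> are adjoint to each other, and they enter with opposite signs; so the
  difference is skew-adjoint.\<close>

lemma \<gamma>s_condition:
  assumes t: "t \<in> T"
  shows "\<gamma>s t + cadjoint (\<gamma>s t) = - D t"
proof -
  note t' = Tab[OF t]
  have a: "cadjoint (\<alpha> t) = \<sigma>2 t ** matrix_inv (\<sigma>1 t)"
    using minv_cadjoint[OF inv1[OF t']] by (simp add: \<alpha>_def cadjoint_mult sa1[OF t'] sa2[OF t'])
  have s: "\<sigma>1 t ** \<alpha> t = \<sigma>2 t" by (simp add: \<alpha>_def minv_right'[OF inv1[OF t']])
  have "cadjoint (\<sigma>1 t ** S1 t ** \<alpha> t) = (\<sigma>2 t ** matrix_inv (\<sigma>1 t)) ** (cadjoint (S1 t) ** \<sigma>1 t)"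
    by (simp add: cadjoint_mult a sa1[OF t'])
  also have "\<dots> = \<sigma>2 t ** S1 t"
    by (simp add: S1_symmetry[OF t, symmetric] matrix_mul_assoc[symmetric] minv_left'[OF inv1[OF t']])
  finally have c1: "cadjoint (\<sigma>1 t ** S1 t ** \<alpha> t) = \<sigma>2 t ** S1 t" .
  have "\<sigma>1 t ** S1 t ** \<alpha> t = cadjoint (S1 t) ** \<sigma>2 t"
    unfolding S1_symmetry[OF t] by (simp add: matrix_mul_assoc[symmetric] s)
  then have c2: "cadjoint (\<sigma>2 t ** S1 t) = \<sigma>1 t ** S1 t ** \<alpha> t"
    by (simp add: cadjoint_mult sa2[OF t'])
  show ?thesis
    unfolding \<gamma>s_eq[OF t] using D\<gamma>[OF t'] by (simp add: cadjoint_add cadjoint_diff c1 c2)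
qed

end

text \<open>The formula for \<open>X\<close> is available only where \<open>Y\<close> is analytic.
  The limit in the cone of twice the aperture bounds \<open>Y\<close> near the vertex, and that cone
  contains a full neighbourhood of each point of the smaller one; so the smaller cone has no poles
  of \<open>Y\<close> near the vertex.\<close>

lemma nontangential_limit_product:
  fixes Y A B X :: "complex \<Rightarrow> 'p::finite cmat"
  assumes Y: "mat_meromorphic_on Y right_half_plane" and L: "nontangential_limit Y y L"
    and A: "isCont A (Complex 0 y)" and B: "isCont B (Complex 0 y)"
    and X: "\<And>z. 0 < Re z \<Longrightarrow> mat_analytic_at Y z \<Longrightarrow> X z = A z ** Y z ** B z"
  shows "nontangential_limit X y (A (Complex 0 y) ** L ** B (Complex 0 y))"
  unfolding nontangential_limit_def
proof (intro allI impI)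
  fix M :: real assume M: "M > 0"
  let ?p = "Complex 0 y" and ?St = "\<lambda>M. {z. 0 < Re z \<and> \<bar>Im z - y\<bar> \<le> M * Re z}"
  have "(Y \<longlongrightarrow> L) (at ?p within ?St (2 * M))"
    using L M unfolding nontangential_limit_def by simp
  then have "eventually (\<lambda>w. dist (Y w) L < 1) (at ?p within ?St (2 * M))"
    by (rule tendstoD) simp
  then obtain d where d: "d > 0" "\<And>w. w \<in> ?St (2 * M) \<Longrightarrow> w \<noteq> ?p \<Longrightarrow> dist w ?p < d \<Longrightarrow> dist (Y w) L < 1"
    unfolding eventually_at by auto
  have good: "mat_analytic_at Y z" if z: "z \<in> ?St M" "dist z ?p < d" for z
    unfolding mat_analytic_at_def
  proof (intro allI)
    fix i j
    let ?U = "{w. 0 < Re w} \<inter> {w. Im w - y < 2 * M * Re w} \<inter> {w. y - Im w < 2 * M * Re w} \<inter> ball ?p d"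
    have op: "open ?U" by (intro open_Int open_Collect_less open_ball continuous_intros)
    have "M * Re z < 2 * M * Re z" using M z by simp
    then have "z \<in> ?U" using z by (auto simp: dist_commute)
    then have "eventually (\<lambda>w. w \<in> ?U) (at z)" using op eventually_at_in_open' by blast
    then have bd: "eventually (\<lambda>w. norm (Y w $ i $ j) \<le> norm L + 1) (at z)"
    proof (rule eventually_mono)
      fix w assume "w \<in> ?U"
      then have "w \<in> ?St (2 * M)" "w \<noteq> ?p" "dist w ?p < d" by (auto simp: dist_commute abs_le_iff)
      then have "dist (Y w) L < 1" by (rule d(2))
      then have "norm (Y w) \<le> norm L + 1"
        using norm_triangle_ineq2[of "Y w" L] by (simp add: dist_norm)
      then show "norm (Y w $ i $ j) \<le> norm L + 1" using norm_entry_le order_trans by blast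
    qed
    have nice: "(\<lambda>w. Y w $ i $ j) nicely_meromorphic_on right_half_plane"
      using Y unfolding mat_meromorphic_on_def by blast
    have "\<not> is_pole (\<lambda>w. Y w $ i $ j) z"
    proof
      assume "is_pole (\<lambda>w. Y w $ i $ j) z"
      then have "eventually (\<lambda>w. norm L + 2 \<le> norm (Y w $ i $ j)) (at z)"
        unfolding is_pole_def filterlim_at_infinity[OF order_refl] by (simp add: add_nonneg_pos)
      with bd have "eventually (\<lambda>w. False) (at z)" by eventually_elim simp
      then show False by simp
    qed
    then show "(\<lambda>w. Y w $ i $ j) analytic_on {z}"
      using nicely_meromorphic_on_imp_analytic_at[OF nice] z by simp
  qed
  have sub: "(f \<longlongrightarrow> f ?p) (at ?p within ?St M)" if "isCont f ?p" for f :: "complex \<Rightarrow> 'p cmat"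
    using that unfolding isCont_def by (rule tendsto_within_subset[where S = UNIV]) simp
  have "(Y \<longlongrightarrow> L) (at ?p within ?St M)"
    using L M unfolding nontangential_limit_def by blast
  then have "((\<lambda>z. A z ** Y z ** B z) \<longlongrightarrow> A ?p ** L ** B ?p) (at ?p within ?St M)"
    by (rule tendsto_mm[OF tendsto_mm[OF sub[OF A]] sub[OF B]])
  moreover have "eventually (\<lambda>z. A z ** Y z ** B z = X z) (at ?p within ?St M)"
    unfolding eventually_at using d(1) good X by (intro exI[of _ d]) auto
  ultimately show "(X \<longlongrightarrow> A ?p ** L ** B ?p) (at ?p within ?St M)"
    by (rule Lim_transform_eventually)
qed

section \<open>Differentiating the factorization with respect to time\<close>

context birkhoff_family
begin

text \<open>Here \<open>(I + dS) (I + dG) = I + dM\<close> is again a Birkhoff factorization; the bounds for splittings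
  turn the first-order expansion of \<open>\<Phi>\<close> at \<open>\<tau>\<close> into one for \<open>\<Phi>s\<close>.\<close>

definition dS where "dS \<tau> t w = S0 w t ** matrix_inv (S0 w \<tau>) - mat 1"
definition dG where "dG \<tau> t w = S0 w \<tau> ** (\<Phi> w t ** \<Psi> w \<tau> - mat 1) ** matrix_inv (S0 w \<tau>)"
definition dM where "dM \<tau> t w = \<Phi>s w t ** matrix_inv (\<Phi>s w \<tau>) - mat 1"

lemma hol_dG: "t \<in> T \<Longrightarrow> \<tau> \<in> T \<Longrightarrow> R \<le> \<rho> \<Longrightarrow> mhol (dG \<tau> t) (outside \<rho>)"
  unfolding dG_def
  by (intro mhol_mult mhol_diff mhol_const mhol_minv mhol_subset[OF hol_S0] mhol_subset[OF hol_\<Phi>]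
      mhol_subset[OF hol_\<Psi>] Tab S0_inv) auto

lemma hol_dS: "t \<in> T \<Longrightarrow> \<tau> \<in> T \<Longrightarrow> R \<le> \<rho> \<Longrightarrow> mhol (dS \<tau> t) (outside \<rho>)"
  unfolding dS_def
  by (intro mhol_mult mhol_diff mhol_const mhol_minv mhol_subset[OF hol_S0] S0_inv) auto

lemma minv_1: "matrix_inv (mat 1 :: 'p cmat) = mat 1"
  by (rule matrix_inv_eqI) simp

lemma dS_lim: "t \<in> T \<Longrightarrow> \<tau> \<in> T \<Longrightarrow> (dS \<tau> t \<longlongrightarrow> 0) at_infinity"
proof -
  assume t: "t \<in> T" "\<tau> \<in> T"
  have "((\<lambda>w. S0 w t ** matrix_inv (S0 w \<tau>) - mat 1) \<longlongrightarrow> mat 1 ** matrix_inv (mat 1) - mat 1) at_infinity"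
    by (intro tendsto_diff tendsto_mm tendsto_const tendsto_minv S0_lim t invertible_mat) simp
  then show ?thesis by (simp add: dS_def[abs_def] minv_1)
qed

text \<open>The factorization of the increment, written additively. The radius \<open>\<rho>\<close>
  is left free so that any given \<open>z\<close> can be placed in the disc of radius
  \<open>2 * \<rho>\<close> on which the entire part is estimated.\<close>

lemma dsplit:
  assumes t: "t \<in> T" "\<tau> \<in> T" and \<rho>: "R \<le> \<rho>"
  shows "splits \<rho> (\<lambda>w. dG \<tau> t w + dS \<tau> t w ** dG \<tau> t w) (dM \<tau> t) (dS \<tau> t)"
  unfolding splits_def
proof (intro conjI ballI)
  show "mhol (dM \<tau> t) UNIV"
    unfolding dM_def by (intro mhol_mult mhol_diff mhol_const mhol_minv hol_\<Phi>s t \<Phi>s_inv)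
  fix w assume "w \<in> outside \<rho>"
  then have w: "R < norm w" using \<rho> by simp
  define X where "X = S0 w \<tau>"
  define Xi where "Xi = matrix_inv X"
  have X: "X ** Xi = mat 1" "Xi ** X = mat 1"
    unfolding X_def Xi_def by (simp_all add: minv_left minv_right S0_inv t w)
  have inv\<tau>: "matrix_inv (\<Phi>s w \<tau>) = Y w ** \<Psi> w \<tau> ** Xi"
  proof (rule matrix_inv_eqI)
    have "\<Phi>s w \<tau> ** (Y w ** \<Psi> w \<tau> ** Xi) = (\<Phi>s w \<tau> ** Y w ** \<Psi> w \<tau>) ** Xi"
      by (simp add: matrix_mul_assoc)
    also have "\<dots> = mat 1" unfolding S0_eq[OF t(2) w, symmetric] X_def[symmetric] by (rule X)
    finally show "\<Phi>s w \<tau> ** (Y w ** \<Psi> w \<tau> ** Xi) = mat 1" .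
  qed
  have dG: "mat 1 + dG \<tau> t w = X ** (\<Phi> w t ** \<Psi> w \<tau>) ** Xi"
    unfolding dG_def X_def[symmetric] Xi_def[symmetric] by (simp add: mm_algebra X)
  have dS: "mat 1 + dS \<tau> t w = S0 w t ** Xi" by (simp add: dS_def Xi_def X_def)
  have "mat 1 + dM \<tau> t w = S0 w t ** \<Phi> w t ** matrix_inv (Y w) ** (Y w ** \<Psi> w \<tau> ** Xi)"
    unfolding dM_def inv\<tau> \<Phi>s_eq[OF t(1) w] by simp
  also have "\<dots> = S0 w t ** (\<Phi> w t ** \<Psi> w \<tau>) ** Xi"
    by (simp add: matrix_mul_assoc[symmetric] minv_left'[OF Y_inv[OF w]])
  also have "\<dots> = S0 w t ** (Xi ** X) ** (\<Phi> w t ** \<Psi> w \<tau>) ** Xi" by (simp add: X)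
  also have "\<dots> = (mat 1 + dS \<tau> t w) ** (mat 1 + dG \<tau> t w)"
    unfolding dG dS by (simp add: matrix_mul_assoc)
  finally have "mat 1 + dM \<tau> t w = (mat 1 + dS \<tau> t w) ** (mat 1 + dG \<tau> t w)" .
  then show "dM \<tau> t w - dS \<tau> t w = dG \<tau> t w + dS \<tau> t w ** dG \<tau> t w"
    by (simp add: mm_algebra algebra_simps)
qed (use hol_dS[OF t \<rho>] dS_lim[OF t] in auto)

text \<open>\<open>dG\<close> is of order \<open>t - \<tau>\<close> on the annulus because
  \<open>\<Phi>\<close> is Lipschitz, while \<open>dS\<close> is at first merely bounded. That
  already makes the function being split of order \<open>t - \<tau>\<close>, and the splitting
  bounds return this order for \<open>dS\<close>.\<close>

lemma local_estimates:
  assumes \<tau>: "\<tau> \<in> T" and \<rho>: "R \<le> \<rho>"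
  shows "\<exists>K\<ge>0. \<forall>t\<in>T.
    (\<forall>w. \<rho> < norm w \<longrightarrow> norm w \<le> 2 * \<rho> \<longrightarrow> norm (dG \<tau> t w) \<le> K * \<bar>t - \<tau>\<bar>) \<and>
    (\<forall>w. \<rho> < norm w \<longrightarrow> norm (dS \<tau> t w) \<le> K * \<bar>t - \<tau>\<bar>) \<and>
    (\<forall>w. 2 * \<rho> \<le> norm w \<longrightarrow> norm w * norm (dS \<tau> t w) \<le> K * \<bar>t - \<tau>\<bar>)"
proof -
  let ?N = "norm (mat 1 :: 'p cmat)" and ?C = "split_const TYPE('p)"
  have \<rho>0: "\<rho> > 0" using R \<rho> by simp
  note \<tau>' = Tab[OF \<tau>]
  obtain L where L: "L \<ge> 0" "\<And>z s t. norm z \<le> 2 * \<rho> \<Longrightarrow> s \<in> {a..b} \<Longrightarrow> t \<in> {a..b} \<Longrightarrow>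
      norm (\<Phi> z t - \<Phi> z s) \<le> L * \<bar>t - s\<bar>"
    using fundamental_pair_lipschitz[OF fp' t0 cont_\<alpha> cont_\<beta>, of "2 * \<rho>"] by blast
  obtain B where B: "\<And>z. norm z \<le> 2 * \<rho> \<Longrightarrow> norm (\<Psi> z \<tau>) \<le> B"
    using fp' \<tau>' unfolding fundamental_pair_def by meson
  have B0: "B \<ge> 0" using order_trans[OF norm_ge_zero B[of 0]] \<rho>0 by simp
  define G where "G = (?N + 1/2) * (L * B) * (2 * ?N)"
  define K1 where "K1 = (?N + 1/2) * (2 * ?N) + ?N"
  have G0: "G \<ge> 0" and K10: "K1 \<ge> 0" using L B0 by (simp_all add: G_def K1_def)
  have C6: "?C \<ge> 6" by (rule split_const_ge)
  have dG: "norm (dG \<tau> t w) \<le> G * \<bar>t - \<tau>\<bar>" if t: "t \<in> T" and w: "\<rho> < norm w" "norm w \<le> 2 * \<rho>" for t w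
  proof -
    have wR: "R < norm w" using w \<rho> by simp
    have "\<Phi> w t ** \<Psi> w \<tau> - mat 1 = (\<Phi> w t - \<Phi> w \<tau>) ** \<Psi> w \<tau>"
      using \<Phi>\<Psi>[OF \<tau>', of w] by (simp add: mm_diff_left)
    then have "norm (\<Phi> w t ** \<Psi> w \<tau> - mat 1) \<le> (L * \<bar>t - \<tau>\<bar>) * B"
      using norm_matrix_mult_le[OF L(2)[OF w(2) \<tau>' Tab[OF t]] B[OF w(2)]] by simp
    then have "norm (dG \<tau> t w) \<le> (?N + 1/2) * ((L * \<bar>t - \<tau>\<bar>) * B) * (2 * ?N)"
      unfolding dG_def by (intro norm_matrix_mult_le norm_S0 norm_S0_inv \<tau> wR)
    then show ?thesis by (simp add: G_def mult_ac)
  qed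
  have dS: "norm (dS \<tau> t w) \<le> K1" if t: "t \<in> T" and w: "\<rho> < norm w" for t w
  proof -
    have wR: "R < norm w" using w \<rho> by simp
    have "norm (S0 w t ** matrix_inv (S0 w \<tau>)) \<le> (?N + 1/2) * (2 * ?N)"
      by (intro norm_matrix_mult_le norm_S0 norm_S0_inv \<tau> t wR)
    then show ?thesis
      unfolding dS_def K1_def using norm_triangle_ineq4[of "S0 w t ** matrix_inv (S0 w \<tau>)" "mat 1"] by linarith
  qed
  have F: "norm (dG \<tau> t w + dS \<tau> t w ** dG \<tau> t w) \<le> (1 + K1) * (G * \<bar>t - \<tau>\<bar>)"
    if t: "t \<in> T" and w: "\<rho> < norm w" "norm w \<le> 2 * \<rho>" for t w
  proof -
    have "norm (dS \<tau> t w ** dG \<tau> t w) \<le> K1 * (G * \<bar>t - \<tau>\<bar>)"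
      by (intro norm_matrix_mult_le dS dG t w)
    then show ?thesis
      using dG[OF t w] norm_triangle_ineq[of "dG \<tau> t w" "dS \<tau> t w ** dG \<tau> t w"] by (simp add: algebra_simps)
  qed
  define K where "K = G + ?C * ((1 + K1) * G) + ?C * \<rho> * ((1 + K1) * G)"
  have nn: "0 \<le> ?C * ((1 + K1) * G)" "0 \<le> ?C * \<rho> * ((1 + K1) * G)"
    using C6 K10 G0 \<rho>0 by simp_all
  have holF: "mhol (\<lambda>w. dG \<tau> t w + dS \<tau> t w ** dG \<tau> t w) (outside \<rho>)" if t: "t \<in> T" for t
    by (intro mhol_add mhol_mult hol_dG hol_dS t \<tau> \<rho>)
  show ?thesis
  proof (intro exI[of _ K] conjI ballI allI impI)
    show "K \<ge> 0" using nn G0 by (simp add: K_def)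
    fix t assume t: "t \<in> T"
    have le: "x * \<bar>t - \<tau>\<bar> \<le> K * \<bar>t - \<tau>\<bar>" if "x \<le> K" for x using that by (intro mult_right_mono) auto
    show "norm (dG \<tau> t w) \<le> K * \<bar>t - \<tau>\<bar>" if "\<rho> < norm w" "norm w \<le> 2 * \<rho>" for w
      by (rule order_trans[OF dG[OF t that] le]) (use nn in \<open>simp add: K_def\<close>)
    show "norm (dS \<tau> t w) \<le> K * \<bar>t - \<tau>\<bar>" if w: "\<rho> < norm w" for w
    proof -
      have "norm (dS \<tau> t w) \<le> ?C * ((1 + K1) * (G * \<bar>t - \<tau>\<bar>))"
        by (rule splits_bounds(2)[OF \<rho>0 holF[OF t] F[OF t] dsplit[OF t \<tau> \<rho>] w])
      also have "\<dots> = (?C * ((1 + K1) * G)) * \<bar>t - \<tau>\<bar>" by (simp add: mult_ac)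
      also have "\<dots> \<le> K * \<bar>t - \<tau>\<bar>" by (rule le) (use nn G0 in \<open>simp add: K_def\<close>)
      finally show ?thesis .
    qed
    show "norm w * norm (dS \<tau> t w) \<le> K * \<bar>t - \<tau>\<bar>" if w: "2 * \<rho> \<le> norm w" for w
    proof -
      have "norm w * norm (dS \<tau> t w) \<le> ?C * \<rho> * ((1 + K1) * (G * \<bar>t - \<tau>\<bar>))"
        by (rule splits_bounds(3)[OF \<rho>0 holF[OF t] F[OF t] dsplit[OF t \<tau> \<rho>] w])
      also have "\<dots> = (?C * \<rho> * ((1 + K1) * G)) * \<bar>t - \<tau>\<bar>" by (simp add: mult_ac)
      also have "\<dots> \<le> K * \<bar>t - \<tau>\<bar>" by (rule le) (use nn G0 in \<open>simp add: K_def\<close>)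
      finally show ?thesis .
    qed
  qed
qed

text \<open>The increment of \<open>S1\<close> is the limit of \<open>w dS S0\<close> at infinity,
  and the estimate for \<open>norm w * norm (dS \<tau> t w)\<close> survives this limit.\<close>

lemma S1_continuous: "continuous_on T S1"
  unfolding continuous_on_iff
proof (intro ballI allI impI)
  fix \<tau> e assume \<tau>: "\<tau> \<in> T" and e: "(e::real) > 0"
  let ?N = "norm (mat 1 :: 'p cmat)"
  obtain K where K: "K \<ge> 0" "\<And>t w. t \<in> T \<Longrightarrow> 2 * R \<le> norm w \<Longrightarrow> norm w * norm (dS \<tau> t w) \<le> K * \<bar>t - \<tau>\<bar>"
    using local_estimates[OF \<tau> order_refl] by blast
  define K' where "K' = K * (?N + 1/2) + 1"
  have K'0: "K' > 0" using K by (simp add: K'_def add_nonneg_pos)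
  show "\<exists>d>0. \<forall>t\<in>T. dist t \<tau> < d \<longrightarrow> dist (S1 t) (S1 \<tau>) < e"
  proof (intro exI[of _ "e / K'"] conjI ballI impI)
    show "e / K' > 0" using e K'0 by simp
    fix t assume t: "t \<in> T" and d: "dist t \<tau> < e / K'"
    have "((\<lambda>w. norm (mat w ** (S0 w t - mat 1) - mat w ** (S0 w \<tau> - mat 1))) \<longlongrightarrow> norm (S1 t - S1 \<tau>)) at_infinity"
      by (intro tendsto_norm tendsto_diff S1 t \<tau>)
    moreover have "eventually (\<lambda>w. norm (mat w ** (S0 w t - mat 1) - mat w ** (S0 w \<tau> - mat 1)) \<le>
        (K * \<bar>t - \<tau>\<bar>) * (?N + 1/2)) at_infinity"
      unfolding eventually_at_infinity
    proof (intro exI[of _ "2 * R"] allI impI)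
      fix w :: complex assume w: "2 * R \<le> norm w"
      then have wR: "R < norm w" using R by simp
      have "mat w ** (S0 w t - mat 1) - mat w ** (S0 w \<tau> - mat 1) = mat w ** (S0 w t - S0 w \<tau>)"
        by (simp add: mm_diff_right)
      also have "S0 w t - S0 w \<tau> = dS \<tau> t w ** S0 w \<tau>"
        by (simp add: dS_def mm_diff_left matrix_mul_assoc[symmetric] minv_left[OF S0_inv[OF \<tau> wR]])
      finally have "norm (mat w ** (S0 w t - mat 1) - mat w ** (S0 w \<tau> - mat 1)) =
          norm ((mat w ** dS \<tau> t w) ** S0 w \<tau>)" by (simp add: matrix_mul_assoc)
      also have "\<dots> \<le> (K * \<bar>t - \<tau>\<bar>) * (?N + 1/2)"
        by (rule norm_matrix_mult_le[OF _ norm_S0[OF \<tau> wR]]) (simp add: norm_mat_mult K(2)[OF t w])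
      finally show "norm (mat w ** (S0 w t - mat 1) - mat w ** (S0 w \<tau> - mat 1)) \<le>
        (K * \<bar>t - \<tau>\<bar>) * (?N + 1/2)" .
    qed
    ultimately have "norm (S1 t - S1 \<tau>) \<le> (K * \<bar>t - \<tau>\<bar>) * (?N + 1/2)"
      by (rule tendsto_upperbound) (rule trivial_limit_at_infinity)
    also have "\<dots> \<le> K' * \<bar>t - \<tau>\<bar>"
      by (simp add: K'_def algebra_simps)
    also have "\<dots> < e" using d K'0 by (simp add: dist_real_def pos_less_divide_eq mult.commute)
    finally show "dist (S1 t) (S1 \<tau>) < e" by (simp add: dist_norm)
  qed
qed

lemma \<gamma>s_continuous: "continuous_on T \<gamma>s"
proof -
  have "continuous_on T (\<lambda>t. \<gamma> t + \<sigma>1 t ** S1 t ** \<alpha> t - \<sigma>2 t ** S1 t)"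
    by (intro continuous_on_add continuous_on_diff continuous_on_mm S1_continuous
        continuous_on_subset[OF cont(1) T(1)] continuous_on_subset[OF cont(2) T(1)]
        continuous_on_subset[OF cont(3) T(1)] continuous_on_subset[OF cont_\<alpha> T(1)])
  then show ?thesis by (rule continuous_on_eq) (simp add: \<gamma>s_eq)
qed

text \<open>Subtracting the linear term from the split increment leaves a function that is small of
  higher order on the annulus, and whose entire part is \<open>dM - (t - \<tau>) As\<close>. The
  result is again a splitting because \<open>\<beta>s\<close> makes the outer correction
  \<open>k\<close> vanish at infinity.\<close>

lemma \<Phi>s_derivative:
  assumes \<tau>: "\<tau> \<in> T"
  shows "(\<Phi>s z has_vector_derivative (mat z ** \<alpha> \<tau> + \<beta>s \<tau>) ** \<Phi>s z \<tau>) (at \<tau> within T)"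
proof -
  let ?N = "norm (mat 1 :: 'p cmat)" and ?C = "split_const TYPE('p)"
  define \<rho> where "\<rho> = max R (norm z)"
  have \<rho>: "R \<le> \<rho>" "\<rho> > 0" "norm z \<le> 2 * \<rho>" using R by (auto simp: \<rho>_def)
  note \<tau>' = Tab[OF \<tau>]
  have C6: "?C \<ge> 6" by (rule split_const_ge)
  define A where "A w = mat w ** \<alpha> \<tau> + \<beta> \<tau>" for w
  define As where "As w = mat w ** \<alpha> \<tau> + \<beta>s \<tau>" for w
  define k where "k w = S0 w \<tau> ** A w ** matrix_inv (S0 w \<tau>) - As w" for w
  have k_lim: "(k \<longlongrightarrow> 0) at_infinity"
  proof -
    let ?E = "\<lambda>w. mat w ** (S0 w \<tau> - mat 1)"
    have l1: "((\<lambda>w. (?E w ** \<alpha> \<tau> - \<alpha> \<tau> ** ?E w + S0 w \<tau> ** \<beta> \<tau> - \<beta>s \<tau> ** S0 w \<tau>) ** matrix_inv (S0 w \<tau>)) \<longlongrightarrow>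
        (S1 \<tau> ** \<alpha> \<tau> - \<alpha> \<tau> ** S1 \<tau> + mat 1 ** \<beta> \<tau> - \<beta>s \<tau> ** mat 1) ** matrix_inv (mat 1)) at_infinity"
      by (intro tendsto_mm tendsto_add tendsto_diff tendsto_const S1 \<tau> S0_lim tendsto_minv invertible_mat) simp
    have l2: "(S1 \<tau> ** \<alpha> \<tau> - \<alpha> \<tau> ** S1 \<tau> + mat 1 ** \<beta> \<tau> - \<beta>s \<tau> ** mat 1) ** matrix_inv (mat 1) = 0"
      by (simp add: \<beta>s_def mm_zero_left)
    have ev: "eventually (\<lambda>w. (?E w ** \<alpha> \<tau> - \<alpha> \<tau> ** ?E w + S0 w \<tau> ** \<beta> \<tau> - \<beta>s \<tau> ** S0 w \<tau>) ** matrix_inv (S0 w \<tau>)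
        = k w) at_infinity"
      unfolding eventually_at_infinity
    proof (intro exI[of _ "R + 1"] allI impI)
      fix w :: complex assume "R + 1 \<le> norm w"
      then have w: "R < norm w" by simp
      have c1: "S0 w \<tau> ** (mat w ** \<alpha> \<tau>) = mat w ** (S0 w \<tau> ** \<alpha> \<tau>)"
        and c2: "\<alpha> \<tau> ** (mat w ** S0 w \<tau>) = mat w ** (\<alpha> \<tau> ** S0 w \<tau>)"
        and c3: "\<alpha> \<tau> ** mat w = mat w ** \<alpha> \<tau>"
        by (rule mat_left_commute mat_commute)+
      have "?E w ** \<alpha> \<tau> - \<alpha> \<tau> ** ?E w + S0 w \<tau> ** \<beta> \<tau> - \<beta>s \<tau> ** S0 w \<tau> =
          S0 w \<tau> ** A w - As w ** S0 w \<tau>"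
        by (simp add: A_def As_def mm_algebra c1 c2 c3 matrix_mul_assoc[symmetric])
      moreover have "(S0 w \<tau> ** A w - As w ** S0 w \<tau>) ** matrix_inv (S0 w \<tau>) = k w"
        by (simp add: k_def mm_diff_left matrix_mul_assoc[symmetric] minv_right[OF S0_inv[OF \<tau> w]])
      ultimately show "(?E w ** \<alpha> \<tau> - \<alpha> \<tau> ** ?E w + S0 w \<tau> ** \<beta> \<tau> - \<beta>s \<tau> ** S0 w \<tau>) ** matrix_inv (S0 w \<tau>)
        = k w" by simp
    qed
    show ?thesis by (rule Lim_transform_eventually[OF l1[unfolded l2] ev])
  qed
  have hol_k: "mhol k (outside \<rho>)"
    unfolding k_def A_def As_def
    by (intro mhol_mult mhol_diff mhol_add mhol_const mhol_minv mhol_subset[OF hol_S0[OF \<tau>]] S0_inv \<tau> mhol_mat holomorphic_intros)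
      (use \<rho> in auto)
  obtain K where K: "K \<ge> 0"
    "\<And>t w. t \<in> T \<Longrightarrow> \<rho> < norm w \<Longrightarrow> norm w \<le> 2 * \<rho> \<Longrightarrow> norm (dG \<tau> t w) \<le> K * \<bar>t - \<tau>\<bar>"
    "\<And>t w. t \<in> T \<Longrightarrow> \<rho> < norm w \<Longrightarrow> norm (dS \<tau> t w) \<le> K * \<bar>t - \<tau>\<bar>"
    using local_estimates[OF \<tau> \<rho>(1)] by blast
  \<comment> \<open>The remainder has two sources: the linearization of \<open>\<Phi>\<close>,
    weighted by the norms of \<open>S0\<close> and of its inverse, and the product
    \<open>dS ** dG\<close>, which is quadratic in \<open>t - \<tau>\<close>.\<close>
  have dM: "norm (dM \<tau> t z - (t - \<tau>) *\<^sub>R As z) \<le> ?C * (((?N + 1/2) * e * (2 * ?N) + K * K * \<bar>t - \<tau>\<bar>) * \<bar>t - \<tau>\<bar>)"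
    if t: "t \<in> T" and e: "e \<ge> 0"
      and lin: "\<And>w. norm w \<le> 2 * \<rho> \<Longrightarrow> norm (\<Phi> w t ** \<Psi> w \<tau> - mat 1 - (t - \<tau>) *\<^sub>R A w) \<le> e * \<bar>t - \<tau>\<bar>" for t e
  proof -
    define F where "F w = dG \<tau> t w + dS \<tau> t w ** dG \<tau> t w - (t - \<tau>) *\<^sub>R (S0 w \<tau> ** A w ** matrix_inv (S0 w \<tau>))" for w
    have scale: "(t - \<tau>) *\<^sub>R X = mat (of_real (t - \<tau>)) ** X" for X :: "'p cmat"
      by (rule mat_of_real_mult[symmetric])
    have sp: "splits \<rho> F (\<lambda>w. dM \<tau> t w - (t - \<tau>) *\<^sub>R As w) (\<lambda>w. dS \<tau> t w + (t - \<tau>) *\<^sub>R k w)"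
      unfolding splits_def
    proof (intro conjI ballI)
      note d = dsplit[OF t \<tau> \<rho>(1), unfolded splits_def]
      show "mhol (\<lambda>w. dM \<tau> t w - (t - \<tau>) *\<^sub>R As w) UNIV"
        unfolding scale As_def using d
        by (intro mhol_diff mhol_mult mhol_add mhol_const mhol_mat holomorphic_intros) auto
      show "mhol (\<lambda>w. dS \<tau> t w + (t - \<tau>) *\<^sub>R k w) (outside \<rho>)"
        unfolding scale using d by (intro mhol_add mhol_mult mhol_const hol_k) auto
      have "((\<lambda>w. dS \<tau> t w + (t - \<tau>) *\<^sub>R k w) \<longlongrightarrow> 0 + (t - \<tau>) *\<^sub>R 0) at_infinity"
        by (intro tendsto_intros dS_lim t \<tau> k_lim)
      then show "((\<lambda>w. dS \<tau> t w + (t - \<tau>) *\<^sub>R k w) \<longlongrightarrow> 0) at_infinity" by simp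
      fix w assume "w \<in> outside \<rho>"
      then have "dM \<tau> t w - dS \<tau> t w = dG \<tau> t w + dS \<tau> t w ** dG \<tau> t w" using d by blast
      then have "dM \<tau> t w = dS \<tau> t w + (dG \<tau> t w + dS \<tau> t w ** dG \<tau> t w)" by (simp add: algebra_simps)
      then show "dM \<tau> t w - (t - \<tau>) *\<^sub>R As w - (dS \<tau> t w + (t - \<tau>) *\<^sub>R k w) = F w"
        by (simp add: F_def k_def scaleR_diff_right)
    qed
    have holF: "mhol F (outside \<rho>)"
      unfolding F_def scale A_def
      by (intro mhol_mult mhol_diff mhol_add mhol_const mhol_minv mhol_subset[OF hol_S0[OF \<tau>]] S0_inv \<tau> mhol_mat
          holomorphic_intros hol_dG hol_dS t \<rho>(1)) (use \<rho> in auto)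
    have bF: "norm (F w) \<le> ((?N + 1/2) * e * (2 * ?N) + K * K * \<bar>t - \<tau>\<bar>) * \<bar>t - \<tau>\<bar>"
      if w: "\<rho> < norm w" "norm w \<le> 2 * \<rho>" for w
    proof -
      have wR: "R < norm w" using w \<rho> by simp
      have eq: "F w = S0 w \<tau> ** (\<Phi> w t ** \<Psi> w \<tau> - mat 1 - (t - \<tau>) *\<^sub>R A w) ** matrix_inv (S0 w \<tau>) + dS \<tau> t w ** dG \<tau> t w"
        unfolding F_def dG_def by (simp add: mm_algebra mm_scaleR_left mm_scaleR_right)
      have b1: "norm (S0 w \<tau> ** (\<Phi> w t ** \<Psi> w \<tau> - mat 1 - (t - \<tau>) *\<^sub>R A w) ** matrix_inv (S0 w \<tau>)) \<le>
          (?N + 1/2) * (e * \<bar>t - \<tau>\<bar>) * (2 * ?N)"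
        by (intro norm_matrix_mult_le norm_S0 norm_S0_inv \<tau> wR lin w)
      have b2: "norm (dS \<tau> t w ** dG \<tau> t w) \<le> (K * \<bar>t - \<tau>\<bar>) * (K * \<bar>t - \<tau>\<bar>)"
        by (intro norm_matrix_mult_le K t w)
      have "norm (F w) \<le> (?N + 1/2) * (e * \<bar>t - \<tau>\<bar>) * (2 * ?N) + (K * \<bar>t - \<tau>\<bar>) * (K * \<bar>t - \<tau>\<bar>)"
        unfolding eq by (rule order_trans[OF norm_triangle_ineq add_mono[OF b1 b2]])
      also have "\<dots> = ((?N + 1/2) * e * (2 * ?N) + K * K * \<bar>t - \<tau>\<bar>) * \<bar>t - \<tau>\<bar>" by (simp add: algebra_simps)
      finally show ?thesis .
    qed
    show ?thesis by (rule splits_bounds(1)[OF \<rho>(2) holF bF sp \<rho>(3)])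
  qed
  have "((\<lambda>t. dM \<tau> t z) has_vector_derivative As z) (at \<tau> within T)"
    unfolding has_vector_derivative_def has_derivative_within_alt
  proof (intro conjI allI impI)
    show "bounded_linear (\<lambda>x. x *\<^sub>R As z)" by (rule bounded_linear_scaleR_left)
    fix e :: real assume e: "0 < e"
    define N2 where "N2 = (?N + 1/2) * (2 * ?N)"
    have N2: "N2 > 0" using norm_mat_1_pos[where 'n = 'p] unfolding N2_def
      by (intro mult_pos_pos; linarith)
    define e1 where "e1 = e / (2 * ?C * N2)"
    have e1: "e1 > 0" using e N2 C6 by (simp add: e1_def)
    obtain d1 where d1: "d1 > 0" "\<And>w t. norm w \<le> 2 * \<rho> \<Longrightarrow> t \<in> {a..b} \<Longrightarrow> \<bar>t - \<tau>\<bar> < d1 \<Longrightarrow>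
       norm (\<Phi> w t ** \<Psi> w \<tau> - mat 1 - (t - \<tau>) *\<^sub>R A w) \<le> e1 * \<bar>t - \<tau>\<bar>"
      using fundamental_pair_linearization[OF fp' t0 cont_\<alpha> cont_\<beta> \<tau>' e1, of "2 * \<rho>"] unfolding A_def by blast
    define d2 where "d2 = e / (2 * ?C * (K * K + 1))"
    have KK: "K * K + 1 > 0" using K(1) by (simp add: add_nonneg_pos)
    have d2: "d2 > 0" using e C6 KK by (simp add: d2_def)
    show "\<exists>d>0. \<forall>t\<in>T. norm (t - \<tau>) < d \<longrightarrow>
        norm (dM \<tau> t z - dM \<tau> \<tau> z - (t - \<tau>) *\<^sub>R As z) \<le> e * norm (t - \<tau>)"
    proof (intro exI[of _ "min d1 d2"] conjI ballI impI)
      show "min d1 d2 > 0" using d1 d2 by simp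
      fix t assume t: "t \<in> T" and td: "norm (t - \<tau>) < min d1 d2"
      have "dM \<tau> \<tau> z = 0" by (simp add: dM_def minv_right[OF \<Phi>s_inv[OF \<tau>]])
      then have "norm (dM \<tau> t z - dM \<tau> \<tau> z - (t - \<tau>) *\<^sub>R As z) \<le>
          ?C * (((?N + 1/2) * e1 * (2 * ?N) + K * K * \<bar>t - \<tau>\<bar>) * \<bar>t - \<tau>\<bar>)"
        using dM[OF t less_imp_le[OF e1] d1(2)] Tab[OF t] td by simp
      also have "\<dots> = (?C * N2 * e1 + ?C * (K * K) * \<bar>t - \<tau>\<bar>) * \<bar>t - \<tau>\<bar>"
        by (simp add: N2_def algebra_simps)
      also have "\<dots> \<le> (e / 2 + e / 2) * \<bar>t - \<tau>\<bar>"
      proof (intro mult_right_mono add_mono)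
        have half: "c * k * (e / (2 * c * k)) = e / 2" if "c > 0" "k > 0" for c k :: real
          using that by (simp add: field_simps)
        show "?C * N2 * e1 \<le> e / 2" using N2 C6 by (simp add: e1_def)
        have "?C * (K * K) * \<bar>t - \<tau>\<bar> \<le> ?C * (K * K + 1) * d2"
          using td C6 K(1) d2 by (intro mult_mono) auto
        also have "\<dots> = e / 2" unfolding d2_def by (rule half) (use C6 KK in auto)
        finally show "?C * (K * K) * \<bar>t - \<tau>\<bar> \<le> e / 2" .
      qed auto
      finally show "norm (dM \<tau> t z - dM \<tau> \<tau> z - (t - \<tau>) *\<^sub>R As z) \<le> e * norm (t - \<tau>)" by simp
    qed
  qed
  then have "((\<lambda>t. (dM \<tau> t z + mat 1) ** \<Phi>s z \<tau>) has_vector_derivative As z ** \<Phi>s z \<tau>) (at \<tau> within T)"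
    by (intro bounded_linear.has_vector_derivative[OF bounded_bilinear.bounded_linear_left
          [OF bounded_bilinear_matrix_mult]]) (simp add: has_vector_derivative_add_const)
  moreover have "(\<lambda>t. (dM \<tau> t z + mat 1) ** \<Phi>s z \<tau>) = \<Phi>s z"
    by (simp add: fun_eq_iff dM_def matrix_mul_assoc[symmetric] minv_left[OF \<Phi>s_inv[OF \<tau>]])
  ultimately show ?thesis by (simp add: As_def)
qed

end

section \<open>The normalised function \<open>S\<close> and its membership in the class\<close>

lemma meromorphic_matrix_product:
  assumes "\<And>i j. (\<lambda>z. A z $ i $ j :: complex) meromorphic_on U" "\<And>i j. (\<lambda>z. B z $ i $ j) meromorphic_on U"
  shows "(\<lambda>z. ((A z :: complex ^ 'n ^ 'm) ** (B z :: complex ^ 'k ^ 'n)) $ i $ j) meromorphic_on U"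
  unfolding matrix_matrix_mult_def using assms by (auto intro!: meromorphic_intros)

lemma mhol_meromorphic: "mhol F U \<Longrightarrow> open U \<Longrightarrow> (\<lambda>z. F z $ i $ j) meromorphic_on U"
  by (intro analytic_on_imp_meromorphic_on) (simp add: analytic_on_open mholD)

lemma mat_meromorphic_imp: "mat_meromorphic_on F U \<Longrightarrow> (\<lambda>z. F z $ i $ j) meromorphic_on U"
  unfolding mat_meromorphic_on_def nicely_meromorphic_on_def by blast

definition remove_sings_mat :: "(complex \<Rightarrow> complex ^ 'n ^ 'm) \<Rightarrow> complex \<Rightarrow> complex ^ 'n ^ 'm" where
  "remove_sings_mat F z = (\<chi> i j. remove_sings (\<lambda>w. F w $ i $ j) z)"

lemma remove_sings_mat_analytic: "mat_analytic_at F z \<Longrightarrow> remove_sings_mat F z = F z"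
  by (simp add: remove_sings_mat_def mat_analytic_at_def vec_eq_iff)

lemma remove_sings_mat_meromorphic:
  "(\<And>i j. (\<lambda>z. F z $ i $ j) meromorphic_on U) \<Longrightarrow> mat_meromorphic_on (remove_sings_mat F) U"
  unfolding mat_meromorphic_on_def remove_sings_mat_def
  by (simp add: remove_sings_nicely_meromorphic)

lemma remove_sings_mat_analytic_at:
  assumes "mat_analytic_at F z"
  shows "mat_analytic_at (remove_sings_mat F) z"
  using assms remove_sings_analytic_on unfolding mat_analytic_at_def remove_sings_mat_def by auto

text \<open>A normalised function is determined at \<open>z\<close> by its values nearby: each entry
  is its limit, or the default 0 at a pole.\<close>

lemma mat_meromorphic_eqI:
  assumes F: "mat_meromorphic_on F U" and G: "mat_meromorphic_on G U" and z: "z \<in> U"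
    and ev: "eventually (\<lambda>w. F w = G w) (at z)"
  shows "F z = G z"
proof -
  have "F z $ i $ j = G z $ i $ j" for i j
  proof -
    have ev': "eventually (\<lambda>w. F w $ i $ j = G w $ i $ j) (at z)"
      using ev by (rule eventually_mono) simp
    have rs: "H z $ i $ j = remove_sings (\<lambda>w. H w $ i $ j) z" if "mat_meromorphic_on H U" for H :: "complex \<Rightarrow> 'a cmat"
    proof -
      have "is_pole (\<lambda>w. H w $ i $ j) z \<and> H z $ i $ j = 0 \<or> (\<lambda>w. H w $ i $ j) \<midarrow>z\<rightarrow> H z $ i $ j"
        using that z unfolding mat_meromorphic_on_def nicely_meromorphic_on_def by blast
      then show ?thesis by (metis remove_sings_at_pole remove_sings_eqI)
    qed
    show ?thesis unfolding rs[OF F] rs[OF G] by (rule remove_sings_cong[OF ev' refl])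
  qed
  then show ?thesis by (simp add: vec_eq_iff)
qed

lemma mat_analytic_at_product:
  assumes "mhol A UNIV" "mhol B UNIV" "mat_analytic_at Y z"
  shows "mat_analytic_at (\<lambda>z. A z ** Y z ** B z) z"
proof -
  obtain e where e: "e > 0" "mhol Y (ball z e)" using mat_analytic_at_ball[OF assms(3)] by blast
  have "mhol (\<lambda>z. A z ** Y z ** B z) (ball z e)"
    by (intro mhol_mult e mhol_subset[OF assms(1)] mhol_subset[OF assms(2)]) auto
  then show ?thesis by (rule mhol_imp_analytic_at) (use e in auto)
qed

context birkhoff_family
begin

text \<open>At a pole of \<open>Y\<close> this product is built from default values and need not be
  normalised; \<open>S\<close> is the normalised representative that the class asks for.\<close>

definition Sraw where "Sraw z t = \<Phi>s z t ** Y z ** \<Psi> z t"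
definition S where "S z t = remove_sings_mat (\<lambda>z. Sraw z t) z"

lemma Y_mero: "mat_meromorphic_on Y right_half_plane" and Y_contr: "contractive_in_rhp (\<sigma>1 t0) Y"
  and Y_bdry: "boundary_unitary (\<sigma>1 t0) Y"
  using YS unfolding class_S_def by auto

lemma Y_an: "R < norm z \<Longrightarrow> mat_analytic_at Y z"
  using mhol_imp_analytic_at[OF hol_Y open_outside] by simp

lemma Sraw_an: "t \<in> T \<Longrightarrow> mat_analytic_at Y z \<Longrightarrow> mat_analytic_at (\<lambda>z. Sraw z t) z"
  unfolding Sraw_def by (intro mat_analytic_at_product hol_\<Phi>s hol_\<Psi> Tab)

lemma S_eq: "t \<in> T \<Longrightarrow> mat_analytic_at Y z \<Longrightarrow> S z t = Sraw z t"
  unfolding S_def by (rule remove_sings_mat_analytic[OF Sraw_an])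

lemma S_mero: "t \<in> T \<Longrightarrow> mat_meromorphic_on (\<lambda>z. S z t) right_half_plane"
  unfolding S_def Sraw_def
  by (intro remove_sings_mat_meromorphic meromorphic_matrix_product mat_meromorphic_imp Y_mero
      mhol_meromorphic mhol_subset[OF hol_\<Phi>s] mhol_subset[OF hol_\<Psi>] Tab open_rhp) auto

lemma \<Phi>s_minv: "t \<in> T \<Longrightarrow> matrix_inv (\<Phi>s z t) ** \<Phi>s z t = mat 1"
  by (rule minv_left[OF \<Phi>s_inv])

text \<open>\<open>\<Phi>s\<close> and \<open>\<Psi>\<close> are entire with invertible values, so
  near \<open>z\<close> the equation can be solved for \<open>Y\<close> in terms of
  \<open>S\<close>. In particular the poles of the constructed \<open>S\<close> do not depend on
  \<open>t\<close>.\<close>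

lemma S_an_iff:
  assumes t: "t \<in> T" and z: "0 < Re z"
  shows "mat_analytic_at (\<lambda>z. S z t) z \<longleftrightarrow> mat_analytic_at Y z"
proof
  assume "mat_analytic_at Y z"
  then show "mat_analytic_at (\<lambda>z. S z t) z"
    unfolding S_def by (rule remove_sings_mat_analytic_at[OF Sraw_an[OF t]])
next
  assume an: "mat_analytic_at (\<lambda>z. S z t) z"
  obtain e where e: "e > 0" "ball z e \<subseteq> right_half_plane" "\<And>w. w \<in> ball z e - {z} \<Longrightarrow> mat_analytic_at Y w"
    using mat_meromorphic_punctured[OF Y_mero open_rhp, of z] z by auto
  have "eventually (\<lambda>w. w \<in> ball z e - {z}) (at z)"
    using e(1) by (intro eventually_at_in_open) auto
  then have ev: "eventually (\<lambda>w. Y w = matrix_inv (\<Phi>s w t) ** S w t ** \<Phi> w t) (at z)"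
  proof (rule eventually_mono)
    fix w assume "w \<in> ball z e - {z}"
    then have "S w t = Sraw w t" by (intro S_eq t e)
    then have "matrix_inv (\<Phi>s w t) ** S w t ** \<Phi> w t =
        (matrix_inv (\<Phi>s w t) ** \<Phi>s w t) ** Y w ** (\<Psi> w t ** \<Phi> w t)"
      by (simp add: Sraw_def matrix_mul_assoc)
    then show "Y w = matrix_inv (\<Phi>s w t) ** S w t ** \<Phi> w t"
      by (simp add: \<Phi>s_minv[OF t] \<Psi>\<Phi>[OF Tab[OF t]])
  qed
  have lim: "((\<lambda>w. matrix_inv (\<Phi>s w t) ** S w t ** \<Phi> w t) \<longlongrightarrow>
      matrix_inv (\<Phi>s z t) ** S z t ** \<Phi> z t) (at z)"
  proof -
    have c: "(f \<longlongrightarrow> f z) (at z)" if "mhol f UNIV" for f :: "complex \<Rightarrow> 'p cmat"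
      using mhol_continuous_on[OF that] continuous_on_eq_continuous_at[OF open_UNIV, of f] by (simp add: isCont_def)
    have "((\<lambda>w. S w t) \<longlongrightarrow> S z t) (at z)"
      using mat_analytic_at_isCont[OF an] by (simp add: isCont_def)
    then show ?thesis
      by (intro tendsto_mm tendsto_minv c[OF hol_\<Phi>s[OF t]] c[OF hol_\<Phi>[OF Tab[OF t]]] \<Phi>s_inv t)
  qed
  show "mat_analytic_at Y z"
    by (rule mat_meromorphic_analytic_atI[OF Y_mero _ ev lim]) (use z in simp)
qed

lemma S_outside: "t \<in> T \<Longrightarrow> R < norm z \<Longrightarrow> S z t = S0 z t"
  using S_eq[OF _ Y_an] S0_eq by (simp add: Sraw_def)

lemma S_infinity: "t \<in> T \<Longrightarrow> mat_analytic_at_infinity (\<lambda>z. S z t) (mat 1)"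
proof (rule mat_analytic_at_infinityI[OF R])
  assume t: "t \<in> T"
  show "mhol (\<lambda>z. S z t) (outside R)"
    using hol_S0[OF t] by (subst mhol_cong[where G = "\<lambda>z. S0 z t"]) (auto simp: S_outside[OF t])
  show "((\<lambda>z. S z t) \<longlongrightarrow> mat 1) at_infinity"
  proof (rule Lim_transform_eventually[OF S0_lim[OF t]])
    show "eventually (\<lambda>z. S0 z t = S z t) at_infinity"
      unfolding eventually_at_infinity by (intro exI[of _ "R + 1"]) (simp add: S_outside[OF t])
  qed
qed

lemma S_t0: "0 < Re z \<Longrightarrow> S z t0 = Y z"
proof (rule mat_meromorphic_eqI[OF S_mero[OF T(3)] Y_mero])
  assume z: "0 < Re z"
  obtain e where e: "e > 0" "\<And>w. w \<in> ball z e - {z} \<Longrightarrow> mat_analytic_at Y w"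
    using mat_meromorphic_punctured[OF Y_mero open_rhp, of z] z by auto
  have "eventually (\<lambda>w. w \<in> ball z e - {z}) (at z)"
    using e(1) by (intro eventually_at_in_open) auto
  then show "eventually (\<lambda>w. S w t0 = Y w) (at z)"
    by (rule eventually_mono) (simp add: S_eq[OF T(3) e(2)] Sraw_def \<Phi>s_t0 \<Psi>_t0)
qed simp

text \<open>A nontangential limit of \<open>Y\<close> is multiplied by the values of
  \<open>\<Phi>s\<close> and \<open>\<Psi>\<close> at the boundary point, and on the axis the two
  symmetries are unitarity between \<open>\<sigma>1 t\<close> and \<open>\<sigma>1 t0\<close>. So
  every boundary point that is good for \<open>Y\<close> is good for \<open>S\<close>.\<close>

lemma S_boundary:
  assumes t: "t \<in> T"
  shows "boundary_unitary (\<sigma>1 t) (\<lambda>z. S z t)"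
  unfolding boundary_unitary_def
proof (rule eventually_mono[OF Y_bdry[unfolded boundary_unitary_def]])
  fix y assume "\<exists>L. nontangential_limit Y y L \<and> cadjoint L ** \<sigma>1 t0 ** L = \<sigma>1 t0"
  then obtain L where L: "nontangential_limit Y y L" "cadjoint L ** \<sigma>1 t0 ** L = \<sigma>1 t0" by blast
  let ?p = "Complex 0 y"
  note t' = Tab[OF t]
  have c: "isCont f ?p" if "mhol f UNIV" for f :: "complex \<Rightarrow> 'p cmat"
    using mhol_continuous_on[OF that] continuous_on_eq_continuous_at[OF open_UNIV, of f] by simp
  have "nontangential_limit (\<lambda>z. S z t) y (\<Phi>s ?p t ** L ** \<Psi> ?p t)"
    by (rule nontangential_limit_product[OF Y_mero L(1) c[OF hol_\<Phi>s[OF t]] c[OF hol_\<Psi>[OF t']]])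
      (simp add: S_eq[OF t] Sraw_def)
  moreover have "cadjoint (\<Phi>s ?p t ** L ** \<Psi> ?p t) ** \<sigma>1 t ** (\<Phi>s ?p t ** L ** \<Psi> ?p t) = \<sigma>1 t"
  proof -
    have p: "- cnj ?p = ?p" by (simp add: complex_eq_iff)
    have 1: "cadjoint (\<Phi>s ?p t) ** \<sigma>1 t ** \<Phi>s ?p t = \<sigma>1 t0" using \<Phi>s_symmetry[OF t, of ?p] by (simp only: p)
    have 2: "cadjoint (\<Phi> ?p t) ** \<sigma>1 t ** \<Phi> ?p t = \<sigma>1 t0" using \<Phi>_symmetry[OF t', of ?p] by (simp only: p)
    have "cadjoint (\<Psi> ?p t) ** cadjoint (\<Phi> ?p t) = mat 1"
      by (metis \<Phi>\<Psi>[OF t'] cadjoint_mat cadjoint_mult complex_cnj_one)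
    then have 3: "cadjoint (\<Psi> ?p t) ** \<sigma>1 t0 ** \<Psi> ?p t = \<sigma>1 t"
      unfolding 2[symmetric] by (metis (no_types) \<Phi>\<Psi>[OF t'] matrix_mul_assoc matrix_mul_lid matrix_mul_rid)
    have "cadjoint (\<Phi>s ?p t ** L ** \<Psi> ?p t) ** \<sigma>1 t ** (\<Phi>s ?p t ** L ** \<Psi> ?p t) =
        cadjoint (\<Psi> ?p t) ** (cadjoint L ** (cadjoint (\<Phi>s ?p t) ** \<sigma>1 t ** \<Phi>s ?p t) ** L) ** \<Psi> ?p t"
      by (simp add: cadjoint_mult matrix_mul_assoc)
    then show ?thesis by (simp only: 1 L(2) 3)
  qed
  ultimately show "\<exists>L. nontangential_limit (\<lambda>z. S z t) y L \<and> cadjoint L ** \<sigma>1 t ** L = \<sigma>1 t" by blast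
qed

text \<open>Every input solution is \<open>\<Phi>\<close> applied to its value at \<open>t0\<close>,
  and \<open>S\<close> turns it into \<open>\<Phi>s\<close> applied to the constant vector
  \<open>Y z *v u t0\<close>.\<close>

lemma S_maps_solutions:
  assumes z: "0 < Re z" and u: "\<And>t. t \<in> T \<Longrightarrow> solves_at T \<sigma>1 \<sigma>2 \<gamma> z u t" and t: "t \<in> T"
    and an: "mat_analytic_at (\<lambda>z. S z t) z"
  shows "solves_at T \<sigma>1 \<sigma>2 \<gamma>s z (\<lambda>s. S z s *v u s) t"
proof -
  have anY: "mat_analytic_at Y z" using S_an_iff[OF t z] an by simp
  have y: "S z s *v u s = \<Phi>s z s *v (Y z *v u t0)" if s: "s \<in> T" for s
  proof -
    have "u s = \<Phi> z s *v u t0" by (rule solution_form[OF T u s])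
    then have "S z s *v u s = \<Phi>s z s ** Y z ** (\<Psi> z s ** \<Phi> z s) *v u t0"
      by (simp add: S_eq[OF s anY] Sraw_def matrix_vector_mul_assoc matrix_mul_assoc)
    then show ?thesis by (simp add: \<Psi>\<Phi>[OF Tab[OF s]] matrix_vector_mul_assoc)
  qed
  have "((\<lambda>s. \<Phi>s z s *v (Y z *v u t0)) has_vector_derivative
      ((mat z ** \<alpha> t + \<beta>s t) ** \<Phi>s z t) *v (Y z *v u t0)) (at t within T)"
    by (rule bounded_linear.has_vector_derivative[OF bounded_bilinear.bounded_linear_left
          [OF bounded_bilinear_matrix_vector_mult] \<Phi>s_derivative[OF t]])
  then have "((\<lambda>s. S z s *v u s) has_vector_derivative
      ((mat z ** \<alpha> t + \<beta>s t) ** \<Phi>s z t) *v (Y z *v u t0)) (at t within T)"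
    by (rule has_vector_derivative_transform[OF t y, rotated 1])
  moreover have "((mat z ** \<alpha> t + \<beta>s t) ** \<Phi>s z t) *v (Y z *v u t0) = (mat z ** \<alpha> t + \<beta>s t) *v (S z t *v u t)"
    by (simp add: y[OF t] matrix_vector_mul_assoc matrix_mul_assoc)
  moreover have "matrix_inv (\<sigma>1 t) ** \<gamma>s t = \<beta>s t"
    by (simp add: \<gamma>s_def minv_left'[OF inv1[OF Tab[OF t]]])
  ultimately show ?thesis
    unfolding solves_at_iff[of \<sigma>1 t T \<sigma>2 \<gamma>s z "\<lambda>s. S z s *v u s", OF inv1[OF Tab[OF t]]]
    by (simp add: \<alpha>_def)
qed

lemma S_continuous:
  assumes z: "0 < Re z" and t: "t \<in> T" and an: "mat_analytic_at (\<lambda>z. S z t) z"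
  shows "continuous (at t within T) (S z)"
proof -
  have anY: "mat_analytic_at Y z" using S_an_iff[OF t z] an by simp
  have c1: "(\<Phi>s z \<longlongrightarrow> \<Phi>s z t) (at t within T)"
    using has_vector_derivative_continuous[OF \<Phi>s_derivative[OF t]] by (simp add: continuous_within)
  have c2: "(\<Psi> z \<longlongrightarrow> \<Psi> z t) (at t within T)"
    using has_vector_derivative_continuous[OF has_vector_derivative_within_subset[OF D\<Psi>[OF Tab[OF t]] T(1)]]
    by (simp add: continuous_within)
  have "((\<lambda>s. Sraw z s) \<longlongrightarrow> Sraw z t) (at t within T)"
    unfolding Sraw_def by (intro tendsto_mm tendsto_const c1 c2)
  then have "(S z \<longlongrightarrow> Sraw z t) (at t within T)"
    by (rule Lim_transform_eventually) (auto simp: eventually_at_filter S_eq[OF _ anY])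
  then show ?thesis by (simp add: continuous_within S_eq[OF t anY])
qed

lemma vessel_parameters_T: "vessel_parameters T \<sigma>1 \<sigma>2 \<gamma> \<gamma>s"
  unfolding vessel_parameters_def self_adjoint_def
proof (intro conjI ballI)
  show "is_interval T" using T(2) by (simp add: is_interval_convex_1)
  show "continuous_on T \<gamma>s" by (rule \<gamma>s_continuous)
  show "continuous_on T \<sigma>1" "continuous_on T \<sigma>2" "continuous_on T \<gamma>"
    by (auto intro: continuous_on_subset[OF _ T(1)] cont)
  fix t assume t: "t \<in> T"
  note t' = Tab[OF t]
  show "cadjoint (\<sigma>1 t) = \<sigma>1 t" "cadjoint (\<sigma>2 t) = \<sigma>2 t" "invertible (\<sigma>1 t)"
    by (rule sa1[OF t'] sa2[OF t'] inv1[OF t'])+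
  show "\<exists>D. (\<sigma>1 has_vector_derivative D) (at t within T) \<and> \<gamma> t + cadjoint (\<gamma> t) = - D \<and> \<gamma>s t + cadjoint (\<gamma>s t) = - D"
    using has_vector_derivative_within_subset[OF D\<sigma>[OF t'] T(1)] D\<gamma>[OF t'] \<gamma>s_condition[OF t] by blast
qed

text \<open>Contractivity is kept as a hypothesis because it depends on the quantitative closeness
  to the identity that is arranged in the existence proof; the other conditions follow from the
  factorization.\<close>

lemma S_class_SI:
  assumes contr: "\<And>t z v. t \<in> T \<Longrightarrow> 0 < Re z \<Longrightarrow> mat_analytic_at Y z \<Longrightarrow>
    Re (hip (Sraw z t *v v) (\<sigma>1 t *v (Sraw z t *v v))) \<le> Re (hip v (\<sigma>1 t *v v))"
  shows "S \<in> class_SI T \<sigma>1 \<sigma>2 \<gamma> \<gamma>s"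
  unfolding class_SI_def
proof (intro CollectI conjI ballI allI impI)
  show "contractive_in_rhp (\<sigma>1 t) (\<lambda>z. S z t)" if t: "t \<in> T" for t
    unfolding contractive_in_rhp_def
  proof (intro ballI impI)
    fix z assume z: "z \<in> right_half_plane" "mat_analytic_at (\<lambda>z. S z t) z"
    then have "mat_analytic_at Y z" using S_an_iff[OF t] by simp
    then show "loewner_le (cadjoint (S z t) ** \<sigma>1 t ** S z t) (\<sigma>1 t)"
      unfolding loewner_le_congruence_iff[OF sa1[OF Tab[OF t]]] using contr[OF t] z S_eq[OF t] by simp
  qed
  show "cadjoint (S z t) ** \<sigma>1 t ** S z t = \<sigma>1 t" if "t \<in> T" "Re z = 0 \<and> mat_analytic_at (\<lambda>w. S w t) z" for t z
    using boundary_unitary_at_analytic[OF S_boundary[OF that(1)]] that(2) by blast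
qed (auto intro: S_mero S_infinity S_continuous S_boundary S_maps_solutions)

end

section \<open>Existence: choice of the neighbourhood\<close>

context vessel_data
begin

text \<open>The order of the choices matters: \<open>R\<close> comes from \<open>Y\<close> alone,
  then the Julia constant fixes \<open>\<delta>\<close>, and only then is the time interval shrunk
  until both factors stay within \<open>\<delta>\<close> of the identity on the disc of radius
  \<open>2 * R\<close>.\<close>

lemma existence:
  assumes YS: "Y \<in> class_S (\<sigma>1 t0)"
  shows "\<exists>T \<gamma>s S. openin (top_of_set {a..b}) T \<and> is_interval T \<and> t0 \<in> T \<and>
    vessel_parameters T \<sigma>1 \<sigma>2 \<gamma> \<gamma>s \<and> S \<in> class_SI T \<sigma>1 \<sigma>2 \<gamma> \<gamma>s \<and>
    (\<forall>z\<in>right_half_plane. S z t0 = Y z)"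
proof -
  let ?N = "norm (mat 1 :: 'p cmat)" and ?Cp = "split_const TYPE('p)"
  have Y: "mat_meromorphic_on Y right_half_plane" "mat_analytic_at_infinity Y (mat 1)"
    "contractive_in_rhp (\<sigma>1 t0) Y"
    using YS unfolding class_S_def by auto
  obtain R0 Y1 where R0: "R0 > 0" "mhol Y (outside R0)" "(Y \<longlongrightarrow> mat 1) at_infinity"
    by (rule mat_analytic_at_infinityE[OF Y(2)])
  have "eventually (\<lambda>z. dist (Y z) (mat 1) < 1/8) at_infinity" by (rule tendstoD[OF R0(3)]) simp
  then obtain r where r: "\<And>z. r \<le> norm z \<Longrightarrow> dist (Y z) (mat 1) < 1/8"
    unfolding eventually_at_infinity by blast
  define R where "R = max R0 r"
  have R: "R > 0" using R0 by (simp add: R_def)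
  have YR: "mhol Y (outside R)" by (rule mhol_subset[OF R0(2)]) (auto simp: R_def)
  have Y8: "norm (Y z - mat 1) \<le> 1/8" if "R < norm z" for z
    using r[of z] that by (simp add: R_def dist_norm)
  have N1: "?N \<ge> 1" by (rule norm_mat_1_pos)
  have Yinv: "invertible (Y z)" if "R < norm z" for z
    using invertible_near_1[OF Y8[OF that]] by simp
  have nY: "norm (Y z) \<le> 2 * ?N" if "R < norm z" for z
    using Y8[OF that] norm_triangle_ineq[of "mat 1" "Y z - mat 1"] N1 by simp
  have nYi: "norm (matrix_inv (Y z)) \<le> 2 * ?N" if "R < norm z" for z
    by (rule norm_minv_near_1) (use Y8[OF that] in simp)
  obtain C where C: "C > 0" "\<And>z u. 0 < Re z \<Longrightarrow> mat_analytic_at Y z \<Longrightarrow> Re z * (norm (u - Y z *v u))\<^sup>2 \<le>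
        C * (Re (hip u (\<sigma>1 t0 *v u)) - Re (hip (Y z *v u) (\<sigma>1 t0 *v (Y z *v u))))"
    using contractive_julia[OF Y(1,3,2) sa1[OF t0] inv1[OF t0]] by blast
  obtain B where B: "\<And>t. t \<in> {a..b} \<Longrightarrow> norm (\<sigma>1 t) \<le> B"
    using compact_imp_bounded[OF compact_continuous_image[OF cont(1)]] by (force simp: bounded_iff)
  have B0: "B \<ge> 0" using order_trans[OF norm_ge_zero B[OF t0]] .
  obtain L where L: "L \<ge> 0" "\<And>z t. norm z \<le> 2 * R \<Longrightarrow> t \<in> {a..b} \<Longrightarrow> norm (\<Phi> z t - mat 1) \<le> L * \<bar>t - t0\<bar>"
    using fundamental_pair_lipschitz[OF fp' t0 cont_\<alpha> cont_\<beta>, of "2 * R"] t0 by (metis \<Phi>_t0)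
  define K where "K = 4 * real (CARD('p) * CARD('p)) * B * (?N + 1) / R"
  have K0: "K \<ge> 0" unfolding K_def using B0 R by (intro divide_nonneg_pos mult_nonneg_nonneg) auto
  \<comment> \<open>One denominator serves both requirements, \<open>\<delta> \<le> 1/2\<close> and
    \<open>\<delta> * K \<le> 1 / (2 * C)\<close>.\<close>
  define \<delta> where "\<delta> = 1 / (2 + 2 * C * K)"
  have CK: "C * K \<ge> 0" using C K0 by simp
  have \<delta>: "\<delta> > 0" "\<delta> \<le> 1/2" "\<delta> * K \<le> 1 / (2 * C)"
  proof -
    show "\<delta> > 0" "\<delta> \<le> 1/2" using CK by (auto simp: \<delta>_def field_simps add_pos_nonneg)
    have "\<delta> * K * (2 * C) = 2 * C * K / (2 + 2 * C * K)" by (simp add: \<delta>_def)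
    also have "\<dots> \<le> 1" using CK by (simp add: divide_le_eq_1)
    finally show "\<delta> * K \<le> 1 / (2 * C)" using C by (simp add: pos_le_divide_eq)
  qed
  \<comment> \<open>\<open>G * \<bar>t - t0\<bar>\<close> bounds \<open>Y (\<Phi> - I) Y^-1\<close>
    on the annulus: one factor \<open>2 * ?N\<close> each for \<open>Y\<close> and its inverse, and
    the Lipschitz constant of \<open>\<Phi>\<close>.\<close>
  define G where "G = 2 * ?N * L * (2 * ?N)"
  have G0: "G \<ge> 0" using L by (simp add: G_def)
  have C6: "?Cp \<ge> 6" by (rule split_const_ge)
  \<comment> \<open>The second entry is the bound on \<open>s\<close> that
    \<open>birkhoff_family\<close> demands.\<close>
  define \<mu> where "\<mu> = min \<delta> (1 / (16 * ?N))"
  have \<mu>: "\<mu> > 0" "\<mu> \<le> \<delta>" "\<mu> \<le> 1 / (16 * ?N)"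
  proof -
    have "0 < 1 / (16 * ?N)" using N1 by (intro divide_pos_pos) linarith+
    then show "\<mu> > 0" using \<delta>(1) by (simp add: \<mu>_def)
  qed (auto simp: \<mu>_def)
  \<comment> \<open>\<open>W\<close> adds up the rates at which the Birkhoff factors and
    \<open>\<Phi>\<close> leave the identity; the summand 1 makes it positive.\<close>
  define W where "W = 2 * ?Cp * G + L + 1"
  have W: "W > 0" using C6 G0 L by (simp add: W_def add_nonneg_pos)
  define \<eta> where "\<eta> = \<mu> / W"
  have \<eta>: "\<eta> > 0" using \<mu> W by (simp add: \<eta>_def)
  define T where "T = {a..b} \<inter> ball t0 \<eta>"
  have Tab: "t \<in> {a..b}" if "t \<in> T" for t using that by (simp add: T_def)
  have Tsmall: "2 * ?Cp * (G * \<bar>t - t0\<bar>) \<le> \<mu>" "L * \<bar>t - t0\<bar> \<le> \<mu>" if "t \<in> T" for t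
  proof -
    have "\<bar>t - t0\<bar> < \<eta>" using that by (simp add: T_def dist_real_def abs_minus_commute)
    then have "W * \<bar>t - t0\<bar> \<le> \<mu>" using W by (simp add: \<eta>_def pos_less_divide_eq mult.commute)
    moreover have "W * \<bar>t - t0\<bar> = 2 * ?Cp * (G * \<bar>t - t0\<bar>) + L * \<bar>t - t0\<bar> + \<bar>t - t0\<bar>"
      by (simp add: W_def algebra_simps)
    moreover have "0 \<le> 2 * ?Cp * (G * \<bar>t - t0\<bar>)" "0 \<le> L * \<bar>t - t0\<bar>" using C6 G0 L by simp_all
    ultimately show "2 * ?Cp * (G * \<bar>t - t0\<bar>) \<le> \<mu>" "L * \<bar>t - t0\<bar> \<le> \<mu>" by linarith+
  qed
  \<comment> \<open>The loop to be factored is \<open>Y \<Phi> Y^-1\<close>, written as the identity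
    plus a small term; multiplying its factorization by \<open>Y\<close> on the right gives
    \<open>fact\<close>.\<close>
  define Q where "Q t m s \<longleftrightarrow> mhol m UNIV \<and> mhol s (outside R) \<and> (s \<longlongrightarrow> 0) at_infinity \<and>
    (\<forall>z. R < norm z \<longrightarrow> (mat 1 + s z) ** (mat 1 + Y z ** (\<Phi> z t - mat 1) ** matrix_inv (Y z)) = mat 1 + m z) \<and>
    (\<forall>z. norm z \<le> 2 * R \<longrightarrow> norm (m z) \<le> 2 * ?Cp * (G * \<bar>t - t0\<bar>)) \<and>
    (\<forall>z. R < norm z \<longrightarrow> norm (s z) \<le> 2 * ?Cp * (G * \<bar>t - t0\<bar>))" for t m s
  have "\<exists>m s. Q t m s" if t: "t \<in> T" for t
    unfolding Q_def
  proof (rule birkhoff_near_identity[OF R])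
    show "mhol (\<lambda>z. Y z ** (\<Phi> z t - mat 1) ** matrix_inv (Y z)) (outside R)"
      by (intro mhol_mult mhol_diff mhol_const mhol_minv YR mhol_subset[OF hol_\<Phi>[OF Tab[OF t]]] Yinv) auto
    show "norm (Y z ** (\<Phi> z t - mat 1) ** matrix_inv (Y z)) \<le> G * \<bar>t - t0\<bar>" if "R < norm z" "norm z \<le> 2 * R" for z
    proof -
      have "norm (Y z ** (\<Phi> z t - mat 1) ** matrix_inv (Y z)) \<le> (2 * ?N) * (L * \<bar>t - t0\<bar>) * (2 * ?N)"
        by (intro norm_matrix_mult_le nY nYi L Tab t that)
      then show ?thesis by (simp add: G_def mult_ac)
    qed
    show "2 * ?Cp * (G * \<bar>t - t0\<bar>) \<le> 1" using Tsmall(1)[OF t] \<mu>(2) \<delta>(2) by linarith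
  qed
  then obtain m s where Q: "\<And>t. t \<in> T \<Longrightarrow> Q t (m t) (s t)" by metis
  have ms: "\<And>t. t \<in> T \<Longrightarrow> mhol (m t) UNIV" "\<And>t. t \<in> T \<Longrightarrow> mhol (s t) (outside R)"
    "\<And>t. t \<in> T \<Longrightarrow> (s t \<longlongrightarrow> 0) at_infinity"
    "\<And>t z. t \<in> T \<Longrightarrow> R < norm z \<Longrightarrow>
       (mat 1 + s t z) ** (mat 1 + Y z ** (\<Phi> z t - mat 1) ** matrix_inv (Y z)) = mat 1 + m t z"
    "\<And>t z. t \<in> T \<Longrightarrow> norm z \<le> 2 * R \<Longrightarrow> norm (m t z) \<le> 2 * ?Cp * (G * \<bar>t - t0\<bar>)"
    "\<And>t z. t \<in> T \<Longrightarrow> R < norm z \<Longrightarrow> norm (s t z) \<le> 2 * ?Cp * (G * \<bar>t - t0\<bar>)"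
    using Q unfolding Q_def by blast+
  define \<Phi>s where "\<Phi>s z t = mat 1 + m t z" for z t
  interpret B: birkhoff_family a b t0 \<sigma>1 \<sigma>2 \<gamma> D \<Phi> \<Psi> Y R T \<Phi>s "\<lambda>z t. s t z"
  proof unfold_locales
    show "T \<subseteq> {a..b}" "t0 \<in> T" using t0 \<eta> by (auto simp: T_def)
    show "convex T" unfolding T_def by (intro convex_Int) auto
    fix t assume t: "t \<in> T"
    show "mhol (\<lambda>z. \<Phi>s z t) UNIV" unfolding \<Phi>s_def by (intro mhol_add mhol_const ms t)
    show "mhol (\<lambda>z. s t z) (outside R)" "((\<lambda>z. s t z) \<longlongrightarrow> 0) at_infinity" using ms(2,3)[OF t] by auto
    show "norm (s t z) \<le> 1 / (16 * ?N)" if "R < norm z" for z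
      using ms(6)[OF t that] Tsmall(1)[OF t] \<mu>(3) by linarith
    show "norm (\<Phi>s z t - mat 1) \<le> 1/2" if "norm z \<le> 2 * R" for z
      using ms(5)[OF t that] Tsmall(1)[OF t] \<mu>(2) \<delta>(2) by (simp add: \<Phi>s_def)
    show "((mat 1 + s t z) ** Y z) ** \<Phi> z t = \<Phi>s z t ** Y z" if z: "R < norm z" for z
    proof -
      have "mat 1 + Y z ** (\<Phi> z t - mat 1) ** matrix_inv (Y z) = Y z ** \<Phi> z t ** matrix_inv (Y z)"
        by (simp add: mm_algebra minv_right[OF Yinv[OF z]])
      then have "\<Phi>s z t = (mat 1 + s t z) ** (Y z ** \<Phi> z t ** matrix_inv (Y z))"
        using ms(4)[OF t z] by (simp add: \<Phi>s_def)
      then show ?thesis by (simp add: matrix_mul_assoc[symmetric] minv_left[OF Yinv[OF z]])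
    qed
  qed (use YS R YR Y8 R0 in auto)
  have "B.S \<in> class_SI T \<sigma>1 \<sigma>2 \<gamma> B.\<gamma>s"
  proof (rule B.S_class_SI)
    fix t z v assume t: "t \<in> T" and z: "0 < Re z" "mat_analytic_at Y z"
    show "Re (hip (B.Sraw z t *v v) (\<sigma>1 t *v (B.Sraw z t *v v))) \<le> Re (hip v (\<sigma>1 t *v v))"
    proof (rule contractivity_persists[where Y = Y and R = R and C = C and J = "\<sigma>1 t0" and B = B
          and P = "\<lambda>z. \<Phi> z t" and Pi = "\<lambda>z. \<Psi> z t" and Q = "\<lambda>z. \<Phi>s z t" and \<delta> = \<delta> and S = "\<lambda>z. B.Sraw z t"])
      have raw: "B.Sraw w t = B.S0 w t" if "R < norm w" for w
        using B.S0_eq[OF t that] by (simp add: B.Sraw_def)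
      show "norm (B.Sraw w t - mat 1) \<le> 1/2" if "R < norm w" for w
        unfolding raw[OF that] by (rule B.S0_near[OF t that])
      show "((\<lambda>w. B.Sraw w t) \<longlongrightarrow> mat 1) at_infinity"
      proof (rule Lim_transform_eventually[OF B.S0_lim[OF t]])
        show "eventually (\<lambda>w. B.S0 w t = B.Sraw w t) at_infinity"
          unfolding eventually_at_infinity by (intro exI[of _ "R + 1"]) (simp add: raw)
      qed
      show "cadjoint (B.Sraw w t) ** \<sigma>1 t ** B.Sraw w t = \<sigma>1 t" if "R < norm w" "Re w = 0" for w
      proof -
        have "- cnj w = w" using that(2) by (simp add: complex_eq_iff)
        then show ?thesis unfolding raw[OF that(1)] using B.S0_symmetry[OF t that(1)] by simp
      qed
      show "norm (\<Phi> w t - mat 1) \<le> \<delta>" if "norm w \<le> 2 * R" for w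
        using L(2)[OF that Tab[OF t]] Tsmall(2)[OF t] \<mu>(2) by linarith
      show "norm (\<Phi>s w t - mat 1) \<le> \<delta>" if "norm w \<le> 2 * R" for w
        using ms(5)[OF t that] Tsmall(1)[OF t] \<mu>(2) by (simp add: \<Phi>s_def)
      show "\<delta> * (4 * real (CARD('p) * CARD('p)) * B * (?N + 1) / R) \<le> 1 / (2 * C)"
        using \<delta>(3) by (simp add: K_def)
    qed (use Y R YR C sa1[OF Tab[OF t]] B[OF Tab[OF t]] hol_\<Phi>[OF Tab[OF t]] hol_\<Psi>[OF Tab[OF t]] B.hol_\<Phi>s[OF t]
        \<Phi>\<Psi>[OF Tab[OF t]] \<Phi>_symmetry[OF Tab[OF t]] B.\<Phi>s_symmetry[OF t] \<delta>(2) z B.Sraw_def in auto)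
  qed
  moreover have "openin (top_of_set {a..b}) T"
    unfolding T_def by (intro openin_open_Int) simp
  moreover have "is_interval T" using B.T(2) by (simp add: is_interval_convex_1)
  ultimately show ?thesis
    using B.vessel_parameters_T B.S_t0 B.T(3) by (intro exI[of _ T] exI[of _ B.\<gamma>s] exI[of _ B.S]) auto
qed

end

section \<open>Uniqueness\<close>

lemma mat_meromorphic_bad_countable:
  assumes Y: "mat_meromorphic_on Y U" and U: "open U"
  shows "countable {z \<in> U. \<not> mat_analytic_at Y z}"
proof -
  have "countable {z \<in> U. \<not> (\<lambda>w. Y w $ i $ j) analytic_on {z}}" for i j
  proof -
    have "{z \<in> U. \<not> (\<lambda>w. Y w $ i $ j) analytic_on {z}} sparse_in U"
      by (rule meromorphic_on_imp_sparse_singularities'[OF mat_meromorphic_imp[OF Y]])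
    from sparse_imp_countable[OF U this] show ?thesis by (simp add: Int_def)
  qed
  then have "countable (\<Union>i. \<Union>j. {z \<in> U. \<not> (\<lambda>w. Y w $ i $ j) analytic_on {z}})"
    by (intro countable_UN countableI_type) auto
  moreover have "{z \<in> U. \<not> mat_analytic_at Y z} \<subseteq> (\<Union>i. \<Union>j. {z \<in> U. \<not> (\<lambda>w. Y w $ i $ j) analytic_on {z}})"
    unfolding mat_analytic_at_def by blast
  ultimately show ?thesis using countable_subset by blast
qed

text \<open>The set where two continuous functions differ is open, and a nonempty open set is
  uncountable.\<close>

lemma eq_off_countable:
  fixes f g :: "complex \<Rightarrow> complex"
  assumes U: "open U" and f: "continuous_on U f" and g: "continuous_on U g" and E: "countable E"
    and eq: "\<And>z. z \<in> U \<Longrightarrow> z \<notin> E \<Longrightarrow> f z = g z" and z: "z \<in> U"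
  shows "f z = g z"
proof (rule ccontr)
  assume ne: "f z \<noteq> g z"
  have "open (U \<inter> (\<lambda>w. f w - g w) -` (- {0}))"
    by (rule continuous_open_preimage[OF continuous_on_diff[OF f g] U]) auto
  also have "U \<inter> (\<lambda>w. f w - g w) -` (- {0}) = {w \<in> U. f w - g w \<in> - {0}}" by auto
  finally have "open {w \<in> U. f w - g w \<in> - {0}}" .
  moreover have "z \<in> {w \<in> U. f w - g w \<in> - {0}}" using z ne by simp
  ultimately obtain e where e: "e > 0" "ball z e \<subseteq> {w \<in> U. f w - g w \<in> - {0}}"
    using open_contains_ball by blast
  then have "ball z e \<subseteq> E" using eq by auto
  then show False using uncountable_ball[OF e(1), of z] E countable_subset by blast
qed

lemma tendsto_det:
  fixes F :: "'a \<Rightarrow> complex ^ 'n ^ 'n"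
  assumes "(F \<longlongrightarrow> L) G"
  shows "((\<lambda>x. det (F x)) \<longlongrightarrow> det L) G"
  unfolding det_def by (intro tendsto_intros assms tendsto_entry)

lemma norm_det_le:
  fixes A :: "complex ^ 'n ^ 'n"
  assumes "\<And>i j. norm (A $ i $ j) \<le> K"
  shows "norm (det A) \<le> (\<Sum>p | p permutes (UNIV :: 'n set). K ^ CARD('n))"
proof -
  have "norm (det A) \<le> (\<Sum>p | p permutes (UNIV :: 'n set). norm (of_int (sign p) * (\<Prod>i\<in>UNIV. A $ i $ p i)))"
    unfolding det_def by (rule norm_sum)
  also have "\<dots> \<le> (\<Sum>p | p permutes (UNIV :: 'n set). K ^ CARD('n))"
  proof (rule sum_mono)
    fix p :: "'n \<Rightarrow> 'n"
    have "norm (of_int (sign p) * (\<Prod>i\<in>UNIV. A $ i $ p i)) = (\<Prod>i\<in>UNIV. norm (A $ i $ p i))"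
      by (simp add: norm_mult prod_norm sign_def)
    also have "\<dots> \<le> (\<Prod>i\<in>(UNIV::'n set). K)" by (intro prod_mono) (auto intro: assms)
    finally show "norm (of_int (sign p) * (\<Prod>i\<in>UNIV. A $ i $ p i)) \<le> K ^ CARD('n)" by simp
  qed
  finally show ?thesis .
qed

text \<open>Poles cannot suddenly appear near \<open>(z, t1)\<close>: the bounded function \<open>k t = det (F t)\<close> vanishes
  exactly at the poles of \<open>S t\<close>. The continuity hypothesis only speaks about single points \<open>z\<close>
  that are not poles, so it is used along a sequence \<open>t n\<close>, off the countably many poles
  belonging to \<open>t1\<close> and all the \<open>t n\<close>; Montel's theorem does the rest.\<close>

lemma analytic_points_locally_constant:
  fixes S :: "complex \<Rightarrow> real \<Rightarrow> 'p::finite cmat" and J :: "real \<Rightarrow> 'p cmat"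
  assumes mero: "\<And>t. t \<in> I \<Longrightarrow> mat_meromorphic_on (\<lambda>z. S z t) right_half_plane"
    and contr: "\<And>t. t \<in> I \<Longrightarrow> contractive_in_rhp (J t) (\<lambda>z. S z t)"
    and cont: "\<And>z t. 0 < Re z \<Longrightarrow> t \<in> I \<Longrightarrow> mat_analytic_at (\<lambda>w. S w t) z \<Longrightarrow> continuous (at t within I) (S z)"
    and J: "continuous_on I J" "\<And>t. t \<in> I \<Longrightarrow> cadjoint (J t) = J t" "\<And>t. t \<in> I \<Longrightarrow> invertible (J t)"
    and small: "\<And>t. t \<in> I \<Longrightarrow> invertible (mat 1 - J t)" and K: "\<And>t. t \<in> I \<Longrightarrow> 1 + norm (matrix_inv (J t)) \<le> K"
    and t1: "t1 \<in> I" and z1: "0 < Re z1" "mat_analytic_at (\<lambda>w. S w t1) z1"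
  shows "\<exists>r>0. \<exists>\<eta>>0. cball z1 r \<subseteq> right_half_plane \<and>
    (\<forall>t\<in>I. \<bar>t - t1\<bar> < \<eta> \<longrightarrow> (\<forall>z\<in>cball z1 r. mat_analytic_at (\<lambda>w. S w t) z))"
proof -
  let ?A = "\<lambda>t z. cayley_den (J t) (S z t)"
  have "\<exists>F. mhol F right_half_plane \<and>
      (\<forall>z. 0 < Re z \<longrightarrow> mat_analytic_at (\<lambda>w. S w t) z \<longrightarrow> F z ** ?A t z = mat 1 \<and> ?A t z ** F z = mat 1) \<and>
      (\<forall>z i j. 0 < Re z \<longrightarrow> norm (F z $ i $ j) \<le> K)" if t: "t \<in> I" for t
  proof -
    obtain F where F: "mhol F right_half_plane"
      "\<And>z. 0 < Re z \<Longrightarrow> mat_analytic_at (\<lambda>w. S w t) z \<Longrightarrow> F z ** ?A t z = mat 1 \<and> ?A t z ** F z = mat 1"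
      "\<And>z i j. 0 < Re z \<Longrightarrow> norm (F z $ i $ j) \<le> 1 + norm (matrix_inv (J t))"
      by (rule cayley_inverse_exists[OF mero[OF t] contr[OF t] J(2)[OF t] J(3)[OF t]]) blast
    then show ?thesis using K[OF t] order_trans by blast
  qed
  then obtain F where F: "\<And>t. t \<in> I \<Longrightarrow> mhol (F t) right_half_plane"
    "\<And>t z. t \<in> I \<Longrightarrow> 0 < Re z \<Longrightarrow> mat_analytic_at (\<lambda>w. S w t) z \<Longrightarrow> F t z ** ?A t z = mat 1 \<and> ?A t z ** F t z = mat 1"
    "\<And>t z i j. t \<in> I \<Longrightarrow> 0 < Re z \<Longrightarrow> norm (F t z $ i $ j) \<le> K"
    by metis
  \<comment> \<open>The entries of \<open>F t\<close> are bounded by \<open>K\<close> whatever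
    \<open>t\<close> is, so the functions \<open>k t\<close> are uniformly bounded and form a normal
    family.\<close>
  define k where "k t z = det (F t z)" for t z
  have good_iff: "mat_analytic_at (\<lambda>w. S w t) z \<longleftrightarrow> k t z \<noteq> 0" if t: "t \<in> I" and z: "0 < Re z" for t z
    using analytic_at_iff_invertible_cayley_inverse[OF mero[OF t] F(1)[OF t] _ small[OF t] z] F(2)[OF t]
      invertible_det_nz by (auto simp: k_def)
  have holk: "k t holomorphic_on right_half_plane" if "t \<in> I" for t
    unfolding k_def by (intro holomorphic_det mholD F that)
  define Kd where "Kd = (\<Sum>p | p permutes (UNIV :: 'p set). K ^ CARD('p))"
  have bk: "norm (k t z) \<le> Kd" if "t \<in> I" "0 < Re z" for t z
    unfolding k_def Kd_def by (rule norm_det_le) (rule F(3)[OF that])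
  have k1: "k t1 z1 \<noteq> 0" using good_iff[OF t1 z1(1)] z1(2) by simp
  have "isCont (\<lambda>z. norm (k t1 z)) z1"
    using holomorphic_on_imp_continuous_on[OF holk[OF t1]] continuous_on_eq_continuous_at[OF open_rhp, of "k t1"] z1(1)
    by (intro continuous_intros) auto
  then obtain d1 where d1: "d1 > 0" "\<And>z. dist z z1 < d1 \<Longrightarrow> dist (norm (k t1 z)) (norm (k t1 z1)) < norm (k t1 z1) / 2"
    using k1 unfolding continuous_at_eps_delta by (metis half_gt_zero zero_less_norm_iff)
  obtain d2 where d2: "d2 > 0" "ball z1 d2 \<subseteq> right_half_plane"
    using open_rhp z1(1) open_contains_ball by (metis mem_Collect_eq)
  define r where "r = min d1 d2 / 2"
  have r: "r > 0" "r < d1" "r < d2" using d1 d2 by (auto simp: r_def)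
  have sub: "cball z1 r \<subseteq> right_half_plane"
  proof
    fix w assume "w \<in> cball z1 r"
    then have "w \<in> ball z1 d2" using r by auto
    then show "w \<in> right_half_plane" using d2(2) by blast
  qed
  define \<mu> where "\<mu> = norm (k t1 z1) / 2"
  have \<mu>: "\<mu> > 0" using k1 by (simp add: \<mu>_def)
  have low: "norm (k t1 z) > \<mu>" if "z \<in> cball z1 r" for z
  proof -
    have "dist z z1 < d1" using that r by (simp add: dist_commute)
    then have "\<bar>norm (k t1 z) - norm (k t1 z1)\<bar> < \<mu>" using d1(2) by (simp add: dist_real_def \<mu>_def)
    then have "norm (k t1 z) > norm (k t1 z1) - \<mu>" by linarith
    then show ?thesis by (simp add: \<mu>_def)
  qed
  have "\<exists>\<eta>>0. \<forall>t\<in>I. \<bar>t - t1\<bar> < \<eta> \<longrightarrow> (\<forall>z\<in>cball z1 r. mat_analytic_at (\<lambda>w. S w t) z)"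
  proof (rule ccontr)
    assume neg: "\<not> (\<exists>\<eta>>0. \<forall>t\<in>I. \<bar>t - t1\<bar> < \<eta> \<longrightarrow> (\<forall>z\<in>cball z1 r. mat_analytic_at (\<lambda>w. S w t) z))"
    have "\<exists>t z. t \<in> I \<and> \<bar>t - t1\<bar> < inverse (real (Suc n)) \<and> z \<in> cball z1 r \<and> \<not> mat_analytic_at (\<lambda>w. S w t) z" for n
    proof -
      have "inverse (real (Suc n)) > 0" by simp
      then show ?thesis using neg by blast
    qed
    then obtain tn zn where tn: "\<And>n. tn n \<in> I" "\<And>n. \<bar>tn n - t1\<bar> < inverse (real (Suc n))"
      and zn: "\<And>n. zn n \<in> cball z1 r" "\<And>n. \<not> mat_analytic_at (\<lambda>w. S w (tn n)) (zn n)"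
      by metis
    have tlim: "tn \<longlonglongrightarrow> t1"
    proof (rule LIM_zero_cancel, rule Lim_null_comparison)
      show "eventually (\<lambda>n. norm (tn n - t1) \<le> inverse (real (Suc n))) sequentially"
        using tn(2) by (intro always_eventually) (simp add: less_imp_le)
      show "(\<lambda>n. inverse (real (Suc n))) \<longlonglongrightarrow> 0" by (rule LIMSEQ_inverse_real_of_nat)
    qed
    obtain g \<phi> where g: "g holomorphic_on right_half_plane" "strict_mono (\<phi> :: nat \<Rightarrow> nat)"
      "\<And>x. x \<in> right_half_plane \<Longrightarrow> ((\<lambda>n. k (tn (\<phi> n)) x) \<longlongrightarrow> g x) sequentially"
      "\<And>K. compact K \<Longrightarrow> K \<subseteq> right_half_plane \<Longrightarrow> uniform_limit K ((\<lambda>n. k (tn n)) \<circ> \<phi>) g sequentially"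
    proof (rule Montel[OF open_rhp, of "range (\<lambda>n. k (tn n))" "\<lambda>n. k (tn n)"])
      show "h holomorphic_on right_half_plane" if "h \<in> range (\<lambda>n. k (tn n))" for h
        using that holk tn(1) by auto
      show "\<exists>B. \<forall>h\<in>range (\<lambda>n. k (tn n)). \<forall>z\<in>C. norm (h z) \<le> B" if "compact C" "C \<subseteq> right_half_plane" for C
        using bk[OF tn(1)] that by (intro exI[of _ Kd]) auto
    qed auto
    \<comment> \<open>Off \<open>E\<close> neither the limit time nor any time of the sequence has a
      pole, so there \<open>k\<close> is the reciprocal of the determinant of the Cayley denominator
      and continuity in \<open>t\<close> applies.\<close>
    define E where "E = {z \<in> right_half_plane. \<not> mat_analytic_at (\<lambda>w. S w t1) z} \<union>
      (\<Union>n. {z \<in> right_half_plane. \<not> mat_analytic_at (\<lambda>w. S w (tn n)) z})"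
    have cE: "countable E"
      unfolding E_def by (intro countable_Un countable_UN countableI_type mat_meromorphic_bad_countable mero tn t1 open_rhp)
    have geq: "g z = k t1 z" if z: "0 < Re z" for z
    proof (rule eq_off_countable[where f = g and g = "k t1" and z = z, OF open_rhp _ _ cE])
      show "continuous_on right_half_plane g" "continuous_on right_half_plane (k t1)"
        using g(1) holk[OF t1] holomorphic_on_imp_continuous_on by blast+
      show "z \<in> right_half_plane" using z by simp
      fix x assume x: "x \<in> right_half_plane" "x \<notin> E"
      have x1: "0 < Re x" using x by simp
      have g1: "mat_analytic_at (\<lambda>w. S w t1) x" and gn: "\<And>n. mat_analytic_at (\<lambda>w. S w (tn n)) x"
        using x unfolding E_def by auto
      have kinv: "k t x * det (?A t x) = 1" if "t \<in> I" "mat_analytic_at (\<lambda>w. S w t) x" for t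
        using F(2)[OF that(1) x1 that(2)] det_mul[of "F t x" "?A t x"] by (simp add: k_def)
      have Slim: "(\<lambda>n. S x (tn n)) \<longlonglongrightarrow> S x t1"
        using cont[OF x1 t1 g1] tlim tn(1) unfolding continuous_within_sequentially by (auto simp: o_def)
      have Jlim: "(\<lambda>n. J (tn n)) \<longlonglongrightarrow> J t1"
        using J(1) t1 tlim tn(1) unfolding continuous_on_sequentially by (auto simp: o_def)
      have "(\<lambda>n. det (?A (tn n) x)) \<longlonglongrightarrow> det (?A t1 x)"
        unfolding cayley_den_def by (intro tendsto_det tendsto_add tendsto_mm tendsto_diff tendsto_const Slim Jlim)
      moreover have "det (?A t1 x) \<noteq> 0" using kinv[OF t1 g1] by auto
      ultimately have "(\<lambda>n. inverse (det (?A (tn n) x))) \<longlonglongrightarrow> inverse (det (?A t1 x))"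
        by (rule tendsto_inverse)
      moreover have "k t x = inverse (det (?A t x))" if "t \<in> I" "mat_analytic_at (\<lambda>w. S w t) x" for t
        using kinv[OF that] by (simp add: inverse_unique mult.commute)
      ultimately have "(\<lambda>n. k (tn n) x) \<longlonglongrightarrow> k t1 x" using tn(1) gn t1 g1 by simp
      then have "(\<lambda>n. k (tn (\<phi> n)) x) \<longlonglongrightarrow> k t1 x"
        using LIMSEQ_subseq_LIMSEQ[OF _ g(2)] by (fastforce simp: o_def)
      then show "g x = k t1 x" using LIMSEQ_unique g(3)[OF x(1)] by blast
    qed
    \<comment> \<open>The limit \<open>k t1\<close> exceeds \<open>\<mu>\<close> in modulus on the
      disc, so uniform convergence there contradicts the zeros at the points
      \<open>zn\<close>.\<close>
    have "uniform_limit (cball z1 r) ((\<lambda>n. k (tn n)) \<circ> \<phi>) g sequentially"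
      by (rule g(4)[OF compact_cball sub])
    then obtain n where n: "\<And>z. z \<in> cball z1 r \<Longrightarrow> dist (k (tn (\<phi> n)) z) (g z) < \<mu>"
      using uniform_limitD[OF _ \<mu>] by (fastforce simp: eventually_sequentially o_def)
    let ?z = "zn (\<phi> n)"
    have zr: "0 < Re ?z" using zn(1)[of "\<phi> n"] sub by blast
    have "k (tn (\<phi> n)) ?z = 0" using good_iff[OF tn(1) zr] zn(2) by blast
    then have "norm (k t1 ?z) < \<mu>" using n[of ?z] zn(1)[of "\<phi> n"] geq[OF zr] by (simp add: dist_norm)
    with low[OF zn(1)] show False by (metis less_asym)
  qed
  then show ?thesis using r(1) sub by blast
qed

text \<open>On a connected open set the difference of two entries either vanishes off a sparse set
  or avoids 0 off a sparse set; equality on \<open>V\<close> excludes the latter.\<close>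

lemma meromorphic_matrix_eq_everywhere:
  fixes X X' :: "complex \<Rightarrow> complex ^ 'n ^ 'm"
  assumes X: "\<And>i j. (\<lambda>z. X z $ i $ j) meromorphic_on U" "\<And>i j. (\<lambda>z. X' z $ i $ j) meromorphic_on U"
    and U: "open U" "connected U" and V: "open V" "V \<subseteq> U" "z1 \<in> V" and eq: "\<And>z. z \<in> V \<Longrightarrow> X z = X' z" and z: "z \<in> U"
  shows "eventually (\<lambda>w. X w = X' w) (at z)"
proof -
  have "eventually (\<lambda>w. X w $ i $ j - X' w $ i $ j = 0) (at z)" for i j
  proof -
    have "(\<lambda>w. X w $ i $ j - X' w $ i $ j) meromorphic_on U" by (intro meromorphic_intros X)
    from meromorphic_imp_constant_or_avoid[OF this U, of 0] show ?thesis
    proof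
      assume "eventually (\<lambda>w. X w $ i $ j - X' w $ i $ j = 0) (cosparse U)"
      then show ?thesis using z by (rule eventually_cosparse_imp_eventually_at)
    next
      assume "eventually (\<lambda>w. X w $ i $ j - X' w $ i $ j \<noteq> 0) (cosparse U)"
      then have "eventually (\<lambda>w. X w $ i $ j - X' w $ i $ j \<noteq> 0) (at z1)"
        using V(2,3) by (rule eventually_cosparse_imp_eventually_at[OF _ subsetD])
      moreover have "eventually (\<lambda>w. w \<in> V) (at z1)"
        using V eventually_at_in_open' by blast
      ultimately have "eventually (\<lambda>w. False) (at z1)"
        by eventually_elim (simp add: eq)
      then show ?thesis by simp
    qed
  qed
  then have "eventually (\<lambda>w. \<forall>i j. X w $ i $ j - X' w $ i $ j = 0) (at z)"
    by (intro eventually_all_finite)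
  then show ?thesis by (rule eventually_mono) (simp add: vec_eq_iff)
qed

text \<open>The identity theorem on the connected exterior. It carries equalities from the half
  plane to the full neighbourhood of infinity that Liouville's theorem requires.\<close>

lemma mhol_eq_outside:
  fixes X X' :: "complex \<Rightarrow> 'p::finite cmat"
  assumes R: "R > 0" and X: "mhol X (outside R)" "mhol X' (outside R)" and z1: "R < norm z1"
    and ev: "eventually (\<lambda>w. X w = X' w) (at z1)" and z: "R < norm z"
  shows "X z = X' z"
proof -
  obtain d where d: "d > 0" "\<And>w. w \<noteq> z1 \<Longrightarrow> dist w z1 < d \<Longrightarrow> X w = X' w"
    using ev unfolding eventually_at by auto
  have lp: "z1 islimpt (ball z1 d - {z1}) \<inter> outside R"
  proof -
    have "z1 islimpt ball z1 d \<inter> outside R"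
      using d(1) z1 by (intro interior_limit_point) (simp add: interior_open open_outside)
    then have "z1 islimpt (ball z1 d \<inter> outside R) - {z1}" by (simp add: islimpt_punctured[symmetric])
    then show ?thesis by (rule islimpt_subset) auto
  qed
  have "X z $ i $ j - X' z $ i $ j = 0" for i j
  proof (rule analytic_continuation[where f = "\<lambda>z. X z $ i $ j - X' z $ i $ j", OF _ open_outside connected_outside[OF R] _ _ lp])
    show "(\<lambda>z. X z $ i $ j - X' z $ i $ j) holomorphic_on outside R" by (intro holomorphic_intros mholD X)
    show "X w $ i $ j - X' w $ i $ j = 0" if "w \<in> (ball z1 d - {z1}) \<inter> outside R" for w
      using d(2)[of w] that by (simp add: dist_commute)
  qed (use z z1 in auto)
  then show ?thesis by (simp add: vec_eq_iff)
qed

lemma class_SI_meromorphic: "S \<in> class_SI T \<sigma>1 \<sigma>2 \<gamma> \<gamma>s \<Longrightarrow> t \<in> T \<Longrightarrow> mat_meromorphic_on (\<lambda>z. S z t) right_half_plane"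
  and class_SI_infinity: "S \<in> class_SI T \<sigma>1 \<sigma>2 \<gamma> \<gamma>s \<Longrightarrow> t \<in> T \<Longrightarrow> mat_analytic_at_infinity (\<lambda>z. S z t) (mat 1)"
  unfolding class_SI_def by blast+

lemma fundamental_pair_inverse:
  assumes "fundamental_pair T t0 \<alpha> \<beta> \<Phi> \<Psi>" "t \<in> T"
  shows "\<Phi> z t ** \<Psi> z t = mat 1" "\<Psi> z t ** \<Phi> z t = mat 1"
  using assms unfolding fundamental_pair_def by blast+

lemma fundamental_pair_entire:
  assumes "fundamental_pair T t0 \<alpha> \<beta> \<Phi> \<Psi>" "t \<in> T"
  shows "mhol (\<lambda>z. \<Phi> z t) UNIV" "mhol (\<lambda>z. \<Psi> z t) UNIV"
  using assms unfolding fundamental_pair_def by blast+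

lemma fundamental_pair_derivative:
  assumes "fundamental_pair T t0 \<alpha> \<beta> \<Phi> \<Psi>" "t \<in> T"
  shows "(\<Phi> z has_vector_derivative (mat z ** \<alpha> t + \<beta> t) ** \<Phi> z t) (at t within T)"
  using assms unfolding fundamental_pair_def by blast

section \<open>From the class conditions to the representation by fundamental matrices\<close>

context vessel_data
begin

lemma \<Phi>_solves:
  assumes T: "T \<subseteq> {a..b}" "t \<in> T"
  shows "solves_at T \<sigma>1 \<sigma>2 \<gamma> z (\<lambda>s. \<Phi> z s *v v) t"
proof -
  have t: "t \<in> {a..b}" using T by blast
  have "((\<lambda>s. \<Phi> z s *v v) has_vector_derivative ((mat z ** \<alpha> t + \<beta> t) ** \<Phi> z t) *v v) (at t within T)"
    by (rule bounded_linear.has_vector_derivative[OF bounded_bilinear.bounded_linear_left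
          [OF bounded_bilinear_matrix_vector_mult] has_vector_derivative_within_subset[OF D\<Phi>[OF t] T(1)]])
  then show ?thesis
    unfolding solves_at_iff[of \<sigma>1 t T \<sigma>2 \<gamma> z "\<lambda>s. \<Phi> z s *v v", OF inv1[OF t]]
    by (simp add: \<alpha>_def \<beta>_def matrix_vector_mul_assoc)
qed

text \<open>By the mapping property \<open>S \<Phi> v\<close> solves the output equation, and
  \<open>\<Psi>s\<close> inverts the fundamental matrix of that equation; so the product has
  derivative 0 as long as \<open>z\<close> is not a pole at any time in \<open>I\<close>.\<close>

lemma SI_quotient_locally_constant:
  assumes T: "T \<subseteq> {a..b}" and S: "S \<in> class_SI T \<sigma>1 \<sigma>2 \<gamma> \<gamma>s" and cd: "{c..d} \<subseteq> T"
    and fps: "fundamental_pair {c..d} t0 \<alpha> (\<lambda>t. matrix_inv (\<sigma>1 t) ** \<gamma>s t) \<Phi>s \<Psi>s"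
    and z: "z \<in> right_half_plane" and r: "\<And>s. s \<in> I \<Longrightarrow> mat_analytic_at (\<lambda>w. S w s) z"
    and I: "I \<subseteq> {c..d}" "convex I" "s \<in> I" "t \<in> I"
  shows "\<Psi>s z s ** S z s ** \<Phi> z s = \<Psi>s z t ** S z t ** \<Phi> z t"
proof (rule matrix_eqI_vec)
  fix v :: "complex ^ 'p"
  define y where "y s = S z s *v (\<Phi> z s *v v)" for s
  define A where "A s = mat z ** \<alpha> s + matrix_inv (\<sigma>1 s) ** \<gamma>s s" for s
  have "((\<lambda>s. \<Psi>s z s *v y s) has_vector_derivative 0) (at s within I)" if s: "s \<in> I" for s
  proof -
    have sT: "s \<in> T" and sab: "s \<in> {a..b}" and scd: "s \<in> {c..d}" using s I(1) cd T by blast+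
    have "solves_at T \<sigma>1 \<sigma>2 \<gamma>s z y s"
      using S z sT r[OF s] \<Phi>_solves[OF T] unfolding class_SI_def y_def by blast
    then have "(y has_vector_derivative A s *v y s) (at s within T)"
      unfolding solves_at_iff[of \<sigma>1 s T \<sigma>2 \<gamma>s z y, OF inv1[OF sab]] A_def \<alpha>_def .
    then have y': "(y has_vector_derivative A s *v y s) (at s within I)"
      using I(1) cd by (blast intro: has_vector_derivative_within_subset)
    have "(\<Psi>s z has_vector_derivative - (\<Psi>s z s ** A s)) (at s within {c..d})"
      using fps scd unfolding fundamental_pair_def A_def by blast
    then have "(\<Psi>s z has_vector_derivative - (\<Psi>s z s ** A s)) (at s within I)"
      using I(1) by (rule has_vector_derivative_within_subset)
    from has_vector_derivative_mv[OF this y'] show ?thesis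
      by (simp add: matrix_vector_mul_assoc mv_algebra)
  qed
  then obtain k where "\<And>s. s \<in> I \<Longrightarrow> \<Psi>s z s *v y s = k"
    using has_vector_derivative_zero_constant[OF I(2), of "\<lambda>s. \<Psi>s z s *v y s"] by blast
  then have "\<Psi>s z s *v y s = \<Psi>s z t *v y t" using I by simp
  then show "(\<Psi>s z s ** S z s ** \<Phi> z s) *v v = (\<Psi>s z t ** S z t ** \<Phi> z t) *v v"
    by (simp add: y_def matrix_vector_mul_assoc matrix_mul_assoc)
qed

text \<open>By compactness one positive factor \<open>k\<close> makes all
  \<open>k *\<^sub>R \<sigma>1 t\<close> smaller than 1 in norm, with uniformly bounded inverses,
  while contractivity is unaffected by the scaling.\<close>

lemma SI_analytic_points_locally_constant:
  assumes T: "T \<subseteq> {a..b}" and S: "S \<in> class_SI T \<sigma>1 \<sigma>2 \<gamma> \<gamma>s" and t1: "t1 \<in> T"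
    and z1: "0 < Re z1" "mat_analytic_at (\<lambda>w. S w t1) z1"
  shows "\<exists>r>0. \<exists>\<eta>>0. cball z1 r \<subseteq> right_half_plane \<and>
    (\<forall>t\<in>T. \<bar>t - t1\<bar> < \<eta> \<longrightarrow> (\<forall>z\<in>cball z1 r. mat_analytic_at (\<lambda>w. S w t) z))"
proof -
  have "bounded (\<sigma>1 ` {a..b})" by (rule compact_imp_bounded[OF compact_continuous_image[OF cont(1)]]) simp
  then obtain B where B: "B > 0" "\<And>t. t \<in> {a..b} \<Longrightarrow> norm (\<sigma>1 t) \<le> B" unfolding bounded_pos by blast
  define k where "k = inverse (B + 1)"
  have k: "k > 0" "k * B < 1" using B(1) by (auto simp: k_def field_simps)
  have invJ: "invertible (k *\<^sub>R \<sigma>1 t)" if "t \<in> {a..b}" for t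
    using k(1) inv1[OF that] by (simp add: invertible_scaleR)
  have contJ: "continuous_on {a..b} (\<lambda>t. k *\<^sub>R \<sigma>1 t)" by (intro continuous_intros cont)
  have "bounded ((\<lambda>t. matrix_inv (k *\<^sub>R \<sigma>1 t)) ` {a..b})"
    by (rule compact_imp_bounded[OF compact_continuous_image[OF continuous_on_minv[OF contJ invJ]]]) auto
  then obtain K where K: "\<And>t. t \<in> {a..b} \<Longrightarrow> norm (matrix_inv (k *\<^sub>R \<sigma>1 t)) \<le> K" unfolding bounded_pos by blast
  have ab: "t \<in> {a..b}" if "t \<in> T" for t using that T by blast
  show ?thesis
  proof (rule analytic_points_locally_constant[where J = "\<lambda>t. k *\<^sub>R \<sigma>1 t" and K = "1 + K" and S = S and I = T, OF _ _ _ _ _ _ _ _ t1 z1])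
    fix t assume t: "t \<in> T"
    show "mat_meromorphic_on (\<lambda>z. S z t) right_half_plane" using S t unfolding class_SI_def by blast
    show "contractive_in_rhp (k *\<^sub>R \<sigma>1 t) (\<lambda>z. S z t)"
      by (rule contractive_in_rhp_scaleR[OF _ _ sa1[OF ab[OF t]]]) (use S t k in \<open>auto simp: class_SI_def\<close>)
    show "cadjoint (k *\<^sub>R \<sigma>1 t) = k *\<^sub>R \<sigma>1 t" by (simp only: cadjoint_scaleR sa1[OF ab[OF t]])
    show "invertible (k *\<^sub>R \<sigma>1 t)" by (rule invJ[OF ab[OF t]])
    have "k * norm (\<sigma>1 t) \<le> k * B" using B(2)[OF ab[OF t]] k by (intro mult_left_mono) auto
    then have "k * norm (\<sigma>1 t) < 1" using k(2) by linarith
    then show "invertible (mat 1 - k *\<^sub>R \<sigma>1 t)" using k(1) by (intro invertible_1_minus_small) simp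
    show "1 + norm (matrix_inv (k *\<^sub>R \<sigma>1 t)) \<le> 1 + K" using K[OF ab[OF t]] by simp
  next
    show "continuous_on T (\<lambda>t. k *\<^sub>R \<sigma>1 t)" by (rule continuous_on_subset[OF contJ T])
  next
    fix z t assume "0 < Re z" "t \<in> T" "mat_analytic_at (\<lambda>w. S w t) z"
    then show "continuous (at t within T) (S z)" using S unfolding class_SI_def by blast
  qed
qed

text \<open>The quotient \<open>\<Psi>s S \<Phi>\<close> is constant in \<open>t\<close> on a small disc near infinity, hence locally
  constant as a meromorphic function, hence constant.\<close>

lemma SI_representation:
  assumes T: "T \<subseteq> {a..b}" and S: "S \<in> class_SI T \<sigma>1 \<sigma>2 \<gamma> \<gamma>s" and cd: "{c..d} \<subseteq> T"
    and fps: "fundamental_pair {c..d} t0 \<alpha> (\<lambda>t. matrix_inv (\<sigma>1 t) ** \<gamma>s t) \<Phi>s \<Psi>s"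
    and t0cd: "t0 \<in> {c..d}" and t: "t \<in> {c..d}" and z: "z \<in> right_half_plane"
  shows "eventually (\<lambda>w. S w t = \<Phi>s w t ** S w t0 ** \<Psi> w t) (at z)"
proof -
  define X where "X s w = \<Psi>s w s ** S w s ** \<Phi> w s" for s w
  define same where "same s s' \<longleftrightarrow> (\<forall>z\<in>right_half_plane. eventually (\<lambda>w. X s w = X s' w) (at z))" for s s'
  have mero: "(\<lambda>w. X s w $ i $ j) meromorphic_on right_half_plane" if s: "s \<in> {c..d}" for s i j
  proof -
    have S': "(\<lambda>w. S w s $ i $ j) meromorphic_on right_half_plane" for i j
      using S s cd by (intro mat_meromorphic_imp[where F = "\<lambda>w. S w s"]) (auto simp: class_SI_def)
    have \<Psi>': "(\<lambda>w. \<Psi>s w s $ i $ j) meromorphic_on right_half_plane" for i j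
    proof -
      have "mhol (\<lambda>w. \<Psi>s w s) UNIV" using fps s unfolding fundamental_pair_def by blast
      then show ?thesis by (rule mhol_meromorphic[OF mhol_subset[OF _ subset_UNIV] open_rhp])
    qed
    have \<Phi>': "(\<lambda>w. \<Phi> w s $ i $ j) meromorphic_on right_half_plane" for i j
    proof -
      have "mhol (\<lambda>w. \<Phi> w s) UNIV" using hol_\<Phi> s cd T by blast
      then show ?thesis by (rule mhol_meromorphic[OF mhol_subset[OF _ subset_UNIV] open_rhp])
    qed
    show ?thesis unfolding X_def by (intro meromorphic_matrix_product S' \<Psi>' \<Phi>')
  qed
  \<comment> \<open>Equality of the quotients as meromorphic functions is an equivalence relation on
    the interval with open classes, so connectedness leaves a single class. The small disc may be
    chosen anew for each \<open>t1\<close>.\<close>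
  have "same t0 t"
  proof (rule connected_equivalence_relation[OF _ t0cd t])
    show "connected {c..d}" by simp
    show "same s' s" if "same s s'" for s s' using that by (simp add: same_def eq_commute)
    show "same s s''" if h: "same s s'" "same s' s''" for s s' s''
      unfolding same_def
    proof
      fix z :: complex assume z: "z \<in> right_half_plane"
      have "eventually (\<lambda>w. X s w = X s' w) (at z)" "eventually (\<lambda>w. X s' w = X s'' w) (at z)"
        using h z unfolding same_def by blast+
      then show "eventually (\<lambda>w. X s w = X s'' w) (at z)" by eventually_elim simp
    qed
    show "\<exists>V. openin (top_of_set {c..d}) V \<and> t1 \<in> V \<and> (\<forall>s\<in>V. same t1 s)" if t1: "t1 \<in> {c..d}" for t1
    proof -
      have t1T: "t1 \<in> T" using t1 cd by blast
      have "mat_analytic_at_infinity (\<lambda>z. S z t1) (mat 1)" using S t1T unfolding class_SI_def by blast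
      then obtain R where R: "R > 0" "mhol (\<lambda>z. S z t1) (outside R)" by (rule mat_analytic_at_infinityE)
      \<comment> \<open>A positive real point beyond \<open>R\<close> lies in the half plane and
        also where \<open>S\<close> is known to be analytic.\<close>
      define z1 where "z1 = complex_of_real (R + 1)"
      have z1: "0 < Re z1" "z1 \<in> outside R" using R(1) by (simp_all add: z1_def)
      have an1: "mat_analytic_at (\<lambda>w. S w t1) z1"
        by (rule mhol_imp_analytic_at[OF R(2) open_outside z1(2)])
      obtain r \<eta> where r: "r > 0" "\<eta> > 0" "cball z1 r \<subseteq> right_half_plane"
        "\<And>t z. t \<in> T \<Longrightarrow> \<bar>t - t1\<bar> < \<eta> \<Longrightarrow> z \<in> cball z1 r \<Longrightarrow> mat_analytic_at (\<lambda>w. S w t) z"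
        using SI_analytic_points_locally_constant[OF T S t1T z1(1) an1] by blast
      let ?I = "{c..d} \<inter> ball t1 \<eta>"
      have "same t1 s" if s: "s \<in> ?I" for s
        unfolding same_def
      proof
        fix z :: complex assume z: "z \<in> right_half_plane"
        have "X t1 w = X s w" if w: "w \<in> ball z1 r" for w
          unfolding X_def
        proof (rule SI_quotient_locally_constant[OF T S cd fps, where I = ?I])
          show "w \<in> right_half_plane" using w r(3) ball_subset_cball by blast
          show "convex ?I" by (intro convex_Int) auto
          show "mat_analytic_at (\<lambda>w. S w s) w" if "s \<in> ?I" for s
            using r(4)[of s w] that w cd by (auto simp: dist_real_def)
        qed (use t1 r s in auto)
        moreover have "ball z1 r \<subseteq> right_half_plane" using r(3) ball_subset_cball by (rule order_trans[rotated])
        ultimately show "eventually (\<lambda>w. X t1 w = X s w) (at z)"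
          using r(1) t1 s z
          by (intro meromorphic_matrix_eq_everywhere[OF mero mero open_rhp connected_rhp, where V = "ball z1 r" and ?z1.0 = z1])
            simp_all
      qed
      then show ?thesis using t1 r(2) by (intro exI[of _ ?I]) (auto intro: openin_open_Int)
    qed
  qed
  then have "eventually (\<lambda>w. X t0 w = X t w) (at z)" using z unfolding same_def by blast
  then show ?thesis
  proof (rule eventually_mono)
    fix w assume "X t0 w = X t w"
    moreover have "\<Psi>s w t0 = mat 1" "\<Phi>s w t ** \<Psi>s w t = mat 1" using fps t unfolding fundamental_pair_def by blast+
    moreover have "\<Phi> w t ** \<Psi> w t = mat 1" using \<Phi>\<Psi> t cd T by blast
    moreover have "\<Phi>s w t ** X t w ** \<Psi> w t = (\<Phi>s w t ** \<Psi>s w t) ** S w t ** (\<Phi> w t ** \<Psi> w t)"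
      by (simp add: X_def matrix_mul_assoc)
    ultimately show "S w t = \<Phi>s w t ** S w t0 ** \<Psi> w t" by (simp add: X_def \<Phi>_t0)
  qed
qed

text \<open>The representation holds near the real point \<open>R + 1\<close> and spreads over the
  whole exterior, including its part in the left half plane.\<close>

lemma SI_representation_outside:
  assumes T: "T \<subseteq> {a..b}" and S: "S \<in> class_SI T \<sigma>1 \<sigma>2 \<gamma> \<gamma>s" and cd: "{c..d} \<subseteq> T"
    and fps: "fundamental_pair {c..d} t0 \<alpha> (\<lambda>t. matrix_inv (\<sigma>1 t) ** \<gamma>s t) \<Phi>s \<Psi>s"
    and t0cd: "t0 \<in> {c..d}" and t: "t \<in> {c..d}"
    and R: "R > 0" "mhol (\<lambda>z. S z t) (outside R)" "mhol (\<lambda>z. S z t0) (outside R)" and z: "R < norm z"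
  shows "S z t = \<Phi>s z t ** S z t0 ** \<Psi> z t"
proof (rule mhol_eq_outside[where X = "\<lambda>z. S z t" and X' = "\<lambda>z. \<Phi>s z t ** S z t0 ** \<Psi> z t" and ?z1.0 = "of_real (R + 1)",
    OF R(1,2) _ _ SI_representation[OF T S cd fps t0cd t] z])
  have "mhol (\<lambda>z. \<Phi>s z t) UNIV" using fps t unfolding fundamental_pair_def by blast
  moreover have "mhol (\<lambda>z. \<Psi> z t) UNIV" using hol_\<Psi> t cd T by blast
  ultimately show "mhol (\<lambda>z. \<Phi>s z t ** S z t0 ** \<Psi> z t) (outside R)"
    using R(3) by (intro mhol_mult) (auto intro: mhol_subset)
qed (use R(1) in auto)

text \<open>Equal values at \<open>t0\<close> make the output fundamental matrices \<open>P\<close>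
  and \<open>P'\<close> entire factors of the same loop near infinity, so they coincide; then
  \<open>S\<close> and \<open>S'\<close> agree by the representation, and \<open>\<gamma>s\<close>
  is read off from the differential equation.\<close>

lemma uniqueness:
  assumes T: "T \<subseteq> {a..b}" "T' \<subseteq> {a..b}"
    and S: "S \<in> class_SI T \<sigma>1 \<sigma>2 \<gamma> \<gamma>s" "S' \<in> class_SI T' \<sigma>1 \<sigma>2 \<gamma> \<gamma>s'"
    and c: "continuous_on T \<gamma>s" "continuous_on T' \<gamma>s'"
    and cd: "c < d" "{c..d} \<subseteq> T \<inter> T'" "t0 \<in> {c..d}" and t: "t \<in> {c..d}"
    and eq: "\<And>z. z \<in> right_half_plane \<Longrightarrow> S z t0 = S' z t0"
  shows "\<gamma>s t = \<gamma>s' t \<and> (\<forall>z\<in>right_half_plane. S z t = S' z t)"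
proof -
  have sub: "{c..d} \<subseteq> T" "{c..d} \<subseteq> T'" "{c..d} \<subseteq> {a..b}" using cd(2) T by blast+
  have ci: "continuous_on {c..d} (\<lambda>t. matrix_inv (\<sigma>1 t))"
    by (rule continuous_on_minv[OF continuous_on_subset[OF cont(1) sub(3)]]) (use inv1 sub(3) in blast)
  have cont: "continuous_on {c..d} \<alpha>" "continuous_on {c..d} (\<lambda>t. matrix_inv (\<sigma>1 t) ** \<gamma>s t)"
    "continuous_on {c..d} (\<lambda>t. matrix_inv (\<sigma>1 t) ** \<gamma>s' t)"
    by (rule continuous_on_subset[OF cont_\<alpha> sub(3)] continuous_on_mm[OF ci] continuous_on_subset[OF c(1) sub(1)]
        continuous_on_subset[OF c(2) sub(2)])+
  obtain P Pi where P: "fundamental_pair {c..d} t0 \<alpha> (\<lambda>t. matrix_inv (\<sigma>1 t) ** \<gamma>s t) P Pi"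
    using fundamental_pair_exists[OF cd(3) cont(1,2)] by blast
  obtain P' Pi' where P': "fundamental_pair {c..d} t0 \<alpha> (\<lambda>t. matrix_inv (\<sigma>1 t) ** \<gamma>s' t) P' Pi'"
    using fundamental_pair_exists[OF cd(3) cont(1,3)] by blast
  have PP: "P z s = P' z s" if s: "s \<in> {c..d}" for z s
  proof -
    have inf: "mat_analytic_at_infinity (\<lambda>z. S z r) (mat 1)" "mat_analytic_at_infinity (\<lambda>z. S' z r) (mat 1)"
      if "r \<in> {c..d}" for r
      by (rule class_SI_infinity[OF S(1) subsetD[OF sub(1) that]], rule class_SI_infinity[OF S(2) subsetD[OF sub(2) that]])
    obtain R1 where R1: "R1 > 0" "mhol (\<lambda>z. S z s) (outside R1)" "((\<lambda>z. S z s) \<longlongrightarrow> mat 1) at_infinity"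
      using inf(1)[OF s] by (rule mat_analytic_at_infinityE)
    obtain R2 where R2: "R2 > 0" "mhol (\<lambda>z. S' z s) (outside R2)" "((\<lambda>z. S' z s) \<longlongrightarrow> mat 1) at_infinity"
      using inf(2)[OF s] by (rule mat_analytic_at_infinityE)
    obtain R3 where R3: "R3 > 0" "mhol (\<lambda>z. S z t0) (outside R3)" "((\<lambda>z. S z t0) \<longlongrightarrow> mat 1) at_infinity"
      using inf(1)[OF cd(3)] by (rule mat_analytic_at_infinityE)
    obtain R4 where R4: "R4 > 0" "mhol (\<lambda>z. S' z t0) (outside R4)"
      using inf(2)[OF cd(3)] by (rule mat_analytic_at_infinityE)
    define R where "R = max (max R1 R2) (max R3 R4)"
    have out: "outside R \<subseteq> outside R1" "outside R \<subseteq> outside R2" "outside R \<subseteq> outside R3" "outside R \<subseteq> outside R4"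
      by (auto simp: R_def)
    have R: "R > 0" "mhol (\<lambda>z. S z s) (outside R)" "mhol (\<lambda>z. S' z s) (outside R)"
      "mhol (\<lambda>z. S z t0) (outside R)" "mhol (\<lambda>z. S' z t0) (outside R)"
      using R1(1) mhol_subset[OF R1(2) out(1)] mhol_subset[OF R2(2) out(2)] mhol_subset[OF R3(2) out(3)]
        mhol_subset[OF R4(2) out(4)] by (simp_all add: R_def)
    have eqo: "S z t0 = S' z t0" if "R < norm z" for z
    proof (rule mhol_eq_outside[OF R(1,4,5) _ _ that, where ?z1.0 = "of_real (R + 1)"])
      have "eventually (\<lambda>w. w \<in> right_half_plane) (at (complex_of_real (R + 1)))"
        using R(1) by (intro eventually_at_in_open' open_rhp) auto
      then show "eventually (\<lambda>w. S w t0 = S' w t0) (at (complex_of_real (R + 1)))"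
        by (rule eventually_mono) (rule eq)
    qed (use R(1) in simp)
    have Sr: "S w s = P w s ** S w t0 ** \<Psi> w s" "S' w s = P' w s ** S w t0 ** \<Psi> w s" if "R < norm w" for w
      using SI_representation_outside[OF T(1) S(1) sub(1) P cd(3) s R(1,2,4) that]
        SI_representation_outside[OF T(2) S(2) sub(2) P' cd(3) s R(1,3,5) that] eqo[OF that] by simp_all
    have i1: "invertible (mat 1 :: 'p cmat)" by (rule invertibleI[of _ "mat 1"]) simp
    \<comment> \<open>Near infinity \<open>S = P S0 \<Psi>\<close> and
      \<open>S' = P' S0 \<Psi>\<close> with the same value \<open>S0\<close> at time
      \<open>t0\<close>. Hence \<open>P P'^-1 = S S'^-1\<close>, which tends to the identity even
      though \<open>P\<close> and \<open>P'\<close> may grow.\<close>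
    define M where "M w = P w s ** Pi' w s" for w
    have "M z = mat 1"
    proof (rule matrix_liouville)
      show "mhol M UNIV" unfolding M_def by (rule mhol_mult[OF fundamental_pair_entire(1)[OF P s] fundamental_pair_entire(2)[OF P' s]])
      have lim: "((\<lambda>w. S w s ** matrix_inv (S' w s)) \<longlongrightarrow> mat 1 ** matrix_inv (mat 1)) at_infinity"
        by (intro tendsto_mm tendsto_minv R1 R2 i1)
      have n1: "eventually (\<lambda>w. norm (S w t0 - mat 1) < 1/2) at_infinity"
        using tendstoD[OF R3(3), of "1/2"] by (simp add: dist_norm)
      have n2: "eventually (\<lambda>w. R + 1 \<le> norm w) at_infinity" by (auto simp: eventually_at_infinity)
      have "eventually (\<lambda>w. S w s ** matrix_inv (S' w s) = M w) at_infinity"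
        using n1 n2
      proof eventually_elim
        case (elim w)
        then have w: "R < norm w" by simp
        have i0: "invertible (S w t0)" using elim(1) by (intro invertible_near_1[of _ "1/2"]) auto
        note p = fundamental_pair_inverse[OF P' s, of w]
        have iP: "invertible (P' w s)" "invertible (\<Psi> w s)"
          using p \<Psi>\<Phi>[of s w] s sub by (auto intro: invertibleI)
        have "M w ** S' w s = P w s ** (Pi' w s ** P' w s) ** S w t0 ** \<Psi> w s"
          by (simp add: M_def Sr(2)[OF w] matrix_mul_assoc)
        then have "M w ** S' w s = S w s" by (simp add: p Sr(1)[OF w])
        moreover have "invertible (S' w s)" unfolding Sr(2)[OF w] by (intro invertible_mm iP i0)
        ultimately show "S w s ** matrix_inv (S' w s) = M w"
          by (metis matrix_mul_assoc matrix_mul_rid minv_right)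
      qed
      from Lim_transform_eventually[OF lim this] show "(M \<longlongrightarrow> mat 1) at_infinity"
        using minv_right[OF i1] by simp
    qed
    then have "(P z s ** Pi' z s) ** P' z s = P' z s" by (simp add: M_def)
    then show ?thesis by (simp add: matrix_mul_assoc[symmetric] fundamental_pair_inverse[OF P' s])
  qed
  have SS: "S z t = S' z t" if z: "z \<in> right_half_plane" for z
  proof (rule mat_meromorphic_eqI[where F = "\<lambda>z. S z t" and G = "\<lambda>z. S' z t", OF _ _ z])
    show "mat_meromorphic_on (\<lambda>z. S z t) right_half_plane" "mat_meromorphic_on (\<lambda>z. S' z t) right_half_plane"
      by (rule class_SI_meromorphic[OF S(1) subsetD[OF sub(1) t]] class_SI_meromorphic[OF S(2) subsetD[OF sub(2) t]])+
    have "eventually (\<lambda>w. w \<in> right_half_plane) (at z)"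
      using z by (intro eventually_at_in_open' open_rhp)
    with SI_representation[OF T(1) S(1) sub(1) P cd(3) t z] SI_representation[OF T(2) S(2) sub(2) P' cd(3) t z]
    show "eventually (\<lambda>w. S w t = S' w t) (at z)"
      by eventually_elim (simp add: eq PP[OF t])
  qed
  \<comment> \<open>At \<open>z = 0\<close> the spectral term drops out, and the logarithmic
    derivative of the common fundamental matrix is the inverse of \<open>\<sigma>1\<close> times the
    output coefficient.\<close>
  have "(P 0 has_vector_derivative (mat 0 ** \<alpha> t + matrix_inv (\<sigma>1 t) ** \<gamma>s t) ** P 0 t) (at t within {c..d})"
    by (rule fundamental_pair_derivative[OF P t])
  moreover have "(P 0 has_vector_derivative (mat 0 ** \<alpha> t + matrix_inv (\<sigma>1 t) ** \<gamma>s' t) ** P 0 t) (at t within {c..d})"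
  proof (rule has_vector_derivative_transform[OF t])
    show "(P' 0 has_vector_derivative (mat 0 ** \<alpha> t + matrix_inv (\<sigma>1 t) ** \<gamma>s' t) ** P 0 t) (at t within {c..d})"
      unfolding PP[OF t] by (rule fundamental_pair_derivative[OF P' t])
  qed (rule PP)
  ultimately have "(mat 0 ** \<alpha> t + matrix_inv (\<sigma>1 t) ** \<gamma>s t) ** P 0 t = (mat 0 ** \<alpha> t + matrix_inv (\<sigma>1 t) ** \<gamma>s' t) ** P 0 t"
    using vector_derivative_unique_within_closed_interval[OF cd(1), of t "P 0"] t by simp
  moreover have "P 0 t ** Pi 0 t = mat 1" by (rule fundamental_pair_inverse[OF P t])
  ultimately have "mat 0 ** \<alpha> t + matrix_inv (\<sigma>1 t) ** \<gamma>s t = mat 0 ** \<alpha> t + matrix_inv (\<sigma>1 t) ** \<gamma>s' t"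
    by (metis matrix_mul_assoc matrix_mul_rid)
  then have "matrix_inv (\<sigma>1 t) ** \<gamma>s t = matrix_inv (\<sigma>1 t) ** \<gamma>s' t" by simp
  moreover have "invertible (\<sigma>1 t)" using inv1 t sub by blast
  ultimately have "\<gamma>s t = \<gamma>s' t" by (metis minv_right')
  with SS show ?thesis by blast
qed

end

text \<open>A nonempty relatively open subset of a nondegenerate interval is never a single point,
  not even at an end point. The extra point \<open>s'\<close> keeps \<open>{c..d}\<close> from
  collapsing when \<open>s = t\<close>, so that derivatives within it are unique.\<close>

lemma relatively_open_interval_nondegenerate:
  fixes a b s t :: real
  assumes ab: "a < b" and W: "openin (top_of_set {a..b}) W" "is_interval W" and st: "s \<in> W" "t \<in> W"
  shows "\<exists>c d. c < d \<and> {c..d} \<subseteq> W \<and> s \<in> {c..d} \<and> t \<in> {c..d}"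
proof -
  have conv: "{c..d} \<subseteq> W" if "c \<in> W" "d \<in> W" for c d
    using mem_is_interval_1_I[OF W(2) that] by auto
  have "\<exists>s'\<in>W. s' \<noteq> s"
  proof -
    obtain e where e: "e > 0" "\<And>x. x \<in> {a..b} \<Longrightarrow> dist x s < e \<Longrightarrow> x \<in> W"
      using W(1) st(1) unfolding openin_euclidean_subtopology_iff by blast
    have s: "a \<le> s" "s \<le> b" using openin_imp_subset[OF W(1)] st(1) by auto
    show ?thesis
    proof (cases "s < b")
      case True
      have "min b (s + e / 2) \<in> W" using e(1) s True by (intro e(2)) (auto simp: dist_real_def)
      moreover have "min b (s + e / 2) \<noteq> s" using e(1) True by auto
      ultimately show ?thesis by blast
    next
      case False
      have "max a (s - e / 2) \<in> W" using e(1) s False ab by (intro e(2)) (auto simp: dist_real_def)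
      moreover have "max a (s - e / 2) \<noteq> s" using e(1) s False ab by auto
      ultimately show ?thesis by blast
    qed
  qed
  then obtain s' where s': "s' \<in> W" "s' \<noteq> s" by blast
  define c d where "c = min (min s t) s'" and "d = max (max s t) s'"
  have "c \<in> W" "d \<in> W" using st s' by (auto simp: c_def d_def min_def max_def)
  moreover have "c < d" "s \<in> {c..d}" "t \<in> {c..d}" using s'(2) by (auto simp: c_def d_def)
  ultimately show ?thesis using conv by blast
qed

text \<open>The neighbourhood \<open>T\<close> is part of the data, so the correspondence is one
  between germs at \<open>t0\<close>: injectivity compares two pairs on the intersection of their
  neighbourhoods. Because of the normalisation, pointwise equality on the half plane is equality of
  meromorphic functions.\<close>

theorem theorem4p1:
  fixes a b t0 :: real
    and \<sigma>1 \<sigma>2 \<gamma> :: "real \<Rightarrow> complex ^ 'p::finite ^ 'p"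
  assumes "a < b"
    and "continuous_on {a..b} \<sigma>1" "continuous_on {a..b} \<sigma>2" "continuous_on {a..b} \<gamma>"
    and "\<And>t. t \<in> {a..b} \<Longrightarrow> self_adjoint (\<sigma>1 t)"
    and "\<And>t. t \<in> {a..b} \<Longrightarrow> self_adjoint (\<sigma>2 t)"
    and "\<And>t. t \<in> {a..b} \<Longrightarrow> invertible (\<sigma>1 t)"
    and "\<And>t. t \<in> {a..b} \<Longrightarrow>
           \<exists>D. (\<sigma>1 has_vector_derivative D) (at t within {a..b}) \<and> \<gamma> t + cadjoint (\<gamma> t) = - D"
    and "t0 \<in> {a..b}"
  shows
    "(\<forall>(T, \<gamma>s, S) \<in> SI_pairs {a..b} \<sigma>1 \<sigma>2 \<gamma> t0. (\<lambda>z. S z t0) \<in> class_S (\<sigma>1 t0)) \<and>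
     (\<forall>Y \<in> class_S (\<sigma>1 t0). \<exists>(T, \<gamma>s, S) \<in> SI_pairs {a..b} \<sigma>1 \<sigma>2 \<gamma> t0.
        \<forall>z\<in>right_half_plane. S z t0 = Y z) \<and>
     (\<forall>(T, \<gamma>s, S) \<in> SI_pairs {a..b} \<sigma>1 \<sigma>2 \<gamma> t0.
      \<forall>(T', \<gamma>s', S') \<in> SI_pairs {a..b} \<sigma>1 \<sigma>2 \<gamma> t0.
        (\<forall>z\<in>right_half_plane. S z t0 = S' z t0) \<longleftrightarrow>
        (\<forall>t \<in> T \<inter> T'. \<gamma>s t = \<gamma>s' t \<and> (\<forall>z\<in>right_half_plane. S z t = S' z t)))"
proof -
  obtain D where D: "\<And>t. t \<in> {a..b} \<Longrightarrow> (\<sigma>1 has_vector_derivative D t) (at t within {a..b})"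
    "\<And>t. t \<in> {a..b} \<Longrightarrow> \<gamma> t + cadjoint (\<gamma> t) = - D t"
    using assms(8) by metis
  have "continuous_on {a..b} (\<lambda>t. matrix_inv (\<sigma>1 t) ** \<sigma>2 t)" "continuous_on {a..b} (\<lambda>t. matrix_inv (\<sigma>1 t) ** \<gamma> t)"
    by (intro continuous_on_mm continuous_on_minv assms(2-4,7); assumption)+
  from fundamental_pair_exists[OF assms(9) this] obtain \<Phi> \<Psi>
    where fp: "fundamental_pair {a..b} t0 (\<lambda>t. matrix_inv (\<sigma>1 t) ** \<sigma>2 t) (\<lambda>t. matrix_inv (\<sigma>1 t) ** \<gamma> t) \<Phi> \<Psi>"
    by blast
  interpret vessel_data a b t0 \<sigma>1 \<sigma>2 \<gamma> D \<Phi> \<Psi>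
    by unfold_locales (use assms(1-7,9) D fp in \<open>simp_all add: self_adjoint_def\<close>)
  have sub: "T \<subseteq> {a..b}" if "openin (top_of_set {a..b}) T" for T
    using openin_imp_subset[OF that] .
  show ?thesis
  proof (intro conjI ballI)
    fix p assume p: "p \<in> SI_pairs {a..b} \<sigma>1 \<sigma>2 \<gamma> t0"
    obtain T \<gamma>s S where [simp]: "p = (T, \<gamma>s, S)" using prod_cases3 by blast
    have "S \<in> class_SI T \<sigma>1 \<sigma>2 \<gamma> \<gamma>s" "t0 \<in> T" using p by (simp_all add: SI_pairs_def)
    then have "(\<lambda>z. S z t0) \<in> class_S (\<sigma>1 t0)" unfolding class_SI_def class_S_def by blast
    then show "case p of (T, \<gamma>s, S) \<Rightarrow> (\<lambda>z. S z t0) \<in> class_S (\<sigma>1 t0)" by simp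
  next
    fix Y assume "Y \<in> class_S (\<sigma>1 t0)"
    from existence[OF this] obtain T \<gamma>s S where "(T, \<gamma>s, S) \<in> SI_pairs {a..b} \<sigma>1 \<sigma>2 \<gamma> t0"
      "\<forall>z\<in>right_half_plane. S z t0 = Y z" unfolding SI_pairs_def by blast
    then show "\<exists>(T, \<gamma>s, S)\<in>SI_pairs {a..b} \<sigma>1 \<sigma>2 \<gamma> t0. \<forall>z\<in>right_half_plane. S z t0 = Y z" by blast
  next
    fix p assume p: "p \<in> SI_pairs {a..b} \<sigma>1 \<sigma>2 \<gamma> t0"
    obtain T \<gamma>s S where pe [simp]: "p = (T, \<gamma>s, S)" using prod_cases3 by blast
    have "(\<forall>z\<in>right_half_plane. S z t0 = S' z t0) \<longleftrightarrow>
        (\<forall>t \<in> T \<inter> T'. \<gamma>s t = \<gamma>s' t \<and> (\<forall>z\<in>right_half_plane. S z t = S' z t))"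
      if p': "(T', \<gamma>s', S') \<in> SI_pairs {a..b} \<sigma>1 \<sigma>2 \<gamma> t0" for T' \<gamma>s' S'
    proof -
      have T: "openin (top_of_set {a..b}) T" "is_interval T" "t0 \<in> T" "vessel_parameters T \<sigma>1 \<sigma>2 \<gamma> \<gamma>s"
        "S \<in> class_SI T \<sigma>1 \<sigma>2 \<gamma> \<gamma>s" using p by (simp_all add: SI_pairs_def)
      have T': "openin (top_of_set {a..b}) T'" "is_interval T'" "t0 \<in> T'" "vessel_parameters T' \<sigma>1 \<sigma>2 \<gamma> \<gamma>s'"
        "S' \<in> class_SI T' \<sigma>1 \<sigma>2 \<gamma> \<gamma>s'" using p' by (simp_all add: SI_pairs_def)
      have c: "continuous_on T \<gamma>s" "continuous_on T' \<gamma>s'"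
        using T(4) T'(4) unfolding vessel_parameters_def by blast+
      have "\<gamma>s t = \<gamma>s' t \<and> (\<forall>z\<in>right_half_plane. S z t = S' z t)"
        if eq: "\<And>z. z \<in> right_half_plane \<Longrightarrow> S z t0 = S' z t0" and t: "t \<in> T \<inter> T'" for t
      proof -
        obtain c' d' where cd: "c' < d'" "{c'..d'} \<subseteq> T \<inter> T'" "t0 \<in> {c'..d'}" "t \<in> {c'..d'}"
          using relatively_open_interval_nondegenerate[OF ab openin_Int[OF T(1) T'(1)] is_interval_Int[OF T(2) T'(2)] _ t, of t0]
            T(3) T'(3) by blast
        show ?thesis by (rule uniqueness[OF sub[OF T(1)] sub[OF T'(1)] T(5) T'(5) c cd eq])
      qed
      moreover have "t0 \<in> T \<inter> T'" using T T' by blast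
      ultimately show ?thesis by blast
    qed
    then have "\<forall>(T', \<gamma>s', S')\<in>SI_pairs {a..b} \<sigma>1 \<sigma>2 \<gamma> t0.
        (\<forall>z\<in>right_half_plane. S z t0 = S' z t0) \<longleftrightarrow>
        (\<forall>t \<in> T \<inter> T'. \<gamma>s t = \<gamma>s' t \<and> (\<forall>z\<in>right_half_plane. S z t = S' z t))"
      by blast
    then show "case p of (T, \<gamma>s, S) \<Rightarrow> \<forall>(T', \<gamma>s', S')\<in>SI_pairs {a..b} \<sigma>1 \<sigma>2 \<gamma> t0.
        (\<forall>z\<in>right_half_plane. S z t0 = S' z t0) \<longleftrightarrow>
        (\<forall>t \<in> T \<inter> T'. \<gamma>s t = \<gamma>s' t \<and> (\<forall>z\<in>right_half_plane. S z t = S' z t))"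
      by (simp only: pe prod.case)
  qed
qed

end
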